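(* Let $\boldsymbol{\omega}=(\omega_1,\omega_2,\ldots)$ be a nondecreasing sequence of positive numbers tending to $+\infty$, and let $f:\mathbb{R}\to\mathbb{R}$ be a measurable function satisfying $$f(x+1)=f(x)\ \text{ for all } x,\qquad \int_0^1 f(x)\,dx=0,\qquad \operatorname{Var}_{[0,1]}f<+\infty .$$ Let $\mu_{\boldsymbol{\omega}}$ be the probability measure on integer sequences defined in the context. Then, for $\mu_{\boldsymbol{\omega}}$-almost every sequence $(n_k)_{k\ge 1}$, for every permutation $\sigma:\mathbb{N}\to\mathbb{N}$ of the positive integers, $$N^{-1/2}\sum_{k=1}^N f(n_{\sigma(k)}x)\ \stackrel{\mathcal D}{\longrightarrow}\ \mathcal{N}(0,\|f\|^2)\qquad (N\to\infty).$$ If, moreover, there exist $\alpha>0$ and $k_0$ such that $\omega_k\ge(\log k)^\alpha$ for all $k\ge k_0$, then for $\mu_{\boldsymbol{\omega}}$-almost every sequence $(n_k)_{k\ge 1}$, for every permutation $\sigma:\mathbb{N}\to\mathbb{N}$ of the positive integers, also $$\limsup_{N\to\infty}\frac{\sum_{k=1}^N f(n_{\sigma(k)}x)}{(2N\log\log N)^{1/2}}=\|f\| \qquad\text{for almost every } x.$$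
   Context: $\operatorname{Var}_{[0,1]}f$ is the total variation of $f$ on $[0,1]$, and $\|f\|$ is the $L_2(0,1)$ norm of $f$. For a fixed sequence $(n_k)$, the functions $f(n_kx)$ are regarded as random variables on $[0,1]$ with Lebesgue measure; $\stackrel{\mathcal D}{\longrightarrow}$ is convergence in distribution with respect to this measure, and "almost every $x$" refers to Lebesgue measure. $\mathcal{N}(0,s^2)$ is the centered normal law with variance $s^2$ (the point mass at $0$ if $s=0$). The measure $\mu_{\boldsymbol{\omega}}$: put $$I_k=[\,a(k-1)^{\omega_{k-1}},\ a k^{\omega_k}),\qquad k=1,2,\ldots,$$ with $I_1=[0,a)$, where $a>0$ is a fixed constant large enough that each $I_k$ contains at least one integer. Choose $n_1,n_2,\ldots$ independently, with $n_k$ uniformly distributed on the set of integers in $I_k$. Then $\mu_{\boldsymbol{\omega}}$ is the distribution of the random sequence $(n_k)_{k\ge 1}$ in the product space $I_1\times I_2\times\cdots$. *)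

theory Defs
  imports "HOL-Probability.Probability"
begin

definition total_variation :: "(real \<Rightarrow> real) \<Rightarrow> real \<Rightarrow> real \<Rightarrow> ereal" where
  "total_variation f a b =
     (SUP (m, t) \<in> {(m :: nat, t). strict_mono_on {..m} t \<and> t 0 = a \<and> t m = b}.
        ereal (\<Sum>i<m. \<bar>f (t (Suc i)) - f (t i)\<bar>))"

definition L2_norm01 :: "(real \<Rightarrow> real) \<Rightarrow> real" where
  "L2_norm01 f = sqrt (\<integral>x. (f x)\<^sup>2 \<partial>lebesgue_on {0..1})"

text \<open>Parametrised by the standard deviation. The case distinction is needed because
  \<open>normal_density 0 0\<close> is the zero function.\<close>

definition centered_normal :: "real \<Rightarrow> real measure" where
  "centered_normal s =
     (if s = 0 then return borel 0 else density lborel (\<lambda>x. ennreal (normal_density 0 s x)))"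

text \<open>Sequences indexed by the positive integers are functions on \<^typ>\<open>nat\<close> whose value
  at \<open>0\<close> plays no role; in particular the left end point of the first interval does not
  refer to \<open>\<omega> 0\<close>.\<close>

definition block :: "(nat \<Rightarrow> real) \<Rightarrow> real \<Rightarrow> nat \<Rightarrow> real set" where
  "block \<omega> a k =
     {(if k = 1 then 0 else a * real (k - 1) powr \<omega> (k - 1)) ..< a * real k powr \<omega> k}"

definition block_ints :: "(nat \<Rightarrow> real) \<Rightarrow> real \<Rightarrow> nat \<Rightarrow> int set" where
  "block_ints \<omega> a k = {n. real_of_int n \<in> block \<omega> a k}"

definition mu_omega :: "(nat \<Rightarrow> real) \<Rightarrow> real \<Rightarrow> (nat \<Rightarrow> int) measure" where
  "mu_omega \<omega> a = (\<Pi>\<^sub>M k\<in>{1..}. uniform_count_measure (block_ints \<omega> a k))"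

end

(* For almost every sequence, the largest term of an integer relation between few terms n_j is
   determined by the smaller ones up to few choices, so by Borel-Cantelli there are eventually no
   nontrivial relations with few terms and polynomially bounded coefficients.  This property does not
   depend on the order of the sequence.  It makes mixed moments of trigonometric polynomials evaluated at
   n_k x coincide with those of independent uniform variables, as long as the number of factors is
   bounded by a multiple of omega.  A function of bounded variation is replaced by a trigonometric
   polynomial of high degree obtained from a discrete Fejer kernel, and exponentials are replaced by
   Taylor polynomials.  Boundedly many moments suffice for the central limit theorem;
   about (log log N)^2 moments, available if omega grows like a power of the logarithm, yield the
   exponential inequalities for the law of the iterated logarithm: the upper bound combines
   them with a maximal inequality, the lower bound with a second moment estimate
   for exponentially tilted sums over disjoint blocks. *)
theory Submission
  imports Defs "HOL-Real_Asymp.Real_Asymp"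
begin

text \<open>A permutation may place small indices anywhere, and the terms with small index may well
  satisfy relations. Hence a threshold \<open>B\<close> between the 16th and the fourth root of the
  number N of summands: as \<open>\<sigma>\<close> is injective, at most \<open>B\<close> terms fall
  below it, which is negligible against the square root of N, while every relation among the others
  has its largest index beyond \<open>B\<close>, so that all parameters can be fixed in terms of
  \<open>B\<close>. Only about \<open>R B\<close> moments are then available, never a whole law;
  every exponential becomes a polynomial, and the truncation error is estimated on the independent
  side, where sub-Gaussian bounds hold. For the central limit theorem the number of moments only has
  to tend to infinity. In the iterated logarithm the exponents have size log log N, and a Taylor
  degree of larger order makes the error negligible. Blocks are independent only at the level of
  moments, so the converse Borel-Cantelli lemma is out of reach. Instead many blocks of one scale
  are treated together: the probability that all of them stay small tends to 0, which already forces
  success at infinitely many scales.\<close>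

abbreviation unit_measure :: "real measure" ("\<U>") where
  "\<U> \<equiv> lebesgue_on {0..1}"

text \<open>Length and coefficient bounds are measured by the largest index \<open>i\<close>,
  because it is the choice of \<open>n i\<close>, given the smaller terms, that rules a relation
  out. Coefficients of smaller terms may vanish; only \<open>c i\<close> must not.\<close>

definition relation_free :: "(nat \<Rightarrow> int) \<Rightarrow> (nat \<Rightarrow> real) \<Rightarrow> nat \<Rightarrow> nat \<Rightarrow> bool" where
  "relation_free n R \<kappa> i\<^sub>0 \<longleftrightarrow>
     (\<forall>i\<ge>i\<^sub>0. \<forall>A c. A \<subseteq> {1..i} \<and> i \<in> A \<and> real (card A) \<le> R i \<and> c i \<noteq> 0 \<and>
        (\<forall>j\<in>A. \<bar>c j\<bar> \<le> int i ^ \<kappa>) \<longrightarrow> (\<Sum>j\<in>A. c j * n j) \<noteq> 0)"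

definition character :: "int \<Rightarrow> real \<Rightarrow> complex" where
  "character j x = cis (2 * pi * (of_int j * x))"

definition trig_poly :: "nat \<Rightarrow> (real \<Rightarrow> real) \<Rightarrow> bool" where
  "trig_poly D g \<longleftrightarrow>
     (\<exists>c. \<forall>x. complex_of_real (g x) = (\<Sum>j\<in>{- int D..int D}. c j * character j x))"

definition iid_measure :: "nat set \<Rightarrow> (nat \<Rightarrow> real) measure" where
  "iid_measure J = (\<Pi>\<^sub>M k\<in>J. \<U>)"

section \<open>Lebesgue measure on the unit interval and its products\<close>

lemma prob_space_unit: "prob_space \<U>"
  by (rule prob_spaceI) (simp add: emeasure_restrict_space)

lemma prob_space_iid: "prob_space (iid_measure J)"
  unfolding iid_measure_def by (intro prob_space_PiM prob_space_unit)

lemma product_prob_unit: "product_prob_space (\<lambda>k::nat. \<U>)"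
  by (intro product_prob_spaceI prob_space_unit)

lemma measurable_unit_continuous:
  fixes g :: "real \<Rightarrow> 'a::{banach, second_countable_topology}"
  assumes "continuous_on UNIV g"
  shows "g \<in> borel_measurable \<U>"
proof -
  have "g \<in> borel_measurable borel" using assms by (rule borel_measurable_continuous_onI)
  then have "g \<in> borel_measurable lebesgue" by (intro measurable_completion) simp
  then show ?thesis by (rule measurable_restrict_space1)
qed

lemma integrable_bounded_prob:
  fixes g :: "'a \<Rightarrow> 'b::{banach, second_countable_topology}"
  assumes "prob_space M" "g \<in> borel_measurable M" "\<And>x. x \<in> space M \<Longrightarrow> norm (g x) \<le> C"
  shows "integrable M g"
proof -
  interpret prob_space M by fact
  show ?thesis using assms by (intro integrable_const_bound[where B=C]) auto
qed

lemma integral_bounded_prob: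
  fixes g :: "'a \<Rightarrow> 'b::{banach, second_countable_topology}"
  assumes "prob_space M" "g \<in> borel_measurable M" "\<And>x. x \<in> space M \<Longrightarrow> norm (g x) \<le> C"
  shows "norm (integral\<^sup>L M g) \<le> C"
proof -
  interpret prob_space M by fact
  have "norm (integral\<^sup>L M g) \<le> (\<integral>x. norm (g x) \<partial>M)" by (rule integral_norm_bound)
  also have "\<dots> \<le> (\<integral>x. C \<partial>M)"
    using assms by (intro integral_mono integrable_norm integrable_bounded_prob[OF assms]) auto
  finally show ?thesis using prob_space by simp
qed

section \<open>Characters and vanishing combinations of frequencies\<close>

lemma continuous_character: "continuous_on UNIV (character j)"
  unfolding character_def by (intro continuous_intros)

lemma norm_character [simp]: "norm (character j x) = 1"
  by (simp add: character_def)

lemma character_add: "character (i + j) x = character i x * character j x"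
  by (simp add: character_def cis_mult algebra_simps)

lemma character_0 [simp]: "character 0 x = 1"
  by (simp add: character_def)

lemma character_sum: "finite A \<Longrightarrow> character (\<Sum>t\<in>A. c t) x = (\<Prod>t\<in>A. character (c t) x)"
  by (induction A rule: finite_induct) (auto simp: character_add)

lemma character_mult_arg: "character j (of_int m * x) = character (j * m) x"
  by (simp add: character_def mult_ac)

lemma character_int: "character j (of_int m) = 1"
  using cis_multiple_2pi[of "of_int (j * m)"] by (simp add: character_def mult_ac)

lemma character_add_arg: "character j (x + y) = character j x * character j y"
  by (simp add: character_def cis_mult algebra_simps)

lemma cnj_character: "cnj (character j x) = character (- j) x"
  by (simp add: character_def cis_cnj)

lemma integrable_character: "integrable \<U> (character j)"
  by (rule integrable_bounded_prob[OF prob_space_unit measurable_unit_continuous[OF continuous_character], where C=1]) simp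

lemma integral_character: "(\<integral>x. character j x \<partial>\<U>) = (if j = 0 then 1 else 0)"
proof (cases "j = 0")
  case True
  interpret prob_space \<U> by (rule prob_space_unit)
  from True show ?thesis using prob_space by simp
next
  case False
  have "((\<lambda>x. character j x) has_integral
      (character j 1 / (2 * pi * \<i> * of_int j) - character j 0 / (2 * pi * \<i> * of_int j))) {0..1}"
  proof (rule fundamental_theorem_of_calculus)
    fix x :: real
    have "((\<lambda>x. exp (of_real x * (2 * pi * \<i> * of_int j)) / (2 * pi * \<i> * of_int j))
       has_vector_derivative (1 * (2 * pi * \<i> * of_int j) * exp (of_real x * (2 * pi * \<i> * of_int j))) / (2 * pi * \<i> * of_int j))
      (at x within {0..1})"
      apply (rule has_vector_derivative_real_field)
      apply (rule derivative_eq_intros refl | simp add: False)+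
      done
    then show "((\<lambda>a. character j a / (2 * pi * \<i> * of_int j)) has_vector_derivative character j x) (at x within {0..1})"
      using False by (simp add: character_def cis_conv_exp mult_ac)
  qed simp
  then have "((\<lambda>x. character j x) has_integral 0) {0..1}"
    using character_int[of j 1] character_int[of j 0] by simp
  moreover have "integral {0..1} (character j) = (\<integral>x. character j x \<partial>\<U>)"
    by (rule lebesgue_integral_eq_integral[symmetric, OF integrable_character]) simp
  ultimately show ?thesis using False by (simp add: integral_unique)
qed

text \<open>Equal indices are merged first. If some merged coefficient survives, the largest index
  carrying one is at least \<open>B\<close>, and merged coefficients are at most
  \<open>q * D \<le> B ^ \<kappa>\<close>, so a vanishing total would be a forbidden relation with
  at most \<open>q\<close> terms.\<close>

lemma relation_free_sum_eq_0_iff: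
  assumes rf: "relation_free n R \<kappa> i\<^sub>0" and J: "finite J" "J \<subseteq> {B..}" "B \<ge> 1" "B \<ge> i\<^sub>0"
    and R: "\<And>i. i \<ge> B \<Longrightarrow> real q \<le> R i" and D: "q * D \<le> B ^ \<kappa>"
    and s: "\<And>t. t < q \<Longrightarrow> s t \<in> J" and j: "\<And>t. t < q \<Longrightarrow> \<bar>j t\<bar> \<le> int D"
  shows "(\<Sum>t<q. j t * n (s t)) = 0 \<longleftrightarrow> (\<forall>k\<in>J. (\<Sum>t | t < q \<and> s t = k. j t) = 0)"
proof -
  define c where "c k = (\<Sum>t | t < q \<and> s t = k. j t)" for k
  have *: "(\<Sum>t<q. j t * n (s t)) = (\<Sum>k\<in>J. c k * n k)"
  proof -
    have "(\<Sum>t<q. j t * n (s t)) = (\<Sum>k\<in>J. \<Sum>t | t \<in> {..<q} \<and> s t = k. j t * n (s t))"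
      by (rule sum.group[symmetric]) (use J s in auto)
    also have "\<dots> = (\<Sum>k\<in>J. c k * n k)"
      unfolding c_def sum_distrib_right by (intro sum.cong) auto
    finally show ?thesis .
  qed
  have "(\<Sum>k\<in>J. c k * n k) \<noteq> 0" if "k \<in> J" "c k \<noteq> 0" for k
  proof -
    define A where "A = {k\<in>J. c k \<noteq> 0}"
    define i where "i = Max A"
    have A: "finite A" "A \<noteq> {}" "A \<subseteq> J" using that J by (auto simp: A_def)
    have iA: "i \<in> A" using A by (auto simp: i_def)
    have iB: "i \<ge> B" using iA A J by auto
    have "A \<subseteq> s ` {..<q}"
    proof
      fix k assume "k \<in> A"
      then have "{t. t < q \<and> s t = k} \<noteq> {}" by (auto simp: A_def c_def simp del: Collect_empty_eq)
      then show "k \<in> s ` {..<q}" by auto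
    qed
    then have "card A \<le> q"
      using card_mono[of "s ` {..<q}" A] card_image_le[of "{..<q}" s] by auto
    moreover have "A \<subseteq> {1..i}"
      using A J by (auto simp: i_def)
    moreover have "\<bar>c k\<bar> \<le> int i ^ \<kappa>" for k
    proof -
      have "\<bar>c k\<bar> \<le> (\<Sum>t | t < q \<and> s t = k. \<bar>j t\<bar>)" unfolding c_def by (rule sum_abs)
      also have "\<dots> \<le> (\<Sum>t | t < q \<and> s t = k. int D)" using j by (intro sum_mono) auto
      also have "\<dots> \<le> (\<Sum>t<q. int D)" by (intro sum_mono2) auto
      also have "\<dots> = int (q * D)" by simp
      also have "\<dots> \<le> int (B ^ \<kappa>)" using D by (rule of_nat_mono)
      also have "\<dots> \<le> int (i ^ \<kappa>)" using iB by (intro of_nat_mono power_mono) auto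
      finally show ?thesis by simp
    qed
    ultimately have "(\<Sum>j\<in>A. c j * n j) \<noteq> 0"
      using rf[unfolded relation_free_def, rule_format, of i A c] iA iB J R[of i]
      by (auto simp: A_def intro: order_trans[of _ "real q"])
    also have "(\<Sum>j\<in>A. c j * n j) = (\<Sum>k\<in>J. c k * n k)"
      using J by (intro sum.mono_neutral_left) (auto simp: A_def)
    finally show ?thesis .
  qed
  then show ?thesis unfolding * c_def[symmetric] by (auto intro!: sum.neutral)
qed

lemma integral_iid_prod:
  fixes h :: "nat \<Rightarrow> real \<Rightarrow> 'a::{real_normed_field,banach,second_countable_topology}"
  assumes "finite J" "\<And>k. k \<in> J \<Longrightarrow> integrable \<U> (h k)"
  shows "(\<integral>u. (\<Prod>k\<in>J. h k (u k)) \<partial>iid_measure J) = (\<Prod>k\<in>J. \<integral>x. h k x \<partial>\<U>)"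
proof -
  interpret product_prob_space "\<lambda>k::nat. \<U>" UNIV by (rule product_prob_unit)
  show ?thesis unfolding iid_measure_def
    by (rule product_integral_prod) (use assms in auto)
qed

lemma measurable_iid_component:
  assumes "g \<in> borel_measurable \<U>" "k \<in> J"
  shows "(\<lambda>u. g (u k)) \<in> borel_measurable (iid_measure J)"
proof -
  have "(\<lambda>u. u k) \<in> measurable (iid_measure J) \<U>"
    unfolding iid_measure_def using assms(2) by (rule measurable_component_singleton)
  from measurable_compose[OF this assms(1)] show ?thesis .
qed

section \<open>Moment matching for trigonometric polynomials\<close>

text \<open>Both integrals are 0 or 1 by orthogonality: the left one is 1 when the total frequency
  vanishes, the right one when the frequency collected at each single index vanishes. Absence of
  relations makes the two conditions equivalent.\<close>

lemma moment_match_characters: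
  assumes rf: "relation_free n R \<kappa> i\<^sub>0" and J: "finite J" "J \<subseteq> {B..}" "B \<ge> 1" "B \<ge> i\<^sub>0"
    and R: "\<And>i. i \<ge> B \<Longrightarrow> real q \<le> R i" and D: "q * D \<le> B ^ \<kappa>"
    and s: "\<And>t. t < q \<Longrightarrow> s t \<in> J" and j: "\<And>t. t < q \<Longrightarrow> \<bar>j t\<bar> \<le> int D"
  shows "(\<integral>x. (\<Prod>t<q. character (j t) (of_int (n (s t)) * x)) \<partial>\<U>)
       = (\<integral>u. (\<Prod>t<q. character (j t) (u (s t))) \<partial>iid_measure J)"
proof -
  have "(\<Prod>t<q. character (j t) (of_int (n (s t)) * x)) = character (\<Sum>t<q. j t * n (s t)) x" for x
    by (simp add: character_sum character_mult_arg)
  then have 1: "(\<integral>x. (\<Prod>t<q. character (j t) (of_int (n (s t)) * x)) \<partial>\<U>)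
      = (if (\<Sum>t<q. j t * n (s t)) = 0 then 1 else 0)"
    by (simp add: integral_character)
  have "(\<Prod>t<q. character (j t) (u (s t)))
      = (\<Prod>k\<in>J. character (\<Sum>t | t < q \<and> s t = k. j t) (u k))" for u :: "nat \<Rightarrow> real"
  proof -
    have "(\<Prod>t<q. character (j t) (u (s t)))
        = (\<Prod>k\<in>J. \<Prod>t | t \<in> {..<q} \<and> s t = k. character (j t) (u (s t)))"
      by (rule prod.group[symmetric]) (use J s in auto)
    also have "\<dots> = (\<Prod>k\<in>J. character (\<Sum>t | t < q \<and> s t = k. j t) (u k))"
      by (intro prod.cong) (auto simp: character_sum)
    finally show ?thesis .
  qed
  then have "(\<integral>u. (\<Prod>t<q. character (j t) (u (s t))) \<partial>iid_measure J)
      = (\<Prod>k\<in>J. \<integral>x. character (\<Sum>t | t < q \<and> s t = k. j t) x \<partial>\<U>)"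
    using integral_iid_prod[OF J(1), of "\<lambda>k. character (\<Sum>t | t < q \<and> s t = k. j t)"]
    by (simp add: integrable_character)
  also have "\<dots> = (if \<forall>k\<in>J. (\<Sum>t | t < q \<and> s t = k. j t) = 0 then 1 else 0)"
    using J by (auto simp: integral_character intro!: prod_zero)
  finally show ?thesis
    unfolding 1 using relation_free_sum_eq_0_iff[OF assms] by simp
qed

lemma trig_poly_continuous:
  assumes "trig_poly D g" shows "continuous_on UNIV g"
proof -
  obtain c where c: "\<And>x. complex_of_real (g x) = (\<Sum>j\<in>{- int D..int D}. c j * character j x)"
    using assms by (auto simp: trig_poly_def)
  have "g = (\<lambda>x. Re (\<Sum>j\<in>{- int D..int D}. c j * character j x))"
    by (simp add: c[symmetric])
  moreover have "continuous_on UNIV (\<lambda>x. Re (\<Sum>j\<in>{- int D..int D}. c j * character j x))"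
    by (intro continuous_intros continuous_character)
  ultimately show ?thesis by simp
qed

lemma moment_match_monomial:
  assumes rf: "relation_free n R \<kappa> i\<^sub>0" and J: "finite J" "J \<subseteq> {B..}" "B \<ge> 1" "B \<ge> i\<^sub>0"
    and R: "\<And>i. i \<ge> B \<Longrightarrow> real q \<le> R i" and D: "q * D \<le> B ^ \<kappa>"
    and g: "trig_poly D g" and s: "\<And>t. t < q \<Longrightarrow> s t \<in> J"
  shows "(\<integral>x. (\<Prod>t<q. g (of_int (n (s t)) * x)) \<partial>\<U>)
       = (\<integral>u. (\<Prod>t<q. g (u (s t))) \<partial>iid_measure J)"
proof -
  obtain c where c: "\<And>x. complex_of_real (g x) = (\<Sum>j\<in>{- int D..int D}. c j * character j x)"
    using g by (auto simp: trig_poly_def)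
  let ?I = "{- int D..int D}"
  let ?P = "\<lambda>j. (\<Prod>t<q. c (j t))"
  have expand: "complex_of_real (\<Prod>t<q. g (y t))
      = (\<Sum>j\<in>PiE {..<q} (\<lambda>_. ?I). ?P j * (\<Prod>t<q. character (j t) (y t)))" for y
    by (simp add: c prod_sum_PiE prod.distrib)
  have m1: "(\<lambda>x. \<Prod>t<q. character (j t) (of_int (n (s t)) * x)) \<in> borel_measurable \<U>" for j
    by (intro measurable_unit_continuous continuous_on_prod
        continuous_on_compose2[OF continuous_character] continuous_intros) auto
  have m2: "(\<lambda>u. \<Prod>t<q. character (j t) (u (s t))) \<in> borel_measurable (iid_measure J)" for j
    by (intro borel_measurable_prod measurable_iid_component measurable_unit_continuous
        continuous_character s) auto
  have i1: "integrable \<U> (\<lambda>x. ?P j * (\<Prod>t<q. character (j t) (of_int (n (s t)) * x)))" for j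
    by (intro integrable_mult_right integrable_bounded_prob[OF prob_space_unit m1, of _ 1])
       (simp add: prod_norm[symmetric])
  have i2: "integrable (iid_measure J) (\<lambda>u. ?P j * (\<Prod>t<q. character (j t) (u (s t))))" for j
    by (intro integrable_mult_right integrable_bounded_prob[OF prob_space_iid m2, of _ 1])
       (simp add: prod_norm[symmetric])
  have "complex_of_real (\<integral>x. (\<Prod>t<q. g (of_int (n (s t)) * x)) \<partial>\<U>)
      = (\<integral>x. complex_of_real (\<Prod>t<q. g (of_int (n (s t)) * x)) \<partial>\<U>)"
    by (rule integral_complex_of_real[symmetric])
  also have "\<dots> = (\<Sum>j\<in>PiE {..<q} (\<lambda>_. ?I). ?P j *
      (\<integral>x. (\<Prod>t<q. character (j t) (of_int (n (s t)) * x)) \<partial>\<U>))"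
    unfolding expand using i1 by (subst Bochner_Integration.integral_sum) auto
  also have "\<dots> = (\<Sum>j\<in>PiE {..<q} (\<lambda>_. ?I). ?P j *
      (\<integral>u. (\<Prod>t<q. character (j t) (u (s t))) \<partial>iid_measure J))"
    by (intro sum.cong arg_cong2[where f="(*)"] refl moment_match_characters[OF rf J R D s])
       (fastforce simp: PiE_iff abs_le_iff)+
  also have "\<dots> = (\<integral>u. complex_of_real (\<Prod>t<q. g (u (s t))) \<partial>iid_measure J)"
    unfolding expand using i2 by (subst Bochner_Integration.integral_sum) auto
  also have "\<dots> = complex_of_real (\<integral>u. (\<Prod>t<q. g (u (s t))) \<partial>iid_measure J)"
    by (rule integral_complex_of_real)
  finally show ?thesis by (simp only: of_real_eq_iff)
qed

text \<open>The weights single out the subset of \<open>J\<close> over which each factor sums.\<close>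

lemma moment_match:
  assumes rf: "relation_free n R \<kappa> i\<^sub>0" and J: "finite J" "J \<subseteq> {B..}" "B \<ge> 1" "B \<ge> i\<^sub>0"
    and R: "\<And>i. i \<ge> B \<Longrightarrow> real q \<le> R i" and D: "q * D \<le> B ^ \<kappa>"
    and g: "trig_poly D g" and bd: "\<And>x. \<bar>g x\<bar> \<le> C"
  shows "(\<integral>x. (\<Prod>t<q. \<Sum>k\<in>J. v t k * g (of_int (n k) * x)) \<partial>\<U>)
       = (\<integral>u. (\<Prod>t<q. \<Sum>k\<in>J. v t k * g (u k)) \<partial>iid_measure J)"
proof -
  let ?P = "\<lambda>s. (\<Prod>t<q. v t (s t))"
  note cont = trig_poly_continuous[OF g]
  have expand: "(\<Prod>t<q. \<Sum>k\<in>J. v t k * y k)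
      = (\<Sum>s\<in>PiE {..<q} (\<lambda>_. J). ?P s * (\<Prod>t<q. y (s t)))" for y
    by (simp add: J prod_sum_PiE prod.distrib)
  have C: "(\<Prod>t<q. \<bar>g (y t)\<bar>) \<le> C ^ q" for y
  proof -
    have "(\<Prod>t<q. \<bar>g (y t)\<bar>) \<le> (\<Prod>t<q. C)" using bd by (intro prod_mono) auto
    then show ?thesis by simp
  qed
  have m1: "(\<lambda>x. \<Prod>t<q. g (of_int (n (s t)) * x)) \<in> borel_measurable \<U>" for s
    by (intro measurable_unit_continuous continuous_on_prod
        continuous_on_compose2[OF cont] continuous_intros) auto
  have m2: "(\<lambda>u. \<Prod>t<q. g (u (s t))) \<in> borel_measurable (iid_measure J)"
    if "s \<in> PiE {..<q} (\<lambda>_. J)" for s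
    by (intro borel_measurable_prod measurable_iid_component measurable_unit_continuous cont)
       (use that in auto)
  have i1: "integrable \<U> (\<lambda>x. ?P s * (\<Prod>t<q. g (of_int (n (s t)) * x)))" for s
    by (intro integrable_mult_right integrable_bounded_prob[OF prob_space_unit m1, of _ "C ^ q"])
       (simp add: abs_prod C)
  have i2: "integrable (iid_measure J) (\<lambda>u. ?P s * (\<Prod>t<q. g (u (s t))))"
    if "s \<in> PiE {..<q} (\<lambda>_. J)" for s
    by (intro integrable_mult_right integrable_bounded_prob[OF prob_space_iid m2[OF that], of "C ^ q"])
       (simp add: abs_prod C)
  have "(\<integral>x. (\<Prod>t<q. \<Sum>k\<in>J. v t k * g (of_int (n k) * x)) \<partial>\<U>)
     = (\<Sum>s\<in>PiE {..<q} (\<lambda>_. J). ?P s * (\<integral>x. (\<Prod>t<q. g (of_int (n (s t)) * x)) \<partial>\<U>))"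
    unfolding expand using i1 by (subst Bochner_Integration.integral_sum) auto
  also have "\<dots> = (\<Sum>s\<in>PiE {..<q} (\<lambda>_. J). ?P s * (\<integral>u. (\<Prod>t<q. g (u (s t))) \<partial>iid_measure J))"
    by (intro sum.cong arg_cong2[where f="(*)"] refl moment_match_monomial[OF rf J R D g]) auto
  also have "\<dots> = (\<integral>u. (\<Prod>t<q. \<Sum>k\<in>J. v t k * g (u k)) \<partial>iid_measure J)"
    unfolding expand using i2 by (subst Bochner_Integration.integral_sum) auto
  finally show ?thesis .
qed

section \<open>Integer relations in random sequences\<close>

text \<open>Given the earlier coordinates, \<open>F n\<close> is a fixed number, hit by the uniform
  \<open>n i\<close> with probability at most one over the size of its range. Conditioning is
  carried out by a finite union of cylinders, one for each choice of the coordinates before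
  \<open>i\<close>.\<close>

lemma uniform_product_hit:
  fixes S :: "nat \<Rightarrow> int set" and F :: "(nat \<Rightarrow> int) \<Rightarrow> int"
  assumes S: "\<And>k. k \<ge> 1 \<Longrightarrow> finite (S k)" "\<And>k. k \<ge> 1 \<Longrightarrow> S k \<noteq> {}" and i: "i \<ge> 1"
    and F: "\<And>n n'. (\<And>j. 1 \<le> j \<Longrightarrow> j < i \<Longrightarrow> n j = n' j) \<Longrightarrow> F n = F n'"
  defines "P \<equiv> (\<Pi>\<^sub>M k\<in>{1..}. uniform_count_measure (S k))"
  shows "{n \<in> space P. n i = F n} \<in> sets P"
    and "measure P {n \<in> space P. n i = F n} \<le> 1 / card (S i)"
proof -
  \<comment> \<open>The product locale wants a probability measure at every index;
    \<open>{0}\<close> supplies one at the index 0, about which the assumptions on \<open>S\<close>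
    say nothing.\<close>
  define S' where "S' k = (if k = 0 then {0} else S k)" for k
  have S': "finite (S' k)" "S' k \<noteq> {}" for k using S[of k] by (auto simp: S'_def)
  have P_eq: "P = (\<Pi>\<^sub>M k\<in>{1..}. uniform_count_measure (S' k))"
    unfolding P_def by (rule PiM_cong) (auto simp: S'_def)
  interpret product_prob_space "\<lambda>k. uniform_count_measure (S' k)" "{1::nat..}"
    by (intro product_prob_spaceI prob_space_uniform_count_measure S')
  interpret prob_space P unfolding P_eq by (rule prob_space_PiM) (intro prob_space_uniform_count_measure S')
  have sp: "space P = PiE {1..} S'" unfolding P_eq by (simp add: space_PiM space_uniform_count_measure)
  define W where "W = PiE {1..<i} S'"
  have W: "finite W" unfolding W_def using S' by (intro finite_PiE) auto
  \<comment> \<open>For \<open>j = i\<close> the set is empty when \<open>F w\<close> lies outside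
    the range, and the cylinder then has measure 0.\<close>
  define X where "X w j = (if j = i then {F w} \<inter> S' i else {w j})" for w :: "nat \<Rightarrow> int" and j
  define E where "E w = {n \<in> space P. \<forall>j\<in>{1..i}. n j \<in> X w j}" for w
  have X: "X w j \<subseteq> S' j" if "w \<in> W" "j \<in> {1..i}" for w j
    using that by (auto simp: X_def W_def PiE_iff)
  have E_sets: "E w \<in> sets P" if "w \<in> W" for w
    unfolding E_def P_eq
    by (intro sets.sets_Collect_finite_All sets_Collect_single')
       (use X[OF that] in \<open>auto simp: sets_uniform_count_measure\<close>)
  have E_meas: "measure P (E w) \<le> (\<Prod>j\<in>{1..i}. 1 / card (S' j))" if "w \<in> W" for w
  proof -
    have "emeasure P (E w) = (\<Prod>j\<in>{1..i}. emeasure (uniform_count_measure (S' j)) (X w j))"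
      unfolding E_def P_eq
      by (rule emeasure_PiM_Collect) (use X[OF that] in \<open>auto simp: sets_uniform_count_measure\<close>)
    also have "\<dots> = (\<Prod>j\<in>{1..i}. ennreal (card (X w j) / card (S' j)))"
      using X[OF that] S' by (intro prod.cong refl emeasure_uniform_count_measure) auto
    also have "\<dots> = ennreal (\<Prod>j\<in>{1..i}. card (X w j) / card (S' j))"
      by (intro prod_ennreal) auto
    finally have "measure P (E w) = (\<Prod>j\<in>{1..i}. card (X w j) / card (S' j))"
      by (simp add: measure_def prod_nonneg)
    also have "\<dots> \<le> (\<Prod>j\<in>{1..i}. 1 / card (S' j))"
    proof (intro prod_mono conjI divide_right_mono)
      fix j show "real (card (X w j)) \<le> 1"
        using card_mono[of "{F w}" "{F w} \<inter> S' i"] by (auto simp: X_def)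
    qed auto
    finally show ?thesis .
  qed
  have eq: "{n \<in> space P. n i = F n} = (\<Union>w\<in>W. E w)"
  proof (intro equalityI subsetI)
    fix n assume n: "n \<in> {n \<in> space P. n i = F n}"
    define w where "w = restrict n {1..<i}"
    have "F w = F n" by (rule F) (auto simp: w_def)
    moreover have "w \<in> W" using n i by (auto simp: W_def w_def sp PiE_iff)
    moreover have "n i \<in> S' i" using n i unfolding sp PiE_iff by blast
    then have "F n \<in> S' i" using n by simp
    ultimately show "n \<in> (\<Union>w\<in>W. E w)"
      using n i by (auto simp: E_def X_def w_def intro!: bexI[of _ w])
  next
    fix n assume "n \<in> (\<Union>w\<in>W. E w)"
    then obtain w where w: "w \<in> W" "n \<in> E w" by auto
    then have n: "n \<in> space P" "\<And>j. j \<in> {1..i} \<Longrightarrow> n j \<in> X w j" by (auto simp: E_def)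
    have "n j = w j" if "1 \<le> j" "j < i" for j using n(2)[of j] that by (auto simp: X_def)
    then have "F n = F w" by (rule F)
    with n(1) n(2)[of i] i show "n \<in> {n \<in> space P. n i = F n}" by (auto simp: X_def)
  qed
  show "{n \<in> space P. n i = F n} \<in> sets P"
    unfolding eq using W E_sets by auto
  have "measure P (\<Union>w\<in>W. E w) \<le> (\<Sum>w\<in>W. measure P (E w))"
    using W E_sets by (intro finite_measure_subadditive_finite) auto
  also have "\<dots> \<le> (\<Sum>w\<in>W. (\<Prod>j\<in>{1..i}. 1 / card (S' j)))"
    using E_meas by (rule sum_mono)
  also have "\<dots> = card W * (\<Prod>j\<in>{1..i}. 1 / card (S' j))" by simp
  also have "card W = (\<Prod>j\<in>{1..<i}. card (S' j))" unfolding W_def by (simp add: card_PiE)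
  also have "{1..i} = insert i {1..<i}" using i by auto
  also have "real (\<Prod>j\<in>{1..<i}. card (S' j)) * (\<Prod>j\<in>insert i {1..<i}. 1 / real (card (S' j)))
      = 1 / card (S' i) * ((\<Prod>j\<in>{1..<i}. real (card (S' j))) * (\<Prod>j\<in>{1..<i}. 1 / real (card (S' j))))"
    by simp
  also have "(\<Prod>j\<in>{1..<i}. real (card (S' j))) * (\<Prod>j\<in>{1..<i}. 1 / real (card (S' j))) = 1"
    unfolding prod.distrib[symmetric] using S' by (intro prod.neutral) auto
  finally show "measure P {n \<in> space P. n i = F n} \<le> 1 / card (S i)"
    unfolding eq using i by (simp add: S'_def)
qed

text \<open>A relation with largest index \<open>i\<close> determines \<open>n i\<close> from the
  smaller terms and the coefficients. The exceptional set is the union over at most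
  \<open>i ^ r\<close> choices of smaller indices and \<open>(2 * K + 1) ^ (r + 1)\<close> choices
  of coefficients.\<close>

lemma uniform_product_relation:
  fixes S :: "nat \<Rightarrow> int set"
  assumes S: "\<And>k. k \<ge> 1 \<Longrightarrow> finite (S k)" "\<And>k. k \<ge> 1 \<Longrightarrow> S k \<noteq> {}" and i: "i \<ge> 2"
  defines "P \<equiv> (\<Pi>\<^sub>M k\<in>{1..}. uniform_count_measure (S k))"
  shows "\<exists>E\<in>sets P. measure P E \<le> real (i ^ r * (2 * K + 1) ^ (r + 1)) / card (S i) \<and>
    (\<forall>n A c. n \<in> space P \<and> A \<subseteq> {1..i} \<and> i \<in> A \<and> card A \<le> r \<and> c i \<noteq> 0 \<and>
      (\<forall>j\<in>A. \<bar>c j\<bar> \<le> int K) \<and> (\<Sum>j\<in>A. c j * n j) = 0 \<longrightarrow> n \<in> E)"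
proof -
  let ?I = "{- int K..int K}"
  interpret prob_space P unfolding P_def
    by (intro prob_space_PiM prob_space_uniform_count_measure) (use S in auto)
  define T where "T = PiE {..<r} (\<lambda>_. {1..<i}) \<times> PiE {..<r} (\<lambda>_. ?I) \<times> ?I"
  \<comment> \<open>The integer division is exact whenever the relation holds. For other sequences
    any value will do, since only membership in \<open>E\<close> is claimed.\<close>
  define G where "G = (\<lambda>(js :: nat \<Rightarrow> nat, cs, c0) (n :: nat \<Rightarrow> int). (- (\<Sum>t<r. cs t * n (js t))) div c0)"
  have T: "finite T" unfolding T_def by (intro finite_cartesian_product finite_PiE) auto
  have G: "G \<tau> n = G \<tau> n'" if "\<tau> \<in> T" "\<And>j. 1 \<le> j \<Longrightarrow> j < i \<Longrightarrow> n j = n' j" for \<tau> n n'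
  proof -
    obtain js cs c0 where \<tau>: "\<tau> = (js, cs, c0)" by (cases \<tau>) auto
    have "(\<Sum>t<r. cs t * n (js t)) = (\<Sum>t<r. cs t * n' (js t))"
      using that by (intro sum.cong refl) (auto simp: T_def \<tau> PiE_iff)
    then show ?thesis by (simp add: G_def \<tau>)
  qed
  define E where "E = (\<Union>\<tau>\<in>T. {n \<in> space P. n i = G \<tau> n})"
  note hit = uniform_product_hit[of S i, folded P_def, OF S _ G]
  have sets: "{n \<in> space P. n i = G \<tau> n} \<in> sets P" if "\<tau> \<in> T" for \<tau>
    by (rule hit(1)) (use i that in auto)
  have "measure P E \<le> (\<Sum>\<tau>\<in>T. measure P {n \<in> space P. n i = G \<tau> n})"
    unfolding E_def using T sets by (intro finite_measure_subadditive_finite) auto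
  also have "\<dots> \<le> (\<Sum>\<tau>\<in>T. 1 / card (S i))"
    by (intro sum_mono hit(2)) (use i in auto)
  also have "\<dots> = card T / card (S i)" by simp
  also have "\<dots> \<le> real (i ^ r * (2 * K + 1) ^ (r + 1)) / card (S i)"
  proof -
    have "card T = (i - 1) ^ r * ((2 * K + 1) ^ r * (2 * K + 1))"
      by (simp add: T_def card_cartesian_product card_PiE nat_add_distrib nat_mult_distrib)
    also have "\<dots> \<le> i ^ r * (2 * K + 1) ^ (r + 1)"
      by (intro mult_mono power_mono) auto
    finally show ?thesis by (intro divide_right_mono of_nat_mono) auto
  qed
  finally have meas: "measure P E \<le> real (i ^ r * (2 * K + 1) ^ (r + 1)) / card (S i)" .
  have mem: "n \<in> E" if n: "n \<in> space P" and A: "A \<subseteq> {1..i}" "i \<in> A" "card A \<le> r" and c: "c i \<noteq> 0"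
    "\<And>j. j \<in> A \<Longrightarrow> \<bar>c j\<bar> \<le> int K" and rel: "(\<Sum>j\<in>A. c j * n j) = 0" for n A c
  proof -
    define A' where "A' = A - {i}"
    have fin: "finite A" "finite A'" using A finite_subset by (auto simp: A'_def)
    obtain h where h: "bij_betw h {..<card A'} A'"
      using ex_bij_betw_nat_finite[OF fin(2)] by (auto simp: atLeast0LessThan)
    have cA': "card A' \<le> r" using A fin card_Diff1_le[of A i] by (simp add: A'_def)
    \<comment> \<open>Shorter relations are padded to exactly \<open>r\<close> entries by index 1
      with coefficient 0; \<open>i \<ge> 2\<close> makes 1 an admissible smaller index.\<close>
    define js where "js = (\<lambda>t\<in>{..<r}. if t < card A' then h t else 1)"
    define cs where "cs = (\<lambda>t\<in>{..<r}. if t < card A' then c (h t) else 0)"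
    have hA: "h t \<in> A'" if "t < card A'" for t using h that by (auto simp: bij_betw_def)
    have lt: "1 \<le> j \<and> j < i" if "j \<in> A'" for j
      using A that by (auto simp: A'_def order_less_le)
    have \<tau>: "(js, cs, c i) \<in> T"
    proof -
      have "js t \<in> {1..<i}" if "t < r" for t using that i lt[OF hA, of t] by (auto simp: js_def)
      moreover have "cs t \<in> ?I" if "t < r" for t
        using that hA[of t] c(2)[of "h t"] by (auto simp: cs_def A'_def abs_le_iff)
      moreover have "c i \<in> ?I" using c(2)[of i] A by (auto simp: abs_le_iff)
      ultimately show ?thesis unfolding T_def by (auto simp: PiE_iff js_def cs_def)
    qed
    have "(\<Sum>t<r. cs t * n (js t)) = (\<Sum>t<card A'. c (h t) * n (h t))"
      using cA' by (intro sum.mono_neutral_cong_right) (auto simp: js_def cs_def)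
    also have "\<dots> = (\<Sum>j\<in>A'. c j * n j)"
      by (rule sum.reindex_bij_betw[OF h])
    also have "\<dots> = - (c i * n i)"
      using rel A fin by (simp add: A'_def sum.remove)
    finally have "G (js, cs, c i) n = n i" using c(1) by (simp add: G_def)
    with \<tau> n show ?thesis unfolding E_def by fastforce
  qed
  have "E \<in> sets P" using sets T unfolding E_def by auto
  with meas mem show ?thesis by blast
qed

lemma finite_block_ints: "finite (block_ints \<omega> a k)"
proof -
  have "block_ints \<omega> a k \<subseteq> {\<lfloor>if k = 1 then 0 else a * real (k - 1) powr \<omega> (k - 1)\<rfloor>..\<lceil>a * real k powr \<omega> k\<rceil>}"
    by (auto simp: block_ints_def block_def floor_le_iff le_ceiling_iff split: if_splits)
  then show ?thesis by (rule finite_subset) simp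
qed

text \<open>Monotonicity of \<open>\<omega>\<close> allows the left end point to be raised to the
  exponent \<open>\<omega> k\<close>. One power of \<open>k\<close> is then lost in taking the
  difference of the end points, and a second one absorbs \<open>a\<close> and the rounding.\<close>

lemma card_block_ints_ge:
  assumes "mono_on {1..} \<omega>" "a > 0" "k \<ge> 2" "\<omega> k \<ge> 2" "real k \<ge> 2 / a" "\<omega> (k - 1) > 0"
  shows "real k powr (\<omega> k - 2) \<le> card (block_ints \<omega> a k)"
proof -
  define x y where "x = a * real (k - 1) powr \<omega> (k - 1)" and "y = a * real k powr \<omega> k"
  have "block_ints \<omega> a k = {\<lceil>x\<rceil>..<\<lceil>y\<rceil>}"
    using assms by (auto simp: block_ints_def block_def x_def y_def ceiling_le_iff less_ceiling_iff)
  then have "real (card (block_ints \<omega> a k)) \<ge> y - x - 1"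
    by simp linarith
  moreover have "y - x \<ge> a * real k powr (\<omega> k - 1)"
  proof -
    have "real (k - 1) powr \<omega> (k - 1) \<le> real (k - 1) powr \<omega> k"
      using assms by (intro powr_mono) (auto intro: mono_onD)
    also have "\<dots> = real (k - 1) powr (\<omega> k - 1) * real (k - 1)"
      using powr_add[of "real (k - 1)" "\<omega> k - 1" 1] assms by simp
    also have "\<dots> \<le> real k powr (\<omega> k - 1) * (real k - 1)"
      using assms by (intro mult_mono powr_mono2) auto
    finally have "real (k - 1) powr \<omega> (k - 1) \<le> real k powr (\<omega> k - 1) * (real k - 1)" .
    moreover have "real k powr \<omega> k = real k powr (\<omega> k - 1) * real k"
      using powr_add[of "real k" "\<omega> k - 1" 1] assms by simp
    ultimately have "real k powr (\<omega> k - 1) \<le> real k powr \<omega> k - real (k - 1) powr \<omega> (k - 1)"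
      by (simp add: algebra_simps)
    from mult_left_mono[OF this, of a] assms show ?thesis by (simp add: x_def y_def algebra_simps)
  qed
  moreover have "a * real k powr (\<omega> k - 1) - 1 \<ge> real k powr (\<omega> k - 2)"
  proof -
    have "real k powr (\<omega> k - 1) = real k powr (\<omega> k - 2) * real k"
      using powr_add[of "real k" "\<omega> k - 2" 1] assms by simp
    moreover have "a * real k \<ge> 2" using assms by (simp add: field_simps)
    moreover have "real k powr (\<omega> k - 2) \<ge> 1" using assms by (intro ge_one_powr_ge_zero) auto
    ultimately have "a * real k powr (\<omega> k - 1) \<ge> 2 * real k powr (\<omega> k - 2)"
      using mult_right_mono[of 2 "a * real k" "real k powr (\<omega> k - 2)"] by (simp add: mult_ac)
    with \<open>real k powr (\<omega> k - 2) \<ge> 1\<close> show ?thesis by simp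
  qed
  ultimately show ?thesis by linarith
qed

text \<open>Nonnegativity is recorded as well because dilations of \<open>x\<close> by
  \<open>n i\<close> are later needed with \<open>n i \<ge> 1\<close>; that \<open>n i\<close> does
  not vanish will come from one-term relations.\<close>

lemma AE_relation_free:
  assumes omega_mono: "mono_on {1..} \<omega>"
    and omega_pos: "\<And>k. k \<ge> 1 \<Longrightarrow> \<omega> k > 0"
    and omega_lim: "filterlim \<omega> at_top sequentially"
    and a_pos: "a > 0"
    and a_large: "\<And>k. k \<ge> 1 \<Longrightarrow> block_ints \<omega> a k \<noteq> {}"
  shows "AE n in mu_omega \<omega> a. (\<exists>i\<^sub>0. relation_free n (\<lambda>i. \<omega> i / 136) 65 i\<^sub>0) \<and> (\<forall>k\<ge>1. n k \<ge> 0)"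
proof -
  define P where "P = mu_omega \<omega> a"
  have P: "P = (\<Pi>\<^sub>M k\<in>{1..}. uniform_count_measure (block_ints \<omega> a k))"
    by (simp add: P_def mu_omega_def)
  define r where "r i = nat \<lfloor>\<omega> i / 136\<rfloor>" for i
  define Q where "Q i E \<longleftrightarrow> E \<in> sets P \<and>
      measure P E \<le> real (i ^ r i * (2 * i ^ 65 + 1) ^ (r i + 1)) / card (block_ints \<omega> a i) \<and>
      (\<forall>n A c. n \<in> space P \<and> A \<subseteq> {1..i} \<and> i \<in> A \<and> card A \<le> r i \<and> c i \<noteq> 0 \<and>
      (\<forall>j\<in>A. \<bar>c j\<bar> \<le> int (i ^ 65)) \<and> (\<Sum>j\<in>A. c j * n j) = 0 \<longrightarrow> n \<in> E)" for i E
  have "\<exists>E. Q i E" if i: "i \<ge> 2" for i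
    using uniform_product_relation[where S="block_ints \<omega> a" and i=i and r="r i" and K="i ^ 65",
        folded P, OF finite_block_ints a_large i]
    unfolding Q_def Bex_def .
  then obtain E where EQ: "\<And>i. i \<ge> 2 \<Longrightarrow> Q i (E i)" by metis
  have E: "E i \<in> sets P"
      "measure P (E i) \<le> real (i ^ r i * (2 * i ^ 65 + 1) ^ (r i + 1)) / card (block_ints \<omega> a i)"
      "\<And>n A c. n \<in> space P \<Longrightarrow> A \<subseteq> {1..i} \<Longrightarrow> i \<in> A \<Longrightarrow> card A \<le> r i \<Longrightarrow> c i \<noteq> 0 \<Longrightarrow>
      (\<forall>j\<in>A. \<bar>c j\<bar> \<le> int (i ^ 65)) \<Longrightarrow> (\<Sum>j\<in>A. c j * n j) = 0 \<Longrightarrow> n \<in> E i"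
    if "i \<ge> 2" for i using EQ[OF that] unfolding Q_def by blast+
  interpret prob_space P unfolding P
    by (intro prob_space_PiM prob_space_uniform_count_measure) (use a_large finite_block_ints in auto)
  \<comment> \<open>From 142 on, \<open>67 * \<omega> i / 136 + 66 \<le> \<omega> i - 4\<close>
    holds, which leaves \<open>i powr (- 2)\<close> after division by the number of choices for
    \<open>n i\<close>.\<close>
  obtain i1 where i1: "\<And>i. i \<ge> i1 \<Longrightarrow> \<omega> i \<ge> 142"
    using omega_lim unfolding filterlim_at_top eventually_sequentially by metis
  define i2 where "i2 = max 3 (max i1 (nat \<lceil>2 / a\<rceil>))"
  have i2: "i \<ge> 3" "\<omega> i \<ge> 142" "real i \<ge> 2 / a" if "i \<ge> i2" for i
    using that i1[of i] by (auto simp: i2_def)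
  \<comment> \<open>Choosing a relation costs \<open>i ^ (67 * r + 66)\<close>, against about \<open>i powr (\<omega> i - 2)\<close> choices of \<open>n i\<close>;
    \<open>136\<close> is a crude constant leaving a summable remainder.\<close>
  have bound: "measure P (E i) \<le> 1 / real i ^ 2" if i: "i \<ge> i2" for i
  proof -
    note i2 = i2[OF i]
    let ?x = "real i"
    have x: "?x \<ge> 3" using i2 by simp
    have 1: "?x powr (\<omega> i - 2) \<le> card (block_ints \<omega> a i)"
      by (rule card_block_ints_ge[OF omega_mono a_pos]) (use i2 omega_pos[of "i - 1"] in auto)
    have "2 * ?x ^ 65 + 1 \<le> ?x ^ 66"
    proof -
      have "1 \<le> ?x ^ 65" using x by (intro one_le_power) auto
      moreover have "3 * ?x ^ 65 \<le> ?x * ?x ^ 65" using x by (intro mult_right_mono) auto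
      ultimately show ?thesis by (simp add: power_Suc[symmetric])
    qed
    then have "real (i ^ r i * (2 * i ^ 65 + 1) ^ (r i + 1)) \<le> ?x ^ r i * (?x ^ 66) ^ (r i + 1)"
      by (simp only: of_nat_mult of_nat_power of_nat_add of_nat_1 of_nat_numeral)
         (intro mult_left_mono power_mono, auto)
    also have "\<dots> = ?x ^ (67 * r i + 66)" by (simp only: power_mult[symmetric] power_add[symmetric])
       (simp add: algebra_simps)
    also have "\<dots> = ?x powr (67 * r i + 66)" using x by (subst powr_realpow[symmetric]) auto
    also have "\<dots> \<le> ?x powr (\<omega> i - 4)"
    proof (rule powr_mono)
      have "real (r i) \<le> \<omega> i / 136" unfolding r_def using i2 by (intro of_nat_floor) simp
      then show "real (67 * r i + 66) \<le> \<omega> i - 4" using i2 by simp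
    qed (use x in auto)
    finally have 2: "real (i ^ r i * (2 * i ^ 65 + 1) ^ (r i + 1)) \<le> ?x powr (\<omega> i - 4)" .
    have "measure P (E i) \<le> real (i ^ r i * (2 * i ^ 65 + 1) ^ (r i + 1)) / card (block_ints \<omega> a i)"
      using i2 by (intro E(2)) auto
    also have "\<dots> \<le> ?x powr (\<omega> i - 4) / ?x powr (\<omega> i - 2)"
      by (intro frac_le 2 1) (use x in auto)
    also have "\<dots> = ?x powr (- 2)"
      by (simp add: powr_diff[symmetric])
    also have "\<dots> = 1 / ?x ^ 2" using x by (simp add: powr_minus powr_numeral divide_inverse)
    finally show ?thesis .
  qed
  have "AE n in P. eventually (\<lambda>i. n \<in> space P - E (i + i2)) sequentially"
  proof (rule borel_cantelli_AE1)
    show "E (i + i2) \<in> sets P" for i using i2(1)[of "i + i2"] by (intro E(1)) auto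
    show "emeasure P (E (i + i2)) < \<infinity>" for i by (simp add: less_top[symmetric])
    have "summable (\<lambda>i. 1 / real (i + i2) ^ 2)"
      using inverse_power_summable[of 2, where 'a=real] by (subst summable_iff_shift) (simp add: divide_inverse)
    then show "summable (\<lambda>i. measure P (E (i + i2)))"
    proof (rule summable_comparison_test')
      fix i show "norm (measure P (E (i + i2))) \<le> 1 / real (i + i2) ^ 2"
        using bound[of "i + i2"] by simp
    qed
  qed
  then show ?thesis unfolding P_def[symmetric]
  proof (rule AE_mp, intro AE_I2 impI conjI)
    fix n assume n: "n \<in> space P" and ev: "eventually (\<lambda>i. n \<in> space P - E (i + i2)) sequentially"
    show "\<forall>k\<ge>1. n k \<ge> 0"
    proof (intro allI impI)
      fix k :: nat assume "k \<ge> 1"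
      then have "n k \<in> block_ints \<omega> a k"
        using n by (auto simp: P space_PiM space_uniform_count_measure PiE_iff)
      then have "(if k = 1 then 0 else a * real (k - 1) powr \<omega> (k - 1)) \<le> real_of_int (n k)"
        by (simp add: block_ints_def block_def)
      moreover have "0 \<le> (if k = 1 then 0 else a * real (k - 1) powr \<omega> (k - 1))"
        using a_pos by simp
      ultimately have "0 \<le> real_of_int (n k)" by linarith
      then show "n k \<ge> 0" by simp
    qed
    obtain i3 where i3: "\<And>i. i \<ge> i3 \<Longrightarrow> n \<notin> E (i + i2)"
      using ev unfolding eventually_sequentially by auto
    have "relation_free n (\<lambda>i. \<omega> i / 136) 65 (i2 + i3)"
      unfolding relation_free_def
    proof (intro allI impI notI, elim conjE)
      fix i A c assume i: "i \<ge> i2 + i3" and A: "A \<subseteq> {1..i}" "i \<in> A" "real (card A) \<le> \<omega> i / 136"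
        and c: "c i \<noteq> 0" "\<forall>j\<in>A. \<bar>c j\<bar> \<le> int i ^ 65" and rel: "(\<Sum>j\<in>A. c j * n j) = 0"
      have "card A \<le> r i" unfolding r_def using A(3) by (simp add: le_nat_floor)
      moreover have "i \<ge> 2" using i i2(1)[of i] by simp
      ultimately have "n \<in> E i" using E(3)[OF _ n A(1,2) _ c(1) _ rel] c(2) by auto
      moreover have "i3 \<le> i - i2" "i - i2 + i2 = i" using i by arith+
      ultimately show False using i3[of "i - i2"] by simp
    qed
    then show "\<exists>i\<^sub>0. relation_free n (\<lambda>i. \<omega> i / 136) 65 i\<^sub>0" ..
  qed
qed

section \<open>Fejer approximation of functions of bounded variation\<close>

lemma measurable_lebesgue_affine:
  fixes h :: "real \<Rightarrow> real"
  assumes "h \<in> borel_measurable lebesgue" "c \<noteq> 0"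
  shows "(\<lambda>x. h (t + c * x)) \<in> borel_measurable lebesgue"
proof -
  have "(\<lambda>x. t + c * x) \<in> lebesgue \<rightarrow>\<^sub>M lebesgue"
    using lebesgue_affine_measurable[where c = "\<lambda>x::real. c" and t = t] assms(2) by simp
  from measurable_compose[OF this assms(1)] show ?thesis .
qed

lemma bounded_measurable_integrable_on:
  fixes h :: "real \<Rightarrow> real"
  assumes "h \<in> borel_measurable lebesgue" "\<And>x. \<bar>h x\<bar> \<le> C"
  shows "h integrable_on {a..b}"
  by (rule measurable_bounded_by_integrable_imp_integrable[where g="\<lambda>_. C"])
     (use assms in \<open>auto intro: measurable_restrict_space1\<close>)

lemma bounded_measurable_integrable_unit:
  fixes h :: "real \<Rightarrow> real"
  assumes "h \<in> borel_measurable lebesgue" "\<And>x. \<bar>h x\<bar> \<le> C"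
  shows "integrable \<U> h"
  by (rule integrable_bounded_prob[OF prob_space_unit measurable_restrict_space1, where C=C])
     (use assms in auto)

lemma integral_unit_eq:
  fixes h :: "real \<Rightarrow> real"
  assumes "h \<in> borel_measurable lebesgue" "\<And>x. \<bar>h x\<bar> \<le> C"
  shows "(\<integral>x. h x \<partial>\<U>) = integral {0..1} h"
  by (rule lebesgue_integral_eq_integral[OF bounded_measurable_integrable_unit[OF assms]]) simp

lemma periodic_add_int:
  fixes h :: "real \<Rightarrow> 'a"
  assumes "\<And>x. h (x + 1) = h x"
  shows "h (x + of_int k) = h x"
proof -
  have nat: "h (x + of_nat m) = h x" for x m
  proof (induction m)
    case (Suc m)
    have "h (x + of_nat (Suc m)) = h ((x + of_nat m) + 1)" by (simp add: algebra_simps)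
    with assms Suc show ?case by simp
  qed simp
  show ?thesis
  proof (cases "k \<ge> 0")
    case True
    with nat[of x "nat k"] show ?thesis by simp
  next
    case False
    with nat[of "x + of_int k" "nat (- k)"] show ?thesis by simp
  qed
qed

lemma integral_periodic_shift:
  fixes h :: "real \<Rightarrow> real"
  assumes h: "h \<in> borel_measurable lebesgue" "\<And>x. \<bar>h x\<bar> \<le> C" and per: "\<And>x. h (x + 1) = h x"
    and s: "s \<ge> 0"
  shows "(\<integral>x. h (x + s) \<partial>\<U>) = (\<integral>x. h x \<partial>\<U>)"
proof -
  note int = bounded_measurable_integrable_on[OF h]
  have "(\<lambda>x. h (x + s)) \<in> borel_measurable lebesgue"
    using measurable_lebesgue_affine[OF h(1), of 1 s] by (simp add: add.commute)
  then have "(\<integral>x. h (x + s) \<partial>\<U>) = integral {0..1} (\<lambda>x. h (x + s))"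
    by (rule integral_unit_eq) (rule h(2))
  also have "\<dots> = integral {s..1 + s} h"
    using integral_shift_real_ivl[of s s "1 + s" h] by simp
  also have "\<dots> = integral {0..1} h"
  proof -
    have "integral {0..s} h + integral {s..1 + s} h = integral {0..1 + s} h"
      using s int by (intro Henstock_Kurzweil_Integration.integral_combine) auto
    moreover have "integral {0..1} h + integral {1..1 + s} h = integral {0..1 + s} h"
      using s int by (intro Henstock_Kurzweil_Integration.integral_combine) auto
    moreover have "integral {1..1 + s} h = integral {0..s} h"
      using integral_shift_real_ivl[of 1 1 "1 + s" h] by (simp add: per)
    ultimately show ?thesis by simp
  qed
  also have "\<dots> = (\<integral>x. h x \<partial>\<U>)"
    by (rule integral_unit_eq[OF h, symmetric])
  finally show ?thesis .
qed

text \<open>Dilation by \<open>m\<close> runs through \<open>m\<close> periods at density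
  \<open>1 / m\<close>. This carries the L1 approximation error from \<open>x\<close> over to
  \<open>n i * x\<close>.\<close>

lemma integral_periodic_scale:
  fixes h :: "real \<Rightarrow> real"
  assumes h: "h \<in> borel_measurable lebesgue" "\<And>x. \<bar>h x\<bar> \<le> C" and per: "\<And>x. h (x + 1) = h x"
    and m: "m \<ge> 1"
  shows "(\<integral>x. h (of_int m * x) \<partial>\<U>) = (\<integral>x. h x \<partial>\<U>)"
proof -
  note int = bounded_measurable_integrable_on[OF h]
  have multi: "integral {0..real k} h = real k * integral {0..1} h" for k
  proof (induction k)
    case (Suc k)
    have "integral {0..real k} h + integral {real k..1 + real k} h = integral {0..1 + real k} h"
      using int by (intro Henstock_Kurzweil_Integration.integral_combine) auto
    moreover have "integral {real k..1 + real k} h = integral {0..1} h"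
      using integral_shift_real_ivl[of "real k" "real k" "1 + real k" h]
        periodic_add_int[of h _ "int k", OF per] by simp
    ultimately show ?case using Suc by (simp add: algebra_simps)
  qed simp
  have "((\<lambda>x. h (of_int m * x)) has_integral ((1 / \<bar>of_int m\<bar>) *\<^sub>R integral {0..real (nat m)} h))
      ((\<lambda>x. x / of_int m) ` {0..real (nat m)})"
    using m by (intro has_integral_stretch_real integrable_integral int) auto
  also have "((\<lambda>x. x / of_int m) ` {0..real (nat m)}) = {0..1}"
    using m image_divide_atLeastAtMost[of "real_of_int m" 0 "real_of_int m"] by simp
  finally have "integral {0..1} (\<lambda>x. h (of_int m * x)) = integral {0..1} h"
    using m multi[of "nat m"] by (simp add: integral_unique)
  moreover have "(\<integral>x. h (of_int m * x) \<partial>\<U>) = integral {0..1} (\<lambda>x. h (of_int m * x))"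
    by (rule integral_unit_eq[where C=C])
       (use m measurable_lebesgue_affine[OF h(1), of "of_int m" 0] h(2) in auto)
  ultimately show ?thesis using integral_unit_eq[OF h] by simp
qed

section \<open>Variation along a grid\<close>

lemma total_variation_bound:
  fixes f :: "real \<Rightarrow> real"
  assumes "total_variation f a b < \<infinity>"
  obtains V where "V \<ge> 0" "\<And>m t. strict_mono_on {..m} t \<Longrightarrow> t 0 = a \<Longrightarrow> t m = b \<Longrightarrow>
    (\<Sum>i<m. \<bar>f (t (Suc i)) - f (t i)\<bar>) \<le> V"
proof -
  obtain k :: nat where k: "total_variation f a b < ereal (real k)"
    using assms less_PInf_Ex_of_nat by auto
  have "(\<Sum>i<m. \<bar>f (t (Suc i)) - f (t i)\<bar>) \<le> real k"
    if t: "strict_mono_on {..m} t" "t 0 = a" "t m = b" for m t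
  proof -
    have "ereal (\<Sum>i<m. \<bar>f (t (Suc i)) - f (t i)\<bar>) \<le> total_variation f a b"
      unfolding total_variation_def by (rule SUP_upper2[of "(m, t)"]) (use t in auto)
    with k show ?thesis by (metis ereal_less_eq(3) less_imp_le order_trans)
  qed
  then show thesis by (intro that[of "real k"]) auto
qed

text \<open>For \<open>0 < s < 1 / D\<close> the two sums together run over the partition
  \<open>0 < s < 1 / D < 1 / D + s < 2 / D < \<dots> < 1\<close>.\<close>

lemma grid_variation:
  fixes D :: nat and f :: "real \<Rightarrow> real"
  assumes V: "\<And>m t. strict_mono_on {..m} t \<Longrightarrow> t 0 = 0 \<Longrightarrow> t m = 1 \<Longrightarrow>
      (\<Sum>i<m. \<bar>f (t (Suc i)) - f (t i)\<bar>) \<le> V"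
    and D: "D \<ge> 1" and s: "0 \<le> s" "s \<le> 1 / D"
  shows "(\<Sum>j<D. \<bar>f (j / D + s) - f (j / D)\<bar> + \<bar>f (real (j + 1) / D) - f (j / D + s)\<bar>) \<le> V"
proof (cases "s = 0 \<or> s = 1 / D")
  case True
  have "(\<Sum>i<D. \<bar>f (Suc i / D) - f (i / D)\<bar>) \<le> V"
    by (rule V) (use D in \<open>auto simp: strict_mono_on_def divide_strict_right_mono\<close>)
  moreover have "\<bar>f (j / D + s) - f (j / D)\<bar> + \<bar>f ((j + 1) / D) - f (j / D + s)\<bar>
      = \<bar>f (Suc j / D) - f (j / D)\<bar>" for j :: nat
    using True by (auto simp: add_divide_distrib add.commute)
  ultimately show ?thesis by simp
next
  case False
  with s have s: "0 < s" "s < 1 / D" by auto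
  define t where "t i = (i div 2) / D + (if even i then 0 else s)" for i :: nat
  have step: "t i < t (Suc i)" for i
    using s by (auto simp: t_def add_divide_distrib elim!: evenE oddE)
  then have "strict_mono t" by (simp add: strict_mono_Suc_iff)
  then have "strict_mono_on {..2 * D} t" by (auto simp: strict_mono_on_def strict_mono_def)
  then have "(\<Sum>i<2 * D. \<bar>f (t (Suc i)) - f (t i)\<bar>) \<le> V"
    by (rule V) (use D in \<open>auto simp: t_def\<close>)
  also have "(\<Sum>i<2 * D. \<bar>f (t (Suc i)) - f (t i)\<bar>)
      = (\<Sum>j<D. \<bar>f (t (Suc (2 * j))) - f (t (2 * j))\<bar> + \<bar>f (t (Suc (Suc (2 * j)))) - f (t (Suc (2 * j)))\<bar>)"
    by (induction D) auto
  also have "\<dots> = (\<Sum>j<D. \<bar>f (j / D + s) - f (j / D)\<bar> + \<bar>f ((j + 1) / D) - f (j / D + s)\<bar>)"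
    by (intro sum.cong) (auto simp: t_def add.commute)
  finally show ?thesis .
qed

lemma sum_lessThan_periodic:
  fixes F :: "nat \<Rightarrow> real"
  assumes "\<And>j. F (j + D) = F j"
  shows "(\<Sum>j<D. F (j + i)) = (\<Sum>j<D. F j)"
proof (induction i)
  case (Suc i)
  have "(\<Sum>j<D. F (j + Suc i)) = (\<Sum>j<Suc D. F (j + i)) - F i"
    by (subst sum.lessThan_Suc_shift) simp
  also have "\<dots> = (\<Sum>j<D. F (j + i))" using assms[of i] by (simp add: add.commute)
  finally show ?case using Suc by simp
qed simp

text \<open>Write \<open>t = q / D + s\<close>. The point \<open>t + j / D\<close> is reached from
  \<open>j / D\<close> forwards over \<open>q\<close> full cells and one partial cell, or backwards
  from \<open>j / D + 1\<close>; the better route gives \<open>min t (1 - t)\<close>. Summed over a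
  full period, the cells at any fixed offset contribute at most \<open>V\<close>.\<close>

lemma grid_translation_variation:
  fixes D :: nat and f :: "real \<Rightarrow> real"
  assumes V: "\<And>m t. strict_mono_on {..m} t \<Longrightarrow> t 0 = 0 \<Longrightarrow> t m = 1 \<Longrightarrow>
      (\<Sum>i<m. \<bar>f (t (Suc i)) - f (t i)\<bar>) \<le> V"
    and V0: "V \<ge> 0" and per: "\<And>x. f (x + 1) = f x"
    and D: "D \<ge> 1" and t: "0 \<le> t" "t < 1"
  shows "(\<Sum>j<D. \<bar>f (t + j / D) - f (j / D)\<bar>) / D \<le> V * (min t (1 - t) + 1 / D)"
proof -
  define q where "q = nat \<lfloor>t * D\<rfloor>"
  define s where "s = t - q / D"
  have q: "real q \<le> t * D" "t * D < real q + 1" using t D by (auto simp: q_def)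
  have "s * D = t * D - q" using D by (simp add: s_def algebra_simps)
  with q have "0 \<le> s * D" "s * D \<le> 1" by auto
  then have s: "0 \<le> s" "s \<le> 1 / D" using D by (auto simp: zero_le_mult_iff pos_le_divide_eq)
  have "t * D < D" using t D by simp
  with q have qD: "q < D" by linarith
  define G where "G j = \<bar>f (j / D + s) - f (j / D)\<bar>" for j :: nat
  define H where "H j = \<bar>f (real (j + 1) / D) - f (j / D + s)\<bar>" for j :: nat
  define K where "K j = \<bar>f (real (j + 1) / D) - f (j / D)\<bar>" for j :: nat
  have e: "real (j + D) / D = j / D + 1" "real (j + D + 1) / D = real (j + 1) / D + 1" for j
    using D by (auto simp: add_divide_distrib)
  have per_add: "f (x + 1 + y) = f (x + y)" for x y
    using per[of "x + y"] by (simp only: add.assoc add.commute[of y 1])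
  have per': "G (j + D) = G j" "H (j + D) = H j" "K (j + D) = K j" for j
    by (simp_all only: G_def H_def K_def e per per_add)
  have GH: "(\<Sum>j<D. G j + H j) \<le> V"
    using grid_variation[of f V D s, OF V D s] unfolding G_def H_def .
  have "(\<Sum>j<D. G j) \<ge> 0" "(\<Sum>j<D. H j) \<ge> 0"
    by (auto simp: G_def H_def intro!: sum_nonneg)
  with GH have G: "(\<Sum>j<D. G j) \<le> V" and H: "(\<Sum>j<D. H j) \<le> V"
    by (simp_all add: sum.distrib)
  have "(\<Sum>j<D. K j) \<le> (\<Sum>j<D. G j + H j)"
    unfolding G_def H_def K_def by (intro sum_mono) auto
  with GH have K: "(\<Sum>j<D. K j) \<le> V" by simp
  have tele: "\<bar>f ((j + b) / D) - f ((j + a) / D)\<bar> \<le> (\<Sum>i = a..<b. K (j + i))" if "a \<le> b" for j a b :: nat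
  proof -
    let ?F = "\<lambda>i. f (real (j + i) / D)"
    have "f (real (j + b) / D) - f (real (j + a) / D) = (\<Sum>i = a..<b. ?F (Suc i) - ?F i)"
      using sum_Suc_diff'[OF that, of ?F] by simp
    also have "\<bar>\<dots>\<bar> \<le> (\<Sum>i = a..<b. \<bar>?F (Suc i) - ?F i\<bar>)"
      by (rule sum_abs)
    also have "\<dots> = (\<Sum>i = a..<b. K (j + i))" by (simp add: K_def)
    finally show ?thesis .
  qed
  have sumK: "(\<Sum>j<D. \<Sum>i = a..<b. K (j + i)) \<le> (real b - real a) * V" if "a \<le> b" for a b
  proof -
    have "(\<Sum>j<D. \<Sum>i = a..<b. K (j + i)) = (\<Sum>i = a..<b. \<Sum>j<D. K (j + i))"
      by (rule sum.swap)
    also have "\<dots> = (\<Sum>i = a..<b. \<Sum>j<D. K j)"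
      using sum_lessThan_periodic[of K D, OF per'(3)] by simp
    also have "\<dots> \<le> (\<Sum>i = a..<b. V)" by (intro sum_mono K)
    finally show ?thesis using that by (simp add: of_nat_diff)
  qed
  have tj: "t + j / D = (j + q) / D + s" for j :: nat
    by (simp add: s_def add_divide_distrib)
  have 1: "(\<Sum>j<D. \<bar>f (t + j / D) - f (j / D)\<bar>) \<le> V * (q + 1)"
  proof -
    have "(\<Sum>j<D. \<bar>f (t + j / D) - f (j / D)\<bar>) \<le> (\<Sum>j<D. G (j + q) + (\<Sum>i = 0..<q. K (j + i)))"
    proof (intro sum_mono)
      fix j show "\<bar>f (t + j / D) - f (j / D)\<bar> \<le> G (j + q) + (\<Sum>i = 0..<q. K (j + i))"
        using tele[of 0 q j] by (simp add: G_def tj)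
    qed
    also have "\<dots> = (\<Sum>j<D. G j) + (\<Sum>j<D. \<Sum>i = 0..<q. K (j + i))"
      by (simp add: sum.distrib sum_lessThan_periodic[of G D, OF per'(1)])
    also have "\<dots> \<le> V + q * V" using sumK[of 0 q] G by simp
    finally show ?thesis by (simp add: algebra_simps)
  qed
  \<comment> \<open>Backward route: the rest of the partial cell and \<open>D - q - 1\<close> full
    cells up to \<open>j / D + 1\<close>, where \<open>f\<close> has the value
    \<open>f (j / D)\<close>.\<close>
  have 2: "(\<Sum>j<D. \<bar>f (t + j / D) - f (j / D)\<bar>) \<le> V * (D - q)"
  proof -
    have "(\<Sum>j<D. \<bar>f (t + j / D) - f (j / D)\<bar>) \<le> (\<Sum>j<D. H (j + q) + (\<Sum>i = Suc q..<D. K (j + i)))"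
    proof (intro sum_mono)
      fix j show "\<bar>f (t + j / D) - f (j / D)\<bar> \<le> H (j + q) + (\<Sum>i = Suc q..<D. K (j + i))"
        using tele[of "Suc q" D j] qD per[of "j / D"] e(1)[of j] by (simp add: H_def tj algebra_simps)
    qed
    also have "\<dots> = (\<Sum>j<D. H j) + (\<Sum>j<D. \<Sum>i = Suc q..<D. K (j + i))"
      by (simp add: sum.distrib sum_lessThan_periodic[of H D, OF per'(2)])
    also have "\<dots> \<le> V + (real D - real (Suc q)) * V"
      using sumK[of "Suc q" D] H qD by simp
    finally show ?thesis using qD by (simp add: algebra_simps of_nat_diff)
  qed
  have 3: "(q + 1) / D \<le> t + 1 / D" "(D - q) / D \<le> 1 - t + 1 / D"
    using s D qD by (auto simp: s_def add_divide_distrib diff_divide_distrib of_nat_diff)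
  have "(\<Sum>j<D. \<bar>f (t + j / D) - f (j / D)\<bar>) / D \<le> V * (t + 1 / D)"
    using divide_right_mono[OF 1, of "real D"] mult_left_mono[OF 3(1) V0] by simp
  moreover have "(\<Sum>j<D. \<bar>f (t + j / D) - f (j / D)\<bar>) / D \<le> V * (1 - t + 1 / D)"
    using divide_right_mono[OF 2, of "real D"] mult_left_mono[OF 3(2) V0] by simp
  ultimately show ?thesis by (cases "t \<le> 1 - t") (simp_all add: min_def)
qed

section \<open>The Fejer kernel\<close>

definition fejer :: "nat \<Rightarrow> real \<Rightarrow> real" where
  "fejer D t = (norm (\<Sum>k<D. character (int k) t))\<^sup>2 / D"

lemma fejer_nonneg: "fejer D t \<ge> 0"
  by (simp add: fejer_def)

lemma fejer_expand:
  "complex_of_real (fejer D t) = (\<Sum>k<D. \<Sum>l<D. character (int k - int l) t) / D"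
proof -
  have "complex_of_real ((norm (\<Sum>k<D. character (int k) t))\<^sup>2)
      = (\<Sum>k<D. character (int k) t) * cnj (\<Sum>l<D. character (int l) t)"
    by (rule complex_norm_square)
  also have "\<dots> = (\<Sum>k<D. \<Sum>l<D. character (int k - int l) t)"
    unfolding cnj_sum cnj_character sum_product character_add[symmetric] by simp
  finally show ?thesis unfolding fejer_def by (simp only: of_real_divide of_real_of_nat_eq)
qed

lemma continuous_fejer: "continuous_on UNIV (fejer D)"
  unfolding fejer_def divide_inverse by (intro continuous_intros continuous_character)

lemma character_periodic: "character j (x + 1) = character j x"
  using character_int[of j 1] by (simp add: character_add_arg)

lemma fejer_periodic: "fejer D (x + 1) = fejer D x"
  by (simp add: fejer_def character_periodic)

lemma fejer_le: "fejer D t \<le> D"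
proof -
  have "norm (\<Sum>k<D. character (int k) t) \<le> (\<Sum>k<D. norm (character (int k) t))" by (rule norm_sum)
  then have "(norm (\<Sum>k<D. character (int k) t))\<^sup>2 \<le> (real D)\<^sup>2" by (intro power_mono) auto
  then show ?thesis by (cases "D = 0") (auto simp: fejer_def power2_eq_square field_simps)
qed

text \<open>Discrete orthogonality: a geometric sum over powers of a root of unity, which differs
  from 1 because \<open>D\<close> cannot divide a nonzero \<open>m\<close> with
  \<open>\<bar>m\<bar> < D\<close>.\<close>

lemma sum_character_grid:
  assumes "\<bar>m\<bar> < int D"
  shows "(\<Sum>j<D. character m (- (real j / D))) = (if m = 0 then of_nat D else 0)"
proof (cases "m = 0")
  case False
  have D: "D > 0" using assms by auto
  define z where "z = character m (- (1 / D))"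
  have z: "character m (- (real j / D)) = z ^ j" for j
    unfolding z_def character_def
    by (subst Complex.DeMoivre, rule arg_cong[where f=cis]) (simp add: field_simps)
  have "z \<noteq> 1"
  proof
    assume "z = 1"
    then have "exp (\<i> * of_real (2 * pi * (of_int m * - (1 / D)))) = 1"
      by (simp add: z_def character_def cis_conv_exp)
    then obtain k :: int where "2 * pi * (of_int m * - (1 / D)) = of_int (2 * k) * pi"
      by (auto simp: exp_eq_1)
    then have "(2 * pi) * (of_int m * - (1 / D)) = (2 * pi) * real_of_int k" by simp
    then have "of_int m * - (1 / D) = real_of_int k" by (simp only: mult_cancel_left) simp
    then have "real_of_int m = real_of_int (- k * int D)" using D by (simp add: field_simps)
    then have "m = - k * int D" by (simp only: of_int_eq_iff)
    with assms False show False
      using zero_less_imp_eq_int[of "\<bar>k\<bar>"] mult_right_mono[of 1 "\<bar>k\<bar>" "int D"]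
      by (cases "k = 0") (auto simp: abs_mult)
  qed
  moreover have "z ^ D = 1"
    using z[of D] character_int[of m "-1"] D by simp
  ultimately show ?thesis using False by (simp add: z sum_gp_strict)
qed (simp add: character_def)

text \<open>The frequencies \<open>k - l\<close> stay below \<open>D\<close> in modulus, so
  summation over the grid kills all but the frequency 0. After division by \<open>D\<close> the
  translates form a partition of unity, which lets samples of \<open>f\<close> take the place of a
  convolution integral.\<close>

lemma sum_fejer_grid:
  assumes "D \<ge> 1"
  shows "(\<Sum>j<D. fejer D (x - real j / D)) = D"
proof -
  have arg: "character m (x - real j / D) = character m x * character m (- (real j / D))" for m and j :: nat
    using character_add_arg[of m x "- (real j / D)"] by simp
  have "complex_of_real (\<Sum>j<D. fejer D (x - real j / D))
      = (\<Sum>j<D. (\<Sum>k<D. \<Sum>l<D. character (int k - int l) x * character (int k - int l) (- (real j / D)))) / D"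
    by (simp only: of_real_sum fejer_expand arg sum_divide_distrib)
  also have "(\<Sum>j<D. (\<Sum>k<D. \<Sum>l<D. character (int k - int l) x * character (int k - int l) (- (real j / D))))
      = (\<Sum>k<D. \<Sum>j<D. \<Sum>l<D. character (int k - int l) x * character (int k - int l) (- (real j / D)))"
    by (rule sum.swap)
  also have "\<dots> = (\<Sum>k<D. \<Sum>l<D. \<Sum>j<D. character (int k - int l) x * character (int k - int l) (- (real j / D)))"
    by (intro sum.cong refl sum.swap)
  also have "\<dots> = (\<Sum>k<D. \<Sum>l<D. if k = l then of_nat D else 0)"
    unfolding sum_distrib_left[symmetric]
    by (intro sum.cong refl) (auto simp: sum_character_grid)
  also have "\<dots> = of_nat D * of_nat D" by (simp add: sum.delta)
  also have "of_nat D * of_nat D / of_nat D = complex_of_real (real D)" using assms by simp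
  finally show ?thesis by (simp only: of_real_eq_iff)
qed

lemma integral_fejer_character:
  assumes "D \<ge> 1" "m \<ge> 0"
  shows "(\<integral>t. fejer D t * character m t \<partial>\<U>) = (if m < D then (D - m) / D else 0)"
proof -
  have "(\<integral>t. fejer D t * character m t \<partial>\<U>)
      = (\<integral>t. (\<Sum>k<D. \<Sum>l<D. character (int k - int l + m) t) / D \<partial>\<U>)"
    by (simp add: fejer_expand character_add sum_distrib_right)
  also have "\<dots> = (\<Sum>k<D. \<Sum>l<D. (if int k - int l + m = 0 then (1::complex) else 0)) / D"
    by (simp add: integral_character integrable_character Bochner_Integration.integral_sum
       Bochner_Integration.integrable_sum)
  also have "(\<Sum>k<D. \<Sum>l<D. (if int k - int l + m = 0 then 1 else (0::complex)))
      = (\<Sum>k<D. if k + nat m < D then 1 else 0)"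
  proof (intro sum.cong refl)
    fix k
    have "(\<Sum>l<D. (if int k - int l + m = 0 then 1 else (0::complex))) = (\<Sum>l<D. if l = k + nat m then 1 else 0)"
      using assms by (intro sum.cong) auto
    then show "(\<Sum>l<D. (if int k - int l + m = 0 then 1 else (0::complex))) = (if k + nat m < D then 1 else 0)"
      by simp
  qed
  also have "\<dots> = of_nat (card {k. k < D \<and> k + nat m < D})"
    by (simp add: sum.If_cases Int_def)
  also have "{k. k < D \<and> k + nat m < D} = {..<D - nat m}" by auto
  finally show ?thesis using assms by (auto simp: of_nat_diff)
qed

lemma integrable_fejer: "integrable \<U> (fejer D)"
  by (rule integrable_bounded_prob[OF prob_space_unit measurable_unit_continuous[OF continuous_fejer],
        where C="real D"])
     (simp add: fejer_nonneg fejer_le)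

lemma integral_fejer:
  assumes "D \<ge> 1" shows "(\<integral>t. fejer D t \<partial>\<U>) = 1"
proof -
  have "complex_of_real (\<integral>t. fejer D t \<partial>\<U>) = 1"
    using integral_fejer_character[OF assms, of 0] assms by (simp flip: integral_complex_of_real)
  then show ?thesis by simp
qed

text \<open>Measures the concentration of the kernel near the integers. As
  \<open>(sin (pi * t))\<^sup>2\<close> is a trigonometric polynomial of degree 1, only the first
  Fourier coefficient \<open>(D - 1) / D\<close> enters.\<close>

lemma integral_fejer_sin:
  assumes "D \<ge> 1"
  shows "integrable \<U> (\<lambda>t. fejer D t * (sin (pi * t))\<^sup>2)"
    and "(\<integral>t. fejer D t * (sin (pi * t))\<^sup>2 \<partial>\<U>) = 1 / (2 * real D)"
proof -
  have int: "integrable \<U> (\<lambda>t. fejer D t * character 1 t)"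
  proof (rule integrable_bounded_prob[OF prob_space_unit measurable_unit_continuous, where C="real D"])
    show "continuous_on UNIV (\<lambda>t. fejer D t * character 1 t)"
      by (intro continuous_intros continuous_fejer continuous_character)
  qed (simp add: fejer_nonneg fejer_le norm_mult)
  have sin2: "(sin (pi * t))\<^sup>2 = (1 - Re (character 1 t)) / 2" for t
    using cos_double_sin[of "pi * t"] by (simp add: character_def mult_ac)
  have *: "fejer D t * (sin (pi * t))\<^sup>2 = (fejer D t - Re (fejer D t * character 1 t)) / 2" for t
    by (simp add: sin2 algebra_simps)
  show "integrable \<U> (\<lambda>t. fejer D t * (sin (pi * t))\<^sup>2)"
    unfolding * using int by (intro integrable_divide Bochner_Integration.integrable_diff integrable_fejer integrable_Re)
  have "(\<integral>t. Re (fejer D t * character 1 t) \<partial>\<U>) = Re (\<integral>t. fejer D t * character 1 t \<partial>\<U>)"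
    by (rule integral_Re[OF int])
  also have "\<dots> = (D - 1) / D"
    using integral_fejer_character[OF assms, of 1] assms by (auto simp: of_nat_diff)
  finally have "(\<integral>t. Re (fejer D t * character 1 t) \<partial>\<U>) = (D - 1) / D" .
  moreover have "(\<integral>t. fejer D t * (sin (pi * t))\<^sup>2 \<partial>\<U>)
      = ((\<integral>t. fejer D t \<partial>\<U>) - (\<integral>t. Re (fejer D t * character 1 t) \<partial>\<U>)) / 2"
    unfolding * using Bochner_Integration.integral_diff[OF integrable_fejer integrable_Re[OF int]]
    by (simp only: integral_divide_zero)
  ultimately have "(\<integral>t. fejer D t * (sin (pi * t))\<^sup>2 \<partial>\<U>) = (1 - (D - 1) / D) / 2"
    by (simp only: integral_fejer[OF assms])
  then show "(\<integral>t. fejer D t * (sin (pi * t))\<^sup>2 \<partial>\<U>) = 1 / (2 * real D)"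
    using assms by (simp add: field_simps of_nat_diff)
qed

text \<open>Concavity of the sine would even give twice the left-hand side; this cruder form follows
  from the cubic Taylor bound.\<close>

lemma min_le_sin:
  fixes t :: real
  assumes "0 \<le> t" "t \<le> 1"
  shows "min t (1 - t) \<le> sin (pi * t)"
proof -
  have *: "t \<le> sin (pi * t)" if t: "0 \<le> t" "t \<le> 1 / 2" for t
  proof -
    have "\<bar>sin (pi * t) - (\<Sum>m<3. sin_coeff m * (pi * t) ^ m)\<bar> \<le> inverse (fact 3) * \<bar>pi * t\<bar> ^ 3"
      by (rule Maclaurin_sin_bound)
    moreover have "(\<Sum>m<3. sin_coeff m * (pi * t) ^ m) = pi * t"
      by (simp add: numeral_3_eq_3 sin_coeff_def)
    ultimately have "\<bar>sin (pi * t) - pi * t\<bar> \<le> (pi * t) ^ 3 / 6"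
      using t by (simp add: fact_numeral)
    then have "sin (pi * t) \<ge> pi * t - (pi * t) ^ 3 / 6" by linarith
    \<comment> \<open>For \<open>y = pi * t\<close> this gives
      \<open>y - y ^ 3 / 6 \<ge> y / 3\<close>, and \<open>pi > 3\<close> finishes.\<close>
    moreover have "(pi * t) ^ 3 \<le> 4 * (pi * t)"
    proof -
      have "pi * t \<le> 2" using mult_mono[of pi 4 t "1 / 2"] t pi_less_4 by simp
      then have "(pi * t)\<^sup>2 \<le> 2\<^sup>2" using t by (intro power_mono) auto
      then have "(pi * t)\<^sup>2 * (pi * t) \<le> 4 * (pi * t)" using t by (intro mult_right_mono) auto
      then show ?thesis by (simp add: power2_eq_square power3_eq_cube)
    qed
    moreover have "3 * t \<le> pi * t" using t pi_gt3 by (intro mult_right_mono) auto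
    ultimately show ?thesis by linarith
  qed
  show ?thesis
  proof (cases "t \<le> 1 / 2")
    case True
    then show ?thesis using *[of t] assms by simp
  next
    case False
    have "sin (pi * (1 - t)) = sin (pi * t)"
      using sin_pi_minus[of "pi * t"] by (simp add: algebra_simps)
    then show ?thesis using *[of "1 - t"] False assms by simp
  qed
qed

lemma bounded_variation_bounded:
  fixes f :: "real \<Rightarrow> real"
  assumes V: "\<And>m t. strict_mono_on {..m} t \<Longrightarrow> t 0 = 0 \<Longrightarrow> t m = 1 \<Longrightarrow>
      (\<Sum>i<m. \<bar>f (t (Suc i)) - f (t i)\<bar>) \<le> V"
    and V0: "V \<ge> 0" and per: "\<And>x. f (x + 1) = f x"
  shows "\<bar>f x\<bar> \<le> \<bar>f 0\<bar> + V"
proof -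
  have *: "\<bar>f y\<bar> \<le> \<bar>f 0\<bar> + V" if y: "0 < y" "y < 1" for y
  proof -
    define t where "t i = (if i = 0 then 0 else if i = 1 then y else 1)" for i :: nat
    have "(\<Sum>i<2. \<bar>f (t (Suc i)) - f (t i)\<bar>) \<le> V"
      by (rule V) (use y in \<open>auto simp: t_def strict_mono_on_def\<close>)
    then have "\<bar>f y - f 0\<bar> \<le> V" by (simp add: t_def numeral_2_eq_2)
    then show ?thesis by linarith
  qed
  have "f x = f (frac x)"
    using periodic_add_int[of f "frac x" "\<lfloor>x\<rfloor>", OF per] by (simp add: frac_def)
  then show ?thesis
    using *[of "frac x"] V0 frac_lt_1[of x] frac_ge_0[of x] by (cases "frac x = 0") auto
qed

section \<open>Trigonometric approximation in the L1 norm\<close>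

lemma character_trig:
  assumes "\<bar>j\<bar> \<le> int D"
  shows "c * character j x = (\<Sum>i\<in>{- int D..int D}. (if i = j then c else 0) * character i x)"
  using assms by (subst sum.mono_neutral_right[of _ "{j}"]) (auto simp: abs_le_iff)

lemma trig_poly_sum_characters:
  assumes "finite A" "\<And>a. a \<in> A \<Longrightarrow> \<bar>m a\<bar> \<le> int D"
    and "\<And>x. complex_of_real (g x) = (\<Sum>a\<in>A. c a * character (m a) x)"
  shows "trig_poly D g"
  unfolding trig_poly_def
proof (intro exI allI)
  fix x
  have "complex_of_real (g x) = (\<Sum>a\<in>A. \<Sum>i\<in>{- int D..int D}. (if i = m a then c a else 0) * character i x)"
    unfolding assms(3) by (intro sum.cong refl character_trig assms(2))
  also have "\<dots> = (\<Sum>i\<in>{- int D..int D}. (\<Sum>a\<in>A. if i = m a then c a else 0) * character i x)"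
    by (subst sum.swap) (simp add: sum_distrib_right)
  finally show "complex_of_real (g x) = \<dots>" .
qed

lemma trig_poly_diff_const:
  assumes "trig_poly D g" shows "trig_poly D (\<lambda>x. g x - m)"
proof -
  obtain c where c: "\<And>x. complex_of_real (g x) = (\<Sum>j\<in>{- int D..int D}. c j * character j x)"
    using assms by (auto simp: trig_poly_def)
  show ?thesis unfolding trig_poly_def
  proof (intro exI allI)
    fix x
    have eq: "complex_of_real m = (\<Sum>j\<in>{- int D..int D}. (if j = 0 then of_real m else 0) * character j x)"
      using character_trig[of 0 D "of_real m" x] by simp
    show "complex_of_real (g x - m)
      = (\<Sum>j\<in>{- int D..int D}. (c j - (if j = 0 then of_real m else 0)) * character j x)"
      unfolding left_diff_distrib sum_subtractf of_real_diff c
      by (rule arg_cong2[where f=minus, OF refl eq])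
  qed
qed

text \<open>The approximant averages the samples \<open>f (j / D)\<close> against translates of the
  kernel. It is a finite sum, so integrals can be interchanged with it freely, and the partition of
  unity lets it inherit the bound of \<open>f\<close>. The rate \<open>1 / sqrt D\<close> is crude;
  a high degree will make up for that.\<close>

lemma fejer_approximation:
  fixes f :: "real \<Rightarrow> real"
  assumes meas: "f \<in> borel_measurable lebesgue" and per: "\<And>x. f (x + 1) = f x"
    and mean: "(\<integral>x. f x \<partial>\<U>) = 0"
    and V: "\<And>m t. strict_mono_on {..m} t \<Longrightarrow> t 0 = 0 \<Longrightarrow> t m = 1 \<Longrightarrow>
      (\<Sum>i<m. \<bar>f (t (Suc i)) - f (t i)\<bar>) \<le> V" and V0: "V \<ge> 0"
    and C: "\<And>x. \<bar>f x\<bar> \<le> C" and D: "D \<ge> 1"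
  shows "\<exists>g. trig_poly D g \<and> (\<forall>x. \<bar>g x\<bar> \<le> 2 * C) \<and> (\<integral>x. g x \<partial>\<U>) = 0 \<and>
    (\<integral>x. \<bar>f x - g x\<bar> \<partial>\<U>) \<le> 4 * V / sqrt D"
proof -
  define h where "h x = (\<Sum>j<D. f (real j / D) * fejer D (x - real j / D)) / D" for x
  have cont_shift: "continuous_on UNIV (\<lambda>x. fejer D (x - y))" for y
    by (intro continuous_on_compose2[OF continuous_fejer] continuous_intros) auto
  have h_cont: "continuous_on UNIV h"
    unfolding h_def divide_inverse
    by (intro continuous_intros cont_shift)
  have borel_leb: "continuous_on UNIV u \<Longrightarrow> u \<in> borel_measurable lebesgue" for u :: "real \<Rightarrow> real"
    by (intro measurable_completion) (simp add: borel_measurable_continuous_onI)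
  have trig: "trig_poly D h"
  proof (rule trig_poly_sum_characters[of "{..<D} \<times> {..<D} \<times> {..<D}" "\<lambda>(j, k, l). int k - int l"])
    fix x
    have arg: "character m (x - y) = character m (- y) * character m x" for m y
      using character_add_arg[of m "- y" x] by simp
    have "complex_of_real (f (real j / D) * fejer D (x - real j / D) / D) = (\<Sum>k<D. \<Sum>l<D.
        of_real (f (real j / D)) / D / D * character (int k - int l) (- (real j / D)) * character (int k - int l) x)"
      for j :: nat
    proof -
      have "complex_of_real (f (real j / D) * fejer D (x - real j / D) / D)
          = (of_real (f (real j / D)) / D / D) *
            (\<Sum>k<D. \<Sum>l<D. character (int k - int l) (- (real j / D)) * character (int k - int l) x)"
        by (simp only: of_real_divide of_real_mult fejer_expand arg of_real_of_nat_eq) simp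
      then show ?thesis by (simp only: sum_distrib_left mult.assoc)
    qed
    then have "complex_of_real (h x) = (\<Sum>j<D. \<Sum>k<D. \<Sum>l<D.
        of_real (f (real j / D)) / D / D * character (int k - int l) (- (real j / D)) * character (int k - int l) x)"
      by (simp only: h_def sum_divide_distrib of_real_sum)
    then show "complex_of_real (h x) = (\<Sum>a\<in>{..<D} \<times> {..<D} \<times> {..<D}.
        (case a of (j, k, l) \<Rightarrow> of_real (f (real j / D)) / D / D * character (int k - int l) (- (real j / D)))
        * character (case a of (j, k, l) \<Rightarrow> int k - int l) x)"
      unfolding sum.cartesian_product by (simp only: split_def fst_conv snd_conv)
  qed auto
  have fej_sum: "(\<Sum>j<D. fejer D (x - real j / D)) / D = 1" for x
    using D by (subst sum_fejer_grid) auto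
  have h_bd: "\<bar>h x\<bar> \<le> C" for x
  proof -
    have "\<bar>h x\<bar> \<le> (\<Sum>j<D. \<bar>f (real j / D) * fejer D (x - real j / D)\<bar>) / D"
      unfolding h_def abs_divide by (simp add: divide_right_mono sum_abs)
    also have "\<dots> \<le> (\<Sum>j<D. C * fejer D (x - real j / D)) / D"
      by (intro divide_right_mono sum_mono) (auto simp: abs_mult fejer_nonneg intro!: mult_right_mono C)
    also have "\<dots> = C * ((\<Sum>j<D. fejer D (x - real j / D)) / D)" by (simp add: sum_distrib_left)
    finally show ?thesis by (simp only: fej_sum)
  qed
  have C0: "C \<ge> 0" using C[of 0] by linarith
  \<comment> \<open>\<open>T j\<close> is the error against the \<open>j\<close>-th sample, weighted
    by the kernel, and \<open>H j\<close> its translate by \<open>j / D\<close>. By periodicity both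
    have the same integral, and summing \<open>H j\<close> over \<open>j\<close> compares
    \<open>f\<close> with its translate by one fixed displacement along the whole grid.\<close>
  define H where "H j t = \<bar>f (t + real j / D) - f (real j / D)\<bar> * fejer D t" for j :: nat and t
  have H_meas: "H j \<in> borel_measurable lebesgue" for j
    unfolding H_def
    using measurable_lebesgue_affine[OF meas, of 1 "real j / D"] borel_leb[OF continuous_fejer, of D]
    by (simp add: add.commute)
  have H_bd: "\<bar>H j t\<bar> \<le> 2 * C * D" for j t
  proof -
    have "\<bar>f (t + real j / D) - f (real j / D)\<bar> \<le> 2 * C"
      using C[of "t + real j / D"] C[of "real j / D"] by linarith
    then show ?thesis unfolding H_def abs_mult
      using C0 fejer_le[of D t] fejer_nonneg[of D t] by (intro mult_mono) auto
  qed
  define T where "T j x = \<bar>f x - f (real j / D)\<bar> * fejer D (x - real j / D)" for j :: nat and x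
  have T_meas: "T j \<in> borel_measurable lebesgue" for j
    unfolding T_def using meas borel_leb[OF cont_shift, of "real j / D"] by simp
  have T_per: "T j (x + 1) = T j x" for j x
    using per[of x] fejer_periodic[of D "x - real j / D"] by (simp add: T_def algebra_simps)
  have T_H: "T j (x + real j / D) = H j x" for j x by (simp add: T_def H_def)
  have T_bd: "\<bar>T j x\<bar> \<le> 2 * C * D" for j x
    using H_bd[of j "x - real j / D"] by (simp add: T_H[symmetric])
  have T_int: "integrable \<U> (T j)" and H_int: "integrable \<U> (H j)" for j
    using bounded_measurable_integrable_unit[OF T_meas T_bd] bounded_measurable_integrable_unit[OF H_meas H_bd] by auto
  have TH: "(\<integral>x. T j x \<partial>\<U>) = (\<integral>x. H j x \<partial>\<U>)" for j
    using integral_periodic_shift[OF T_meas T_bd T_per, of "real j / D" j] by (simp add: T_H)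
  have fh_meas: "(\<lambda>x. f x - h x) \<in> borel_measurable lebesgue"
    using meas borel_leb[OF h_cont] by simp
  have fh_bd: "\<bar>f x - h x\<bar> \<le> 2 * C" for x using C[of x] h_bd[of x] by linarith
  have fh_int: "integrable \<U> (\<lambda>x. f x - h x)"
    by (rule bounded_measurable_integrable_unit[OF fh_meas fh_bd])
  have pt: "\<bar>f x - h x\<bar> \<le> (\<Sum>j<D. T j x) / D" for x
  proof -
    have "f x - h x = f x * ((\<Sum>j<D. fejer D (x - real j / D)) / D) - h x" by (simp only: fej_sum mult_1_right)
    also have "\<dots> = (\<Sum>j<D. (f x - f (real j / D)) * fejer D (x - real j / D)) / D"
      by (simp add: h_def left_diff_distrib sum_subtractf diff_divide_distrib sum_distrib_left)
    also have "\<bar>\<dots>\<bar> \<le> (\<Sum>j<D. \<bar>(f x - f (real j / D)) * fejer D (x - real j / D)\<bar>) / D"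
      by (simp add: abs_divide divide_right_mono sum_abs)
    also have "\<dots> = (\<Sum>j<D. T j x) / D"
      by (simp add: T_def abs_mult fejer_nonneg)
    finally show ?thesis .
  qed
  let ?e = "1 / sqrt D"
  have Dsq: "sqrt D > 0" "sqrt D * sqrt D = D" "sqrt D \<ge> 1" using D by auto
  have s1: "(\<integral>x. \<bar>f x - h x\<bar> \<partial>\<U>) \<le> (\<integral>x. (\<Sum>j<D. T j x) / D \<partial>\<U>)"
    by (intro integral_mono integrable_abs fh_int integrable_divide Bochner_Integration.integrable_sum T_int pt)
  have s2: "(\<integral>x. (\<Sum>j<D. T j x) / D \<partial>\<U>) = (\<integral>x. (\<Sum>j<D. H j x) / D \<partial>\<U>)"
    using T_int H_int by (simp add: Bochner_Integration.integral_sum TH)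
  have s3: "(\<integral>x. (\<Sum>j<D. H j x) / D \<partial>\<U>) \<le> (\<integral>t. V * ((1 / D + ?e / 2) * fejer D t + sqrt D / 2 * (fejer D t * (sin (pi * t))\<^sup>2)) \<partial>\<U>)"
  proof (rule integral_mono_AE)
    show "integrable \<U> (\<lambda>t. V * ((1 / D + ?e / 2) * fejer D t + sqrt D / 2 * (fejer D t * (sin (pi * t))\<^sup>2)))"
      by (intro integrable_mult_right Bochner_Integration.integrable_add integrable_fejer integral_fejer_sin(1)[OF D])
    show "integrable \<U> (\<lambda>x. (\<Sum>j<D. H j x) / D)"
      by (intro integrable_divide Bochner_Integration.integrable_sum H_int)
    \<comment> \<open>The grid estimate is stated for \<open>t < 1\<close>, so the right end point
      has to be left out.\<close>
    have "AE t in lebesgue. t \<noteq> (1::real)"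
      by (intro AE_completion) (simp add: AE_lborel_singleton)
    then have "AE t in \<U>. t \<noteq> 1"
      by (simp add: AE_restrict_space_iff eventually_mono)
    then show "AE t in \<U>. (\<Sum>j<D. H j t) / D
        \<le> V * ((1 / D + ?e / 2) * fejer D t + sqrt D / 2 * (fejer D t * (sin (pi * t))\<^sup>2))"
    proof (rule AE_mp, intro AE_I2 impI)
      fix t :: real assume "t \<in> space \<U>" "t \<noteq> 1"
      then have t: "0 \<le> t" "t < 1" by auto
      let ?s = "sin (pi * t)"
      \<comment> \<open>Arithmetic-geometric mean: the first power of the sine is traded for its
        square, whose integral against the kernel is known. The weight \<open>sqrt D\<close> makes
        both parts of order \<open>1 / sqrt D\<close>.\<close>
      have "0 \<le> (?s * sqrt D - 1)\<^sup>2" by simp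
      also have "\<dots> = ?s\<^sup>2 * (sqrt D * sqrt D) - 2 * ?s * sqrt D + 1"
        by (simp add: power2_eq_square algebra_simps del: real_sqrt_mult_self)
      finally have le: "2 * ?s * sqrt D \<le> ?s\<^sup>2 * (sqrt D * sqrt D) + 1" by simp
      have "?s = (2 * ?s * sqrt D) / (2 * sqrt D)" using Dsq by simp
      also have "\<dots> \<le> (?s\<^sup>2 * (sqrt D * sqrt D) + 1) / (2 * sqrt D)"
        using le Dsq by (intro divide_right_mono) auto
      also have "\<dots> = ?e / 2 + sqrt D / 2 * ?s\<^sup>2"
        using Dsq(1) by (simp add: add_divide_distrib mult_ac del: real_sqrt_mult_self)
      finally have sq: "?s \<le> ?e / 2 + sqrt D / 2 * ?s\<^sup>2" .
      have "(\<Sum>j<D. H j t) / D = (\<Sum>j<D. \<bar>f (t + real j / D) - f (real j / D)\<bar>) / D * fejer D t"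
        by (simp add: H_def sum_distrib_right)
      also have "\<dots> \<le> V * (min t (1 - t) + 1 / D) * fejer D t"
        by (intro mult_right_mono fejer_nonneg grid_translation_variation[of f V D t, OF V V0 per D t])
      also have "\<dots> \<le> V * (1 / D + ?e / 2 + sqrt D / 2 * ?s\<^sup>2) * fejer D t"
        using min_le_sin[of t] t sq by (intro mult_right_mono mult_left_mono fejer_nonneg V0) auto
      finally show "(\<Sum>j<D. H j t) / D
        \<le> V * ((1 / D + ?e / 2) * fejer D t + sqrt D / 2 * (fejer D t * (sin (pi * t))\<^sup>2))"
        by (simp add: algebra_simps)
    qed
  qed
  have s4: "(\<integral>t. V * ((1 / D + ?e / 2) * fejer D t + sqrt D / 2 * (fejer D t * (sin (pi * t))\<^sup>2)) \<partial>\<U>)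
      = V * ((1 / D + ?e / 2) * 1 + sqrt D / 2 * (1 / (2 * real D)))"
    using integral_fejer_sin[OF D] integral_fejer[OF D] integrable_fejer[of D]
    by (simp only: integral_mult_right_zero Bochner_Integration.integral_add integrable_mult_right)
  have le1: "1 / D \<le> ?e"
  proof -
    have "sqrt D * 1 \<le> sqrt D * sqrt D" using Dsq(1,3) by (intro mult_left_mono) auto
    then show ?thesis using Dsq(1) unfolding Dsq(2) by (intro frac_le) auto
  qed
  have "sqrt D / 2 * (1 / (2 * (sqrt D * sqrt D))) = ?e / 4"
    using Dsq(1) by (simp del: real_sqrt_mult_self)
  then have eq1: "sqrt D / 2 * (1 / (2 * real D)) = ?e / 4" by (simp only: Dsq(2))
  have "(u + v / 2) * 1 + w \<le> 2 * v" if "u \<le> v" "w = v / 4" "0 \<le> v" for u v w :: real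
    using that by simp
  note this[OF le1 eq1]
  moreover have "0 \<le> ?e" by simp
  ultimately have "(1 / D + ?e / 2) * 1 + sqrt D / 2 * (1 / (2 * real D)) \<le> 2 * ?e" by (rule meta_mp)
  then have "V * ((1 / D + ?e / 2) * 1 + sqrt D / 2 * (1 / (2 * real D))) \<le> V * (2 * ?e)"
    using V0 by (rule mult_left_mono)
  with s1 s2 s3 s4 have "(\<integral>x. \<bar>f x - h x\<bar> \<partial>\<U>) \<le> V * (2 * ?e)" by linarith
  then have L1: "(\<integral>x. \<bar>f x - h x\<bar> \<partial>\<U>) \<le> 2 * V / sqrt D"
    by (simp only: times_divide_eq_right mult_1_right mult.commute[of V])
  \<comment> \<open>Since \<open>f\<close> has mean 0, subtracting the mean of \<open>h\<close>
    costs at most the L1 error once more; this doubles the constant.\<close>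
  define m where "m = (\<integral>x. h x \<partial>\<U>)"
  have h_int: "integrable \<U> h" and f_int: "integrable \<U> f"
    using bounded_measurable_integrable_unit[OF borel_leb[OF h_cont] h_bd]
      bounded_measurable_integrable_unit[OF meas C] by auto
  interpret prob_space \<U> by (rule prob_space_unit)
  have "\<bar>m\<bar> = \<bar>\<integral>x. f x - h x \<partial>\<U>\<bar>"
    using mean by (simp add: Bochner_Integration.integral_diff[OF f_int h_int] m_def)
  also have "\<dots> \<le> (\<integral>x. \<bar>f x - h x\<bar> \<partial>\<U>)" by (rule integral_abs_bound)
  finally have m: "\<bar>m\<bar> \<le> 2 * V / sqrt D" using L1 by simp
  have mC: "\<bar>m\<bar> \<le> C"
    using integral_bounded_prob[OF prob_space_unit, of h C] h_bd h_int by (simp add: m_def)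
  show ?thesis
  proof (intro exI[of _ "\<lambda>x. h x - m"] conjI allI)
    show "trig_poly D (\<lambda>x. h x - m)" by (rule trig_poly_diff_const[OF trig])
    show "\<bar>h x - m\<bar> \<le> 2 * C" for x using h_bd[of x] mC by linarith
    show "(\<integral>x. h x - m \<partial>\<U>) = 0"
      using h_int prob_space by (simp add: Bochner_Integration.integral_diff m_def)
    have "(\<integral>x. \<bar>f x - (h x - m)\<bar> \<partial>\<U>) \<le> (\<integral>x. \<bar>f x - h x\<bar> + \<bar>m\<bar> \<partial>\<U>)"
      using fh_int by (intro integral_mono integrable_abs Bochner_Integration.integrable_add
          Bochner_Integration.integrable_diff f_int h_int integrable_const) auto
    also have "\<dots> = (\<integral>x. \<bar>f x - h x\<bar> \<partial>\<U>) + \<bar>m\<bar>"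
      using fh_int prob_space by (subst Bochner_Integration.integral_add) auto
    finally have "(\<integral>x. \<bar>f x - (h x - m)\<bar> \<partial>\<U>) \<le> 2 * V / sqrt D + 2 * V / sqrt D"
      using L1 m by linarith
    also have "\<dots> = 4 * V / sqrt D" by (simp only: add_divide_distrib[symmetric]) simp
    finally show "(\<integral>x. \<bar>f x - (h x - m)\<bar> \<partial>\<U>) \<le> 4 * V / sqrt D" .
  qed
qed

section \<open>Truncated exponentials\<close>

text \<open>The degree is even, so the truncation is positive on the whole line.\<close>

definition texp :: "nat \<Rightarrow> real \<Rightarrow> real" where
  "texp Q y = (\<Sum>i<2 * Q + 1. y ^ i / fact i)"

lemma power_div_fact_le_exp:
  fixes x :: real
  assumes "x \<ge> 0" shows "x ^ m / fact m \<le> exp x"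
proof -
  obtain t where "exp x = (\<Sum>i<Suc m. x ^ i / fact i) + (exp t / fact (Suc m)) * x ^ Suc m"
    using Maclaurin_exp_le[of x "Suc m"] by blast
  moreover have "(exp t / fact (Suc m)) * x ^ Suc m \<ge> 0" using assms by (intro mult_nonneg_nonneg) auto
  moreover have "(\<Sum>i<m. x ^ i / fact i) \<ge> 0" using assms by (intro sum_nonneg) auto
  ultimately show ?thesis by simp
qed

text \<open>The remainder has the odd order \<open>2 * Q + 1\<close>, hence it is nonpositive for
  nonpositive \<open>y\<close>.\<close>

lemma texp_ge_exp: "y \<le> 0 \<Longrightarrow> exp y \<le> texp Q y"
proof -
  assume y: "y \<le> 0"
  obtain t where "exp y = texp Q y + (exp t / fact (2 * Q + 1)) * y ^ (2 * Q + 1)"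
    using Maclaurin_exp_le[of y "2 * Q + 1"] unfolding texp_def by blast
  moreover have "y ^ (2 * Q + 1) \<le> 0" using y by (simp add: mult_nonpos_nonneg)
  then have "(exp t / fact (2 * Q + 1)) * y ^ (2 * Q + 1) \<le> 0"
    by (intro mult_nonneg_nonpos) auto
  ultimately show ?thesis by linarith
qed

lemma texp_mono: "0 \<le> y \<Longrightarrow> y \<le> z \<Longrightarrow> texp Q y \<le> texp Q z"
  unfolding texp_def by (intro sum_mono divide_right_mono power_mono) auto

lemma texp_ge_1: "0 \<le> y \<Longrightarrow> 1 \<le> texp Q y"
proof -
  assume "0 \<le> y"
  then have "(\<Sum>i<2 * Q. y ^ Suc i / fact (Suc i)) \<ge> 0" by (intro sum_nonneg) auto
  moreover have "texp Q y = 1 + (\<Sum>i<2 * Q. y ^ Suc i / fact (Suc i))"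
    unfolding texp_def Suc_eq_plus1[symmetric] by (subst sum.lessThan_Suc_shift) simp
  ultimately show ?thesis by simp
qed

lemma texp_pos: "texp Q y > 0"
proof (cases "y \<ge> 0")
  case True then show ?thesis using texp_ge_1[of y Q] by linarith
next
  case False then show ?thesis using texp_ge_exp[of y Q] exp_gt_zero[of y] by linarith
qed

text \<open>In the remainder, \<open>\<bar>y\<bar> ^ m / fact m\<close> is written as
  \<open>exp (- m)\<close> times the same expression at \<open>exp 1 * \<bar>y\<bar>\<close>. This
  gains a factor exponentially small in \<open>Q\<close> and leaves an exponential of
  \<open>\<bar>y\<bar>\<close>, whose expectation can be bounded for independent sums.\<close>

lemma texp_error: "\<bar>exp y - texp Q y\<bar> \<le> exp (- 2 * real Q) * exp (4 * \<bar>y\<bar>)"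
proof -
  define m where "m = 2 * Q + 1"
  obtain t where t: "\<bar>t\<bar> \<le> \<bar>y\<bar>" "exp y = texp Q y + (exp t / fact m) * y ^ m"
    using Maclaurin_exp_le[of y m] unfolding texp_def m_def by blast
  have e3: "exp (1::real) \<le> 3" by (rule exp_le)
  have "\<bar>exp y - texp Q y\<bar> = exp t * (\<bar>y\<bar> ^ m / fact m)"
    using t(2) by (simp add: abs_mult power_abs)
  also have "\<bar>y\<bar> ^ m / fact m = exp (- real m) * ((exp 1 * \<bar>y\<bar>) ^ m / fact m)"
    by (simp add: power_mult_distrib exp_of_nat_mult[symmetric] exp_minus)
  also have "exp t * \<dots> \<le> exp \<bar>y\<bar> * (exp (- 2 * real Q) * exp (3 * \<bar>y\<bar>))"
  proof (intro mult_mono)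
    show "exp t \<le> exp \<bar>y\<bar>" using t(1) by simp
    show "exp (- real m) \<le> exp (- 2 * real Q)" by (simp add: m_def)
    have "(exp 1 * \<bar>y\<bar>) ^ m / fact m \<le> exp (exp 1 * \<bar>y\<bar>)" by (rule power_div_fact_le_exp) simp
    also have "\<dots> \<le> exp (3 * \<bar>y\<bar>)" using e3 by (simp add: mult_right_mono)
    finally show "(exp 1 * \<bar>y\<bar>) ^ m / fact m \<le> exp (3 * \<bar>y\<bar>)" .
  qed auto
  also have "\<dots> = exp (- 2 * real Q) * exp (4 * \<bar>y\<bar>)" by (simp add: exp_add[symmetric])
  finally show ?thesis .
qed

text \<open>For \<open>y\<close> between 0 and \<open>Q / 4\<close> the truncation error is at most
  \<open>exp (y - 1)\<close>, which is below half of \<open>exp y\<close>.\<close>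

lemma texp_ge_half_exp:
  assumes "y \<le> real Q / 4" "Q \<ge> 1"
  shows "exp y / 2 \<le> texp Q y"
proof (cases "y \<ge> 0")
  case True
  have "exp (4 * y - 2 * real Q) \<le> exp (y - 1)" using assms by simp
  also have "\<dots> = exp y * exp (- 1)" by (simp add: exp_diff exp_minus divide_inverse)
  also have "\<dots> \<le> exp y * (1 / 2)"
    using exp_ge_add_one_self[of 1] by (intro mult_left_mono) (auto simp: exp_minus field_simps)
  finally have "exp (- 2 * real Q) * exp (4 * \<bar>y\<bar>) \<le> exp y / 2"
    using True by (simp add: exp_add[symmetric])
  with texp_error[of y Q] show ?thesis by linarith
next
  case False
  then show ?thesis using texp_ge_exp[of y Q] exp_gt_zero[of y] by linarith
qed

lemma texp_prod_le:
  "texp Q y * texp Q z \<le> exp (y + z) + 3 * exp (- 2 * real Q) * (exp (4 * \<bar>y\<bar>) * exp (4 * \<bar>z\<bar>))"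
proof -
  define \<delta> where "\<delta> = exp (- 2 * real Q)"
  define a where "a = exp (4 * \<bar>y\<bar>)"
  define b where "b = exp (4 * \<bar>z\<bar>)"
  have 1: "texp Q y \<le> exp y + \<delta> * a" "texp Q z \<le> exp z + \<delta> * b"
    using texp_error[of y Q] texp_error[of z Q] unfolding \<delta>_def a_def b_def by linarith+
  have pos: "\<delta> > 0" "a > 0" "b > 0" "\<delta> \<le> 1" by (auto simp: \<delta>_def a_def b_def)
  have le: "exp y \<le> a" "exp z \<le> b" by (auto simp: a_def b_def)
  have "texp Q y * texp Q z \<le> (exp y + \<delta> * a) * (exp z + \<delta> * b)"
    using 1 texp_pos[of Q y] texp_pos[of Q z] by (intro mult_mono) auto
  also have "\<dots> = exp (y + z) + \<delta> * (exp y * b) + \<delta> * (a * exp z) + \<delta> * \<delta> * (a * b)"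
    by (simp add: exp_add distrib_left distrib_right mult_ac)
  also have "\<dots> \<le> exp (y + z) + \<delta> * (a * b) + \<delta> * (a * b) + \<delta> * 1 * (a * b)"
    using pos le by (intro add_mono mult_mono order_refl mult_nonneg_nonneg) auto
  finally show ?thesis unfolding \<delta>_def a_def b_def by (simp add: mult_ac)
qed

section \<open>Sums whose moments agree with those of independent variables\<close>

text \<open>Isolates what the probabilistic estimates rely on: bounded functions whose mixed moments
  up to order \<open>p\<close> agree with those of \<open>g\<close> at independent uniform points.
  Relations, permutations and approximation do not appear, so each block and each threshold is just
  another instance.\<close>

locale matched =
  fixes J :: "nat set" and p :: nat and X :: "nat \<Rightarrow> real \<Rightarrow> real" and g :: "real \<Rightarrow> real" and C :: real
  assumes finite_J: "finite J"
    and X_meas: "\<And>k. k \<in> J \<Longrightarrow> X k \<in> borel_measurable \<U>"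
    and X_bd: "\<And>k x. k \<in> J \<Longrightarrow> \<bar>X k x\<bar> \<le> C"
    and g_meas: "g \<in> borel_measurable \<U>"
    and g_bd: "\<And>x. \<bar>g x\<bar> \<le> C"
    and g_mean: "(\<integral>x. g x \<partial>\<U>) = 0"
    and C_pos: "C > 0"
    and match: "\<And>q (v :: nat \<Rightarrow> nat \<Rightarrow> real). q \<le> p \<Longrightarrow> (\<integral>x. (\<Prod>t<q. \<Sum>k\<in>J. v t k * X k x) \<partial>\<U>)
       = (\<integral>u. (\<Prod>t<q. \<Sum>k\<in>J. v t k * g (u k)) \<partial>iid_measure J)"
begin

definition XS :: "nat set \<Rightarrow> real \<Rightarrow> real" where "XS S x = (\<Sum>k\<in>S. X k x)"
definition YS :: "nat set \<Rightarrow> (nat \<Rightarrow> real) \<Rightarrow> real" where "YS S u = (\<Sum>k\<in>S. g (u k))"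
definition mgf :: "real \<Rightarrow> real" where "mgf \<kappa> = (\<integral>x. exp (\<kappa> * g x) \<partial>\<U>)"

abbreviation "\<P> \<equiv> iid_measure J"

lemma XS_meas: "S \<subseteq> J \<Longrightarrow> XS S \<in> borel_measurable \<U>"
  unfolding XS_def using X_meas by (intro borel_measurable_sum) auto

lemma YS_meas: "S \<subseteq> J \<Longrightarrow> YS S \<in> borel_measurable \<P>"
  unfolding YS_def by (intro borel_measurable_sum measurable_iid_component g_meas) auto

lemma XS_bd: "S \<subseteq> J \<Longrightarrow> \<bar>XS S x\<bar> \<le> C * card S"
proof -
  assume S: "S \<subseteq> J"
  have "\<bar>XS S x\<bar> \<le> (\<Sum>k\<in>S. \<bar>X k x\<bar>)" unfolding XS_def by (rule sum_abs)
  also have "\<dots> \<le> (\<Sum>k\<in>S. C)" using S X_bd by (intro sum_mono) auto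
  finally show ?thesis by (simp add: mult.commute)
qed

lemma YS_bd: "S \<subseteq> J \<Longrightarrow> \<bar>YS S u\<bar> \<le> C * card S"
proof -
  have "\<bar>YS S u\<bar> \<le> (\<Sum>k\<in>S. \<bar>g (u k)\<bar>)" unfolding YS_def by (rule sum_abs)
  also have "\<dots> \<le> (\<Sum>k\<in>S. C)" using g_bd by (intro sum_mono) auto
  finally show ?thesis by (simp add: mult.commute)
qed

lemma integrable_continuous2_X:
  fixes F :: "real \<times> real \<Rightarrow> 'b::{banach, second_countable_topology}"
  assumes F: "continuous_on UNIV F" and S: "S1 \<subseteq> J" "S2 \<subseteq> J"
  shows "integrable \<U> (\<lambda>x. F (XS S1 x, XS S2 x))"
proof -
  let ?K = "{- (C * card S1)..C * card S1} \<times> {- (C * card S2)..C * card S2}"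
  have "compact (F ` ?K)"
    by (intro compact_continuous_image compact_Times continuous_on_subset[OF F]) auto
  then have "bounded (F ` ?K)" by (rule compact_imp_bounded)
  then obtain B where B: "\<And>z. z \<in> ?K \<Longrightarrow> norm (F z) \<le> B"
    unfolding bounded_iff by blast
  show ?thesis
  proof (rule integrable_bounded_prob[OF prob_space_unit])
    have "(\<lambda>x. (XS S1 x, XS S2 x)) \<in> borel_measurable \<U>"
      by (intro borel_measurable_Pair XS_meas S)
    from measurable_compose[OF this borel_measurable_continuous_onI[OF F]]
    show "(\<lambda>x. F (XS S1 x, XS S2 x)) \<in> borel_measurable \<U>" .
    show "norm (F (XS S1 x, XS S2 x)) \<le> B" for x
      using XS_bd[OF S(1), of x] XS_bd[OF S(2), of x] by (intro B) (auto simp: abs_le_iff)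
  qed
qed

lemma integrable_continuous2_Y:
  fixes F :: "real \<times> real \<Rightarrow> 'b::{banach, second_countable_topology}"
  assumes F: "continuous_on UNIV F" and S: "S1 \<subseteq> J" "S2 \<subseteq> J"
  shows "integrable \<P> (\<lambda>u. F (YS S1 u, YS S2 u))"
proof -
  let ?K = "{- (C * card S1)..C * card S1} \<times> {- (C * card S2)..C * card S2}"
  have "compact (F ` ?K)"
    by (intro compact_continuous_image compact_Times continuous_on_subset[OF F]) auto
  then have "bounded (F ` ?K)" by (rule compact_imp_bounded)
  then obtain B where B: "\<And>z. z \<in> ?K \<Longrightarrow> norm (F z) \<le> B"
    unfolding bounded_iff by blast
  show ?thesis
  proof (rule integrable_bounded_prob[OF prob_space_iid])
    have "(\<lambda>u. (YS S1 u, YS S2 u)) \<in> borel_measurable \<P>"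
      by (intro borel_measurable_Pair YS_meas S)
    from measurable_compose[OF this borel_measurable_continuous_onI[OF F]]
    show "(\<lambda>u. F (YS S1 u, YS S2 u)) \<in> borel_measurable \<P>" .
    show "norm (F (YS S1 u, YS S2 u)) \<le> B" for u
      using YS_bd[OF S(1), of u] YS_bd[OF S(2), of u] by (intro B) (auto simp: abs_le_iff)
  qed
qed

lemma integrable_continuous_X:
  fixes F :: "real \<Rightarrow> 'b::{banach, second_countable_topology}"
  assumes "continuous_on UNIV F" "S \<subseteq> J"
  shows "integrable \<U> (\<lambda>x. F (XS S x))"
proof -
  have "continuous_on UNIV (\<lambda>z :: real \<times> real. F (fst z))"
    by (rule continuous_on_compose2[OF assms(1)]) (auto intro: continuous_intros)
  from integrable_continuous2_X[OF this assms(2) assms(2)] show ?thesis by simp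
qed

lemma integrable_continuous_Y:
  fixes F :: "real \<Rightarrow> 'b::{banach, second_countable_topology}"
  assumes "continuous_on UNIV F" "S \<subseteq> J"
  shows "integrable \<P> (\<lambda>u. F (YS S u))"
proof -
  have "continuous_on UNIV (\<lambda>z :: real \<times> real. F (fst z))"
    by (rule continuous_on_compose2[OF assms(1)]) (auto intro: continuous_intros)
  from integrable_continuous2_Y[OF this assms(2) assms(2)] show ?thesis by simp
qed

lemma match_powers:
  assumes S: "S1 \<subseteq> J" "S2 \<subseteq> J" and ab: "a + b \<le> p"
  shows "(\<integral>x. XS S1 x ^ a * XS S2 x ^ b \<partial>\<U>) = (\<integral>u. YS S1 u ^ a * YS S2 u ^ b \<partial>\<P>)"
proof -
  define v where "v t k = (if t < a then indicator S1 k else indicator S2 k :: real)" for t k :: nat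
  have ind: "(\<Sum>k\<in>J. indicator S k * y k) = sum y S" if "S \<subseteq> J" for S and y :: "nat \<Rightarrow> real"
    using that finite_J by (simp add: indicator_def if_distrib[of "\<lambda>z. z * _"] sum.If_cases
        Int_absorb1 cong: if_cong)
  have "(\<Prod>t<a + b. \<Sum>k\<in>J. v t k * y k) = sum y S1 ^ a * sum y S2 ^ b" for y
  proof -
    have "(\<Prod>t<a + b. \<Sum>k\<in>J. v t k * y k) = (\<Prod>t<a + b. if t < a then sum y S1 else sum y S2)"
      unfolding v_def by (intro prod.cong refl) (auto simp: ind S)
    also have "\<dots> = (\<Prod>t\<in>{..<a} \<union> {a..<a + b}. if t < a then sum y S1 else sum y S2)"
      by (intro prod.cong) auto
    also have "\<dots> = (\<Prod>t<a. sum y S1) * (\<Prod>t=a..<a + b. sum y S2)"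
      by (subst prod.union_disjoint) auto
    finally show ?thesis by simp
  qed
  then show ?thesis using match[OF ab, of v] unfolding XS_def YS_def by simp
qed

text \<open>The product is a polynomial of total degree \<open>4 * Q\<close>, which is how many
  moments have to match.\<close>

lemma match_texp:
  assumes S: "S1 \<subseteq> J" "S2 \<subseteq> J" and Q: "4 * Q \<le> p"
  shows "(\<integral>x. texp Q (\<nu> * XS S1 x) * texp Q (\<mu> * XS S2 x) \<partial>\<U>)
       = (\<integral>u. texp Q (\<nu> * YS S1 u) * texp Q (\<mu> * YS S2 u) \<partial>\<P>)"
proof -
  let ?c = "\<lambda>i j. (\<nu> ^ i / fact i) * (\<mu> ^ j / fact j)"
  have ex: "texp Q (\<nu> * y) * texp Q (\<mu> * z) = (\<Sum>i<2 * Q + 1. \<Sum>j<2 * Q + 1. ?c i j * (y ^ i * z ^ j))" for y z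
    unfolding texp_def sum_product
    by (intro sum.cong refl) (simp add: power_mult_distrib)
  have cont: "continuous_on UNIV (\<lambda>z :: real \<times> real. fst z ^ i * snd z ^ j)" for i j
    by (intro continuous_intros)
  have iX: "integrable \<U> (\<lambda>x. ?c i j * (XS S1 x ^ i * XS S2 x ^ j))" for i j
    using integrable_continuous2_X[OF cont S] by (intro integrable_mult_right) simp
  have iY: "integrable \<P> (\<lambda>x. ?c i j * (YS S1 x ^ i * YS S2 x ^ j))" for i j
    using integrable_continuous2_Y[OF cont S] by (intro integrable_mult_right) simp
  have "(\<integral>x. texp Q (\<nu> * XS S1 x) * texp Q (\<mu> * XS S2 x) \<partial>\<U>)
      = (\<Sum>i<2 * Q + 1. \<Sum>j<2 * Q + 1. ?c i j * (\<integral>x. XS S1 x ^ i * XS S2 x ^ j \<partial>\<U>))"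
    unfolding ex using iX by (subst Bochner_Integration.integral_sum, force, subst Bochner_Integration.integral_sum) auto
  also have "\<dots> = (\<Sum>i<2 * Q + 1. \<Sum>j<2 * Q + 1. ?c i j * (\<integral>u. YS S1 u ^ i * YS S2 u ^ j \<partial>\<P>))"
    using Q by (intro sum.cong refl arg_cong2[where f="(*)"] match_powers S) auto
  also have "\<dots> = (\<integral>u. texp Q (\<nu> * YS S1 u) * texp Q (\<mu> * YS S2 u) \<partial>\<P>)"
    unfolding ex using iY by (subst Bochner_Integration.integral_sum, force, subst Bochner_Integration.integral_sum) auto
  finally show ?thesis .
qed

lemma texp_0: "texp Q 0 = 1"
  using texp_ge_exp[of 0 Q] texp_error[of 0 Q] unfolding texp_def
  by (subst sum.remove[of _ 0]) (auto simp: power_0_left)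

lemma match_texp1:
  assumes S: "S \<subseteq> J" and Q: "4 * Q \<le> p"
  shows "(\<integral>x. texp Q (\<nu> * XS S x) \<partial>\<U>) = (\<integral>u. texp Q (\<nu> * YS S u) \<partial>\<P>)"
  using match_texp[OF S S Q, of \<nu> 0] by (simp add: texp_0)

lemma integral_exp_YS2:
  assumes S: "S1 \<subseteq> J" "S2 \<subseteq> J" "S1 \<inter> S2 = {}"
  shows "(\<integral>u. exp (\<nu> * YS S1 u + \<mu> * YS S2 u) \<partial>\<P>) = mgf \<nu> ^ card S1 * mgf \<mu> ^ card S2"
proof -
  define \<kappa> where "\<kappa> k = (if k \<in> S1 then \<nu> else if k \<in> S2 then \<mu> else 0)" for k
  have fin: "finite S1" "finite S2"
    using S by (auto intro: finite_subset[OF _ finite_J])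
  have int: "integrable \<U> (\<lambda>x. exp (c * g x))" for c
  proof (rule integrable_bounded_prob[OF prob_space_unit])
    show "(\<lambda>x. exp (c * g x)) \<in> borel_measurable \<U>" using g_meas by measurable
    show "norm (exp (c * g x)) \<le> exp (\<bar>c\<bar> * C)" for x
      using abs_le_D1[of "c * g x" "\<bar>c\<bar> * C"] g_bd[of x] by (auto simp: abs_mult mult_left_mono)
  qed
  have sub: "(\<Prod>k\<in>J. F k) = (\<Prod>k\<in>S1. F k) * (\<Prod>k\<in>S2. F k)"
    if "\<And>k. k \<notin> S1 \<Longrightarrow> k \<notin> S2 \<Longrightarrow> F k = 1" for F :: "nat \<Rightarrow> real"
  proof -
    have "(\<Prod>k\<in>J. F k) = (\<Prod>k\<in>S1 \<union> S2. F k)"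
      using S that finite_J by (intro prod.mono_neutral_right) auto
    then show ?thesis using prod.union_disjoint[OF fin S(3), of F] by simp
  qed
  have "exp (\<nu> * YS S1 u + \<mu> * YS S2 u) = (\<Prod>k\<in>J. exp (\<kappa> k * g (u k)))" for u
  proof -
    have "(\<Prod>k\<in>J. exp (\<kappa> k * g (u k))) = (\<Prod>k\<in>S1. exp (\<kappa> k * g (u k))) * (\<Prod>k\<in>S2. exp (\<kappa> k * g (u k)))"
      by (rule sub) (simp add: \<kappa>_def)
    also have "(\<Prod>k\<in>S1. exp (\<kappa> k * g (u k))) = exp (\<nu> * YS S1 u)"
      using fin by (simp add: YS_def sum_distrib_left exp_sum \<kappa>_def cong: prod.cong)
    also have "(\<Prod>k\<in>S2. exp (\<kappa> k * g (u k))) = (\<Prod>k\<in>S2. exp (\<mu> * g (u k)))"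
      using S(3) by (intro prod.cong) (auto simp: \<kappa>_def)
    also have "\<dots> = exp (\<mu> * YS S2 u)"
      using fin by (simp add: YS_def sum_distrib_left exp_sum)
    finally show ?thesis by (simp add: exp_add)
  qed
  then have "(\<integral>u. exp (\<nu> * YS S1 u + \<mu> * YS S2 u) \<partial>\<P>) = (\<Prod>k\<in>J. mgf (\<kappa> k))"
    using integral_iid_prod[OF finite_J, of "\<lambda>k x. exp (\<kappa> k * g x)"] int unfolding mgf_def by simp
  also have "\<dots> = (\<Prod>k\<in>S1. mgf (\<kappa> k)) * (\<Prod>k\<in>S2. mgf (\<kappa> k))"
  proof (rule sub)
    interpret prob_space \<U> by (rule prob_space_unit)
    show "mgf (\<kappa> k) = 1" if "k \<notin> S1" "k \<notin> S2" for k
      using that prob_space by (simp add: \<kappa>_def mgf_def)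
  qed
  also have "(\<Prod>k\<in>S1. mgf (\<kappa> k)) = mgf \<nu> ^ card S1"
    by (simp add: \<kappa>_def)
  also have "(\<Prod>k\<in>S2. mgf (\<kappa> k)) = (\<Prod>k\<in>S2. mgf \<mu>)"
    using S(3) by (intro prod.cong) (auto simp: \<kappa>_def)
  finally show ?thesis by simp
qed

lemma integral_exp_YS:
  "S \<subseteq> J \<Longrightarrow> (\<integral>u. exp (\<nu> * YS S u) \<partial>\<P>) = mgf \<nu> ^ card S"
  using integral_exp_YS2[of S "{}" \<nu> 0] by simp

lemma mgf_nonneg: "mgf \<kappa> \<ge> 0"
  unfolding mgf_def by (intro Bochner_Integration.integral_nonneg) auto

text \<open>Hoeffding's lemma for a centred variable in an interval of length \<open>2 * C\<close>;
  negative \<open>\<kappa>\<close> is reduced to positive by passing to \<open>- g\<close>. This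
  bound ignores the variance and serves for error terms, while \<open>mgf_bounds\<close> supplies
  the precise main terms.\<close>

lemma mgf_subgaussian: "mgf \<kappa> \<le> exp (\<kappa>\<^sup>2 * C\<^sup>2 / 2)"
proof -
  have *: "(\<integral>x. exp (\<kappa> * h x) \<partial>\<U>) \<le> exp (\<kappa>\<^sup>2 * C\<^sup>2 / 2)"
    if \<kappa>: "\<kappa> > 0" and h: "h \<in> borel_measurable \<U>" "\<And>x. \<bar>h x\<bar> \<le> C" "(\<integral>x. h x \<partial>\<U>) = 0" for h \<kappa>
  proof -
    interpret prob_space \<U> by (rule prob_space_unit)
    interpret interval_bounded_random_variable \<U> h "- C" C
      using h by unfold_locales (auto simp: abs_le_iff minus_le_iff)
    have int: "integrable \<U> (\<lambda>x. exp (\<kappa> * h x))"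
    proof (rule integrable_bounded_prob[OF prob_space_unit])
      show "(\<lambda>x. exp (\<kappa> * h x)) \<in> borel_measurable \<U>" using h by measurable
      show "norm (exp (\<kappa> * h x)) \<le> exp (\<kappa> * C)" for x
        using h(2)[of x] \<kappa> by (auto simp: abs_le_iff)
    qed
    have "ennreal (\<integral>x. exp (\<kappa> * h x) \<partial>\<U>) = (\<integral>\<^sup>+x. exp (\<kappa> * h x) \<partial>\<U>)"
      using int by (intro nn_integral_eq_integral[symmetric]) auto
    also have "\<dots> \<le> ennreal (exp (\<kappa>\<^sup>2 * (C - - C)\<^sup>2 / 8))"
      by (rule Hoeffdings_lemma_nn_integral_0[OF \<kappa> h(3)])
    also have "(C - - C)\<^sup>2 / 8 = C\<^sup>2 / 2" by (simp add: power2_eq_square)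
    then have "\<kappa>\<^sup>2 * (C - - C)\<^sup>2 / 8 = \<kappa>\<^sup>2 * C\<^sup>2 / 2" by (simp add: field_simps)
    finally show ?thesis by simp
  qed
  interpret prob_space \<U> by (rule prob_space_unit)
  consider "\<kappa> > 0" | "\<kappa> = 0" | "\<kappa> < 0" by linarith
  then show ?thesis
  proof cases
    case 1 then show ?thesis unfolding mgf_def by (rule *[OF _ g_meas g_bd g_mean])
  next
    case 2 then show ?thesis using prob_space by (simp add: mgf_def)
  next
    case 3
    then show ?thesis using *[of "- \<kappa>" "\<lambda>x. - g x"] g_meas g_bd g_mean by (simp add: mgf_def)
  qed
qed

lemma mgf_power_subgaussian: "mgf \<kappa> ^ m \<le> exp (\<kappa>\<^sup>2 * C\<^sup>2 * m / 2)"
proof -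
  have "mgf \<kappa> ^ m \<le> exp (\<kappa>\<^sup>2 * C\<^sup>2 / 2) ^ m" by (intro power_mono mgf_subgaussian mgf_nonneg)
  also have "\<dots> = exp (\<kappa>\<^sup>2 * C\<^sup>2 * m / 2)" by (simp add: exp_of_nat_mult[symmetric] mult_ac)
  finally show ?thesis .
qed

lemma integral_exp_abs_YS:
  assumes "S \<subseteq> J" shows "(\<integral>u. exp (\<bar>\<kappa> * YS S u\<bar>) \<partial>\<P>) \<le> 2 * exp (\<kappa>\<^sup>2 * C\<^sup>2 * card S / 2)"
proof -
  have int: "integrable \<P> (\<lambda>u. exp (c * YS S u))" for c
    by (rule integrable_continuous_Y[where F="\<lambda>y. exp (c * y)", OF _ assms]) (intro continuous_intros)
  have "(\<integral>u. exp (\<bar>\<kappa> * YS S u\<bar>) \<partial>\<P>) \<le> (\<integral>u. exp (\<kappa> * YS S u) + exp (- \<kappa> * YS S u) \<partial>\<P>)"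
  proof (intro integral_mono Bochner_Integration.integrable_add int)
    show "integrable \<P> (\<lambda>u. exp \<bar>\<kappa> * YS S u\<bar>)"
      by (rule integrable_continuous_Y[where F="\<lambda>y. exp \<bar>\<kappa> * y\<bar>", OF _ assms]) (intro continuous_intros)
    show "exp \<bar>\<kappa> * YS S u\<bar> \<le> exp (\<kappa> * YS S u) + exp (- \<kappa> * YS S u)" for u
      by (cases "\<kappa> * YS S u \<ge> 0") auto
  qed
  also have "\<dots> = mgf \<kappa> ^ card S + mgf (- \<kappa>) ^ card S"
    by (simp only: Bochner_Integration.integral_add[OF int int] integral_exp_YS[OF assms])
  also have "\<dots> \<le> exp (\<kappa>\<^sup>2 * C\<^sup>2 * card S / 2) + exp ((- \<kappa>)\<^sup>2 * C\<^sup>2 * card S / 2)"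
    by (intro add_mono mgf_power_subgaussian)
  finally show ?thesis by simp
qed

end

lemma prob_le_integral:
  assumes "prob_space M" "Measurable.pred M P" "integrable M F"
    and "\<And>x. x \<in> space M \<Longrightarrow> 0 \<le> F x" "\<And>x. x \<in> space M \<Longrightarrow> P x \<Longrightarrow> 1 \<le> F x"
  shows "measure M {x \<in> space M. P x} \<le> (\<integral>x. F x \<partial>M)"
proof -
  interpret prob_space M by fact
  have sets: "{x \<in> space M. P x} \<in> sets M" using assms(2) by measurable
  have "measure M {x \<in> space M. P x} = (\<integral>x. indicator {x \<in> space M. P x} x \<partial>M)"
    using sets by (simp add: Int_absorb1 sets.sets_into_space)
  also have "\<dots> \<le> (\<integral>x. F x \<partial>M)"
    using assms(3-5) sets
    by (intro integral_mono integrable_real_indicator) (auto simp: indicator_def less_top[symmetric])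
  finally show ?thesis .
qed

lemma fact_le_self_power: "fact n \<le> (real n) ^ n"
  using fact_le_power[of n, where 'a=real] by simp

context matched
begin

text \<open>The power is bounded by one term of the series of
  \<open>exp (K * \<bar>y\<bar>)\<close>. The parameter \<open>K\<close> stays free: it will be 2
  for characteristic functions and optimised for high moments.\<close>

lemma integral_YS_power_bound:
  assumes "S \<subseteq> J" "even q" and that: "K > 0"
  shows "(\<integral>u. (t * YS S u) ^ q / fact q \<partial>\<P>) \<le> 2 / K ^ q * exp (K\<^sup>2 * t\<^sup>2 * C\<^sup>2 * card S / 2)"
proof -
  have i1: "integrable \<P> (\<lambda>u. (t * YS S u) ^ q / fact q)"
    by (rule integrable_continuous_Y[where F="\<lambda>y. (t * y) ^ q / fact q", OF _ assms(1)])
       (intro continuous_intros, simp)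
  have i2: "integrable \<P> (\<lambda>u. exp \<bar>(K * t) * YS S u\<bar> / K ^ q)"
    by (rule integrable_continuous_Y[where F="\<lambda>y. exp \<bar>(K * t) * y\<bar> / K ^ q", OF _ assms(1)])
       (use that in \<open>intro continuous_intros, simp\<close>)
  have "(\<integral>u. (t * YS S u) ^ q / fact q \<partial>\<P>) \<le> (\<integral>u. exp \<bar>(K * t) * YS S u\<bar> / K ^ q \<partial>\<P>)"
  proof (intro integral_mono i1 i2)
    fix u
    have "(t * YS S u) ^ q / fact q = (\<bar>(K * t) * YS S u\<bar> ^ q / fact q) / K ^ q"
      using that by (simp add: power_even_abs assms(2) power_mult_distrib)
    also have "\<dots> \<le> exp \<bar>(K * t) * YS S u\<bar> / K ^ q"
      using that by (intro divide_right_mono power_div_fact_le_exp) auto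
    finally show "(t * YS S u) ^ q / fact q \<le> exp \<bar>(K * t) * YS S u\<bar> / K ^ q" .
  qed
  also have "\<dots> = (\<integral>u. exp \<bar>(K * t) * YS S u\<bar> \<partial>\<P>) / K ^ q" by (rule integral_divide_zero)
  also have "\<dots> \<le> 2 * exp ((K * t)\<^sup>2 * C\<^sup>2 * card S / 2) / K ^ q"
    using that by (intro divide_right_mono integral_exp_abs_YS[OF assms(1)]) auto
  finally show ?thesis by (simp add: power_mult_distrib mult_ac)
qed

lemma match_power:
  assumes "S \<subseteq> J" "q \<le> p"
  shows "(\<integral>x. XS S x ^ q \<partial>\<U>) = (\<integral>u. YS S u ^ q \<partial>\<P>)"
  using match_powers[OF assms(1) assms(1), of q 0] assms(2) by simp

lemma integral_XS_moment:
  assumes "S \<subseteq> J" "2 * r \<le> p" "r \<ge> 1" "real (card S) \<le> l" "l > 0"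
  shows "(\<integral>x. XS S x ^ (2 * r) \<partial>\<U>) \<le> 2 * (6 * r * C\<^sup>2 * l) ^ r"
proof -
  \<comment> \<open>This \<open>K\<close> minimises
    \<open>exp (K\<^sup>2 * C\<^sup>2 * l / 2) / K ^ (2 * r)\<close>.\<close>
  define K where "K = sqrt (2 * r / (C\<^sup>2 * l))"
  have K: "K > 0" "K\<^sup>2 = 2 * r / (C\<^sup>2 * l)" using assms C_pos by (auto simp: K_def)
  have "(\<integral>x. XS S x ^ (2 * r) \<partial>\<U>) = fact (2 * r) * (\<integral>u. (1 * YS S u) ^ (2 * r) / fact (2 * r) \<partial>\<P>)"
    by (simp add: match_power[OF assms(1,2)])
  also have "\<dots> \<le> fact (2 * r) * (2 / K ^ (2 * r) * exp (K\<^sup>2 * 1\<^sup>2 * C\<^sup>2 * card S / 2))"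
    by (intro mult_left_mono integral_YS_power_bound assms(1) K(1)) auto
  also have "\<dots> \<le> (2 * r) ^ (2 * r) * (2 / K ^ (2 * r) * exp r)"
  proof (intro mult_mono)
    show "fact (2 * r) \<le> real ((2 * r) ^ (2 * r))" using fact_le_self_power[of "2 * r"] by simp
    have "K\<^sup>2 * 1\<^sup>2 * C\<^sup>2 * card S / 2 = r * (card S / l)"
      using C_pos assms by (simp add: K(2))
    also have "\<dots> \<le> real r * 1" using assms by (intro mult_left_mono) auto
    finally show "exp (K\<^sup>2 * 1\<^sup>2 * C\<^sup>2 * card S / 2) \<le> exp r" by simp
  qed (use K in auto)
  also have "exp r \<le> (3::real) ^ r"
    using power_mono[OF exp_le, of r] by (simp add: exp_of_nat_mult[symmetric])
  then have "(2 * r) ^ (2 * r) * (2 / K ^ (2 * r) * exp r) \<le> (2 * r) ^ (2 * r) * (2 / K ^ (2 * r) * 3 ^ r)"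
    using K by (intro mult_left_mono) auto
  also have "\<dots> = 2 * (((2 * r)\<^sup>2 / K\<^sup>2) * 3) ^ r"
    using power_mult_distrib[of "4 :: real" 3 r]
    by (simp add: power_mult power_mult_distrib power_divide)
  also have "((2 * r)\<^sup>2 / K\<^sup>2) * 3 = 6 * r * C\<^sup>2 * l"
    using assms C_pos unfolding K(2) by (simp add: power2_eq_square)
  finally show ?thesis by simp
qed

section \<open>Characteristic functions of matched sums\<close>

definition charf :: "real \<Rightarrow> complex" where "charf t = (\<integral>x. iexp (t * g x) \<partial>\<U>)"

lemma integral_iexp_YS:
  assumes "S \<subseteq> J"
  shows "(\<integral>u. iexp (t * YS S u) \<partial>\<P>) = charf t ^ card S"
proof -
  define \<kappa> where "\<kappa> k = (if k \<in> S then t else 0)" for k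
  have int: "integrable \<U> (\<lambda>x. iexp (c * g x))" for c
    by (rule integrable_bounded_prob[OF prob_space_unit, where C=1]) (use g_meas in auto)
  have sub: "(\<Prod>k\<in>J. F k) = (\<Prod>k\<in>S. F k)" if "\<And>k. k \<notin> S \<Longrightarrow> F k = 1" for F :: "nat \<Rightarrow> complex"
    using assms that finite_J by (intro prod.mono_neutral_right) auto
  have "iexp (t * YS S u) = (\<Prod>k\<in>J. iexp (\<kappa> k * g (u k)))" for u
  proof -
    have "(\<Prod>k\<in>J. iexp (\<kappa> k * g (u k))) = (\<Prod>k\<in>S. iexp (\<kappa> k * g (u k)))"
      by (rule sub) (simp add: \<kappa>_def)
    also have "\<dots> = (\<Prod>k\<in>S. iexp (t * g (u k)))" by (intro prod.cong) (auto simp: \<kappa>_def)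
    also have "\<dots> = iexp (t * YS S u)"
      using finite_subset[OF assms finite_J] by (simp add: YS_def sum_distrib_left exp_sum)
    finally show ?thesis by simp
  qed
  then have "(\<integral>u. iexp (t * YS S u) \<partial>\<P>) = (\<Prod>k\<in>J. charf (\<kappa> k))"
    using integral_iid_prod[OF finite_J, of "\<lambda>k x. iexp (\<kappa> k * g x)"] int unfolding charf_def by simp
  also have "\<dots> = (\<Prod>k\<in>S. charf (\<kappa> k))"
  proof (rule sub)
    interpret prob_space \<U> by (rule prob_space_unit)
    show "charf (\<kappa> k) = 1" if "k \<notin> S" for k
      using that prob_space by (simp add: \<kappa>_def charf_def)
  qed
  also have "\<dots> = (\<Prod>k\<in>S. charf t)" by (intro prod.cong) (auto simp: \<kappa>_def)
  finally show ?thesis by simp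
qed

text \<open>Both sides are compared through the Taylor polynomial of degree \<open>q\<close>. For
  even \<open>q\<close> the bound on the remainder is itself a polynomial, so its expectation is the
  same for \<open>XS\<close> and \<open>YS\<close> and can be estimated on the independent
  side.\<close>

lemma integral_iexp_XS:
  assumes S: "S \<subseteq> J" and q: "even q" "q \<le> p"
  shows "norm ((\<integral>x. iexp (t * XS S x) \<partial>\<U>) - charf t ^ card S) \<le> 8 / 2 ^ q * exp (2 * t\<^sup>2 * C\<^sup>2 * card S)"
proof -
  define T where "T y = (\<Sum>k\<le>q. (\<i> * complex_of_real (t * y)) ^ k / fact k)" for y
  have T': "T y = (\<Sum>k\<le>q. ((\<i> * t) ^ k / fact k) * complex_of_real (y ^ k))" for y
    unfolding T_def by (intro sum.cong) (auto simp: power_mult_distrib)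
  have iXk: "integrable \<U> (\<lambda>x. ((\<i> * t) ^ k / fact k) * complex_of_real (XS S x ^ k))" for k
    by (rule integrable_continuous_X[where F="\<lambda>y. ((\<i> * t) ^ k / fact k) * complex_of_real (y ^ k)", OF _ S])
       (intro continuous_intros)
  have iYk: "integrable \<P> (\<lambda>x. ((\<i> * t) ^ k / fact k) * complex_of_real (YS S x ^ k))" for k
    by (rule integrable_continuous_Y[where F="\<lambda>y. ((\<i> * t) ^ k / fact k) * complex_of_real (y ^ k)", OF _ S])
       (intro continuous_intros)
  have TT: "(\<integral>x. T (XS S x) \<partial>\<U>) = (\<integral>u. T (YS S u) \<partial>\<P>)"
  proof -
    have "(\<integral>x. T (XS S x) \<partial>\<U>) = (\<Sum>k\<le>q. ((\<i> * t) ^ k / fact k) * complex_of_real (\<integral>x. XS S x ^ k \<partial>\<U>))"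
      unfolding T' Bochner_Integration.integral_sum[OF iXk] by (simp only: integral_mult_right_zero integral_complex_of_real)
    also have "\<dots> = (\<Sum>k\<le>q. ((\<i> * t) ^ k / fact k) * complex_of_real (\<integral>u. YS S u ^ k \<partial>\<P>))"
      using q by (intro sum.cong refl) (simp add: match_power[OF S])
    also have "\<dots> = (\<integral>u. T (YS S u) \<partial>\<P>)"
      unfolding T' Bochner_Integration.integral_sum[OF iYk] by (simp only: integral_mult_right_zero integral_complex_of_real)
    finally show ?thesis .
  qed
  have bound: "norm (iexp (t * y) - T y) \<le> 2 * ((t * y) ^ q / fact q)" for y
    using iexp_approx2[of "t * y" q] q(1) unfolding T_def by (simp add: power_even_abs)
  have cT: "continuous_on UNIV T" unfolding T_def by (intro continuous_intros) auto
  have iX: "integrable \<U> (\<lambda>x. iexp (t * XS S x))" "integrable \<U> (\<lambda>x. T (XS S x))"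
      "integrable \<U> (\<lambda>x. 2 * ((t * XS S x) ^ q / fact q))"
    by (rule integrable_continuous_X[where F="\<lambda>y. iexp (t * y)", OF _ S], intro continuous_intros)
       (rule integrable_continuous_X[OF cT S],
        rule integrable_continuous_X[where F="\<lambda>y. 2 * ((t * y) ^ q / fact q)", OF _ S], intro continuous_intros, simp)
  have iY: "integrable \<P> (\<lambda>x. iexp (t * YS S x))" "integrable \<P> (\<lambda>x. T (YS S x))"
      "integrable \<P> (\<lambda>x. 2 * ((t * YS S x) ^ q / fact q))"
    by (rule integrable_continuous_Y[where F="\<lambda>y. iexp (t * y)", OF _ S], intro continuous_intros)
       (rule integrable_continuous_Y[OF cT S],
        rule integrable_continuous_Y[where F="\<lambda>y. 2 * ((t * y) ^ q / fact q)", OF _ S], intro continuous_intros, simp)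
  define E where "E = (\<integral>u. 2 * ((t * YS S u) ^ q / fact q) \<partial>\<P>)"
  have "E = 2 * (\<integral>u. (t * YS S u) ^ q / fact q \<partial>\<P>)" unfolding E_def by (rule integral_mult_right_zero)
  also have "\<dots> \<le> 2 * (2 / 2 ^ q * exp (2\<^sup>2 * t\<^sup>2 * C\<^sup>2 * card S / 2))"
    by (intro mult_left_mono integral_YS_power_bound S q) auto
  finally have E: "E \<le> 4 / 2 ^ q * exp (2 * t\<^sup>2 * C\<^sup>2 * card S)" by (simp add: mult_ac)
  have EX: "(\<integral>x. 2 * ((t * XS S x) ^ q / fact q) \<partial>\<U>) = E"
    by (simp add: E_def power_mult_distrib match_power[OF S q(2)])
  have "norm ((\<integral>x. iexp (t * XS S x) \<partial>\<U>) - (\<integral>x. T (XS S x) \<partial>\<U>)) \<le> E"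
    unfolding EX[symmetric] Bochner_Integration.integral_diff[OF iX(1,2), symmetric]
    by (intro order_trans[OF integral_norm_bound] integral_mono integrable_norm Bochner_Integration.integrable_diff iX bound)
  moreover have "norm ((\<integral>u. iexp (t * YS S u) \<partial>\<P>) - (\<integral>u. T (YS S u) \<partial>\<P>)) \<le> E"
    unfolding E_def Bochner_Integration.integral_diff[OF iY(1,2), symmetric]
    by (intro order_trans[OF integral_norm_bound] integral_mono integrable_norm Bochner_Integration.integrable_diff iY bound)
  ultimately have "norm ((\<integral>x. iexp (t * XS S x) \<partial>\<U>) - (\<integral>u. iexp (t * YS S u) \<partial>\<P>)) \<le> E + E"
    unfolding TT by (rule norm_diff_triangle_le[OF _ order_trans[OF eq_refl[OF norm_minus_commute]]])
  then show ?thesis unfolding integral_iexp_YS[OF S] using E by simp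
qed

section \<open>Exponential estimates for matched sums\<close>

lemma texp_continuous: "continuous_on UNIV (\<lambda>y. texp Q (c * y))"
  unfolding texp_def by (intro continuous_intros) auto

lemma integral_texp_YS_diff:
  assumes S: "S \<subseteq> J"
  shows "\<bar>(\<integral>u. texp Q (\<nu> * YS S u) \<partial>\<P>) - mgf \<nu> ^ card S\<bar>
    \<le> 2 * exp (- 2 * real Q) * exp (8 * (\<nu>\<^sup>2 * C\<^sup>2 * card S))"
proof -
  have i1: "integrable \<P> (\<lambda>u. texp Q (\<nu> * YS S u))"
    by (rule integrable_continuous_Y[OF texp_continuous S])
  have i2: "integrable \<P> (\<lambda>u. exp (\<nu> * YS S u))"
    by (rule integrable_continuous_Y[where F="\<lambda>y. exp (\<nu> * y)", OF _ S]) (intro continuous_intros)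
  have i3: "integrable \<P> (\<lambda>u. exp (- 2 * real Q) * exp \<bar>(4 * \<nu>) * YS S u\<bar>)"
    by (rule integrable_continuous_Y[where F="\<lambda>y. exp (- 2 * real Q) * exp \<bar>(4 * \<nu>) * y\<bar>", OF _ S])
       (intro continuous_intros)
  have "\<bar>(\<integral>u. texp Q (\<nu> * YS S u) \<partial>\<P>) - mgf \<nu> ^ card S\<bar>
      = \<bar>\<integral>u. texp Q (\<nu> * YS S u) - exp (\<nu> * YS S u) \<partial>\<P>\<bar>"
    by (simp only: Bochner_Integration.integral_diff[OF i1 i2] integral_exp_YS[OF S])
  also have "\<dots> \<le> (\<integral>u. \<bar>texp Q (\<nu> * YS S u) - exp (\<nu> * YS S u)\<bar> \<partial>\<P>)"
    by (rule integral_abs_bound)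
  also have "\<dots> \<le> (\<integral>u. exp (- 2 * real Q) * exp \<bar>(4 * \<nu>) * YS S u\<bar> \<partial>\<P>)"
  proof (intro integral_mono i3 integrable_abs Bochner_Integration.integrable_diff i1 i2)
    show "\<bar>texp Q (\<nu> * YS S u) - exp (\<nu> * YS S u)\<bar> \<le> exp (- 2 * real Q) * exp \<bar>(4 * \<nu>) * YS S u\<bar>" for u
      using texp_error[of "\<nu> * YS S u" Q] by (simp add: abs_minus_commute abs_mult mult.assoc)
  qed
  also have "\<dots> = exp (- 2 * real Q) * (\<integral>u. exp \<bar>(4 * \<nu>) * YS S u\<bar> \<partial>\<P>)"
    by (rule integral_mult_right_zero)
  also have "\<dots> \<le> exp (- 2 * real Q) * (2 * exp ((4 * \<nu>)\<^sup>2 * C\<^sup>2 * card S / 2))"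
    by (intro mult_left_mono integral_exp_abs_YS S) auto
  finally show ?thesis by (simp add: power_mult_distrib mult_ac)
qed

text \<open>Markov's inequality with the polynomial \<open>texp\<close> in the role of the
  exponential: it is positive on the whole line and increasing on the nonnegative half-line, where
  \<open>\<nu> * \<theta>\<close> lies. The condition \<open>\<nu> * \<theta> \<le> Q / 4\<close>
  allows the denominator to be replaced by half an exponential, whence the leading factor 2.\<close>

lemma chernoff:
  assumes S: "S \<subseteq> J" and Q: "4 * Q \<le> p" "Q \<ge> 1" and \<nu>: "\<nu> \<ge> 0" "\<theta> \<ge> 0" "\<nu> * \<theta> \<le> Q / 4"
  shows "measure \<U> {x \<in> space \<U>. \<theta> \<le> XS S x}
    \<le> 2 * exp (- \<nu> * \<theta>) * (mgf \<nu> ^ card S + 2 * exp (- 2 * real Q) * exp (8 * (\<nu>\<^sup>2 * C\<^sup>2 * card S)))"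
proof -
  have i: "integrable \<U> (\<lambda>x. texp Q (\<nu> * XS S x) / texp Q (\<nu> * \<theta>))"
    by (intro integrable_divide integrable_continuous_X[OF texp_continuous S])
  have m: "Measurable.pred \<U> (\<lambda>x. \<theta> \<le> XS S x)"
    using XS_meas[OF S] by measurable
  have "measure \<U> {x \<in> space \<U>. \<theta> \<le> XS S x} \<le> (\<integral>x. texp Q (\<nu> * XS S x) / texp Q (\<nu> * \<theta>) \<partial>\<U>)"
  proof (rule prob_le_integral[OF prob_space_unit m i])
    show "0 \<le> texp Q (\<nu> * XS S x) / texp Q (\<nu> * \<theta>)" for x
      using texp_pos[of Q] by (simp add: less_imp_le)
    show "1 \<le> texp Q (\<nu> * XS S x) / texp Q (\<nu> * \<theta>)" if "\<theta> \<le> XS S x" for x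
    proof -
      have "texp Q (\<nu> * \<theta>) \<le> texp Q (\<nu> * XS S x)"
        using \<nu> that by (intro texp_mono mult_left_mono) auto
      then show ?thesis using texp_pos[of Q "\<nu> * \<theta>"] by simp
    qed
  qed
  also have "\<dots> = (\<integral>u. texp Q (\<nu> * YS S u) \<partial>\<P>) / texp Q (\<nu> * \<theta>)"
    by (simp only: integral_divide_zero match_texp1[OF S Q(1)])
  also have "\<dots> \<le> (mgf \<nu> ^ card S + 2 * exp (- 2 * real Q) * exp (8 * (\<nu>\<^sup>2 * C\<^sup>2 * card S))) / (exp (\<nu> * \<theta>) / 2)"
  proof (intro frac_le texp_ge_half_exp \<nu>(3) Q(2))
    show "(\<integral>u. texp Q (\<nu> * YS S u) \<partial>\<P>)
        \<le> mgf \<nu> ^ card S + 2 * exp (- 2 * real Q) * exp (8 * (\<nu>\<^sup>2 * C\<^sup>2 * card S))"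
      using integral_texp_YS_diff[OF S, of Q \<nu>] by linarith
  qed (auto intro!: add_nonneg_nonneg zero_le_power mgf_nonneg)
  finally show ?thesis by (simp add: exp_minus field_simps)
qed

text \<open>The two sets may overlap: disjoint blocks yield correlations, equal ones yield
  exponential moments under a tilted law. The mixed error is split into single exponentials by the
  arithmetic-geometric mean, which doubles the factor 4 to 8, and \<open>8\<^sup>2 / 2 = 32\<close>
  appears in the sub-Gaussian bound.\<close>

lemma integral_texp_prod_le:
  assumes S: "S1 \<subseteq> J" "S2 \<subseteq> J" and Q: "4 * Q \<le> p"
    and A: "\<nu>\<^sup>2 * C\<^sup>2 * card S1 \<le> A" "\<mu>\<^sup>2 * C\<^sup>2 * card S2 \<le> A"
  shows "(\<integral>x. texp Q (\<nu> * XS S1 x) * texp Q (\<mu> * XS S2 x) \<partial>\<U>)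
    \<le> (\<integral>u. exp (\<nu> * YS S1 u + \<mu> * YS S2 u) \<partial>\<P>) + 6 * exp (- 2 * real Q) * exp (32 * A)"
proof -
  let ?R = "\<lambda>u. exp \<bar>(8 * \<nu>) * YS S1 u\<bar> + exp \<bar>(8 * \<mu>) * YS S2 u\<bar>"
  let ?d = "3 / 2 * exp (- 2 * real Q)"
  have i1: "integrable \<P> (\<lambda>u. texp Q (\<nu> * YS S1 u) * texp Q (\<mu> * YS S2 u))"
    by (rule integrable_continuous2_Y[where F="\<lambda>z. texp Q (\<nu> * fst z) * texp Q (\<mu> * snd z)", OF _ S, simplified])
       (unfold texp_def, intro continuous_intros, auto)
  have i2: "integrable \<P> (\<lambda>u. exp (\<nu> * YS S1 u + \<mu> * YS S2 u))"
    by (rule integrable_continuous2_Y[where F="\<lambda>z. exp (\<nu> * fst z + \<mu> * snd z)", OF _ S, simplified])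
       (intro continuous_intros)
  have ir: "integrable \<P> (\<lambda>u. exp \<bar>c * YS S u\<bar>)" if "S \<subseteq> J" for c S
    by (rule integrable_continuous_Y[where F="\<lambda>y. exp \<bar>c * y\<bar>", OF _ that]) (intro continuous_intros)
  have "(\<integral>x. texp Q (\<nu> * XS S1 x) * texp Q (\<mu> * XS S2 x) \<partial>\<U>)
      = (\<integral>u. texp Q (\<nu> * YS S1 u) * texp Q (\<mu> * YS S2 u) \<partial>\<P>)"
    by (rule match_texp[OF S Q])
  also have "\<dots> \<le> (\<integral>u. exp (\<nu> * YS S1 u + \<mu> * YS S2 u) + ?d * ?R u \<partial>\<P>)"
  proof (intro integral_mono i1 i2 Bochner_Integration.integrable_add integrable_mult_right ir S)
    fix u
    define y z where "y = exp (4 * \<bar>\<nu> * YS S1 u\<bar>)" and "z = exp (4 * \<bar>\<mu> * YS S2 u\<bar>)"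
    have "texp Q (\<nu> * YS S1 u) * texp Q (\<mu> * YS S2 u)
        \<le> exp (\<nu> * YS S1 u + \<mu> * YS S2 u) + 3 * exp (- 2 * real Q) * (y * z)"
      unfolding y_def z_def by (rule texp_prod_le)
    moreover have "y * z \<le> (y\<^sup>2 + z\<^sup>2) / 2"
      using zero_le_power2[of "y - z"] by (simp add: power2_diff)
    then have "3 * exp (- 2 * real Q) * (y * z) \<le> 3 * exp (- 2 * real Q) * ((y\<^sup>2 + z\<^sup>2) / 2)"
      by (intro mult_left_mono) auto
    moreover have "3 * exp (- 2 * real Q) * ((y\<^sup>2 + z\<^sup>2) / 2) = ?d * ?R u"
      unfolding y_def z_def by (simp add: exp_double[symmetric] abs_mult mult.assoc)
    ultimately show "texp Q (\<nu> * YS S1 u) * texp Q (\<mu> * YS S2 u)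
        \<le> exp (\<nu> * YS S1 u + \<mu> * YS S2 u) + ?d * ?R u" by linarith
  qed
  also have "\<dots> = (\<integral>u. exp (\<nu> * YS S1 u + \<mu> * YS S2 u) \<partial>\<P>)
      + ?d * ((\<integral>u. exp \<bar>(8 * \<nu>) * YS S1 u\<bar> \<partial>\<P>) + (\<integral>u. exp \<bar>(8 * \<mu>) * YS S2 u\<bar> \<partial>\<P>))"
    by (simp only: Bochner_Integration.integral_add i2 ir S integral_mult_right_zero
        integrable_mult_right Bochner_Integration.integrable_add)
  also have "\<dots> \<le> (\<integral>u. exp (\<nu> * YS S1 u + \<mu> * YS S2 u) \<partial>\<P>) + ?d * (2 * exp (32 * A) + 2 * exp (32 * A))"
  proof (intro add_left_mono mult_left_mono add_mono)
    show "(\<integral>u. exp \<bar>(8 * \<nu>) * YS S1 u\<bar> \<partial>\<P>) \<le> 2 * exp (32 * A)"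
      using A(1) by (intro order_trans[OF integral_exp_abs_YS[OF S(1)]]) (simp add: power_mult_distrib mult_ac)
    show "(\<integral>u. exp \<bar>(8 * \<mu>) * YS S2 u\<bar> \<partial>\<P>) \<le> 2 * exp (32 * A)"
      using A(2) by (intro order_trans[OF integral_exp_abs_YS[OF S(2)]]) (simp add: power_mult_distrib mult_ac)
  qed auto
  finally show ?thesis by simp
qed

text \<open>Second-order expansion of the exponential, integrated against a function of mean 0. The
  lower bound passes through \<open>ln (1 + z) \<ge> z - 2 * z\<^sup>2\<close>, whose quadratic loss
  is absorbed by the cubic term.\<close>

lemma mgf_bounds:
  defines "s2 \<equiv> (\<integral>x. (g x)\<^sup>2 \<partial>\<U>)"
  assumes k: "\<bar>\<kappa>\<bar> * C \<le> 1 / 2"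
  shows "mgf \<kappa> \<le> exp (\<kappa>\<^sup>2 * s2 / 2 + (\<bar>\<kappa>\<bar> * C) ^ 3)"
    and "exp (\<kappa>\<^sup>2 * s2 / 2 - 4 * (\<bar>\<kappa>\<bar> * C) ^ 3) \<le> mgf \<kappa>"
proof -
  interpret prob_space \<U> by (rule prob_space_unit)
  define w where "w = \<bar>\<kappa>\<bar> * C"
  have w: "0 \<le> w" "w \<le> 1 / 2" using k C_pos by (auto simp: w_def)
  have i1: "integrable \<U> (\<lambda>x. exp (\<kappa> * g x))"
  proof (rule integrable_bounded_prob[OF prob_space_unit])
    show "(\<lambda>x. exp (\<kappa> * g x)) \<in> borel_measurable \<U>" using g_meas by measurable
    show "norm (exp (\<kappa> * g x)) \<le> exp (\<bar>\<kappa>\<bar> * C)" for x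
      using abs_le_D1[of "\<kappa> * g x" "\<bar>\<kappa>\<bar> * C"] g_bd[of x] by (auto simp: abs_mult mult_left_mono)
  qed
  have ig: "integrable \<U> g"
    by (rule integrable_bounded_prob[OF prob_space_unit g_meas, where C=C]) (simp add: g_bd)
  have ig2: "integrable \<U> (\<lambda>x. (g x)\<^sup>2)"
  proof (rule integrable_bounded_prob[OF prob_space_unit])
    show "(\<lambda>x. (g x)\<^sup>2) \<in> borel_measurable \<U>" using g_meas by measurable
    show "norm ((g x)\<^sup>2) \<le> C\<^sup>2" for x
      using power_mono[OF g_bd[of x], of 2] by simp
  qed
  have pt: "\<bar>exp (\<kappa> * g x) - (1 + \<kappa> * g x + \<kappa>\<^sup>2 / 2 * (g x)\<^sup>2)\<bar> \<le> w ^ 3" for x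
  proof -
    obtain t where t: "\<bar>t\<bar> \<le> \<bar>\<kappa> * g x\<bar>"
      "exp (\<kappa> * g x) = (\<Sum>m<3. (\<kappa> * g x) ^ m / fact m) + (exp t / fact 3) * (\<kappa> * g x) ^ 3"
      using Maclaurin_exp_le by blast
    have y: "\<bar>\<kappa> * g x\<bar> \<le> w" unfolding w_def abs_mult by (intro mult_left_mono g_bd) auto
    have "exp t \<le> exp 1" using t(1) y w by simp
    then have "exp t \<le> 6" using exp_le by linarith
    then have "exp t / fact 3 \<le> 1" by (simp add: fact_numeral)
    then have "(exp t / fact 3) * \<bar>\<kappa> * g x\<bar> ^ 3 \<le> 1 * w ^ 3"
      using y by (intro mult_mono power_mono) auto
    moreover have "exp (\<kappa> * g x) - (1 + \<kappa> * g x + \<kappa>\<^sup>2 / 2 * (g x)\<^sup>2) = (exp t / fact 3) * (\<kappa> * g x) ^ 3"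
      using t(2) by (simp add: numeral_3_eq_3 power2_eq_square mult_ac)
    ultimately show ?thesis by (simp add: abs_mult power_abs)
  qed
  have iP: "integrable \<U> (\<lambda>x. 1 + \<kappa> * g x + \<kappa>\<^sup>2 / 2 * (g x)\<^sup>2)"
    by (intro Bochner_Integration.integrable_add integrable_mult_right ig ig2 integrable_const)
  have EP: "(\<integral>x. 1 + \<kappa> * g x + \<kappa>\<^sup>2 / 2 * (g x)\<^sup>2 \<partial>\<U>) = 1 + \<kappa>\<^sup>2 * s2 / 2"
    using ig ig2 g_mean prob_space by (simp add: Bochner_Integration.integral_add s2_def)
  have "\<bar>mgf \<kappa> - (1 + \<kappa>\<^sup>2 * s2 / 2)\<bar> = \<bar>\<integral>x. exp (\<kappa> * g x) - (1 + \<kappa> * g x + \<kappa>\<^sup>2 / 2 * (g x)\<^sup>2) \<partial>\<U>\<bar>"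
    unfolding mgf_def EP[symmetric] by (simp only: Bochner_Integration.integral_diff[OF i1 iP])
  also have "\<dots> \<le> w ^ 3"
    using integral_bounded_prob[OF prob_space_unit, of "\<lambda>x. exp (\<kappa> * g x) - (1 + \<kappa> * g x + \<kappa>\<^sup>2 / 2 * (g x)\<^sup>2)" "w ^ 3"]
      pt borel_measurable_integrable[OF Bochner_Integration.integrable_diff[OF i1 iP]] by simp
  finally have m: "\<bar>mgf \<kappa> - (1 + \<kappa>\<^sup>2 * s2 / 2)\<bar> \<le> w ^ 3" .
  have "mgf \<kappa> \<le> 1 + (\<kappa>\<^sup>2 * s2 / 2 + w ^ 3)" using m by linarith
  also have "\<dots> \<le> exp (\<kappa>\<^sup>2 * s2 / 2 + w ^ 3)" by (rule exp_ge_add_one_self)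
  finally show "mgf \<kappa> \<le> exp (\<kappa>\<^sup>2 * s2 / 2 + (\<bar>\<kappa>\<bar> * C) ^ 3)" by (simp add: w_def)
  have s2: "0 \<le> s2" "s2 \<le> C\<^sup>2"
  proof -
    show "0 \<le> s2" unfolding s2_def by (intro Bochner_Integration.integral_nonneg) auto
    have "(g x)\<^sup>2 \<le> C\<^sup>2" for x using power_mono[OF g_bd[of x], of 2] by simp
    then have "\<bar>s2\<bar> \<le> C\<^sup>2" unfolding s2_def
      using integral_bounded_prob[OF prob_space_unit borel_measurable_integrable[OF ig2], of "C\<^sup>2"] by simp
    then show "s2 \<le> C\<^sup>2" by linarith
  qed
  define z where "z = \<kappa>\<^sup>2 * s2 / 2 - w ^ 3"
  have ks: "0 \<le> \<kappa>\<^sup>2 * s2 / 2" "\<kappa>\<^sup>2 * s2 / 2 \<le> w\<^sup>2 / 2"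
    using s2 by (auto simp: w_def power_mult_distrib mult_left_mono)
  have w3: "0 \<le> w ^ 3" "w ^ 3 \<le> w\<^sup>2 / 2"
    using w mult_right_mono[of w "1 / 2" "w\<^sup>2"] by (auto simp: power3_eq_cube power2_eq_square)
  have w2: "w\<^sup>2 \<le> w * (1 / 2)" unfolding power2_eq_square using w by (intro mult_left_mono) auto
  have z: "\<bar>z\<bar> \<le> w\<^sup>2 / 2" using ks w3 unfolding z_def by linarith
  then have zb: "- (1 / 2) \<le> z" "z \<le> 1 / 2" using w2 w by auto
  have "z\<^sup>2 \<le> (w\<^sup>2 / 2)\<^sup>2" using power_mono[OF z, of 2] by simp
  also have "\<dots> = w ^ 3 * (w / 4)" by (simp add: power2_eq_square power3_eq_cube)
  also have "\<dots> \<le> w ^ 3 * 1" using w w3 by (intro mult_left_mono) auto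
  finally have z2: "z\<^sup>2 \<le> w ^ 3" by simp
  have "\<kappa>\<^sup>2 * s2 / 2 - 4 * w ^ 3 \<le> z - 2 * z\<^sup>2" using z2 w3 z_def by linarith
  then have "exp (\<kappa>\<^sup>2 * s2 / 2 - 4 * w ^ 3) \<le> exp (z - 2 * z\<^sup>2)" by simp
  also have "\<dots> \<le> 1 + z"
  proof -
    have "z - 2 * z\<^sup>2 \<le> ln (1 + z)"
      using abs_ln_one_plus_x_minus_x_bound[of z] zb abs_le_iff[of z "1 / 2"] by (simp add: abs_le_iff)
    then have "exp (z - 2 * z\<^sup>2) \<le> exp (ln (1 + z))" by simp
    then show ?thesis using zb by (simp add: exp_ln)
  qed
  also have "\<dots> \<le> mgf \<kappa>" using m unfolding z_def by linarith
  finally show "exp (\<kappa>\<^sup>2 * s2 / 2 - 4 * (\<bar>\<kappa>\<bar> * C) ^ 3) \<le> mgf \<kappa>" by (simp add: w_def)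
qed

end

section \<open>A maximal inequality\<close>

text \<open>Either \<open>u\<close> is at least a tenth of the sum or \<open>v\<close> at least nine
  tenths. The lopsided split keeps the factor on \<open>v\<close> close to 1, so that it can be
  iterated over dyadic levels.\<close>

lemma add_power_le_split:
  fixes u v :: real
  assumes "u \<ge> 0" "v \<ge> 0"
  shows "(u + v) ^ q \<le> 10 ^ q * u ^ q + (10 / 9) ^ q * v ^ q"
proof (cases "u + v \<le> 10 * u")
  case True
  then have "(u + v) ^ q \<le> (10 * u) ^ q" using assms by (intro power_mono) auto
  moreover have "0 \<le> (10 / 9) ^ q * v ^ q" using assms by simp
  ultimately show ?thesis by (simp add: power_mult_distrib)
next
  case False
  then have "(u + v) ^ q \<le> ((10 / 9) * v) ^ q" using assms by (intro power_mono) auto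
  moreover have "0 \<le> 10 ^ q * u ^ q" using assms by simp
  ultimately show ?thesis unfolding power_mult_distrib by linarith
qed

text \<open>Closes the dyadic induction: \<open>100 / 81 = (10 / 9)\<^sup>2\<close> is the loss on
  each of the two halves, and \<open>2 ^ r\<close> is the growth of the bound when the length
  doubles. For \<open>r = 2\<close> the inequality just fails.\<close>

lemma power_growth: "r \<ge> 3 \<Longrightarrow> 1 + 2 * (100 / 81) ^ r \<le> (2::real) ^ r"
proof (induction r rule: dec_induct)
  case (step r)
  have "1 + 2 * (100 / 81) ^ Suc r \<le> 2 * (1 + 2 * (100 / 81 :: real) ^ r)" by simp
  also have "\<dots> \<le> 2 * 2 ^ r" using step by (intro mult_left_mono) auto
  finally show ?case by simp
qed (simp add: power3_eq_cube)

text \<open>The empty sum \<open>N = 0\<close> is included and makes the maximum nonnegative; the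
  range is dyadic for the sake of bisection.\<close>

definition partial_max :: "(nat \<Rightarrow> 'a \<Rightarrow> real) \<Rightarrow> nat \<Rightarrow> nat \<Rightarrow> 'a \<Rightarrow> real" where
  "partial_max X j a x = Max ((\<lambda>N. \<bar>\<Sum>k=a..<a + N. X k x\<bar>) ` {..2 ^ j})"

lemma partial_max_ge: "N \<le> 2 ^ j \<Longrightarrow> \<bar>\<Sum>k=a..<a + N. X k x\<bar> \<le> partial_max X j a x"
  unfolding partial_max_def by (intro Max_ge) auto

lemma partial_max_nonneg: "0 \<le> partial_max X j a x"
  using partial_max_ge[where N = 0 and j = j and X = X and a = a and x = x] by simp

lemma partial_max_le: "(\<And>N. N \<le> 2 ^ j \<Longrightarrow> \<bar>\<Sum>k=a..<a + N. X k x\<bar> \<le> c) \<Longrightarrow> partial_max X j a x \<le> c"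
  unfolding partial_max_def by (intro Max.boundedI) auto

lemma partial_max_Suc:
  "partial_max X (Suc j) a x \<le> \<bar>\<Sum>k=a..<a + 2 ^ j. X k x\<bar>
    + max (partial_max X j a x) (partial_max X j (a + 2 ^ j) x)"
proof (rule partial_max_le)
  fix N :: nat assume N: "N \<le> 2 ^ Suc j"
  show "\<bar>\<Sum>k=a..<a + N. X k x\<bar> \<le> \<bar>\<Sum>k=a..<a + 2 ^ j. X k x\<bar>
    + max (partial_max X j a x) (partial_max X j (a + 2 ^ j) x)"
  proof (cases "N \<le> 2 ^ j")
    case True
    then show ?thesis using partial_max_ge[where N = N and j = j and X = X and a = a and x = x] by linarith
  next
    case False
    then have "(\<Sum>k=a..<a + N. X k x) = (\<Sum>k=a..<a + 2 ^ j. X k x)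
        + (\<Sum>k=a + 2 ^ j..<a + 2 ^ j + (N - 2 ^ j). X k x)"
      by (simp add: sum.atLeastLessThan_concat)
    moreover have "N - 2 ^ j \<le> 2 ^ j" using N by simp
    from partial_max_ge[OF this, where X = X and a = "a + 2 ^ j" and x = x]
    have "\<bar>\<Sum>k=a + 2 ^ j..<a + 2 ^ j + (N - 2 ^ j). X k x\<bar> \<le> partial_max X j (a + 2 ^ j) x" .
    ultimately show ?thesis by linarith
  qed
qed

lemma partial_max_measurable:
  assumes "\<And>k. X k \<in> borel_measurable M"
  shows "partial_max X j a \<in> borel_measurable M"
proof -
  have "(\<lambda>x. Max ((\<lambda>N. \<bar>\<Sum>k=a..<a + N. X k x\<bar>) ` {..2 ^ j})) \<in> borel_measurable M"
    using assms by (intro borel_measurable_Max) auto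
  then show ?thesis unfolding partial_max_def[abs_def] .
qed

text \<open>Bisection: a partial sum over the doubled range is a partial sum of the first half, or
  the whole first half plus a partial sum of the second. Only moment bounds for the increments
  enter; as the bound grows by \<open>2 ^ r\<close> per doubling, it outweighs the contributions of
  the two halves.\<close>

lemma maximal_moment:
  fixes X :: "nat \<Rightarrow> 'a \<Rightarrow> real" and A :: real
  assumes M: "prob_space M" and meas: "\<And>k. X k \<in> borel_measurable M"
    and bd: "\<And>k x. \<bar>X k x\<bar> \<le> C" and r: "r \<ge> 3"
    and mom: "\<And>a b. a\<^sub>0 \<le> a \<Longrightarrow> a < b \<Longrightarrow> b \<le> b\<^sub>0 \<Longrightarrow>
      (\<integral>x. (\<Sum>k=a..<b. X k x) ^ (2 * r) \<partial>M) \<le> A * real (b - a) ^ r"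
  shows "a\<^sub>0 \<le> a \<Longrightarrow> a + 2 ^ j \<le> b\<^sub>0 \<Longrightarrow>
    (\<integral>x. partial_max X j a x ^ (2 * r) \<partial>M) \<le> 100 ^ r * A * (2 ^ j) ^ r"
proof (induction j arbitrary: a)
  case 0
  have "partial_max X 0 a x = \<bar>\<Sum>k=a..<a + 1. X k x\<bar>" for x
    by (auto simp: partial_max_def atMost_Suc intro!: Max_eqI)
  then have "(\<integral>x. partial_max X 0 a x ^ (2 * r) \<partial>M) = (\<integral>x. (\<Sum>k=a..<a + 1. X k x) ^ (2 * r) \<partial>M)"
    by (simp add: power_even_abs)
  also have "\<dots> \<le> A" using mom[of a "a + 1"] 0 by simp
  finally have A: "(\<integral>x. partial_max X 0 a x ^ (2 * r) \<partial>M) \<le> A" .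
  moreover have "0 \<le> (\<integral>x. partial_max X 0 a x ^ (2 * r) \<partial>M)"
    by (intro Bochner_Integration.integral_nonneg zero_le_power partial_max_nonneg)
  ultimately have "0 \<le> A" by linarith
  then have "A \<le> 100 ^ r * A" using mult_right_mono[of 1 "100 ^ r" A] by simp
  with A show ?case by simp
next
  case (Suc j)
  have bd': "\<bar>\<Sum>k=a..<b. X k x\<bar> \<le> C * (b - a)" for a b x
  proof -
    have "\<bar>\<Sum>k=a..<b. X k x\<bar> \<le> (\<Sum>k=a..<b. \<bar>X k x\<bar>)" by (rule sum_abs)
    also have "\<dots> \<le> (\<Sum>k=a..<b. C)" by (intro sum_mono bd)
    finally show ?thesis by (simp add: mult.commute)
  qed
  have pm_bd: "partial_max X j a x \<le> C * 2 ^ j" for j a x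
  proof (rule partial_max_le)
    fix N :: nat assume "N \<le> 2 ^ j"
    then have "real N \<le> 2 ^ j" using of_nat_mono[of N "2 ^ j", where 'a=real] by simp
    moreover have "C \<ge> 0" using bd[of 0 undefined] by linarith
    ultimately show "\<bar>\<Sum>k=a..<a + N. X k x\<bar> \<le> C * 2 ^ j"
      using bd'[where a = a and b = "a + N" and x = x] mult_left_mono[of "real N" "2 ^ j" C] by simp
  qed
  have iS: "integrable M (\<lambda>x. (\<Sum>k=a..<b. X k x) ^ (2 * r))" for a b
  proof (rule integrable_bounded_prob[OF M])
    show "(\<lambda>x. (\<Sum>k=a..<b. X k x) ^ (2 * r)) \<in> borel_measurable M" using meas by measurable
    show "norm ((\<Sum>k=a..<b. X k x) ^ (2 * r)) \<le> (C * (b - a)) ^ (2 * r)" for x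
      using power_mono[OF bd'[where a = a and b = b and x = x], of "2 * r"] by (simp add: power_abs)
  qed
  have iM: "integrable M (\<lambda>x. partial_max X j a x ^ (2 * r))" for j a
  proof (rule integrable_bounded_prob[OF M])
    show "(\<lambda>x. partial_max X j a x ^ (2 * r)) \<in> borel_measurable M"
      using partial_max_measurable[of X M j a] meas by measurable
    show "norm (partial_max X j a x ^ (2 * r)) \<le> (C * 2 ^ j) ^ (2 * r)" for x
      using power_mono[OF pm_bd[of j a x] partial_max_nonneg, of "2 * r"] partial_max_nonneg[of X j a x]
      by (simp add: power_abs)
  qed
  let ?S = "\<lambda>x. \<Sum>k=a..<a + 2 ^ j. X k x"
  have "(\<integral>x. partial_max X (Suc j) a x ^ (2 * r) \<partial>M) \<le> (\<integral>x. 10 ^ (2 * r) * ?S x ^ (2 * r)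
      + (10 / 9) ^ (2 * r) * (partial_max X j a x ^ (2 * r) + partial_max X j (a + 2 ^ j) x ^ (2 * r)) \<partial>M)"
  proof (intro integral_mono iM Bochner_Integration.integrable_add integrable_mult_right iS)
    fix x
    let ?m = "max (partial_max X j a x) (partial_max X j (a + 2 ^ j) x)"
    have m: "0 \<le> ?m" using partial_max_nonneg[of X j a x] by linarith
    have "partial_max X (Suc j) a x ^ (2 * r) \<le> (\<bar>?S x\<bar> + ?m) ^ (2 * r)"
      by (intro power_mono partial_max_Suc partial_max_nonneg)
    also have "\<dots> \<le> 10 ^ (2 * r) * \<bar>?S x\<bar> ^ (2 * r) + (10 / 9) ^ (2 * r) * ?m ^ (2 * r)"
      using m by (intro add_power_le_split) auto
    also have "\<dots> \<le> 10 ^ (2 * r) * ?S x ^ (2 * r)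
      + (10 / 9) ^ (2 * r) * (partial_max X j a x ^ (2 * r) + partial_max X j (a + 2 ^ j) x ^ (2 * r))"
    proof (intro add_mono mult_left_mono)
      show "?m ^ (2 * r) \<le> partial_max X j a x ^ (2 * r) + partial_max X j (a + 2 ^ j) x ^ (2 * r)"
        by (simp add: max_def)
    qed (auto simp: power_even_abs)
    finally show "partial_max X (Suc j) a x ^ (2 * r) \<le> 10 ^ (2 * r) * ?S x ^ (2 * r)
      + (10 / 9) ^ (2 * r) * (partial_max X j a x ^ (2 * r) + partial_max X j (a + 2 ^ j) x ^ (2 * r))" .
  qed
  also have "\<dots> = 10 ^ (2 * r) * (\<integral>x. ?S x ^ (2 * r) \<partial>M) + (10 / 9) ^ (2 * r) *
      ((\<integral>x. partial_max X j a x ^ (2 * r) \<partial>M) + (\<integral>x. partial_max X j (a + 2 ^ j) x ^ (2 * r) \<partial>M))"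
    by (simp only: Bochner_Integration.integral_add iM iS integrable_mult_right integral_mult_right_zero
        Bochner_Integration.integrable_add)
  also have "\<dots> \<le> 10 ^ (2 * r) * (A * (2 ^ j) ^ r) + (10 / 9) ^ (2 * r) *
      (100 ^ r * A * (2 ^ j) ^ r + 100 ^ r * A * (2 ^ j) ^ r)"
    using Suc.prems mom[of a "a + 2 ^ j"] by (intro add_mono mult_left_mono Suc.IH) auto
  also have "\<dots> = 100 ^ r * (A * (2 ^ j) ^ r) * (1 + 2 * (100 / 81) ^ r)"
  proof -
    have "(10 :: real) ^ (2 * r) = (10\<^sup>2) ^ r" "(10 / 9 :: real) ^ (2 * r) = ((10 / 9)\<^sup>2) ^ r"
      by (rule power_mult)+
    then have h: "(10 :: real) ^ (2 * r) = 100 ^ r" "(10 / 9 :: real) ^ (2 * r) = (100 / 81) ^ r"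
      by (simp_all add: power_divide)
    show ?thesis unfolding h by (simp add: algebra_simps)
  qed
  also have "\<dots> \<le> 100 ^ r * (A * (2 ^ j) ^ r) * 2 ^ r"
  proof (intro mult_left_mono power_growth r)
    have "0 \<le> (\<integral>x. ?S x ^ (2 * r) \<partial>M)"
      by (intro Bochner_Integration.integral_nonneg) (simp add: zero_le_even_power)
    also have "\<dots> \<le> A * (2 ^ j) ^ r" using Suc.prems mom[of a "a + 2 ^ j"] by simp
    finally show "0 \<le> 100 ^ r * (A * (2 ^ j) ^ r)" by simp
  qed
  finally show ?case by (simp add: power_mult_distrib mult_ac)
qed

lemma maximal_probability:
  fixes X :: "nat \<Rightarrow> 'a \<Rightarrow> real" and A :: real
  assumes M: "prob_space M" and meas: "\<And>k. X k \<in> borel_measurable M"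
    and bd: "\<And>k x. \<bar>X k x\<bar> \<le> C" and r: "r \<ge> 3"
    and mom: "\<And>a b. a\<^sub>0 \<le> a \<Longrightarrow> a < b \<Longrightarrow> b \<le> b\<^sub>0 \<Longrightarrow>
      (\<integral>x. (\<Sum>k=a..<b. X k x) ^ (2 * r) \<partial>M) \<le> A * real (b - a) ^ r"
    and a: "a\<^sub>0 \<le> a" "a + 2 ^ j \<le> b\<^sub>0" and \<eta>: "\<eta> > 0"
  shows "measure M {x \<in> space M. \<eta> < partial_max X j a x} \<le> 100 ^ r * A * (2 ^ j) ^ r / \<eta> ^ (2 * r)"
proof -
  have bd': "\<bar>\<Sum>k=a..<a + N. X k x\<bar> \<le> C * N" for N x
  proof -
    have "\<bar>\<Sum>k=a..<a + N. X k x\<bar> \<le> (\<Sum>k=a..<a + N. \<bar>X k x\<bar>)" by (rule sum_abs)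
    also have "\<dots> \<le> (\<Sum>k=a..<a + N. C)" by (intro sum_mono bd)
    finally show ?thesis by (simp add: mult.commute)
  qed
  have pm_bd: "partial_max X j a x \<le> C * 2 ^ j" for x
  proof (rule partial_max_le)
    fix N :: nat assume "N \<le> 2 ^ j"
    then have "real N \<le> 2 ^ j" using of_nat_mono[of N "2 ^ j", where 'a=real] by simp
    moreover have "C \<ge> 0" using bd[of 0 undefined] by linarith
    ultimately show "\<bar>\<Sum>k=a..<a + N. X k x\<bar> \<le> C * 2 ^ j"
      using bd'[where N = N and x = x] mult_left_mono[of "real N" "2 ^ j" C] by simp
  qed
  have pm[measurable]: "partial_max X j a \<in> borel_measurable M"
    by (rule partial_max_measurable) (rule meas)
  have iM: "integrable M (\<lambda>x. partial_max X j a x ^ (2 * r) / \<eta> ^ (2 * r))"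
  proof (intro integrable_divide integrable_bounded_prob[OF M])
    show "(\<lambda>x. partial_max X j a x ^ (2 * r)) \<in> borel_measurable M" by measurable
    show "norm (partial_max X j a x ^ (2 * r)) \<le> (C * 2 ^ j) ^ (2 * r)" for x
      using power_mono[OF pm_bd[of x] partial_max_nonneg, of "2 * r"] partial_max_nonneg[of X j a x]
      by (simp add: power_abs)
  qed
  have "measure M {x \<in> space M. \<eta> < partial_max X j a x} \<le> (\<integral>x. partial_max X j a x ^ (2 * r) / \<eta> ^ (2 * r) \<partial>M)"
  proof (rule prob_le_integral[OF M _ iM])
    show "Measurable.pred M (\<lambda>x. \<eta> < partial_max X j a x)" by measurable
    show "1 \<le> partial_max X j a x ^ (2 * r) / \<eta> ^ (2 * r)" if "\<eta> < partial_max X j a x" for x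
      using that \<eta> by (simp add: power_mono)
  qed simp
  also have "\<dots> = (\<integral>x. partial_max X j a x ^ (2 * r) \<partial>M) / \<eta> ^ (2 * r)" by (rule integral_divide_zero)
  also have "\<dots> \<le> 100 ^ r * A * (2 ^ j) ^ r / \<eta> ^ (2 * r)"
    using \<eta> by (intro divide_right_mono maximal_moment[OF M meas bd r mom a]) auto
  finally show ?thesis .
qed

section \<open>Permuted sequences and their trigonometric approximation\<close>

text \<open>A single constant \<open>C\<close> bounds \<open>f\<close>, its approximants and the
  rate of approximation; from here on the variation of \<open>f\<close> is felt only through
  it.\<close>

locale permuted_sequence =
  fixes n :: "nat \<Rightarrow> int" and \<sigma> :: "nat \<Rightarrow> nat" and R :: "nat \<Rightarrow> real" and i\<^sub>0 :: nat
    and f :: "real \<Rightarrow> real" and C :: real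
  assumes rf: "relation_free n R 65 i\<^sub>0"
    and R_mono: "\<And>i j. 1 \<le> i \<Longrightarrow> i \<le> j \<Longrightarrow> R i \<le> R j"
    and R_lim: "filterlim R at_top sequentially"
    and n_nonneg: "\<And>k. k \<ge> 1 \<Longrightarrow> n k \<ge> 0"
    and \<sigma>: "bij_betw \<sigma> {1..} {1..}"
    and f_meas: "f \<in> borel_measurable lebesgue"
    and f_per: "\<And>x. f (x + 1) = f x"
    and f_mean: "(\<integral>x. f x \<partial>\<U>) = 0"
    and f_bd: "\<And>x. \<bar>f x\<bar> \<le> C"
    and C1: "C \<ge> 1"
    and approx: "\<And>D. D \<ge> 1 \<Longrightarrow> \<exists>g. trig_poly D g \<and> (\<forall>x. \<bar>g x\<bar> \<le> C) \<and> (\<integral>x. g x \<partial>\<U>) = 0 \<and>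
        (\<integral>x. \<bar>f x - g x\<bar> \<partial>\<U>) \<le> C / sqrt D"
begin

text \<open>Terms with index below \<open>B\<close> are dropped; the others are replaced by polynomials of degree \<open>B ^ 64\<close>.
  This degree makes the \<open>L\<^sup>1\<close> error of the first \<open>B ^ 16\<close> terms summable over \<open>B\<close>, and up to \<open>B\<close> frequencies still
  add up to at most \<open>B ^ 65\<close>, the coefficient size allowed in \<^term>\<open>relation_free n R 65 i\<^sub>0\<close>.\<close>

definition app :: "nat \<Rightarrow> real \<Rightarrow> real" where
  "app B = (SOME g. trig_poly (B ^ 64) g \<and> (\<forall>x. \<bar>g x\<bar> \<le> C) \<and> (\<integral>x. g x \<partial>\<U>) = 0 \<and>
        (\<integral>x. \<bar>f x - g x\<bar> \<partial>\<U>) \<le> C / sqrt (real (B ^ 64)))"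

text \<open>\<open>P\<close> is a set of positions in the permuted sequence, whereas
  \<open>hi B P\<close> is a set of indices of \<open>n\<close>: those found at these positions and
  not below the threshold.\<close>

definition hi :: "nat \<Rightarrow> nat set \<Rightarrow> nat set" where "hi B P = \<sigma> ` P \<inter> {B..}"
definition S :: "nat \<Rightarrow> real \<Rightarrow> real" where "S N x = (\<Sum>k=1..N. f (of_int (n (\<sigma> k)) * x))"
definition G :: "nat \<Rightarrow> nat set \<Rightarrow> real \<Rightarrow> real" where
  "G B P x = (\<Sum>i\<in>hi B P. app B (of_int (n i) * x))"
definition s2 :: "nat \<Rightarrow> real" where "s2 B = (\<integral>x. (app B x)\<^sup>2 \<partial>\<U>)"
definition \<tau>2 :: real where "\<tau>2 = (\<integral>x. (f x)\<^sup>2 \<partial>\<U>)"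

lemma app:
  assumes "B \<ge> 1"
  shows "trig_poly (B ^ 64) (app B)" "\<bar>app B x\<bar> \<le> C" "(\<integral>x. app B x \<partial>\<U>) = 0"
    "(\<integral>x. \<bar>f x - app B x\<bar> \<partial>\<U>) \<le> C / real B ^ 32"
proof -
  have "\<exists>g. trig_poly (B ^ 64) g \<and> (\<forall>x. \<bar>g x\<bar> \<le> C) \<and> (\<integral>x. g x \<partial>\<U>) = 0 \<and>
        (\<integral>x. \<bar>f x - g x\<bar> \<partial>\<U>) \<le> C / sqrt (real (B ^ 64))"
    by (rule approx) (use assms in auto)
  from someI_ex[OF this] have *: "trig_poly (B ^ 64) (app B) \<and> (\<forall>x. \<bar>app B x\<bar> \<le> C) \<and>
     (\<integral>x. app B x \<partial>\<U>) = 0 \<and> (\<integral>x. \<bar>f x - app B x\<bar> \<partial>\<U>) \<le> C / sqrt (real (B ^ 64))"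
    unfolding app_def .
  have "sqrt (real (B ^ 64)) = sqrt ((real B ^ 32)\<^sup>2)" by (simp add: power_mult[symmetric])
  also have "\<dots> = real B ^ 32" by (rule real_sqrt_unique) auto
  finally show "trig_poly (B ^ 64) (app B)" "\<bar>app B x\<bar> \<le> C" "(\<integral>x. app B x \<partial>\<U>) = 0"
    "(\<integral>x. \<bar>f x - app B x\<bar> \<partial>\<U>) \<le> C / real B ^ 32" using * by auto
qed

lemma app_cont: "B \<ge> 1 \<Longrightarrow> continuous_on UNIV (app B)"
  using trig_poly_continuous[OF app(1)] .

lemma app_meas: "B \<ge> 1 \<Longrightarrow> app B \<in> borel_measurable lebesgue"
  using borel_measurable_continuous_onI[OF app_cont] by (intro measurable_completion) simp

lemma app_per: "B \<ge> 1 \<Longrightarrow> app B (x + 1) = app B x"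
proof -
  assume B: "B \<ge> 1"
  obtain c where c: "\<And>x. complex_of_real (app B x) = (\<Sum>j\<in>{- int (B ^ 64)..int (B ^ 64)}. c j * character j x)"
    using app(1)[OF B] by (auto simp only: trig_poly_def)
  have "complex_of_real (app B (x + 1)) = complex_of_real (app B x)"
    unfolding c character_periodic ..
  then show ?thesis by (simp only: of_real_eq_iff)
qed

lemma hi_simps:
  assumes "finite P" "P \<subseteq> {1..}"
  shows "finite (hi B P)" "card (hi B P) \<le> card P" "card P \<le> card (hi B P) + B" "hi B P \<subseteq> {1..}" "hi B P \<subseteq> {B..}"
proof -
  have inj: "inj_on \<sigma> P" by (rule inj_on_subset[OF bij_betw_imp_inj_on[OF \<sigma>] assms(2)])
  show fin: "finite (hi B P)" using assms by (auto simp: hi_def)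
  have c: "card (\<sigma> ` P) = card P" using inj by (rule card_image)
  show "card (hi B P) \<le> card P" unfolding c[symmetric] hi_def using assms by (intro card_mono) auto
  have "\<sigma> ` P \<subseteq> hi B P \<union> {..<B}" by (auto simp: hi_def)
  then have "card (\<sigma> ` P) \<le> card (hi B P \<union> {..<B})" using fin by (intro card_mono) auto
  also have "\<dots> \<le> card (hi B P) + card {..<B}" by (rule card_Un_le)
  finally show "card P \<le> card (hi B P) + B" by (simp add: c)
  show "hi B P \<subseteq> {1..}" using \<sigma> assms(2) unfolding hi_def bij_betw_def by blast
  show "hi B P \<subseteq> {B..}" by (auto simp: hi_def)
qed

lemma hi_mono: "P \<subseteq> P' \<Longrightarrow> hi B P \<subseteq> hi B P'"
  by (auto simp: hi_def)

lemma hi_disjoint: "P \<subseteq> {1..} \<Longrightarrow> P' \<subseteq> {1..} \<Longrightarrow> P \<inter> P' = {} \<Longrightarrow> hi B P \<inter> hi B P' = {}"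
  using \<sigma> unfolding hi_def bij_betw_def inj_on_def by blast

lemma G_positions:
  assumes "finite P" "P \<subseteq> {1..}"
  shows "G B P x = (\<Sum>k\<in>P. if \<sigma> k \<ge> B then app B (of_int (n (\<sigma> k)) * x) else 0)"
proof -
  let ?P = "{k\<in>P. \<sigma> k \<ge> B}"
  have "inj_on \<sigma> ?P"
    by (rule inj_on_subset[OF bij_betw_imp_inj_on[OF \<sigma>]]) (use assms(2) in auto)
  moreover have "hi B P = \<sigma> ` ?P" by (auto simp: hi_def)
  ultimately have "G B P x = (\<Sum>k\<in>?P. app B (of_int (n (\<sigma> k)) * x))"
    unfolding G_def by (simp add: sum.reindex)
  then show ?thesis using assms(1) by (simp add: sum.inter_filter)
qed

lemma matched:
  assumes "finite P" "P \<subseteq> {1..}" "B \<ge> 1" "B \<ge> i\<^sub>0" "p \<le> B" "real p \<le> R B"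
  shows "matched (hi B P) p (\<lambda>i x. app B (of_int (n i) * x)) (app B) C"
proof
  note hs = hi_simps[OF assms(1,2), of B]
  show "finite (hi B P)" by (rule hs)
  have cont: "continuous_on UNIV (\<lambda>x. app B (of_int m * x))" for m
    by (intro continuous_on_compose2[OF app_cont[OF assms(3)]] continuous_intros) auto
  show "(\<lambda>x. app B (of_int (n k) * x)) \<in> borel_measurable \<U>" for k
    by (rule measurable_unit_continuous[OF cont])
  show "app B \<in> borel_measurable \<U>" by (rule measurable_unit_continuous[OF app_cont[OF assms(3)]])
  show "C > 0" using C1 by simp
  fix q and v :: "nat \<Rightarrow> nat \<Rightarrow> real" assume q: "q \<le> p"
  show "(\<integral>x. (\<Prod>t<q. \<Sum>k\<in>hi B P. v t k * app B (of_int (n k) * x)) \<partial>\<U>)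
       = (\<integral>u. (\<Prod>t<q. \<Sum>k\<in>hi B P. v t k * app B (u k)) \<partial>iid_measure (hi B P))"
  proof (rule moment_match[OF rf hs(1,5) assms(3,4) _ _ app(1)[OF assms(3)] app(2)[OF assms(3)]])
    show "real q \<le> R i" if "i \<ge> B" for i using R_mono[of B i] that assms q by linarith
    have "q * B ^ 64 \<le> B * B ^ 64" using q assms(5) by (intro mult_right_mono) auto
    then show "q * B ^ 64 \<le> B ^ 65" by (simp add: power_Suc[symmetric])
  qed
qed (use app[OF assms(3)] in auto)

lemma XS_eq_G:
  fixes P :: "nat set"
  assumes "finite P" "P \<subseteq> {1..}" "B \<ge> 1" "B \<ge> i\<^sub>0" "real p \<le> R B" "p \<le> B"
  shows "matched.XS (\<lambda>i x. app B (of_int (n i) * x)) (hi B P') = G B P'"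
  using matched.XS_def[OF matched[OF assms(1-4,6,5)], of "hi B P'"]
  by (simp add: G_def fun_eq_iff)

text \<open>A vanishing \<open>n i\<close> would be a relation with a single term.\<close>

lemma n_pos: "i \<ge> i\<^sub>0 \<Longrightarrow> i \<ge> 1 \<Longrightarrow> R i \<ge> 1 \<Longrightarrow> n i \<ge> 1"
proof -
  assume i: "i \<ge> i\<^sub>0" "i \<ge> 1" "R i \<ge> 1"
  have "(\<Sum>j\<in>{i}. 1 * n j) \<noteq> 0"
    using rf[unfolded relation_free_def, rule_format, of i "{i}" "\<lambda>_. 1"] i by auto
  with n_nonneg[of i] i show ?thesis by simp
qed

text \<open>One majorant for the approximation errors of all partial sums of length up to
  \<open>B ^ 16\<close>, so that a single Borel-Cantelli argument covers them.\<close>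

definition err :: "nat \<Rightarrow> real \<Rightarrow> real" where
  "err B x = (\<Sum>k=1..B ^ 16. if \<sigma> k \<ge> B then \<bar>f (of_int (n (\<sigma> k)) * x) - app B (of_int (n (\<sigma> k)) * x)\<bar> else 0)"

lemma err_nonneg: "err B x \<ge> 0"
  unfolding err_def by (intro sum_nonneg) auto

definition good :: "nat \<Rightarrow> bool" where
  "good B \<longleftrightarrow> B \<ge> 1 \<and> B \<ge> i\<^sub>0 \<and> R B \<ge> 1"

lemma eventually_good: "eventually good sequentially"
proof -
  have "eventually (\<lambda>B. R B \<ge> 1) sequentially" using R_lim by (simp add: filterlim_at_top)
  then show ?thesis unfolding good_def
    by (intro eventually_conj eventually_ge_at_top)
qed

lemma err_term:
  assumes "good B" "i \<ge> B"
  shows "(\<lambda>x. \<bar>f (of_int (n i) * x) - app B (of_int (n i) * x)\<bar>) \<in> borel_measurable lebesgue"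
    and "integrable \<U> (\<lambda>x. \<bar>f (of_int (n i) * x) - app B (of_int (n i) * x)\<bar>)"
    and "(\<integral>x. \<bar>f (of_int (n i) * x) - app B (of_int (n i) * x)\<bar> \<partial>\<U>) \<le> C / real B ^ 32"
proof -
  define h where "h x = \<bar>f x - app B x\<bar>" for x
  have B: "B \<ge> 1" "B \<ge> i\<^sub>0" "R B \<ge> 1" using assms(1) by (auto simp: good_def)
  have "R B \<le> R i" using B assms(2) by (intro R_mono) auto
  then have ni: "n i \<ge> 1" using B assms(2) by (intro n_pos) auto
  have h: "h \<in> borel_measurable lebesgue" unfolding h_def using f_meas app_meas[OF B(1)] by simp
  have h_bd: "\<bar>h x\<bar> \<le> 2 * C" for x using f_bd[of x] app(2)[OF B(1), of x] unfolding h_def by linarith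
  have h_per: "h (x + 1) = h x" for x by (simp add: h_def f_per app_per[OF B(1)])
  have m: "(\<lambda>x. h (of_int (n i) * x)) \<in> borel_measurable lebesgue"
    using measurable_lebesgue_affine[OF h, of "of_int (n i)" 0] ni by simp
  then show "(\<lambda>x. \<bar>f (of_int (n i) * x) - app B (of_int (n i) * x)\<bar>) \<in> borel_measurable lebesgue"
    unfolding h_def .
  have "integrable \<U> (\<lambda>x. h (of_int (n i) * x))"
    by (rule bounded_measurable_integrable_unit[OF m h_bd])
  then show "integrable \<U> (\<lambda>x. \<bar>f (of_int (n i) * x) - app B (of_int (n i) * x)\<bar>)"
    unfolding h_def .
  have "(\<integral>x. h (of_int (n i) * x) \<partial>\<U>) = (\<integral>x. h x \<partial>\<U>)"
    by (rule integral_periodic_scale[OF h h_bd h_per ni])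
  then show "(\<integral>x. \<bar>f (of_int (n i) * x) - app B (of_int (n i) * x)\<bar> \<partial>\<U>) \<le> C / real B ^ 32"
    using app(4)[OF B(1)] unfolding h_def by simp
qed

lemma err_integral:
  assumes "good B"
  shows "integrable \<U> (err B)" "(\<integral>x. err B x \<partial>\<U>) \<le> C / real B ^ 16"
proof -
  have B: "B \<ge> 1" using assms by (auto simp: good_def)
  let ?T = "\<lambda>k x. if \<sigma> k \<ge> B then \<bar>f (of_int (n (\<sigma> k)) * x) - app B (of_int (n (\<sigma> k)) * x)\<bar> else 0"
  have int: "integrable \<U> (?T k)" for k
    using err_term(2)[OF assms, of "\<sigma> k"] by (cases "\<sigma> k \<ge> B") auto
  have le: "(\<integral>x. ?T k x \<partial>\<U>) \<le> C / real B ^ 32" for k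
    using err_term(3)[OF assms, of "\<sigma> k"] C1 by (cases "\<sigma> k \<ge> B") auto
  have eq: "err B = (\<lambda>x. \<Sum>k=1..B ^ 16. ?T k x)" by (simp add: err_def fun_eq_iff)
  show "integrable \<U> (err B)" unfolding eq by (intro Bochner_Integration.integrable_sum int)
  have "(\<integral>x. err B x \<partial>\<U>) = (\<Sum>k=1..B ^ 16. \<integral>x. ?T k x \<partial>\<U>)"
    unfolding eq by (rule Bochner_Integration.integral_sum[OF int])
  also have "\<dots> \<le> (\<Sum>k=1..B ^ 16. C / real B ^ 32)" by (intro sum_mono le)
  also have "\<dots> = real B ^ 16 * (C / real B ^ 32)" by simp
  also have "\<dots> = C / real B ^ 16"
  proof -
    have *: "real B ^ 32 = real B ^ 16 * real B ^ 16" by (simp flip: power_add)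
    have "y * (C / (y * y)) = C / y" if "y \<noteq> 0" for y :: real using that by simp
    moreover have "real B ^ 16 \<noteq> 0" using B by simp
    ultimately show ?thesis unfolding * .
  qed
  finally show "(\<integral>x. err B x \<partial>\<U>) \<le> C / real B ^ 16" .
qed

text \<open>As \<open>\<sigma>\<close> is injective, at most \<open>B\<close> positions carry an
  index below \<open>B\<close>, and each costs at most \<open>C\<close>. The other positions are
  covered by \<open>err B\<close>.\<close>

lemma S_G_diff:
  assumes "good B" "N \<le> B ^ 16"
  shows "\<bar>S N x - G B {1..N} x\<bar> \<le> C * B + err B x"
proof -
  let ?T = "\<lambda>k. if \<sigma> k \<ge> B then \<bar>f (of_int (n (\<sigma> k)) * x) - app B (of_int (n (\<sigma> k)) * x)\<bar> else 0"
  have "S N x - G B {1..N} x = (\<Sum>k=1..N. f (of_int (n (\<sigma> k)) * x)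
      - (if \<sigma> k \<ge> B then app B (of_int (n (\<sigma> k)) * x) else 0))"
    by (simp add: S_def G_positions sum_subtractf)
  then have "\<bar>S N x - G B {1..N} x\<bar> \<le> (\<Sum>k=1..N. \<bar>f (of_int (n (\<sigma> k)) * x)
      - (if \<sigma> k \<ge> B then app B (of_int (n (\<sigma> k)) * x) else 0)\<bar>)"
    by (simp only: sum_abs)
  also have "\<dots> \<le> (\<Sum>k=1..N. (if \<sigma> k < B then C else 0) + ?T k)"
    by (intro sum_mono) (auto simp: f_bd)
  also have "\<dots> = (\<Sum>k=1..N. if \<sigma> k < B then C else 0) + (\<Sum>k=1..N. ?T k)"
    by (rule sum.distrib)
  finally have 1: "\<bar>S N x - G B {1..N} x\<bar> \<le> (\<Sum>k=1..N. if \<sigma> k < B then C else 0) + (\<Sum>k=1..N. ?T k)" .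
  have "(\<Sum>k=1..N. if \<sigma> k < B then C else 0) = C * card {k\<in>{1..N}. \<sigma> k < B}"
    by (simp add: sum.inter_filter[symmetric])
  also have "\<dots> \<le> C * B"
  proof (intro mult_left_mono of_nat_mono)
    have inj: "inj_on \<sigma> {k\<in>{1..N}. \<sigma> k < B}"
      using \<sigma> unfolding bij_betw_def inj_on_def by auto
    have "card {k\<in>{1..N}. \<sigma> k < B} = card (\<sigma> ` {k\<in>{1..N}. \<sigma> k < B})" using card_image[OF inj] by simp
    also have "\<dots> \<le> card {..<B}" by (intro card_mono) auto
    finally show "card {k\<in>{1..N}. \<sigma> k < B} \<le> B" by simp
  qed (use C1 in auto)
  finally have 2: "(\<Sum>k=1..N. if \<sigma> k < B then C else 0) \<le> C * B" .
  have 3: "(\<Sum>k=1..N. ?T k) \<le> err B x"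
    unfolding err_def using assms(2) by (intro sum_mono2) auto
  from 1 2 3 show ?thesis by linarith
qed

text \<open>By Markov's inequality \<open>err B \<ge> 1\<close> has probability at most
  \<open>C / B ^ 16\<close>, which is summable over all \<open>B\<close>.\<close>

lemma AE_S_G: "AE x in \<U>. eventually (\<lambda>B. \<forall>N\<le>B ^ 16. \<bar>S N x - G B {1..N} x\<bar> \<le> C * B + 1) sequentially"
proof -
  interpret prob_space \<U> by (rule prob_space_unit)
  obtain B0 where B0: "\<And>B. B \<ge> B0 \<Longrightarrow> good B" using eventually_good unfolding eventually_sequentially by auto
  have meas: "Measurable.pred \<U> (\<lambda>x. 1 \<le> err (B + B0) x)" for B
    using borel_measurable_integrable[OF err_integral(1)[OF B0[of "B + B0"]]] by measurable
  have "AE x in \<U>. eventually (\<lambda>B. x \<in> space \<U> - {x \<in> space \<U>. 1 \<le> err (B + B0) x}) sequentially"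
  proof (rule borel_cantelli_AE1)
    show "{x \<in> space \<U>. 1 \<le> err (B + B0) x} \<in> sets \<U>" for B using meas[of B] by measurable
    show "emeasure \<U> {x \<in> space \<U>. 1 \<le> err (B + B0) x} < \<infinity>" for B by (simp add: less_top[symmetric])
    have "summable (\<lambda>B. C * (1 / real (B + B0) ^ 16))"
      using inverse_power_summable[of 16, where 'a=real]
      by (intro summable_mult) (subst summable_iff_shift, simp add: divide_inverse)
    then show "summable (\<lambda>B. measure \<U> {x \<in> space \<U>. 1 \<le> err (B + B0) x})"
    proof (rule summable_comparison_test')
      fix B
      have "measure \<U> {x \<in> space \<U>. 1 \<le> err (B + B0) x} \<le> (\<integral>x. err (B + B0) x \<partial>\<U>)"
        by (rule prob_le_integral[OF prob_space_unit meas err_integral(1)[OF B0]]) (auto simp: err_nonneg)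
      also have "\<dots> \<le> C / real (B + B0) ^ 16" by (rule err_integral(2)[OF B0]) simp
      finally show "norm (measure \<U> {x \<in> space \<U>. 1 \<le> err (B + B0) x}) \<le> C * (1 / real (B + B0) ^ 16)"
        by simp
    qed
  qed
  then show ?thesis
  proof (rule AE_mp, intro AE_I2 impI)
    fix x assume "x \<in> space \<U>"
      and "eventually (\<lambda>B. x \<in> space \<U> - {x \<in> space \<U>. 1 \<le> err (B + B0) x}) sequentially"
    then obtain B1 where B1: "\<And>B. B \<ge> B1 \<Longrightarrow> err (B + B0) x < 1"
      unfolding eventually_sequentially by (auto simp: not_le)
    show "eventually (\<lambda>B. \<forall>N\<le>B ^ 16. \<bar>S N x - G B {1..N} x\<bar> \<le> C * B + 1) sequentially"
      unfolding eventually_sequentially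
    proof (intro exI allI impI)
      fix B N assume B: "B \<ge> B0 + B1" and N: "N \<le> B ^ 16"
      have "err B x < 1" using B1[of "B - B0"] B by simp
      then show "\<bar>S N x - G B {1..N} x\<bar> \<le> C * B + 1"
        using S_G_diff[OF B0[of B] N, of x] B by linarith
    qed
  qed
qed

lemma f_int: "integrable \<U> f"
  by (rule bounded_measurable_integrable_unit[OF f_meas f_bd])

lemma s2_bounds: "B \<ge> 1 \<Longrightarrow> \<bar>s2 B - \<tau>2\<bar> \<le> 2 * C\<^sup>2 / real B ^ 32"
proof -
  assume B: "B \<ge> 1"
  have sq: "integrable \<U> (\<lambda>x. (h x)\<^sup>2)" if "h \<in> borel_measurable lebesgue" "\<And>x. \<bar>h x\<bar> \<le> C" for h
  proof (rule bounded_measurable_integrable_unit)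
    show "(\<lambda>x. (h x)\<^sup>2) \<in> borel_measurable lebesgue" using that(1) by measurable
    show "\<bar>(h x)\<^sup>2\<bar> \<le> C\<^sup>2" for x using power_mono[OF that(2)[of x], of 2] by simp
  qed
  note i = sq[OF app_meas[OF B] app(2)[OF B]] sq[OF f_meas f_bd]
  have ia: "integrable \<U> (app B)"
    by (rule bounded_measurable_integrable_unit[OF app_meas[OF B] app(2)[OF B]])
  have "\<bar>s2 B - \<tau>2\<bar> = \<bar>\<integral>x. (app B x)\<^sup>2 - (f x)\<^sup>2 \<partial>\<U>\<bar>"
    unfolding s2_def \<tau>2_def by (simp only: Bochner_Integration.integral_diff[OF i])
  also have "\<dots> \<le> (\<integral>x. \<bar>(app B x)\<^sup>2 - (f x)\<^sup>2\<bar> \<partial>\<U>)" by (rule integral_abs_bound)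
  also have "\<dots> \<le> (\<integral>x. 2 * C * \<bar>f x - app B x\<bar> \<partial>\<U>)"
  proof (intro integral_mono integrable_abs integrable_mult_right Bochner_Integration.integrable_diff i f_int ia)
    fix x
    have "(app B x)\<^sup>2 - (f x)\<^sup>2 = (app B x + f x) * (app B x - f x)"
      by (simp add: power2_eq_square algebra_simps)
    then have "\<bar>(app B x)\<^sup>2 - (f x)\<^sup>2\<bar> = \<bar>app B x + f x\<bar> * \<bar>f x - app B x\<bar>"
      by (simp add: abs_mult abs_minus_commute)
    also have "\<dots> \<le> 2 * C * \<bar>f x - app B x\<bar>"
      using app(2)[OF B, of x] f_bd[of x] by (intro mult_right_mono) auto
    finally show "\<bar>(app B x)\<^sup>2 - (f x)\<^sup>2\<bar> \<le> 2 * C * \<bar>f x - app B x\<bar>" .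
  qed
  also have "\<dots> = 2 * C * (\<integral>x. \<bar>f x - app B x\<bar> \<partial>\<U>)" by (rule integral_mult_right_zero)
  also have "\<dots> \<le> 2 * C * (C / real B ^ 32)"
    using C1 by (intro mult_left_mono app(4)[OF B]) auto
  finally show ?thesis by (simp add: power2_eq_square)
qed

lemma s2_tendsto: "s2 \<longlonglongrightarrow> \<tau>2"
proof -
  have "(\<lambda>B. s2 B - \<tau>2) \<longlonglongrightarrow> 0"
  proof (rule Lim_null_comparison)
    show "eventually (\<lambda>B. norm (s2 B - \<tau>2) \<le> 2 * C\<^sup>2 / real B ^ 32) sequentially"
      using eventually_ge_at_top[of 1] by eventually_elim (simp add: s2_bounds)
    show "(\<lambda>B. 2 * C\<^sup>2 / real B ^ 32) \<longlonglongrightarrow> 0" by real_asymp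
  qed
  then show ?thesis by (simp add: LIM_zero_iff)
qed

lemma S_meas: "S N \<in> borel_measurable \<U>"
proof -
  have "(\<lambda>x. f (of_int m * x)) \<in> borel_measurable lebesgue" for m
    using measurable_lebesgue_affine[OF f_meas, of "of_int m" 0] by (cases "m = 0") auto
  then have "(\<lambda>x. f (of_int m * x)) \<in> borel_measurable \<U>" for m
    by (rule measurable_restrict_space1)
  then show ?thesis unfolding S_def[abs_def] by (intro borel_measurable_sum) auto
qed

lemma G_meas:
  assumes "B \<ge> 1" shows "G B P \<in> borel_measurable \<U>"
proof -
  have cont: "continuous_on UNIV (\<lambda>x. app B (of_int m * x))" for m
    by (intro continuous_on_compose2[OF app_cont[OF assms]] continuous_intros) auto
  show ?thesis unfolding G_def[abs_def]
    by (rule borel_measurable_sum) (rule measurable_unit_continuous[OF cont])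
qed

end

section \<open>The central limit theorem\<close>

lemma iexp_lipschitz: "norm (iexp a - iexp b) \<le> \<bar>a - b\<bar>"
proof -
  have "iexp a - iexp b = iexp b * (iexp (a - b) - 1)"
    by (simp add: right_diff_distrib exp_add[symmetric])
  then have "norm (iexp a - iexp b) = norm (iexp (a - b) - 1)" by (simp add: norm_mult)
  also have "\<dots> \<le> \<bar>a - b\<bar>" using iexp_approx1[of "a - b" 0] by simp
  finally show ?thesis .
qed

context matched
begin

text \<open>First \<open>iexp\<close> is expanded to second order, then \<open>1 - z\<close> is
  compared with \<open>exp (- z)\<close>. For \<open>t\<close> of order \<open>1 / sqrt N\<close>
  both errors remain small even after multiplication by \<open>N\<close>, the number of
  factors.\<close>

lemma charf_gauss:
  defines "v \<equiv> (\<integral>x. (g x)\<^sup>2 \<partial>\<U>)"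
  shows "norm (charf t - exp (- t\<^sup>2 * v / 2)) \<le> (\<bar>t\<bar> * C) ^ 3 + (\<bar>t\<bar> * C) ^ 4"
    and "norm (charf t) \<le> 1"
proof -
  interpret prob_space \<U> by (rule prob_space_unit)
  have m[measurable]: "g \<in> borel_measurable \<U>" by (rule g_meas)
  have i1: "integrable \<U> (\<lambda>x. iexp (t * g x))"
    by (rule integrable_bounded_prob[OF prob_space_unit, where C=1]) auto
  have ig: "integrable \<U> g"
    by (rule integrable_bounded_prob[OF prob_space_unit g_meas, where C=C]) (simp add: g_bd)
  have g2: "(g x)\<^sup>2 \<le> C\<^sup>2" for x using power_mono[OF g_bd[of x], of 2] by simp
  have ig2: "integrable \<U> (\<lambda>x. (g x)\<^sup>2)"
    by (rule integrable_bounded_prob[OF prob_space_unit, where C="C\<^sup>2"]) (auto simp: g2)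
  show "norm (charf t) \<le> 1"
    unfolding charf_def by (rule integral_bounded_prob[OF prob_space_unit]) auto
  define T where "T x = 1 + (\<i> * t) * complex_of_real (g x) - complex_of_real (t\<^sup>2 / 2) * complex_of_real ((g x)\<^sup>2)" for x
  have c1: "integrable \<U> (\<lambda>x. 1 :: complex)" by simp
  have c2: "integrable \<U> (\<lambda>x. (\<i> * t) * complex_of_real (g x))"
    by (intro integrable_mult_right integrable_of_real ig)
  have c3: "integrable \<U> (\<lambda>x. complex_of_real (t\<^sup>2 / 2) * complex_of_real ((g x)\<^sup>2))"
    by (intro integrable_mult_right integrable_of_real ig2)
  note c12 = Bochner_Integration.integrable_add[OF c1 c2]
  have iT: "integrable \<U> T"
    unfolding T_def by (rule Bochner_Integration.integrable_diff[OF c12 c3])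
  have ET: "(\<integral>x. T x \<partial>\<U>) = complex_of_real (1 - t\<^sup>2 * v / 2)"
  proof -
    have "(\<integral>x. T x \<partial>\<U>) = (\<integral>x. (1 :: complex) \<partial>\<U>) + (\<i> * t) * complex_of_real (\<integral>x. g x \<partial>\<U>)
        - complex_of_real (t\<^sup>2 / 2) * complex_of_real (\<integral>x. (g x)\<^sup>2 \<partial>\<U>)"
      unfolding T_def Bochner_Integration.integral_diff[OF c12 c3] Bochner_Integration.integral_add[OF c1 c2]
      by (simp only: integral_mult_right_zero integral_complex_of_real)
    also have "(\<integral>x. (1 :: complex) \<partial>\<U>) = 1" using prob_space by simp
    finally show ?thesis by (simp add: g_mean v_def)
  qed
  have pt: "norm (iexp (t * g x) - T x) \<le> (\<bar>t\<bar> * C) ^ 3" for x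
  proof -
    have "(\<Sum>k\<le>2. (\<i> * z) ^ k / fact k) = 1 + \<i> * z - z\<^sup>2 / 2" for z :: complex
    proof -
      have "(\<i> * z)\<^sup>2 = - z\<^sup>2" by (simp add: power_mult_distrib)
      moreover have "(\<Sum>k\<le>2. (\<i> * z) ^ k / fact k) = 1 + \<i> * z + (\<i> * z)\<^sup>2 / 2"
        by (simp add: eval_nat_numeral)
      ultimately show ?thesis by simp
    qed
    moreover have "T x = 1 + \<i> * complex_of_real (t * g x) - (complex_of_real (t * g x))\<^sup>2 / 2"
      unfolding T_def by (simp add: power_mult_distrib mult.assoc)
    ultimately have "(\<Sum>k\<le>2. (\<i> * complex_of_real (t * g x)) ^ k / fact k) = T x"
      by (simp only:)
    moreover have "Suc 2 = 3" by simp
    ultimately have "norm (iexp (t * g x) - T x) \<le> \<bar>t * g x\<bar> ^ 3 / fact 3"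
      using iexp_approx1[of "t * g x" 2] by (simp only:)
    also have "\<dots> \<le> \<bar>t * g x\<bar> ^ 3 / 1" by (intro divide_left_mono) (auto simp: fact_numeral)
    also have "\<dots> \<le> (\<bar>t\<bar> * C) ^ 3 / 1"
      unfolding abs_mult using g_bd[of x] by (intro divide_right_mono power_mono mult_left_mono) auto
    finally show ?thesis by simp
  qed
  have "norm (charf t - complex_of_real (1 - t\<^sup>2 * v / 2)) = norm (\<integral>x. iexp (t * g x) - T x \<partial>\<U>)"
    unfolding charf_def ET[symmetric] by (simp only: Bochner_Integration.integral_diff[OF i1 iT])
  also have "\<dots> \<le> (\<bar>t\<bar> * C) ^ 3"
    by (rule integral_bounded_prob[OF prob_space_unit _ pt])
       (intro borel_measurable_integrable Bochner_Integration.integrable_diff i1 iT)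
  finally have 1: "norm (charf t - complex_of_real (1 - t\<^sup>2 * v / 2)) \<le> (\<bar>t\<bar> * C) ^ 3" .
  define z where "z = t\<^sup>2 * v / 2"
  have v: "0 \<le> v" "v \<le> C\<^sup>2"
  proof -
    show "0 \<le> v" unfolding v_def by (intro Bochner_Integration.integral_nonneg) auto
    have "\<bar>v\<bar> \<le> C\<^sup>2" unfolding v_def
      using integral_bounded_prob[OF prob_space_unit borel_measurable_integrable[OF ig2], of "C\<^sup>2"] g2 by simp
    then show "v \<le> C\<^sup>2" by linarith
  qed
  have z: "0 \<le> z" "z \<le> (\<bar>t\<bar> * C)\<^sup>2"
  proof -
    show "0 \<le> z" using v by (simp add: z_def)
    have "t\<^sup>2 * v \<le> t\<^sup>2 * C\<^sup>2" using v by (intro mult_left_mono) auto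
    moreover have "0 \<le> t\<^sup>2 * C\<^sup>2" by simp
    ultimately show "z \<le> (\<bar>t\<bar> * C)\<^sup>2" unfolding z_def power_mult_distrib power2_abs by linarith
  qed
  obtain y where y: "\<bar>y\<bar> \<le> \<bar>- z\<bar>" "exp (- z) = (\<Sum>m<2. (- z) ^ m / fact m) + (exp y / fact 2) * (- z) ^ 2"
    using Maclaurin_exp_le by blast
  have 2: "\<bar>(1 - z) - exp (- z)\<bar> \<le> z\<^sup>2"
  proof -
    \<comment> \<open>After multiplication by \<open>1 + z\<close> the upper bound for
      \<open>exp (- z)\<close> reduces to \<open>1 \<le> 1 + z ^ 3\<close>.\<close>
    have "exp (- z) * (1 + z) \<le> exp (- z) * exp z" by (intro mult_left_mono exp_ge_add_one_self) auto
    then have a: "exp (- z) * (1 + z) \<le> 1" by (simp add: exp_add[symmetric])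
    have "(1 - z + z\<^sup>2) * (1 + z) = 1 + z ^ 3" by algebra
    moreover have "0 \<le> z ^ 3" using z by simp
    ultimately have "exp (- z) * (1 + z) \<le> (1 - z + z\<^sup>2) * (1 + z)" using a by linarith
    then have "exp (- z) \<le> 1 - z + z\<^sup>2" by (rule mult_right_le_imp_le) (use z in simp)
    moreover have "1 - z \<le> exp (- z)" using exp_ge_add_one_self[of "- z"] by simp
    ultimately show ?thesis by (simp add: abs_le_iff)
  qed
  have "norm (complex_of_real (1 - z) - complex_of_real (exp (- z))) = \<bar>(1 - z) - exp (- z)\<bar>"
    by (simp only: of_real_diff[symmetric] norm_of_real)
  also have "\<dots> \<le> ((\<bar>t\<bar> * C)\<^sup>2)\<^sup>2" using 2 power_mono[OF z(2,1), of 2] by linarith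
  also have "\<dots> = (\<bar>t\<bar> * C) ^ 4" by (simp add: power_mult[symmetric])
  finally have 3: "norm (complex_of_real (1 - z) - complex_of_real (exp (- z))) \<le> (\<bar>t\<bar> * C) ^ 4" .
  have "norm (charf t - complex_of_real (exp (- z))) \<le> (\<bar>t\<bar> * C) ^ 3 + (\<bar>t\<bar> * C) ^ 4"
    using norm_triangle_mono[OF 1[folded z_def] 3] by simp
  then show "norm (charf t - exp (- t\<^sup>2 * v / 2)) \<le> (\<bar>t\<bar> * C) ^ 3 + (\<bar>t\<bar> * C) ^ 4"
    by (simp add: z_def exp_of_real)
qed

end

context permuted_sequence
begin

text \<open>Three replacements, one for each group of error terms: \<open>S N\<close> by
  \<open>G\<close>, where the dropped terms are small because \<open>B \<le> sqrt N / B\<close>; the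
  characteristic function of \<open>G\<close> by the independent one, through \<open>q\<close>
  matched moments; and this one by a Gaussian. The limit \<open>B ^ 16\<close> on \<open>N\<close>
  is the range covered by \<open>err B\<close>.\<close>

lemma char_bound:
  assumes B: "good B" "B \<ge> 1" and N: "B ^ 4 \<le> N" "N \<le> B ^ 16" and q: "even q" "q \<le> B" "real q \<le> R B"
  defines "m \<equiv> card (hi B {1..N})"
  shows "norm ((\<integral>x. iexp (t * (real N powr (- 1 / 2) * S N x)) \<partial>\<U>)
      - complex_of_real (exp (- t\<^sup>2 * s2 B * (m / N) / 2)))
    \<le> 2 * \<bar>t\<bar> * C / B + 8 / 2 ^ q * exp (2 * t\<^sup>2 * C\<^sup>2) + ((\<bar>t\<bar> * C) ^ 3 / real B ^ 2 + (\<bar>t\<bar> * C) ^ 4 / real B ^ 4)"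
proof -
  have B0: "B \<ge> i\<^sub>0" using B by (auto simp: good_def)
  interpret m: matched "hi B {1..N}" q "\<lambda>i x. app B (of_int (n i) * x)" "app B" C
    by (rule matched) (use B B0 q in auto)
  have XS: "m.XS (hi B {1..N}) = G B {1..N}"
    using XS_eq_G[of "{1..N}" B q "{1..N}"] B B0 q by simp
  have Np: "N \<ge> 1" using N(1) B(2) one_le_power[of B 4] by linarith
  define w where "w = t / sqrt N"
  have wN: "w\<^sup>2 * N = t\<^sup>2" using Np by (simp add: w_def power_divide)
  have arg: "t * (real N powr (- 1 / 2) * y) = w * y" for y
  proof -
    have "real N powr (- 1 / 2) = inverse (sqrt N)"
      using powr_half_sqrt[of "real N"] powr_minus[of "real N" "1 / 2"]
      by (simp only: minus_divide_left of_nat_0_le_iff)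
    then show ?thesis unfolding w_def divide_inverse by (simp only: mult_ac)
  qed
  have B2: "real B ^ 2 \<le> sqrt N"
  proof (rule real_le_rsqrt)
    have "real (B ^ 4) \<le> real N" using N(1) by (rule of_nat_mono)
    moreover have "(real B ^ 2)\<^sup>2 = real (B ^ 4)" by (simp only: of_nat_power power_mult[symmetric]) simp
    ultimately show "(real B ^ 2)\<^sup>2 \<le> real N" by (simp only:)
  qed
  have B2p: "real B ^ 2 > 0" using B(2) by simp
  have w_le: "\<bar>w\<bar> \<le> \<bar>t\<bar> / real B ^ 2"
  proof -
    have "\<bar>t\<bar> / sqrt N \<le> \<bar>t\<bar> / real B ^ 2" using B2 B2p Np by (intro divide_left_mono mult_pos_pos) auto
    then show ?thesis by (simp add: w_def abs_divide)
  qed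
  have m_le: "real m \<le> N" using hi_simps(2)[of "{1..N}" B] by (simp add: m_def)
  have iexp_int: "integrable \<U> (\<lambda>x. iexp (w * h x))" if "h \<in> borel_measurable \<U>" for h
  proof (rule integrable_bounded_prob[OF prob_space_unit])
    have "continuous_on UNIV (\<lambda>y. iexp (w * y))" by (intro continuous_intros)
    from measurable_compose[OF that borel_measurable_continuous_onI[OF this]]
    show "(\<lambda>x. iexp (w * h x)) \<in> borel_measurable \<U>" .
    show "norm (iexp (w * h x)) \<le> 1" for x by (simp only: norm_exp_i_times)
  qed
  note iS = iexp_int[OF S_meas[of N]] and iG = iexp_int[OF G_meas[OF B(2), of "{1..N}"]]
  interpret U: prob_space \<U> by (rule prob_space_unit)
  have 1: "norm ((\<integral>x. iexp (w * S N x) \<partial>\<U>) - (\<integral>x. iexp (w * G B {1..N} x) \<partial>\<U>)) \<le> 2 * \<bar>t\<bar> * C / B"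
  proof -
    have "norm ((\<integral>x. iexp (w * S N x) \<partial>\<U>) - (\<integral>x. iexp (w * G B {1..N} x) \<partial>\<U>))
        \<le> (\<integral>x. norm (iexp (w * S N x) - iexp (w * G B {1..N} x)) \<partial>\<U>)"
      unfolding Bochner_Integration.integral_diff[OF iS iG, symmetric] by (rule integral_norm_bound)
    also have "\<dots> \<le> (\<integral>x. \<bar>w\<bar> * (C * B + err B x) \<partial>\<U>)"
    proof (intro integral_mono integrable_norm Bochner_Integration.integrable_diff iS iG
        integrable_mult_right Bochner_Integration.integrable_add err_integral(1)[OF B(1)])
      fix x
      have "norm (iexp (w * S N x) - iexp (w * G B {1..N} x)) \<le> \<bar>w * S N x - w * G B {1..N} x\<bar>"
        by (rule iexp_lipschitz)
      also have "\<dots> = \<bar>w\<bar> * \<bar>S N x - G B {1..N} x\<bar>" by (simp add: abs_mult[symmetric] right_diff_distrib)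
      also have "\<dots> \<le> \<bar>w\<bar> * (C * B + err B x)" by (intro mult_left_mono S_G_diff B(1) N(2)) auto
      finally show "norm (iexp (w * S N x) - iexp (w * G B {1..N} x)) \<le> \<bar>w\<bar> * (C * B + err B x)" .
    qed auto
    also have "\<dots> = \<bar>w\<bar> * (C * B + (\<integral>x. err B x \<partial>\<U>))"
      using err_integral(1)[OF B(1)] U.prob_space by (simp add: Bochner_Integration.integral_add)
    also have "\<dots> \<le> (\<bar>t\<bar> / real B ^ 2) * (C * B + C * B)"
    proof (intro mult_mono w_le add_left_mono)
      have "C / real B ^ 16 \<le> C / 1" using B(2) C1 by (intro divide_left_mono) auto
      also have "\<dots> \<le> C * B" using B(2) C1 by simp
      finally show "(\<integral>x. err B x \<partial>\<U>) \<le> C * B" using err_integral(2)[OF B(1)] by linarith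
      show "0 \<le> C * B + (\<integral>x. err B x \<partial>\<U>)"
        using C1 by (intro add_nonneg_nonneg Bochner_Integration.integral_nonneg err_nonneg) auto
    qed auto
    also have "\<dots> = 2 * \<bar>t\<bar> * C / B" using B(2) by (simp add: power2_eq_square)
    finally show ?thesis .
  qed
  have 2: "norm ((\<integral>x. iexp (w * G B {1..N} x) \<partial>\<U>) - m.charf w ^ m) \<le> 8 / 2 ^ q * exp (2 * t\<^sup>2 * C\<^sup>2)"
  proof -
    have "norm ((\<integral>x. iexp (w * G B {1..N} x) \<partial>\<U>) - m.charf w ^ m) \<le> 8 / 2 ^ q * exp (2 * w\<^sup>2 * C\<^sup>2 * m)"
      using m.integral_iexp_XS[OF order_refl q(1) order_refl, of w] unfolding XS m_def .
    also have "\<dots> \<le> 8 / 2 ^ q * exp (2 * t\<^sup>2 * C\<^sup>2)"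
    proof -
      have "(2 * w\<^sup>2 * C\<^sup>2) * m \<le> (2 * w\<^sup>2 * C\<^sup>2) * N" by (intro mult_left_mono m_le) auto
      also have "\<dots> = 2 * (w\<^sup>2 * N) * C\<^sup>2" by simp
      finally show ?thesis unfolding wN by (intro mult_left_mono) auto
    qed
    finally show ?thesis .
  qed
  define e where "e = complex_of_real (exp (- w\<^sup>2 * s2 B / 2))"
  have s2: "s2 B \<ge> 0" unfolding s2_def by (intro Bochner_Integration.integral_nonneg) auto
  have e1: "norm e \<le> 1" using s2 by (simp add: e_def)
  have ce: "norm (m.charf w - e) \<le> (\<bar>w\<bar> * C) ^ 3 + (\<bar>w\<bar> * C) ^ 4"
    using m.charf_gauss(1)[of w] by (simp add: e_def s2_def exp_of_real[symmetric])
  have 3: "norm (m.charf w ^ m - e ^ m) \<le> (\<bar>t\<bar> * C) ^ 3 / real B ^ 2 + (\<bar>t\<bar> * C) ^ 4 / real B ^ 4"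
  proof -
    have "norm (m.charf w ^ m - e ^ m) \<le> m * norm (m.charf w - e)"
      by (rule norm_power_diff[OF m.charf_gauss(2) e1])
    also have "\<dots> \<le> N * ((\<bar>w\<bar> * C) ^ 3 + (\<bar>w\<bar> * C) ^ 4)"
      by (intro mult_mono m_le ce) auto
    also have "\<dots> = (w\<^sup>2 * N) * (\<bar>w\<bar> * C ^ 3 + \<bar>w\<bar> ^ 2 * C ^ 4)"
    proof -
      have "real N * ((u * C) ^ 3 + (u * C) ^ 4) = (u\<^sup>2 * N) * (u * C ^ 3 + u ^ 2 * C ^ 4)" for u
        by algebra
      from this[of "\<bar>w\<bar>"] show ?thesis by (simp only: power2_abs)
    qed
    also have "\<dots> \<le> t\<^sup>2 * ((\<bar>t\<bar> / real B ^ 2) * C ^ 3 + (\<bar>t\<bar> / real B ^ 2) ^ 2 * C ^ 4)"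
      unfolding wN using C1 by (intro mult_left_mono add_mono mult_right_mono power_mono w_le) auto
    also have "\<dots> = (\<bar>t\<bar> * C) ^ 3 / real B ^ 2 + (\<bar>t\<bar> * C) ^ 4 / real B ^ 4"
    proof -
      have *: "d\<^sup>2 * ((d / y) * C ^ 3 + (d / y) ^ 2 * C ^ 4) = (d * C) ^ 3 / y + (d * C) ^ 4 / y ^ 2" for d y
        by (simp add: power_mult_distrib power_divide distrib_left eval_nat_numeral mult_ac)
      have "(real B ^ 2) ^ 2 = real B ^ 4" by (simp add: power_mult[symmetric])
      with *[of "\<bar>t\<bar>" "real B ^ 2"] show ?thesis by (simp only: power2_abs)
    qed
    finally show ?thesis .
  qed
  have e: "e ^ m = complex_of_real (exp (- t\<^sup>2 * s2 B * (m / N) / 2))"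
  proof -
    have "e ^ m = complex_of_real (exp (- w\<^sup>2 * s2 B / 2) ^ m)" by (simp add: e_def)
    also have "exp (- w\<^sup>2 * s2 B / 2) ^ m = exp (m * (- w\<^sup>2 * s2 B / 2))" by (rule exp_of_nat_mult[symmetric])
    also have "m * (- w\<^sup>2 * s2 B / 2) = - (w\<^sup>2 * N) * s2 B * (m / N) / 2" using Np by simp
    finally show ?thesis unfolding wN .
  qed
  show ?thesis unfolding arg e[symmetric]
    using norm_triangle_mono[OF norm_triangle_mono[OF 1 2] 3] by simp
qed

lemma char_limit:
  "(\<lambda>N. \<integral>x. iexp (t * (real N powr (- 1 / 2) * S N x)) \<partial>\<U>) \<longlonglongrightarrow> complex_of_real (exp (- t\<^sup>2 * \<tau>2 / 2))"
proof -
  \<comment> \<open>\<open>b N\<close> is the fourth root of \<open>N\<close> rounded down, and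
    \<open>q B\<close> the largest even order allowed by both \<open>B\<close> and
    \<open>R B\<close>; it tends to infinity however slowly \<open>R\<close> grows.\<close>
  define b where "b N = nat \<lfloor>real N powr (1 / 4)\<rfloor>" for N :: nat
  define q where "q B = 2 * nat \<lfloor>min (real B) (R B) / 2\<rfloor>" for B
  define m where "m N = card (hi (b N) {1..N})" for N
  have y4: "(real N powr (1 / 4)) ^ 4 = real N" for N :: nat
    using powr_powr[of "real N" "1 / 4" 4] by (cases "N = 0") (auto simp: powr_numeral)
  have b_lim: "filterlim b at_top sequentially"
    unfolding filterlim_at_top
  proof
    fix Z :: nat
    show "eventually (\<lambda>N. Z \<le> b N) sequentially"
      using eventually_ge_at_top[of "Z ^ 4"]
    proof eventually_elim
      case (elim N)
      then have "real (Z ^ 4) \<le> real N" by (rule of_nat_mono)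
      then have "real Z ^ Suc 3 \<le> (real N powr (1 / 4)) ^ Suc 3" using y4[of N] by (simp add: eval_nat_numeral)
      then have "real Z \<le> real N powr (1 / 4)" by (rule power_le_imp_le_base) simp
      then show ?case unfolding b_def by (rule le_nat_floor)
    qed
  qed
  have q_lim: "filterlim q at_top sequentially"
    unfolding filterlim_at_top
  proof
    fix Z :: nat
    have "eventually (\<lambda>B. 2 * real Z \<le> R B) sequentially" using R_lim by (simp add: filterlim_at_top)
    then show "eventually (\<lambda>B. Z \<le> q B) sequentially"
      using eventually_ge_at_top[of "2 * Z"]
    proof eventually_elim
      case (elim B)
      then have "real Z \<le> min (real B) (R B) / 2" by simp
      then show ?case unfolding q_def using le_nat_floor[of Z "min (real B) (R B) / 2"] by linarith
    qed
  qed
  have b_prop: "eventually (\<lambda>N. good (b N) \<and> b N \<ge> 2 \<and> b N ^ 4 \<le> N \<and> N \<le> b N ^ 16) sequentially"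
  proof -
    have "eventually (\<lambda>B. good B \<and> B \<ge> 2) sequentially"
      using eventually_good eventually_ge_at_top[of 2] by eventually_elim auto
    then have "eventually (\<lambda>N. good (b N) \<and> b N \<ge> 2) sequentially"
      using b_lim by (auto simp: filterlim_iff)
    then show ?thesis
    proof eventually_elim
      case (elim N)
      let ?y = "real N powr (1 / 4)"
      have y: "real (b N) \<le> ?y" "?y < real (b N) + 1" by (auto simp: b_def)
      have "real (b N) ^ 4 \<le> ?y ^ 4" using y by (intro power_mono) auto
      then have "real (b N ^ 4) \<le> real N" by (simp add: y4)
      then have 1: "b N ^ 4 \<le> N" by (simp only: of_nat_le_iff)
      have "?y ^ 4 \<le> (real (b N) + 1) ^ 4" using y by (intro power_mono) auto
      then have "real N \<le> real ((b N + 1) ^ 4)" by (simp add: y4 add.commute)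
      then have "N \<le> (b N + 1) ^ 4" by (simp only: of_nat_le_iff)
      also have "(b N + 1) ^ 4 \<le> (b N ^ 2) ^ 4"
      proof (rule power_mono)
        have "b N + 1 \<le> 2 * b N" using elim by simp
        also have "\<dots> \<le> b N * b N" using elim by (intro mult_right_mono) auto
        finally show "b N + 1 \<le> b N ^ 2" by (simp add: power2_eq_square)
      qed simp
      also have "\<dots> = b N ^ 8" by (simp add: power_mult[symmetric])
      also have "\<dots> \<le> b N ^ 16" using elim by (intro power_increasing) auto
      finally show ?case using elim 1 by simp
    qed
  qed
  define E where "E B = 2 * \<bar>t\<bar> * C / B + 8 / 2 ^ q B * exp (2 * t\<^sup>2 * C\<^sup>2)
      + ((\<bar>t\<bar> * C) ^ 3 / real B ^ 2 + (\<bar>t\<bar> * C) ^ 4 / real B ^ 4)" for B :: nat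
  have "E \<longlonglongrightarrow> 0 + 0 * exp (2 * t\<^sup>2 * C\<^sup>2) + (0 + 0)"
    unfolding E_def
  proof (intro tendsto_add tendsto_mult_right)
    show "(\<lambda>B. 2 * \<bar>t\<bar> * C / real B) \<longlonglongrightarrow> 0" "(\<lambda>B. (\<bar>t\<bar> * C) ^ 3 / real B ^ 2) \<longlonglongrightarrow> 0"
      "(\<lambda>B. (\<bar>t\<bar> * C) ^ 4 / real B ^ 4) \<longlonglongrightarrow> 0"
      by real_asymp+
    have "(\<lambda>k::nat. 8 / 2 ^ k :: real) \<longlonglongrightarrow> 0" by real_asymp
    from filterlim_compose[OF this q_lim] show "(\<lambda>B. 8 / 2 ^ q B :: real) \<longlonglongrightarrow> 0" .
  qed
  then have "E \<longlonglongrightarrow> 0" by simp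
  from filterlim_compose[OF this b_lim] have E_lim: "(\<lambda>N. E (b N)) \<longlonglongrightarrow> 0" .
  have m_lim: "(\<lambda>N. real (m N) / N) \<longlonglongrightarrow> 1"
  proof (rule tendsto_sandwich)
    show "eventually (\<lambda>N. 1 - real N powr (1 / 4) / N \<le> real (m N) / N) sequentially"
      using eventually_ge_at_top[of 1]
    proof eventually_elim
      case (elim N)
      have "N \<le> m N + b N" using hi_simps(3)[of "{1..N}" "b N"] by (simp add: m_def)
      then have "real N \<le> real (m N) + real (b N)" by linarith
      moreover have "real (b N) \<le> real N powr (1 / 4)" unfolding b_def by (rule of_nat_floor) simp
      ultimately have "real N \<le> real (m N) + real N powr (1 / 4)" by linarith
      then have "real N / N \<le> (real (m N) + real N powr (1 / 4)) / N" by (rule divide_right_mono) simp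
      then show ?case using elim by (simp add: add_divide_distrib)
    qed
    show "eventually (\<lambda>N. real (m N) / N \<le> 1) sequentially"
      using eventually_ge_at_top[of 1]
    proof eventually_elim
      case (elim N)
      have "m N \<le> N" using hi_simps(2)[of "{1..N}" "b N"] by (simp add: m_def)
      then show ?case using elim by simp
    qed
    show "(\<lambda>N. 1 - real N powr (1 / 4) / N) \<longlonglongrightarrow> 1" by real_asymp
  qed simp
  define A where "A N = complex_of_real (exp (- t\<^sup>2 * s2 (b N) * (m N / N) / 2))" for N
  have "A \<longlonglongrightarrow> complex_of_real (exp (- t\<^sup>2 * \<tau>2 * 1 / 2))"
    unfolding A_def
    by (intro tendsto_of_real tendsto_exp tendsto_divide tendsto_mult tendsto_const m_lim
        filterlim_compose[OF s2_tendsto b_lim]) auto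
  moreover have "(\<lambda>N. (\<integral>x. iexp (t * (real N powr (- 1 / 2) * S N x)) \<partial>\<U>) - A N) \<longlonglongrightarrow> 0"
  proof (rule Lim_null_comparison[OF _ E_lim])
    show "eventually (\<lambda>N. norm ((\<integral>x. iexp (t * (real N powr (- 1 / 2) * S N x)) \<partial>\<U>) - A N) \<le> E (b N)) sequentially"
      using b_prop
    proof eventually_elim
      case (elim N)
      have q: "q (b N) \<le> b N" "real (q (b N)) \<le> R (b N)"
      proof -
        let ?z = "min (real (b N)) (R (b N)) / 2"
        have "R (b N) \<ge> 1" using elim by (simp add: good_def)
        then have "real (nat \<lfloor>?z\<rfloor>) \<le> ?z" using elim by (intro of_nat_floor) auto
        then show "q (b N) \<le> b N" "real (q (b N)) \<le> R (b N)" by (auto simp: q_def)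
      qed
      show ?case unfolding A_def E_def m_def
        using elim q by (intro char_bound) (auto simp: q_def)
    qed
  qed
  ultimately have "(\<lambda>N. ((\<integral>x. iexp (t * (real N powr (- 1 / 2) * S N x)) \<partial>\<U>) - A N) + A N)
     \<longlonglongrightarrow> 0 + complex_of_real (exp (- t\<^sup>2 * \<tau>2 * 1 / 2))"
    by (intro tendsto_add)
  then show ?thesis by simp
qed

end

lemma centered_normal_char:
  assumes "s \<ge> 0"
  shows "real_distribution (centered_normal s)"
    and "char (centered_normal s) t = complex_of_real (exp (- (s * t)\<^sup>2 / 2))"
proof -
  have "real_distribution (centered_normal s) \<and>
    char (centered_normal s) t = complex_of_real (exp (- (s * t)\<^sup>2 / 2))"
  proof (cases "s = 0")
    case True
    have "real_distribution (return borel (0 :: real))"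
      unfolding real_distribution_def real_distribution_axioms_def
      by (auto intro: prob_space_return)
    moreover have "char (return borel (0 :: real)) t = 1"
      unfolding char_def by (subst integral_return) auto
    ultimately show ?thesis using True by (simp add: centered_normal_def)
  next
    case False
    then have s: "s > 0" using assms by simp
    let ?N = std_normal_distribution
    interpret N: real_distribution ?N by (rule real_dist_normal_dist)
    have "distributed ?N lborel (\<lambda>x. x) std_normal_density"
      unfolding distributed_def by (auto simp: distr_id2)
    from N.normal_density_affine[OF this, of s 0] s
    have "distributed ?N lborel (\<lambda>x. 0 + s * x) (normal_density (0 + s * 0) (\<bar>s\<bar> * 1))" by simp
    then have "distr ?N lborel (\<lambda>x. s * x) = density lborel (\<lambda>x. ennreal (normal_density 0 s x))"
      using s by (simp add: distributed_distr_eq_density)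
    moreover have "distr ?N lborel (\<lambda>x. s * x) = distr ?N borel (\<lambda>x. s * x)"
      by (rule distr_cong) auto
    ultimately have eq: "centered_normal s = distr ?N borel (\<lambda>x. s * x)"
      using False by (simp add: centered_normal_def)
    have m: "(\<lambda>x. s * x) \<in> borel_measurable ?N" by simp
    have "char (distr ?N borel (\<lambda>x. s * x)) t = (\<integral>x. iexp (t * (s * x)) \<partial>?N)"
      unfolding char_def by (subst integral_distr[OF m]) auto
    also have "\<dots> = char ?N (s * t)" unfolding char_def by (simp add: mult_ac)
    also have "\<dots> = complex_of_real (exp (- (s * t)\<^sup>2 / 2))"
      by (simp add: char_std_normal_distribution)
    finally show ?thesis unfolding eq using N.real_distribution_distr[OF m] by simp
  qed
  then show "real_distribution (centered_normal s)"
    and "char (centered_normal s) t = complex_of_real (exp (- (s * t)\<^sup>2 / 2))" by auto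
qed

context permuted_sequence
begin

theorem clt:
  "weak_conv_m (\<lambda>N. distr \<U> borel (\<lambda>x. real N powr (- 1 / 2) * S N x)) (centered_normal (sqrt \<tau>2))"
proof (rule levy_continuity)
  interpret prob_space \<U> by (rule prob_space_unit)
  have m: "(\<lambda>x. real N powr (- 1 / 2) * S N x) \<in> borel_measurable \<U>" for N
    by (intro borel_measurable_times borel_measurable_const S_meas)
  have \<tau>2: "\<tau>2 \<ge> 0" unfolding \<tau>2_def by (intro Bochner_Integration.integral_nonneg) auto
  show "real_distribution (distr \<U> borel (\<lambda>x. real N powr (- 1 / 2) * S N x))" for N
    by (rule real_distribution_distr[OF m])
  show "real_distribution (centered_normal (sqrt \<tau>2))" using \<tau>2 by (intro centered_normal_char) auto
  fix t
  have "char (distr \<U> borel (\<lambda>x. real N powr (- 1 / 2) * S N x)) t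
      = (\<integral>x. iexp (t * (real N powr (- 1 / 2) * S N x)) \<partial>\<U>)" for N
    unfolding char_def by (subst integral_distr[OF m]) auto
  moreover have "char (centered_normal (sqrt \<tau>2)) t = complex_of_real (exp (- t\<^sup>2 * \<tau>2 / 2))"
    using \<tau>2 by (subst centered_normal_char) (auto simp: power_mult_distrib mult_ac)
  ultimately show "(\<lambda>N. char (distr \<U> borel (\<lambda>x. real N powr (- 1 / 2) * S N x)) t)
      \<longlonglongrightarrow> char (centered_normal (sqrt \<tau>2)) t"
    using char_limit[of t] by simp
qed

section \<open>Tail and increment bounds at moderate deviations\<close>

lemma s2_nonneg: "s2 B \<ge> 0"
  unfolding s2_def by (intro Bochner_Integration.integral_nonneg) auto

lemma mgf_power_bound:
  assumes "matched J p X (app B) C" "\<bar>\<nu>\<bar> * C \<le> 1 / 2" "real k \<le> N"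
  shows "matched.mgf (app B) \<nu> ^ k \<le> exp (N * (\<nu>\<^sup>2 * s2 B / 2 + (\<bar>\<nu>\<bar> * C) ^ 3))"
proof -
  interpret m: matched J p X "app B" C by (rule assms(1))
  have "m.mgf \<nu> ^ k \<le> exp (\<nu>\<^sup>2 * s2 B / 2 + (\<bar>\<nu>\<bar> * C) ^ 3) ^ k"
    using m.mgf_bounds(1)[OF assms(2)] m.mgf_nonneg unfolding s2_def by (intro power_mono) auto
  also have "\<dots> = exp (k * (\<nu>\<^sup>2 * s2 B / 2 + (\<bar>\<nu>\<bar> * C) ^ 3))" by (rule exp_of_nat_mult[symmetric])
  also have "\<dots> \<le> exp (N * (\<nu>\<^sup>2 * s2 B / 2 + (\<bar>\<nu>\<bar> * C) ^ 3))"
    using assms(3) s2_nonneg[of B] C1 by (simp add: mult_right_mono)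
  finally show ?thesis .
qed

text \<open>\<open>\<tau>\<close> is meant to exceed the standard deviation slightly: the surplus
  pays for the cubic term of the generating function and for the deviation of \<open>s2 B\<close>
  from the variance. The tilt \<open>u / (\<tau> * sqrt N)\<close> yields the exponent
  \<open>- u\<^sup>2 + u\<^sup>2 / 2\<close>.\<close>

lemma tail_bound:
  assumes B: "good B" "4 * Q \<le> B" "real (4 * Q) \<le> R B" "Q \<ge> 1"
    and P: "finite P" "P \<subseteq> {1..}" "real (card P) \<le> N" "N > 0"
    and u: "u > 0" "\<tau> > 0" "u\<^sup>2 \<le> Q / 4" "u * C / (\<tau> * sqrt N) \<le> 1 / 2"
      "u\<^sup>2 * s2 B / (2 * \<tau>\<^sup>2) + (u * C / \<tau>) ^ 3 / sqrt N \<le> u\<^sup>2 / 2" "8 * (u * C / \<tau>)\<^sup>2 \<le> 2 * real Q - 1"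
  shows "measure \<U> {x \<in> space \<U>. \<tau> * u * sqrt N \<le> G B P x} \<le> 4 * exp (- u\<^sup>2 / 2)"
proof -
  have B0: "B \<ge> i\<^sub>0" "B \<ge> 1" using B by (auto simp: good_def)
  have mt: "matched (hi B P) (4 * Q) (\<lambda>i x. app B (of_int (n i) * x)) (app B) C"
    by (rule matched[OF P(1,2) B0(2,1) B(2,3)])
  interpret m: matched "hi B P" "4 * Q" "\<lambda>i x. app B (of_int (n i) * x)" "app B" C by (rule mt)
  have XS: "m.XS (hi B P) = G B P"
    by (rule XS_eq_G[OF P(1,2) B0(2,1) B(3,2)])
  define \<nu> where "\<nu> = u / (\<tau> * sqrt N)"
  define \<theta> where "\<theta> = \<tau> * u * sqrt N"
  define k where "k = card (hi B P)"
  have sN: "sqrt N > 0" "sqrt N * sqrt N = N" using P(4) by auto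
  have \<nu>: "\<nu> > 0" "\<theta> > 0" using u sN by (auto simp: \<nu>_def \<theta>_def)
  have \<nu>\<theta>: "\<nu> * \<theta> = u\<^sup>2" using u sN(1) by (simp add: \<nu>_def \<theta>_def power2_eq_square)
  have kN: "real k \<le> N" using hi_simps(2)[OF P(1,2), of B] P(3) unfolding k_def by linarith
  have w: "\<bar>\<nu>\<bar> * C \<le> 1 / 2" using u(4) unfolding abs_of_pos[OF \<nu>(1)] by (simp add: \<nu>_def)
  have \<nu>2: "\<nu>\<^sup>2 * N = (u / \<tau>)\<^sup>2"
    using u sN P(4) by (simp add: \<nu>_def power_divide power_mult_distrib)
  have \<nu>3: "N * (\<nu> * C) ^ 3 = (u * C / \<tau>) ^ 3 / sqrt N"
  proof -
    have "N * (\<nu> * C) ^ 3 = (sqrt N * sqrt N) * ((u * C / \<tau>) / sqrt N) ^ 3"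
      using sN by (simp add: \<nu>_def)
    also have "\<dots> = (u * C / \<tau>) ^ 3 / sqrt N"
      using sN(1) by (simp add: power3_eq_cube del: real_sqrt_mult_self)
    finally show ?thesis .
  qed
  have 1: "m.mgf \<nu> ^ k \<le> exp (u\<^sup>2 / 2)"
  proof -
    have "m.mgf \<nu> ^ k \<le> exp (N * (\<nu>\<^sup>2 * s2 B / 2 + (\<bar>\<nu>\<bar> * C) ^ 3))"
      by (rule mgf_power_bound[OF mt w kN])
    also have "N * (\<nu>\<^sup>2 * s2 B / 2 + (\<bar>\<nu>\<bar> * C) ^ 3) = (\<nu>\<^sup>2 * N) * s2 B / 2 + N * (\<nu> * C) ^ 3"
      using \<nu> by (simp add: distrib_left)
    also have "\<dots> = u\<^sup>2 * s2 B / (2 * \<tau>\<^sup>2) + (u * C / \<tau>) ^ 3 / sqrt N"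
      unfolding \<nu>2 \<nu>3 by (simp add: power_divide)
    finally show ?thesis using u(5) by (meson exp_le_cancel_iff order_trans)
  qed
  have 2: "2 * exp (- 2 * real Q) * exp (8 * (\<nu>\<^sup>2 * C\<^sup>2 * k)) \<le> exp (u\<^sup>2 / 2)"
  proof -
    have "\<nu>\<^sup>2 * C\<^sup>2 * k \<le> \<nu>\<^sup>2 * C\<^sup>2 * N" using kN by (intro mult_left_mono) auto
    also have "\<dots> = (\<nu>\<^sup>2 * N) * C\<^sup>2" by simp
    also have "\<dots> = (u * C / \<tau>)\<^sup>2" unfolding \<nu>2 by (simp add: power_divide power_mult_distrib)
    finally have "exp (- 2 * real Q) * exp (8 * (\<nu>\<^sup>2 * C\<^sup>2 * k)) \<le> exp (- 1)"
      using u(6) by (simp add: exp_add[symmetric])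
    moreover have "exp (- 1 :: real) \<le> 1 / 2"
      using exp_ge_add_one_self[of 1] by (simp add: exp_minus field_simps)
    moreover have "1 \<le> exp (u\<^sup>2 / 2)" by simp
    ultimately show ?thesis by linarith
  qed
  have "measure \<U> {x \<in> space \<U>. \<theta> \<le> G B P x}
    \<le> 2 * exp (- \<nu> * \<theta>) * (m.mgf \<nu> ^ k + 2 * exp (- 2 * real Q) * exp (8 * (\<nu>\<^sup>2 * C\<^sup>2 * k)))"
    using m.chernoff[OF order_refl order_refl B(4), of \<nu> \<theta>] \<nu> u(3) unfolding XS k_def \<nu>\<theta> by simp
  also have "\<dots> \<le> 2 * exp (- \<nu> * \<theta>) * (exp (u\<^sup>2 / 2) + exp (u\<^sup>2 / 2))"
    using 1 2 by (intro mult_left_mono add_mono) auto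
  also have "\<dots> = 4 * (exp (- u\<^sup>2) * exp (u\<^sup>2 / 2))" using \<nu>\<theta> by simp
  also have "\<dots> = 4 * exp (- u\<^sup>2 / 2)" unfolding exp_add[symmetric] by simp
  finally show ?thesis unfolding \<theta>_def .
qed

text \<open>Indexed by positions rather than by indices of \<open>n\<close>, since the maximal
  inequality runs along consecutive positions; dropped terms become 0.\<close>

definition pos :: "nat \<Rightarrow> nat \<Rightarrow> real \<Rightarrow> real" where
  "pos B k x = (if \<sigma> k \<ge> B then app B (of_int (n (\<sigma> k)) * x) else 0)"

lemma pos_meas: "B \<ge> 1 \<Longrightarrow> pos B k \<in> borel_measurable \<U>"
proof -
  assume B: "B \<ge> 1"
  have "continuous_on UNIV (\<lambda>x. app B (of_int m * x))" for m
    by (intro continuous_on_compose2[OF app_cont[OF B]] continuous_intros) auto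
  from measurable_unit_continuous[OF this] show ?thesis unfolding pos_def[abs_def] by simp
qed

lemma pos_bd: "B \<ge> 1 \<Longrightarrow> \<bar>pos B k x\<bar> \<le> C"
  unfolding pos_def using app(2)[of B] C1 by simp

lemma G_pos: "1 \<le> a \<Longrightarrow> (\<Sum>k=a..<b. pos B k x) = G B {a..<b} x"
  by (subst G_positions) (auto simp: pos_def)

text \<open>In the factor 600, the maximal inequality contributes 100 and the moment bound for
  \<open>XS\<close> contributes 6.\<close>

lemma increment_bound:
  assumes B: "good B" "2 * r \<le> B" "real (2 * r) \<le> R B" and r: "r \<ge> 3" and a: "a \<ge> 1" and \<eta>: "\<eta> > 0"
  shows "measure \<U> {x \<in> space \<U>. \<eta> < partial_max (pos B) j a x} \<le> 2 * (600 * real r * C\<^sup>2 * 2 ^ j / \<eta>\<^sup>2) ^ r"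
proof -
  have B0: "B \<ge> i\<^sub>0" "B \<ge> 1" using B by (auto simp: good_def)
  have "measure \<U> {x \<in> space \<U>. \<eta> < partial_max (pos B) j a x}
      \<le> 100 ^ r * (2 * (6 * real r * C\<^sup>2) ^ r) * (2 ^ j) ^ r / \<eta> ^ (2 * r)"
  proof (rule maximal_probability[OF prob_space_unit pos_meas[OF B0(2)] pos_bd[OF B0(2)] r _ _ _ \<eta>,
        where a\<^sub>0 = 1 and b\<^sub>0 = "a + 2 ^ j"])
    fix a b :: nat assume ab: "1 \<le> a" "a < b"
    have P: "finite {a..<b}" "{a..<b} \<subseteq> {1..}" using ab by auto
    interpret m: matched "hi B {a..<b}" "2 * r" "\<lambda>i x. app B (of_int (n i) * x)" "app B" C
      by (rule matched[OF P B0(2,1) B(2,3)])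
    have XS: "m.XS (hi B {a..<b}) = G B {a..<b}"
      by (rule XS_eq_G[OF P B0(2,1) B(3,2)])
    have "real (card (hi B {a..<b})) \<le> real (b - a)"
      using hi_simps(2)[OF P, of B] by simp
    then have "(\<integral>x. G B {a..<b} x ^ (2 * r) \<partial>\<U>) \<le> 2 * (6 * real r * C\<^sup>2 * real (b - a)) ^ r"
      using m.integral_XS_moment[OF order_refl order_refl, of "real (b - a)"] r ab unfolding XS by simp
    then show "(\<integral>x. (\<Sum>k=a..<b. pos B k x) ^ (2 * r) \<partial>\<U>) \<le> 2 * (6 * real r * C\<^sup>2) ^ r * real (b - a) ^ r"
      unfolding G_pos[OF ab(1)] by (simp add: power_mult_distrib)
  qed (use a in auto)
  also have "\<dots> = 2 * (100 * (6 * real r * C\<^sup>2) * 2 ^ j / \<eta>\<^sup>2) ^ r"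
    unfolding power_mult power_divide power_mult_distrib[of _ "2 ^ j"] power_mult_distrib[of 100] by simp
  finally show ?thesis by (simp add: mult.assoc)
qed

end

section \<open>The law of the iterated logarithm\<close>

text \<open>The cube leaves room above the \<open>4 * Qh h\<close> moments to be matched, whose
  number is of the order of the square of the iterated logarithm.\<close>

locale permuted_sequence_lil = permuted_sequence +
  assumes R_big: "eventually (\<lambda>B. ln (ln (real B)) ^ 3 \<le> R B) sequentially"
begin

text \<open>For \<open>B = L ^ h\<close>, \<open>ln h\<close> is the iterated logarithm of
  \<open>B\<close> up to an additive constant. All exponents to be truncated are of order
  \<open>ln h\<close>; its square exceeds every multiple of it, so one choice of the degree suits
  all constants.\<close>

definition Qh :: "nat \<Rightarrow> nat" where "Qh h = nat \<lceil>(ln (real h))\<^sup>2\<rceil>"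

lemma Qh: "(ln (real h))\<^sup>2 \<le> Qh h" "Qh h \<le> (ln (real h))\<^sup>2 + 1"
  using of_int_ceiling_le_add_one[of "(ln (real h))\<^sup>2"] unfolding Qh_def by (linarith, simp)

lemma eventually_scale:
  assumes L: "L \<ge> 2"
  shows "eventually (\<lambda>h. good (L ^ h) \<and> 4 * Qh h \<le> L ^ h \<and> real (4 * Qh h) \<le> R (L ^ h) \<and> Qh h \<ge> 1) sequentially"
proof -
  have lim: "filterlim (\<lambda>h. L ^ h) at_top sequentially"
  proof (rule filterlim_at_top_mono[OF filterlim_ident])
    show "eventually (\<lambda>h. h \<le> L ^ h) sequentially"
    proof (rule always_eventually, rule allI)
      fix h :: nat
      have "h \<le> 2 ^ h" by (rule less_imp_le[OF less_exp])
      also have "\<dots> \<le> L ^ h" using L by (intro power_mono) auto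
      finally show "h \<le> L ^ h" .
    qed
  qed
  have 1: "eventually (\<lambda>h. good (L ^ h) \<and> ln (ln (real (L ^ h))) ^ 3 \<le> R (L ^ h)) sequentially"
    using eventually_compose_filterlim[OF eventually_conj[OF eventually_good R_big] lim] .
  have 2: "eventually (\<lambda>h::nat. 4 * ((ln (real h))\<^sup>2 + 1) \<le> ln (real h * ln 2) ^ 3) sequentially"
    by real_asymp
  have 3: "eventually (\<lambda>h::nat. 4 * ((ln (real h))\<^sup>2 + 1) \<le> 2 ^ h) sequentially"
    by real_asymp
  have 4: "eventually (\<lambda>h::nat. (ln (real h))\<^sup>2 \<ge> 1) sequentially" by real_asymp
  have 5: "eventually (\<lambda>h::nat. real h * ln 2 \<ge> 1) sequentially" by real_asymp
  show ?thesis using 1 2 3 4 5 eventually_ge_at_top[of 1]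
  proof eventually_elim
    case (elim h)
    have "real h * ln 2 \<le> real h * ln (real L)" using L by (intro mult_left_mono) auto
    also have "\<dots> = ln (real (L ^ h))" using L by (simp add: ln_realpow)
    finally have "ln (real h * ln 2) \<le> ln (ln (real (L ^ h)))" using elim by (subst ln_le_cancel_iff) auto
    moreover have "0 \<le> ln (real h * ln 2)" using elim by (intro ln_ge_zero) auto
    ultimately have "ln (real h * ln 2) ^ 3 \<le> ln (ln (real (L ^ h))) ^ 3" by (intro power_mono)
    then have R: "real (4 * Qh h) \<le> R (L ^ h)" using elim Qh(2)[of h] by simp
    have "(2::real) ^ h \<le> real L ^ h" using L by (intro power_mono) auto
    have "4 * real (Qh h) \<le> 4 * ((ln (real h))\<^sup>2 + 1)" by (intro mult_left_mono Qh(2)) simp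
    also have "\<dots> \<le> 2 ^ h" by (rule elim(3))
    also have "\<dots> \<le> real L ^ h" by fact
    finally have "4 * real (Qh h) \<le> real L ^ h" .
    then have "real (4 * Qh h) \<le> real (L ^ h)" by simp
    then have "4 * Qh h \<le> L ^ h" by (simp only: of_nat_le_iff)
    moreover have "Qh h \<ge> 1" using elim Qh(1)[of h] by linarith
    ultimately show ?case using R elim by blast
  qed
qed

text \<open>The range from \<open>16 ^ h\<close> to \<open>16 ^ Suc h\<close> is cut at a fixed
  number of grid points. The tail bound controls the sum at these points and the maximal inequality
  its oscillation in between. The threshold \<open>B = 2 ^ h\<close> is the fourth root of the left
  end, so the at most \<open>B\<close> dropped terms are negligible.\<close>

lemma lil_upper:
  assumes \<kappa>: "\<kappa> > sqrt \<tau>2"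
  shows "AE x in \<U>. eventually (\<lambda>N. S N x \<le> \<kappa> * sqrt (2 * real N * ln (ln (real N)))) sequentially"
proof -
  interpret U: prob_space \<U> by (rule prob_space_unit)
  have \<tau>2: "\<tau>2 \<ge> 0" unfolding \<tau>2_def by (intro Bochner_Integration.integral_nonneg) auto
  define \<sigma>\<^sub>0 where "\<sigma>\<^sub>0 = sqrt \<tau>2"
  define \<gamma> where "\<gamma> = \<kappa> - \<sigma>\<^sub>0"
  \<comment> \<open>Budget for the excess \<open>\<gamma>\<close>: at the grid points
    \<open>\<tau> * c = \<sigma>\<^sub>0 + \<gamma> / 2\<close>, then \<open>\<gamma> / 8\<close>
    for the oscillation and \<open>\<gamma> / 8\<close> for the approximation error. Since
    \<open>c > 1\<close>, the probabilities \<open>h powr (- c\<^sup>2)\<close> are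
    summable.\<close>
  define \<tau> where "\<tau> = \<sigma>\<^sub>0 + \<gamma> / 4"
  define c where "c = 1 + \<gamma> / (4 * \<tau>)"
  define \<delta> where "\<delta> = \<gamma> / 8"
  have \<sigma>0: "\<sigma>\<^sub>0 \<ge> 0" "\<sigma>\<^sub>0\<^sup>2 = \<tau>2" using \<tau>2 by (auto simp: \<sigma>\<^sub>0_def)
  have \<gamma>: "\<gamma> > 0" using \<kappa> by (simp add: \<gamma>_def \<sigma>\<^sub>0_def)
  have \<tau>: "\<tau> > 0" "\<tau>\<^sup>2 > \<tau>2"
  proof -
    show "\<tau> > 0" using \<sigma>0 \<gamma> by (simp add: \<tau>_def)
    have "\<sigma>\<^sub>0\<^sup>2 < \<tau>\<^sup>2" using \<sigma>0 \<gamma> by (intro power_strict_mono) (auto simp: \<tau>_def)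
    then show "\<tau>\<^sup>2 > \<tau>2" by (simp add: \<sigma>0)
  qed
  have c: "c > 1" "\<tau> * c = \<sigma>\<^sub>0 + \<gamma> / 2"
    using \<tau> \<gamma> by (auto simp: c_def distrib_left) (simp add: \<tau>_def)
  have \<delta>: "\<delta> > 0" using \<gamma> by (simp add: \<delta>_def)
  \<comment> \<open>Fineness of the grid. The constant is \<open>600 * 3 * 3\<close>: 600 from the
    increment bound, 3 from \<open>r h \<le> 3 * ln h\<close>, and another 3 to bring the base of
    the power down to \<open>1 / 3 \<le> exp (- 1)\<close>.\<close>
  obtain q :: nat where q: "5400 * C\<^sup>2 / \<delta>\<^sup>2 < 2 ^ q"
    using real_arch_pow[of 2] by auto
  define u where "u h = c * sqrt (2 * ln (real h))" for h :: nat
  define \<eta> where "\<eta> h = \<delta> * sqrt (16 ^ h * ln (real h))" for h :: nat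
  \<comment> \<open>A base of at most \<open>exp (- 1)\<close> raised to a power of at least
    \<open>2 * ln h\<close> gives \<open>h powr (- 2)\<close>; the summand 3 meets the requirement
    of the maximal inequality.\<close>
  define r where "r h = nat \<lceil>2 * ln (real h)\<rceil> + 3" for h :: nat
  define j where "j h = 4 * h - q" for h :: nat
  \<comment> \<open>The step is \<open>16 ^ h / 2 ^ q\<close>, so \<open>15 * 2 ^ q\<close> steps
    lead from \<open>16 ^ h\<close> to \<open>16 ^ Suc h\<close>.\<close>
  define N where "N h i = 16 ^ h + i * 2 ^ j h" for h i :: nat
  define bad where "bad h = (\<Union>i<15 * 2 ^ q. {x \<in> space \<U>. \<tau> * u h * sqrt (N h i) \<le> G (2 ^ h) {1..N h i} x}
      \<union> {x \<in> space \<U>. \<eta> h < partial_max (pos (2 ^ h)) (j h) (N h i + 1) x})" for h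
  have B1: "(2::nat) ^ h \<ge> 1" for h by simp
  have sets1: "{x \<in> space \<U>. \<tau> * u h * sqrt (N h i) \<le> G (2 ^ h) {1..N h i} x} \<in> sets \<U>" for h i
    using G_meas[OF B1, of h "{1..N h i}"] by measurable
  have sets2: "{x \<in> space \<U>. \<eta> h < partial_max (pos (2 ^ h)) (j h) (N h i + 1) x} \<in> sets \<U>" for h i
    using partial_max_measurable[of "pos (2 ^ h)" \<U> "j h" "N h i + 1", OF pos_meas[OF B1]] by measurable
  have bad_sets: "bad h \<in> sets \<U>" for h
    unfolding bad_def by (intro sets.finite_UN sets.Un sets1 sets2) auto
  \<comment> \<open>The share of \<open>u\<^sup>2\<close> that remains free when \<open>s2 B\<close>
    is below the midpoint of \<open>\<tau>2\<close> and \<open>\<tau>\<^sup>2\<close>; the cubic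
    term has to fit into it.\<close>
  define d where "d = (\<tau>\<^sup>2 - \<tau>2) / (4 * \<tau>\<^sup>2)"
  have d: "d > 0" using \<tau> by (simp add: d_def)
  have e1: "eventually (\<lambda>h. (u h)\<^sup>2 \<le> (ln (real h))\<^sup>2 / 4) sequentially"
    unfolding u_def using c(1) by real_asymp
  have e2: "eventually (\<lambda>h. u h * C / \<tau> / 4 ^ h \<le> 1 / 2) sequentially"
    unfolding u_def using c(1) C1 \<tau>(1) by real_asymp
  have e3: "eventually (\<lambda>h. (u h * C / \<tau>) ^ 3 / 4 ^ h \<le> d * (u h)\<^sup>2) sequentially"
    unfolding u_def using c(1) C1 \<tau>(1) d by real_asymp
  have e4: "eventually (\<lambda>h. 8 * (u h * C / \<tau>)\<^sup>2 \<le> 2 * (ln (real h))\<^sup>2 - 1) sequentially"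
    unfolding u_def using c(1) C1 \<tau>(1) by real_asymp
  have e5: "eventually (\<lambda>h. 2 * (2 * ln (real h) + 4) \<le> 4 * (ln (real h))\<^sup>2) sequentially"
    by real_asymp
  have e6: "eventually (\<lambda>h. 4 \<le> ln (real h)) sequentially" by real_asymp
  have e7: "eventually (\<lambda>h. C * 2 ^ h + 1 \<le> \<gamma> / 8 * 4 ^ h) sequentially"
    using C1 \<gamma> by real_asymp
  have e8: "eventually (\<lambda>h. s2 (2 ^ h) < (\<tau>2 + \<tau>\<^sup>2) / 2) sequentially"
  proof -
    have "filterlim (\<lambda>h. 2 ^ h :: nat) at_top sequentially"
      by (rule filterlim_at_top_mono[OF filterlim_ident]) (auto intro: always_eventually less_imp_le[OF less_exp])
    then have "(\<lambda>h. s2 (2 ^ h)) \<longlonglongrightarrow> \<tau>2" by (rule filterlim_compose[OF s2_tendsto])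
    then show ?thesis by (rule order_tendstoD) (use \<tau> in simp)
  qed
  have bad_meas: "eventually (\<lambda>h. norm (measure \<U> (bad h))
      \<le> 15 * 2 ^ q * (4 * real h powr (- c\<^sup>2) + 2 * real h powr (- 2))) sequentially"
    using e1 e2 e3 e4 e5 e6 e8 eventually_scale[of 2, OF order_refl] eventually_ge_at_top[of "q + 1"]
  proof eventually_elim
    case (elim h)
    let ?B = "2 ^ h :: nat"
    have h: "h \<ge> 1" "q \<le> 4 * h" "ln (real h) \<ge> 4" using elim by auto
    have "0 < ln (real h)" using h(3) by linarith
    then have h1: "h > 1" using h(1) by simp
    have u: "u h > 0" "(u h)\<^sup>2 = 2 * c\<^sup>2 * ln (real h)"
      using h1 c(1) by (auto simp: u_def power_mult_distrib)
    have m1: "measure \<U> {x \<in> space \<U>. \<tau> * u h * sqrt (N h i) \<le> G ?B {1..N h i} x}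
        \<le> 4 * real h powr (- c\<^sup>2)" for i
    proof -
      have Nge: "real (N h i) \<ge> 16 ^ h" and Np: "N h i > 0" by (simp_all add: N_def)
      have "(4 ^ h)\<^sup>2 = (16 :: real) ^ h"
        unfolding power_mult[symmetric] mult.commute[of h 2] by (simp add: power_mult)
      then have sq: "sqrt (N h i) \<ge> 4 ^ h" using Nge by (intro real_le_rsqrt) simp
      have "measure \<U> {x \<in> space \<U>. \<tau> * u h * sqrt (N h i) \<le> G ?B {1..N h i} x} \<le> 4 * exp (- (u h)\<^sup>2 / 2)"
      proof (rule tail_bound)
        show "good ?B" "4 * Qh h \<le> ?B" "real (4 * Qh h) \<le> R ?B" "Qh h \<ge> 1" using elim by auto
        show "0 < real (N h i)" using Nge by (rule less_le_trans[rotated]) simp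
        show "0 < u h" "0 < \<tau>" by fact+
        show "(u h)\<^sup>2 \<le> real (Qh h) / 4" using elim(1) Qh(1)[of h] by linarith
        show "8 * (u h * C / \<tau>)\<^sup>2 \<le> 2 * real (Qh h) - 1" using elim(4) Qh(1)[of h] by linarith
        have "u h * C / (\<tau> * sqrt (N h i)) = u h * C / \<tau> / sqrt (N h i)" by simp
        also have "\<dots> \<le> u h * C / \<tau> / 4 ^ h"
          using u C1 \<tau> sq Np by (intro divide_left_mono mult_pos_pos divide_nonneg_pos) auto
        also have "\<dots> \<le> 1 / 2" by (rule elim(2))
        finally show "u h * C / (\<tau> * sqrt (N h i)) \<le> 1 / 2" .
        have "(u h * C / \<tau>) ^ 3 / sqrt (N h i) \<le> (u h * C / \<tau>) ^ 3 / 4 ^ h"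
          using u C1 \<tau> sq Np by (intro divide_left_mono mult_pos_pos zero_le_power divide_nonneg_pos) auto
        also have "\<dots> \<le> d * (u h)\<^sup>2" by (rule elim(3))
        finally have a: "(u h * C / \<tau>) ^ 3 / sqrt (N h i) \<le> d * (u h)\<^sup>2" .
        have "(u h)\<^sup>2 * s2 ?B / (2 * \<tau>\<^sup>2) \<le> (u h)\<^sup>2 * ((\<tau>2 + \<tau>\<^sup>2) / 2) / (2 * \<tau>\<^sup>2)"
          using elim(7) by (intro divide_right_mono mult_left_mono) auto
        also have "\<dots> = (u h)\<^sup>2 / 2 - d * (u h)\<^sup>2"
          using \<tau>(1) by (simp add: d_def field_simps)
        finally show "(u h)\<^sup>2 * s2 ?B / (2 * \<tau>\<^sup>2) + (u h * C / \<tau>) ^ 3 / sqrt (N h i) \<le> (u h)\<^sup>2 / 2"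
          using a by linarith
      qed auto
      also have "exp (- (u h)\<^sup>2 / 2) = real h powr (- c\<^sup>2)"
        using h by (simp add: u(2) powr_def)
      finally show ?thesis .
    qed
    have r: "2 * ln (real h) \<le> r h" "r h \<le> 2 * ln (real h) + 4" "r h \<ge> 3"
    proof -
      have "0 \<le> \<lceil>2 * ln (real h)\<rceil>" using h(3) by linarith
      then have "real (nat \<lceil>2 * ln (real h)\<rceil>) = of_int \<lceil>2 * ln (real h)\<rceil>" by simp
      then show "2 * ln (real h) \<le> r h" "r h \<le> 2 * ln (real h) + 4" "r h \<ge> 3"
        unfolding r_def by linarith+
    qed
    have \<eta>: "\<eta> h > 0" "(\<eta> h)\<^sup>2 = \<delta>\<^sup>2 * 16 ^ h * ln (real h)"
      using h1 \<delta> by (auto simp: \<eta>_def power_mult_distrib)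
    have m2: "measure \<U> {x \<in> space \<U>. \<eta> h < partial_max (pos ?B) (j h) (N h i + 1) x} \<le> 2 * real h powr (- 2)" for i
    proof -
      let ?y = "600 * real (r h) * C\<^sup>2 * 2 ^ j h / (\<eta> h)\<^sup>2"
      have m2a: "measure \<U> {x \<in> space \<U>. \<eta> h < partial_max (pos ?B) (j h) (N h i + 1) x} \<le> 2 * ?y ^ r h"
      proof (rule increment_bound)
        show "good ?B" using elim by auto
        have "2 * real (r h) \<le> real (4 * Qh h)" using elim(5) r(2) Qh(1)[of h] by simp
        moreover have "4 * Qh h \<le> ?B" "real (4 * Qh h) \<le> R ?B" using elim by auto
        ultimately show "2 * r h \<le> ?B" "real (2 * r h) \<le> R ?B" by linarith+
      qed (use r \<eta> in auto)
      have "?y \<le> exp (- 1)"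
      proof -
        have "(16 :: real) ^ h = 2 ^ (4 * h)" by (simp add: power_mult)
        also have "\<dots> = 2 ^ j h * 2 ^ q" using h(2) by (simp add: j_def power_add[symmetric])
        finally have p16: "(16 :: real) ^ h = 2 ^ j h * 2 ^ q" .
        have "?y = (600 * C\<^sup>2 / (\<delta>\<^sup>2 * 2 ^ q)) * (r h / ln (real h))"
          unfolding \<eta>(2) p16 by (simp add: mult_ac)
        also have "\<dots> \<le> (600 * C\<^sup>2 / (\<delta>\<^sup>2 * 2 ^ q)) * 3"
        proof (rule mult_left_mono)
          show "r h / ln (real h) \<le> 3" using r(2) h(3) by (simp add: divide_le_eq)
        qed simp
        also have "\<dots> = (5400 * C\<^sup>2 / \<delta>\<^sup>2) / 2 ^ q * (1 / 3)" by simp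
        also have "\<dots> \<le> 1 * (1 / 3)"
        proof (rule mult_right_mono)
          show "(5400 * C\<^sup>2 / \<delta>\<^sup>2) / 2 ^ q \<le> 1"
            by (rule iffD2[OF pos_divide_le_eq]) (use q in auto)
        qed simp
        also have "1 * (1 / 3) \<le> exp (- 1 :: real)" using exp_le by (simp add: exp_minus field_simps)
        finally show ?thesis .
      qed
      moreover have "0 \<le> ?y" by simp
      ultimately have "2 * ?y ^ r h \<le> 2 * exp (- 1) ^ r h"
        by (intro mult_left_mono power_mono) auto
      also have "exp (- 1) ^ r h = exp (- real (r h))" by (simp add: exp_of_nat_mult[symmetric])
      also have "2 * exp (- real (r h)) \<le> 2 * exp (- (2 * ln (real h)))" using r(1) by simp
      also have "exp (- (2 * ln (real h))) = real h powr (- 2)" using h by (simp add: powr_def)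
      finally show ?thesis using m2a by linarith
    qed
    have "measure \<U> (bad h) \<le> (\<Sum>i<15 * 2 ^ q. measure \<U> ({x \<in> space \<U>. \<tau> * u h * sqrt (N h i) \<le> G ?B {1..N h i} x}
      \<union> {x \<in> space \<U>. \<eta> h < partial_max (pos ?B) (j h) (N h i + 1) x}))"
      unfolding bad_def by (intro U.finite_measure_subadditive_finite) (use sets1 sets2 in auto)
    also have "\<dots> \<le> (\<Sum>i<(15 * 2 ^ q :: nat). 4 * real h powr (- c\<^sup>2) + 2 * real h powr (- 2))"
    proof (rule sum_mono)
      fix i
      have "measure \<U> ({x \<in> space \<U>. \<tau> * u h * sqrt (N h i) \<le> G ?B {1..N h i} x}
        \<union> {x \<in> space \<U>. \<eta> h < partial_max (pos ?B) (j h) (N h i + 1) x})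
        \<le> measure \<U> {x \<in> space \<U>. \<tau> * u h * sqrt (N h i) \<le> G ?B {1..N h i} x}
        + measure \<U> {x \<in> space \<U>. \<eta> h < partial_max (pos ?B) (j h) (N h i + 1) x}"
        by (rule measure_Un_le[OF sets1 sets2])
      then show "measure \<U> ({x \<in> space \<U>. \<tau> * u h * sqrt (N h i) \<le> G ?B {1..N h i} x}
        \<union> {x \<in> space \<U>. \<eta> h < partial_max (pos ?B) (j h) (N h i + 1) x})
        \<le> 4 * real h powr (- c\<^sup>2) + 2 * real h powr (- 2)"
        using m1[of i] m2[of i] by linarith
    qed
    finally show ?case by simp
  qed
  have "AE x in \<U>. eventually (\<lambda>h. x \<in> space \<U> - bad h) sequentially"
  proof (rule borel_cantelli_AE1[OF bad_sets])
    show "emeasure \<U> (bad h) < \<infinity>" for h by (simp add: less_top[symmetric])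
    have "c\<^sup>2 > 1" using c(1) by (simp add: one_less_power)
    then have "summable (\<lambda>h. 15 * 2 ^ q * (4 * real h powr (- c\<^sup>2) + 2 * real h powr (- 2)))"
      by (intro summable_mult summable_add) (auto simp: summable_real_powr_iff)
    then show "summable (\<lambda>h. measure \<U> (bad h))"
      by (rule summable_comparison_test_ev[OF bad_meas])
  qed
  moreover have "AE x in \<U>. eventually (\<lambda>h. \<forall>N\<le>(2 ^ h) ^ 16. \<bar>S N x - G (2 ^ h) {1..N} x\<bar> \<le> C * 2 ^ h + 1) sequentially"
    using AE_S_G
  proof (rule AE_mp, intro AE_I2 impI)
    fix x
    have lim: "filterlim (\<lambda>h. 2 ^ h :: nat) at_top sequentially"
      by (rule filterlim_at_top_mono[OF filterlim_ident]) (auto intro: always_eventually less_imp_le[OF less_exp])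
    assume "eventually (\<lambda>B. \<forall>N\<le>B ^ 16. \<bar>S N x - G B {1..N} x\<bar> \<le> C * B + 1) sequentially"
    from eventually_compose_filterlim[OF this lim]
    show "eventually (\<lambda>h. \<forall>N\<le>(2 ^ h) ^ 16. \<bar>S N x - G (2 ^ h) {1..N} x\<bar> \<le> C * 2 ^ h + 1) sequentially" by simp
  qed
  ultimately show ?thesis
  proof (rule AE_mp[OF AE_conjI], intro AE_I2 impI, elim conjE)
    fix x assume x: "eventually (\<lambda>h. x \<in> space \<U> - bad h) sequentially"
      "eventually (\<lambda>h. \<forall>N\<le>(2 ^ h) ^ 16. \<bar>S N x - G (2 ^ h) {1..N} x\<bar> \<le> C * 2 ^ h + 1) sequentially"
    have "eventually (\<lambda>h. \<forall>n. 16 ^ h \<le> n \<and> n < 16 ^ Suc h \<longrightarrow> S n x \<le> \<kappa> * sqrt (2 * real n * ln (ln (real n)))) sequentially"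
      using x e6 e7 eventually_ge_at_top[of "q + 1"]
    proof eventually_elim
      case (elim h)
      let ?B = "2 ^ h :: nat"
      have h: "h \<ge> 1" "q \<le> 4 * h" "ln (real h) \<ge> 4" using elim by auto
      have p16: "(16 :: nat) ^ h = 2 ^ q * 2 ^ j h"
      proof -
        have "(16 :: nat) ^ h = 2 ^ (4 * h)" by (simp add: power_mult)
        also have "\<dots> = 2 ^ q * 2 ^ j h" using h(2) by (simp add: j_def power_add[symmetric])
        finally show ?thesis .
      qed
      show ?case
      proof (intro allI impI, elim conjE)
        fix n :: nat assume n: "16 ^ h \<le> n" "n < 16 ^ Suc h"
        define i where "i = (n - 16 ^ h) div 2 ^ j h"
        define l where "l = (n - 16 ^ h) mod 2 ^ j h"
        have nl: "n = N h i + l" using n(1) div_mult_mod_eq[of "n - 16 ^ h" "2 ^ j h"] unfolding N_def i_def l_def by linarith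
        have l: "l \<le> 2 ^ j h" by (simp add: l_def less_imp_le)
        have "n - 16 ^ h < 15 * 2 ^ q * 2 ^ j h" using n p16 by simp
        then have i: "i < 15 * 2 ^ q" unfolding i_def by (rule less_mult_imp_div_less)
        have "x \<in> space \<U>" "x \<notin> bad h" using elim(1) by auto
        with i have g1: "G ?B {1..N h i} x < \<tau> * u h * sqrt (N h i)"
          and g2: "partial_max (pos ?B) (j h) (N h i + 1) x \<le> \<eta> h"
          unfolding bad_def by (auto simp: not_le not_less)
        have "G ?B {1..n} x = (\<Sum>k=1..<n + 1. pos ?B k x)"
          using G_pos[of 1 ?B x "n + 1"] by (simp add: atLeastLessThanSuc_atLeastAtMost)
        also have "\<dots> = (\<Sum>k=1..<N h i + 1. pos ?B k x) + (\<Sum>k=N h i + 1..<N h i + 1 + l. pos ?B k x)"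
          unfolding nl by (subst sum.atLeastLessThan_concat) auto
        also have "(\<Sum>k=1..<N h i + 1. pos ?B k x) = G ?B {1..N h i} x"
          using G_pos[of 1 ?B x "N h i + 1"] by (simp add: atLeastLessThanSuc_atLeastAtMost)
        finally have Gn: "G ?B {1..n} x \<le> \<tau> * u h * sqrt (N h i) + \<eta> h"
          using g1 g2 partial_max_ge[OF l, where X = "pos ?B" and a = "N h i + 1" and x = x] by linarith
        have n': "real n \<ge> 16 ^ h" using n(1) of_nat_mono[OF n(1), where 'a=real] by simp
        let ?s = "sqrt (2 * real n * ln (real h))"
        have t1: "\<tau> * u h * sqrt (N h i) \<le> \<tau> * c * ?s"
        proof -
          have "u h * sqrt (N h i) \<le> u h * sqrt n"
            using nl c h by (intro mult_left_mono) (auto simp: u_def)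
          also have "\<dots> = c * ?s" by (simp add: u_def real_sqrt_mult mult_ac)
          finally show ?thesis using \<tau>(1) by (simp add: mult.assoc)
        qed
        have t2: "\<eta> h \<le> \<delta> * ?s"
        proof -
          have "16 ^ h * ln (real h) \<le> real n * ln (real h)" using n' h by (intro mult_right_mono) auto
          moreover have "0 \<le> real n * ln (real h)" using h by simp
          ultimately have "16 ^ h * ln (real h) \<le> 2 * real n * ln (real h)" by linarith
          then show ?thesis unfolding \<eta>_def using \<delta> by (intro mult_left_mono real_sqrt_le_mono) auto
        qed
        have t3: "C * 2 ^ h + 1 \<le> \<gamma> / 8 * ?s"
        proof -
          have "(4 ^ h)\<^sup>2 = (16 :: real) ^ h"
            unfolding power_mult[symmetric] mult.commute[of h 2] by (simp add: power_mult)
          also have "\<dots> \<le> real n * 1" using n' by simp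
          also have "\<dots> \<le> real n * (2 * ln (real h))" using h by (intro mult_left_mono) auto
          finally have "4 ^ h \<le> ?s" by (intro real_le_rsqrt) (simp add: mult_ac)
          then have "\<gamma> / 8 * 4 ^ h \<le> \<gamma> / 8 * ?s" using \<gamma> by (intro mult_left_mono) auto
          with elim(4) show ?thesis by linarith
        qed
        have "n \<le> (2 ^ h) ^ 16"
        proof -
          have "n \<le> 16 ^ Suc h" using n(2) by simp
          also have "(16 :: nat) ^ Suc h \<le> 16 ^ (4 * h)" using h(1) by (intro power_increasing) auto
          also have "(16 :: nat) ^ (4 * h) = (16 ^ 4) ^ h" by (rule power_mult)
          also have "\<dots> = (2 ^ 16) ^ h" by simp
          also have "\<dots> = (2 ^ h) ^ 16" by (simp only: power_mult[symmetric] mult.commute)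
          finally show ?thesis .
        qed
        with elim(2) have "\<bar>S n x - G ?B {1..n} x\<bar> \<le> C * 2 ^ h + 1" by blast
        then have "S n x \<le> G ?B {1..n} x + (C * 2 ^ h + 1)" by linarith
        also have "\<dots> \<le> \<tau> * c * ?s + \<delta> * ?s + \<gamma> / 8 * ?s" using Gn t1 t2 t3 by linarith
        also have "\<dots> = (\<tau> * c + \<delta> + \<gamma> / 8) * ?s" by (simp add: distrib_right)
        also have "\<dots> \<le> \<kappa> * ?s"
        proof (rule mult_right_mono)
          show "\<tau> * c + \<delta> + \<gamma> / 8 \<le> \<kappa>" unfolding c(2) \<delta>_def using \<gamma> \<gamma>_def by linarith
        qed (use h in simp)
        also have "\<dots> \<le> \<kappa> * sqrt (2 * real n * ln (ln (real n)))"
        proof -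
          \<comment> \<open>Base 16 exceeds Euler's number, so \<open>h \<le> ln n\<close> and
            \<open>ln h\<close> may be replaced by \<open>ln (ln n)\<close>.\<close>
          have "real h \<le> real h * ln 16"
          proof -
            have "(1::real) \<le> ln 16" using exp_le ln_ge_iff[of 16 1] by simp
            then show ?thesis using mult_left_mono[of 1 "ln 16" "real h"] by simp
          qed
          also have "\<dots> = ln (16 ^ h)" by (simp add: ln_realpow)
          also have "\<dots> \<le> ln (real n)" using n' by (intro ln_mono) (auto intro: less_le_trans[OF _ n'])
          finally have "ln (real h) \<le> ln (ln (real n))" using h by (intro ln_mono) auto
          then have "2 * real n * ln (real h) \<le> 2 * real n * ln (ln (real n))" by (intro mult_left_mono) auto
          moreover have "0 \<le> \<kappa>" using \<gamma> \<gamma>_def \<sigma>0 by linarith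
          ultimately show ?thesis by (rule mult_left_mono[OF real_sqrt_le_mono])
        qed
        finally show "S n x \<le> \<kappa> * sqrt (2 * real n * ln (ln (real n)))" .
      qed
    qed
    then obtain h0 where h0: "\<And>h n. h \<ge> h0 \<Longrightarrow> 16 ^ h \<le> n \<Longrightarrow> n < 16 ^ Suc h \<Longrightarrow>
        S n x \<le> \<kappa> * sqrt (2 * real n * ln (ln (real n)))"
      unfolding eventually_sequentially by auto
    show "eventually (\<lambda>N. S N x \<le> \<kappa> * sqrt (2 * real N * ln (ln (real N)))) sequentially"
      using eventually_ge_at_top[of "16 ^ h0"]
    proof eventually_elim
      case (elim n)
      have "1 \<le> n" using elim one_le_power[of "16 :: nat" h0] by linarith
      then obtain h where h: "16 ^ h \<le> n" "n < 16 ^ (h + 1)" using ex_power_ivl1[of 16 n] by auto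
      have "(16 :: nat) ^ h0 < 16 ^ (h + 1)" using elim h by linarith
      then have "h0 < h + 1" by (rule power_less_imp_less_exp[rotated]) simp
      then show ?case using h by (intro h0[of h]) auto
    qed
  qed
qed

end

section \<open>The lower half: second moments of tilted blocks\<close>

lemma texp_le_exp: "0 \<le> y \<Longrightarrow> texp Q y \<le> exp y"
proof -
  assume y: "0 \<le> y"
  obtain t where "exp y = texp Q y + (exp t / fact (2 * Q + 1)) * y ^ (2 * Q + 1)"
    using Maclaurin_exp_le[of y "2 * Q + 1"] unfolding texp_def by blast
  moreover have "0 \<le> (exp t / fact (2 * Q + 1)) * y ^ (2 * Q + 1)"
    using y by (intro mult_nonneg_nonneg) auto
  ultimately show ?thesis by linarith
qed

context matched
begin

text \<open>Second moment method for the exponentially tilted, truncated variables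
  \<open>W m = exp (\<nu> m * XS (T m)) / E (exp (\<nu> m * XS (T m)))\<close>. Cutting them off outside the window where the tilted
  law concentrates keeps their variance at \<open>exp (u\<^sup>2 / 2)\<close> instead of \<open>exp (u\<^sup>2)\<close>; positivity of
  the truncated exponential gives the upper bound for the correlations without cutting off.\<close>

lemma tilted_second_moment:
  fixes W :: "nat set" and T :: "nat \<Rightarrow> nat set" and \<nu> :: "nat \<Rightarrow> real"
  assumes W: "finite W" "W \<noteq> {}" and T: "\<And>m. m \<in> W \<Longrightarrow> T m \<subseteq> J"
      "\<And>m l. m \<in> W \<Longrightarrow> l \<in> W \<Longrightarrow> m \<noteq> l \<Longrightarrow> T m \<inter> T l = {}"
    and Q: "4 * Q \<le> p" "Q \<ge> 1" and \<epsilon>: "0 < \<epsilon>" "\<epsilon> \<le> 1 / 2" and \<delta>: "\<delta> = \<epsilon>\<^sup>2 / 12"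
    and A: "\<And>m. m \<in> W \<Longrightarrow> (\<nu> m)\<^sup>2 * C\<^sup>2 * card (T m) \<le> A"
    and up: "\<And>m \<kappa>. m \<in> W \<Longrightarrow> 0 \<le> \<kappa> \<Longrightarrow> \<kappa> \<le> 2 \<Longrightarrow> mgf (\<kappa> * \<nu> m) ^ card (T m) \<le> exp (\<kappa>\<^sup>2 * u\<^sup>2 * (1 + \<delta>) / 2)"
    and low: "\<And>m. m \<in> W \<Longrightarrow> exp (u\<^sup>2 * (1 - \<delta>) / 2) \<le> mgf (\<nu> m) ^ card (T m)"
    and E0: "6 * exp (- 2 * real Q) * exp (32 * A) \<le> E0" "E0 \<le> 1" and uQ: "(1 + \<epsilon>) * \<epsilon> * u\<^sup>2 \<le> Q / 4"
  shows "measure \<U> {x \<in> space \<U>. \<forall>m\<in>W. \<nu> m * XS (T m) x < (1 - \<epsilon>) * u\<^sup>2}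
    \<le> 2 * exp (u\<^sup>2 * (1 / 2 + \<epsilon> + \<delta> / 2)) / card W + 3 * E0 + 12 * exp (- (\<epsilon>\<^sup>2 * u\<^sup>2 / 3))"
proof -
  interpret U: prob_space \<U> by (rule prob_space_unit)
  define M where "M m = mgf (\<nu> m) ^ card (T m)" for m
  define y where "y m x = \<nu> m * XS (T m) x" for m x
  define Z where "Z m x = texp Q (y m x) / M m" for m x
  define I where "I m = {x \<in> space \<U>. (1 - \<epsilon>) * u\<^sup>2 \<le> y m x \<and> y m x \<le> (1 + \<epsilon>) * u\<^sup>2}" for m
  define Z' where "Z' m x = Z m x * indicator (I m) x" for m x
  define V where "V x = (\<Sum>m\<in>W. Z' m x)" for x
  define w where "w = real (card W)"
  define K where "K = exp (u\<^sup>2 * (1 / 2 + \<epsilon> + \<delta> / 2))"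
  define D where "D = exp (- (\<epsilon>\<^sup>2 * u\<^sup>2 / 3))"
  have w: "w > 0" using W by (simp add: w_def card_gt_0_iff)
  have \<epsilon>2: "\<epsilon>\<^sup>2 \<le> 1 / 4" using power_mono[OF \<epsilon>(2), of 2] \<epsilon> by (simp add: power_divide)
  have \<delta>01: "0 \<le> \<delta>" "\<delta> \<le> 1" using \<epsilon>2 by (auto simp: \<delta>)
  have u2: "0 \<le> u\<^sup>2" by simp
  have E0p: "0 \<le> E0" using E0(1) by (rule order_trans[rotated]) simp
  have Mlow: "exp (u\<^sup>2 * (1 - \<delta>) / 2) \<le> M m" if "m \<in> W" for m using low[OF that] by (simp add: M_def)
  have M1: "1 \<le> M m" if "m \<in> W" for m
  proof -
    have "0 \<le> u\<^sup>2 * (1 - \<delta>) / 2" using \<delta>01 u2 by (intro divide_nonneg_pos mult_nonneg_nonneg) auto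
    then have "1 \<le> exp (u\<^sup>2 * (1 - \<delta>) / 2)" by simp
    then show ?thesis using Mlow[OF that] by linarith
  qed
  have y_meas: "y m \<in> borel_measurable \<U>" if "m \<in> W" for m
    unfolding y_def[abs_def] using XS_meas[OF T(1)[OF that]] by (intro borel_measurable_times borel_measurable_const)
  have I_sets: "I m \<in> sets \<U>" if "m \<in> W" for m
    unfolding I_def using y_meas[OF that] by measurable
  have int2: "integrable \<U> (\<lambda>x. texp Q (a * XS (T m) x) * texp Q (b * XS (T l) x))" if "m \<in> W" "l \<in> W" for m l a b
    by (rule integrable_continuous2_X[where F="\<lambda>z. texp Q (a * fst z) * texp Q (b * snd z)",
        OF _ T(1)[OF that(1)] T(1)[OF that(2)], simplified])
       (unfold texp_def, intro continuous_intros, auto)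
  have int1: "integrable \<U> (\<lambda>x. texp Q (a * XS (T m) x))" if "m \<in> W" for m a
    by (rule integrable_continuous_X[OF texp_continuous T(1)[OF that]])
  have Zpos: "0 \<le> Z m x" if "m \<in> W" for m x
    unfolding Z_def using M1[OF that] texp_pos[of Q "y m x"] by (intro divide_nonneg_pos) auto
  have Zint: "integrable \<U> (Z m)" if "m \<in> W" for m
    unfolding Z_def[abs_def] y_def by (intro integrable_divide int1 that)
  have EZ: "1 - E0 \<le> (\<integral>x. Z m x \<partial>\<U>)" "(\<integral>x. Z m x \<partial>\<U>) \<le> 1 + E0" if m: "m \<in> W" for m
  proof -
    have "\<bar>(\<integral>x. texp Q (y m x) \<partial>\<U>) - M m\<bar> \<le> 2 * exp (- 2 * real Q) * exp (8 * ((\<nu> m)\<^sup>2 * C\<^sup>2 * card (T m)))"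
      unfolding y_def M_def match_texp1[OF T(1)[OF m] Q(1)] by (rule integral_texp_YS_diff[OF T(1)[OF m]])
    also have "\<dots> \<le> 6 * exp (- 2 * real Q) * exp (32 * A)"
    proof (intro mult_mono)
      have "0 \<le> (\<nu> m)\<^sup>2 * C\<^sup>2 * card (T m)" by simp
      then have "8 * ((\<nu> m)\<^sup>2 * C\<^sup>2 * card (T m)) \<le> 32 * A" using A[OF m] by linarith
      then show "exp (8 * ((\<nu> m)\<^sup>2 * C\<^sup>2 * card (T m))) \<le> exp (32 * A)" by (rule iffD2[OF exp_le_cancel_iff])
    qed auto
    also have "\<dots> \<le> E0" by (rule E0(1))
    finally have a: "\<bar>(\<integral>x. texp Q (y m x) \<partial>\<U>) - M m\<bar> \<le> E0" .
    have "E0 \<le> E0 * M m" using M1[OF m] E0p by (simp add: mult_le_cancel_left1)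
    with a have b: "(1 - E0) * M m \<le> (\<integral>x. texp Q (y m x) \<partial>\<U>)" "(\<integral>x. texp Q (y m x) \<partial>\<U>) \<le> (1 + E0) * M m"
      unfolding left_diff_distrib distrib_right by linarith+
    have c: "(\<integral>x. Z m x \<partial>\<U>) = (\<integral>x. texp Q (y m x) \<partial>\<U>) / M m"
      unfolding Z_def by (rule integral_divide_zero)
    have Mp: "0 < M m" using M1[OF m] by linarith
    show "1 - E0 \<le> (\<integral>x. Z m x \<partial>\<U>)" "(\<integral>x. Z m x \<partial>\<U>) \<le> 1 + E0"
      unfolding c using b Mp by (simp_all add: pos_le_divide_eq pos_divide_le_eq)
  qed
  \<comment> \<open>A further tilt by \<open>a\<close> equal to \<open>\<epsilon>\<close> or
    \<open>- \<epsilon>\<close> of an already tilted variable is a single exponential with parameter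
    \<open>(1 + a) * \<nu> m\<close>, up to the truncation error.\<close>
  have tilt: "(\<integral>x. texp Q (y m x) * texp Q (a * y m x) \<partial>\<U>) \<le> 2 * exp ((1 + a)\<^sup>2 * u\<^sup>2 * (1 + \<delta>) / 2)"
    if m: "m \<in> W" and a: "\<bar>a\<bar> = \<epsilon>" for m a
  proof -
    have "(a * \<nu> m)\<^sup>2 * C\<^sup>2 * card (T m) \<le> A"
    proof -
      have "a\<^sup>2 = \<epsilon>\<^sup>2" using a by (metis power2_abs)
      then have "(a * \<nu> m)\<^sup>2 * C\<^sup>2 * card (T m) = \<epsilon>\<^sup>2 * ((\<nu> m)\<^sup>2 * C\<^sup>2 * card (T m))"
        by (simp add: power_mult_distrib)
      also have "\<dots> \<le> 1 * ((\<nu> m)\<^sup>2 * C\<^sup>2 * card (T m))" using \<epsilon>2 by (intro mult_right_mono) auto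
      finally show ?thesis using A[OF m] by linarith
    qed
    from integral_texp_prod_le[OF T(1)[OF m] T(1)[OF m] Q(1) A[OF m] this]
    have "(\<integral>x. texp Q (y m x) * texp Q (a * y m x) \<partial>\<U>)
        \<le> (\<integral>v. exp (\<nu> m * YS (T m) v + (a * \<nu> m) * YS (T m) v) \<partial>\<P>) + 6 * exp (- 2 * real Q) * exp (32 * A)"
      unfolding y_def by (simp only: mult.assoc)
    also have "(\<lambda>v. exp (\<nu> m * YS (T m) v + (a * \<nu> m) * YS (T m) v)) = (\<lambda>v. exp (((1 + a) * \<nu> m) * YS (T m) v))"
      by (simp add: fun_eq_iff distrib_right)
    also have "(\<integral>v. exp (((1 + a) * \<nu> m) * YS (T m) v) \<partial>\<P>) = mgf ((1 + a) * \<nu> m) ^ card (T m)"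
      by (rule integral_exp_YS[OF T(1)[OF m]])
    finally have "(\<integral>x. texp Q (y m x) * texp Q (a * y m x) \<partial>\<U>) \<le> mgf ((1 + a) * \<nu> m) ^ card (T m) + E0"
      using E0(1) by linarith
    moreover have "mgf ((1 + a) * \<nu> m) ^ card (T m) \<le> exp ((1 + a)\<^sup>2 * u\<^sup>2 * (1 + \<delta>) / 2)"
      using a \<epsilon> by (intro up m) auto
    moreover have "1 \<le> exp ((1 + a)\<^sup>2 * u\<^sup>2 * (1 + \<delta>) / 2)" using \<delta>01 by simp
    ultimately show ?thesis using E0(2) by linarith
  qed
  \<comment> \<open>Chernoff exponents for the two flanks outside the window. The gain is
    \<open>\<epsilon>\<^sup>2 / 2\<close>, and \<open>\<delta> = \<epsilon>\<^sup>2 / 12\<close>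
    costs at most \<open>2 * \<delta>\<close>, which leaves
    \<open>\<epsilon>\<^sup>2 / 3\<close>.\<close>
  have expo1: "(1 + \<epsilon>)\<^sup>2 * u\<^sup>2 * (1 + \<delta>) / 2 - \<epsilon> * (1 + \<epsilon>) * u\<^sup>2 - u\<^sup>2 * (1 - \<delta>) / 2 \<le> - (\<epsilon>\<^sup>2 * u\<^sup>2 / 3)"
    and expo2: "(1 - \<epsilon>)\<^sup>2 * u\<^sup>2 * (1 + \<delta>) / 2 + \<epsilon> * (1 - \<epsilon>) * u\<^sup>2 - u\<^sup>2 * (1 - \<delta>) / 2 \<le> - (\<epsilon>\<^sup>2 * u\<^sup>2 / 3)"
  proof -
    have a: "(1 + \<epsilon>)\<^sup>2 * u\<^sup>2 * (1 + \<delta>) / 2 - \<epsilon> * (1 + \<epsilon>) * u\<^sup>2 - u\<^sup>2 * (1 - \<delta>) / 2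
        = u\<^sup>2 * (- (\<epsilon>\<^sup>2 / 2) + \<delta> * (((1 + \<epsilon>)\<^sup>2 + 1) / 2))" by (simp add: field_simps power2_eq_square)
    have b: "(1 - \<epsilon>)\<^sup>2 * u\<^sup>2 * (1 + \<delta>) / 2 + \<epsilon> * (1 - \<epsilon>) * u\<^sup>2 - u\<^sup>2 * (1 - \<delta>) / 2
        = u\<^sup>2 * (- (\<epsilon>\<^sup>2 / 2) + \<delta> * (((1 - \<epsilon>)\<^sup>2 + 1) / 2))" by (simp add: field_simps power2_eq_square)
    have "(1 + \<epsilon>)\<^sup>2 \<le> (3 / 2)\<^sup>2" using \<epsilon> by (intro power_mono) auto
    then have "\<delta> * (((1 + \<epsilon>)\<^sup>2 + 1) / 2) \<le> \<delta> * 2" using \<delta>01 by (intro mult_left_mono) (auto simp: power2_eq_square)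
    then have "u\<^sup>2 * (- (\<epsilon>\<^sup>2 / 2) + \<delta> * (((1 + \<epsilon>)\<^sup>2 + 1) / 2)) \<le> u\<^sup>2 * (- (\<epsilon>\<^sup>2 / 3))"
      by (intro mult_left_mono u2) (simp add: \<delta>)
    then show "(1 + \<epsilon>)\<^sup>2 * u\<^sup>2 * (1 + \<delta>) / 2 - \<epsilon> * (1 + \<epsilon>) * u\<^sup>2 - u\<^sup>2 * (1 - \<delta>) / 2 \<le> - (\<epsilon>\<^sup>2 * u\<^sup>2 / 3)"
      unfolding a by (simp add: mult.commute)
    have "(1 - \<epsilon>)\<^sup>2 \<le> 1\<^sup>2" using \<epsilon> by (intro power_mono) auto
    then have "\<delta> * (((1 - \<epsilon>)\<^sup>2 + 1) / 2) \<le> \<delta> * 2" using \<delta>01 by (intro mult_left_mono) auto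
    then have "u\<^sup>2 * (- (\<epsilon>\<^sup>2 / 2) + \<delta> * (((1 - \<epsilon>)\<^sup>2 + 1) / 2)) \<le> u\<^sup>2 * (- (\<epsilon>\<^sup>2 / 3))"
      by (intro mult_left_mono u2) (simp add: \<delta>)
    then show "(1 - \<epsilon>)\<^sup>2 * u\<^sup>2 * (1 + \<delta>) / 2 + \<epsilon> * (1 - \<epsilon>) * u\<^sup>2 - u\<^sup>2 * (1 - \<delta>) / 2 \<le> - (\<epsilon>\<^sup>2 * u\<^sup>2 / 3)"
      unfolding b by (simp add: mult.commute)
  qed
  \<comment> \<open>On the flank above the window the factor
    \<open>texp Q (\<epsilon> * y m x)\<close>, suitably normalised, is at least 1, and below the
    window the same holds for \<open>- \<epsilon>\<close>. The flanks therefore cost at most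
    \<open>4 * D\<close> and \<open>2 * D\<close>.\<close>
  have EZ': "1 - E0 - 6 * D \<le> (\<integral>x. Z' m x \<partial>\<U>)" if m: "m \<in> W" for m
  proof -
    let ?c1 = "2 * exp (- (\<epsilon> * (1 + \<epsilon>) * u\<^sup>2)) / M m" and ?c2 = "exp (\<epsilon> * (1 - \<epsilon>) * u\<^sup>2) / M m"
    let ?F = "\<lambda>x. Z' m x + (?c1 * (texp Q (y m x) * texp Q (\<epsilon> * y m x)) + ?c2 * (texp Q (y m x) * texp Q (- \<epsilon> * y m x)))"
    have Mp: "0 < M m" using M1[OF m] by linarith
    have iy: "integrable \<U> (\<lambda>x. texp Q (y m x) * texp Q (a * y m x))" for a
      using int2[OF m m, of "\<nu> m" "a * \<nu> m"] unfolding y_def by (simp only: mult.assoc)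
    have iZ': "integrable \<U> (Z' m)"
      unfolding Z'_def[abs_def] by (rule integrable_real_mult_indicator[OF I_sets[OF m] Zint[OF m]])
    have pt: "Z m x \<le> ?F x" if x: "x \<in> space \<U>" for x
    proof -
      have n1: "0 \<le> ?c1 * (texp Q (y m x) * texp Q (\<epsilon> * y m x))"
        using Mp texp_pos[of Q] by (intro mult_nonneg_nonneg divide_nonneg_pos) (auto intro: less_imp_le)
      have n2: "0 \<le> ?c2 * (texp Q (y m x) * texp Q (- \<epsilon> * y m x))"
        using Mp texp_pos[of Q] by (intro mult_nonneg_nonneg divide_nonneg_pos) (auto intro: less_imp_le)
      have n3: "0 \<le> Z' m x" unfolding Z'_def using Zpos[OF m] by (simp add: indicator_def)
      consider "x \<in> I m" | "(1 + \<epsilon>) * u\<^sup>2 < y m x" | "y m x < (1 - \<epsilon>) * u\<^sup>2"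
        using x unfolding I_def by fastforce
      then show ?thesis
      proof cases
        case 1
        then have "Z m x = Z' m x" by (simp add: Z'_def)
        then show ?thesis using n1 n2 by linarith
      next
        case 2
        have "exp (\<epsilon> * (1 + \<epsilon>) * u\<^sup>2) / 2 \<le> texp Q (\<epsilon> * (1 + \<epsilon>) * u\<^sup>2)"
          using uQ by (intro texp_ge_half_exp Q(2)) (simp add: mult_ac)
        also have "\<dots> \<le> texp Q (\<epsilon> * y m x)"
        proof (rule texp_mono)
          show "\<epsilon> * (1 + \<epsilon>) * u\<^sup>2 \<le> \<epsilon> * y m x" using 2 \<epsilon> by (simp add: mult.assoc)
        qed (use \<epsilon> in simp)
        finally have "exp (\<epsilon> * (1 + \<epsilon>) * u\<^sup>2) / 2 \<le> texp Q (\<epsilon> * y m x)" .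
        then have "2 * exp (- (\<epsilon> * (1 + \<epsilon>) * u\<^sup>2)) * (exp (\<epsilon> * (1 + \<epsilon>) * u\<^sup>2) / 2)
            \<le> 2 * exp (- (\<epsilon> * (1 + \<epsilon>) * u\<^sup>2)) * texp Q (\<epsilon> * y m x)" by (intro mult_left_mono) auto
        moreover have "2 * exp (- (\<epsilon> * (1 + \<epsilon>) * u\<^sup>2)) * (exp (\<epsilon> * (1 + \<epsilon>) * u\<^sup>2) / 2) = 1"
          by (simp add: exp_minus)
        ultimately have "1 \<le> 2 * exp (- (\<epsilon> * (1 + \<epsilon>) * u\<^sup>2)) * texp Q (\<epsilon> * y m x)" by linarith
        then have "Z m x * 1 \<le> Z m x * (2 * exp (- (\<epsilon> * (1 + \<epsilon>) * u\<^sup>2)) * texp Q (\<epsilon> * y m x))"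
          by (rule mult_left_mono[OF _ Zpos[OF m]])
        also have "\<dots> = ?c1 * (texp Q (y m x) * texp Q (\<epsilon> * y m x))" by (simp add: Z_def)
        finally show ?thesis using n2 n3 by linarith
      next
        case 3
        \<comment> \<open>\<open>texp\<close> dominates \<open>exp\<close> for nonpositive
          arguments, that is for \<open>y m x \<ge> 0\<close>; for negative \<open>y m x\<close> the
          bound 1 is enough.\<close>
        have "exp (- (\<epsilon> * (1 - \<epsilon>) * u\<^sup>2)) \<le> texp Q (- \<epsilon> * y m x)"
        proof (cases "0 \<le> y m x")
          case True
          have "\<epsilon> * y m x \<le> \<epsilon> * ((1 - \<epsilon>) * u\<^sup>2)" using 3 \<epsilon> by (intro mult_left_mono) auto
          then have "exp (- (\<epsilon> * (1 - \<epsilon>) * u\<^sup>2)) \<le> exp (- \<epsilon> * y m x)" by (simp add: mult.assoc)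
          also have "\<dots> \<le> texp Q (- \<epsilon> * y m x)" using True \<epsilon> by (intro texp_ge_exp) auto
          finally show ?thesis .
        next
          case False
          have "exp (- (\<epsilon> * (1 - \<epsilon>) * u\<^sup>2)) \<le> 1" using \<epsilon> by simp
          also have "1 \<le> texp Q (- \<epsilon> * y m x)" using False \<epsilon> by (intro texp_ge_1) (simp add: mult_nonneg_nonpos)
          finally show ?thesis .
        qed
        then have "exp (\<epsilon> * (1 - \<epsilon>) * u\<^sup>2) * exp (- (\<epsilon> * (1 - \<epsilon>) * u\<^sup>2))
            \<le> exp (\<epsilon> * (1 - \<epsilon>) * u\<^sup>2) * texp Q (- \<epsilon> * y m x)" by (intro mult_left_mono) auto
        moreover have "exp (\<epsilon> * (1 - \<epsilon>) * u\<^sup>2) * exp (- (\<epsilon> * (1 - \<epsilon>) * u\<^sup>2)) = 1" by (simp add: exp_minus)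
        ultimately have "1 \<le> exp (\<epsilon> * (1 - \<epsilon>) * u\<^sup>2) * texp Q (- \<epsilon> * y m x)" by linarith
        then have "Z m x * 1 \<le> Z m x * (exp (\<epsilon> * (1 - \<epsilon>) * u\<^sup>2) * texp Q (- \<epsilon> * y m x))"
          by (rule mult_left_mono[OF _ Zpos[OF m]])
        also have "\<dots> = ?c2 * (texp Q (y m x) * texp Q (- \<epsilon> * y m x))" by (simp add: Z_def)
        finally show ?thesis using n1 n3 by linarith
      qed
    qed
    define F1 where "F1 x = texp Q (y m x) * texp Q (\<epsilon> * y m x)" for x
    define F2 where "F2 x = texp Q (y m x) * texp Q (- \<epsilon> * y m x)" for x
    define k1 where "k1 = ?c1"
    define k2 where "k2 = ?c2"
    have iF1: "integrable \<U> (\<lambda>x. k1 * F1 x)" and iF2: "integrable \<U> (\<lambda>x. k2 * F2 x)"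
      unfolding F1_def F2_def by (rule integrable_mult_right[OF iy])+
    have iF12: "integrable \<U> (\<lambda>x. k1 * F1 x + k2 * F2 x)"
      by (rule Bochner_Integration.integrable_add[OF iF1 iF2])
    have F0: "(\<integral>x. Z m x \<partial>\<U>) \<le> (\<integral>x. Z' m x + (k1 * F1 x + k2 * F2 x) \<partial>\<U>)"
      using pt by (intro integral_mono[OF Zint[OF m] Bochner_Integration.integrable_add[OF iZ' iF12]])
        (simp only: F1_def F2_def k1_def k2_def)
    have F3: "(\<integral>x. Z' m x + (k1 * F1 x + k2 * F2 x) \<partial>\<U>) = (\<integral>x. Z' m x \<partial>\<U>) + (\<integral>x. k1 * F1 x + k2 * F2 x \<partial>\<U>)"
      by (rule Bochner_Integration.integral_add[OF iZ' iF12])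
    have F4: "(\<integral>x. k1 * F1 x + k2 * F2 x \<partial>\<U>) = (\<integral>x. k1 * F1 x \<partial>\<U>) + (\<integral>x. k2 * F2 x \<partial>\<U>)"
      by (rule Bochner_Integration.integral_add[OF iF1 iF2])
    have F5: "(\<integral>x. k1 * F1 x \<partial>\<U>) = k1 * (\<integral>x. F1 x \<partial>\<U>)" "(\<integral>x. k2 * F2 x \<partial>\<U>) = k2 * (\<integral>x. F2 x \<partial>\<U>)"
      by (rule integral_mult_right_zero)+
    have F: "(\<integral>x. Z m x \<partial>\<U>) \<le> (\<integral>x. Z' m x \<partial>\<U>) + (k1 * (\<integral>x. F1 x \<partial>\<U>) + k2 * (\<integral>x. F2 x \<partial>\<U>))"
      using F0 F3 F4 F5 by linarith
    have Minv: "1 / M m \<le> exp (- (u\<^sup>2 * (1 - \<delta>) / 2))"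
      unfolding exp_minus inverse_eq_divide using Mlow[OF m] Mp by (intro divide_left_mono mult_pos_pos) auto
    have b1': "?c1 * (\<integral>x. texp Q (y m x) * texp Q (\<epsilon> * y m x) \<partial>\<U>) \<le> 4 * D"
    proof -
      have "?c1 * (\<integral>x. texp Q (y m x) * texp Q (\<epsilon> * y m x) \<partial>\<U>)
          \<le> ?c1 * (2 * exp ((1 + \<epsilon>)\<^sup>2 * u\<^sup>2 * (1 + \<delta>) / 2))"
        using \<epsilon> Mp by (intro mult_left_mono tilt m) auto
      also have "\<dots> = 4 * (exp (- (\<epsilon> * (1 + \<epsilon>) * u\<^sup>2)) * exp ((1 + \<epsilon>)\<^sup>2 * u\<^sup>2 * (1 + \<delta>) / 2)) * (1 / M m)" by simp
      also have "\<dots> \<le> 4 * (exp (- (\<epsilon> * (1 + \<epsilon>) * u\<^sup>2)) * exp ((1 + \<epsilon>)\<^sup>2 * u\<^sup>2 * (1 + \<delta>) / 2)) * exp (- (u\<^sup>2 * (1 - \<delta>) / 2))"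
        by (intro mult_left_mono Minv) auto
      also have "\<dots> = 4 * exp ((1 + \<epsilon>)\<^sup>2 * u\<^sup>2 * (1 + \<delta>) / 2 - \<epsilon> * (1 + \<epsilon>) * u\<^sup>2 - u\<^sup>2 * (1 - \<delta>) / 2)"
        unfolding mult.assoc mult_exp_exp by (simp add: algebra_simps)
      also have "\<dots> \<le> 4 * D" unfolding D_def using expo1 by simp
      finally show ?thesis .
    qed
    have b1: "k1 * (\<integral>x. F1 x \<partial>\<U>) \<le> 4 * D"
      unfolding k1_def F1_def by (rule b1')
    have b2': "?c2 * (\<integral>x. texp Q (y m x) * texp Q (- \<epsilon> * y m x) \<partial>\<U>) \<le> 2 * D"
    proof -
      have "?c2 * (\<integral>x. texp Q (y m x) * texp Q (- \<epsilon> * y m x) \<partial>\<U>)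
          \<le> ?c2 * (2 * exp ((1 + - \<epsilon>)\<^sup>2 * u\<^sup>2 * (1 + \<delta>) / 2))"
        using \<epsilon> Mp by (intro mult_left_mono tilt m) auto
      also have "\<dots> = 2 * (exp (\<epsilon> * (1 - \<epsilon>) * u\<^sup>2) * exp ((1 - \<epsilon>)\<^sup>2 * u\<^sup>2 * (1 + \<delta>) / 2)) * (1 / M m)" by simp
      also have "\<dots> \<le> 2 * (exp (\<epsilon> * (1 - \<epsilon>) * u\<^sup>2) * exp ((1 - \<epsilon>)\<^sup>2 * u\<^sup>2 * (1 + \<delta>) / 2)) * exp (- (u\<^sup>2 * (1 - \<delta>) / 2))"
        by (intro mult_left_mono Minv) auto
      also have "\<dots> = 2 * exp ((1 - \<epsilon>)\<^sup>2 * u\<^sup>2 * (1 + \<delta>) / 2 + \<epsilon> * (1 - \<epsilon>) * u\<^sup>2 - u\<^sup>2 * (1 - \<delta>) / 2)"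
        unfolding mult.assoc mult_exp_exp by (simp add: algebra_simps)
      also have "\<dots> \<le> 2 * D" unfolding D_def using expo2 by simp
      finally show ?thesis .
    qed
    have b2: "k2 * (\<integral>x. F2 x \<partial>\<U>) \<le> 2 * D"
      unfolding k2_def F2_def by (rule b2')
    from F b1 b2 EZ(1)[OF m] show ?thesis by linarith
  qed
  have Z'_le_Z: "Z' m x \<le> Z m x" "0 \<le> Z' m x" if "m \<in> W" for m x
    unfolding Z'_def using Zpos[OF that, of x] by (auto simp: indicator_def)
  \<comment> \<open>Upper end of the window against the lower bound for \<open>M m\<close>:
    \<open>(1 + \<epsilon>) - (1 - \<delta>) / 2 = 1 / 2 + \<epsilon> + \<delta> /
    2\<close>.\<close>
  have Z'_le_K: "Z' m x \<le> K" if m: "m \<in> W" for m x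
  proof (cases "x \<in> I m")
    case True
    then have yb: "(1 - \<epsilon>) * u\<^sup>2 \<le> y m x" "y m x \<le> (1 + \<epsilon>) * u\<^sup>2" by (auto simp: I_def)
    have "0 \<le> (1 - \<epsilon>) * u\<^sup>2" using \<epsilon> by (intro mult_nonneg_nonneg) auto
    then have "texp Q (y m x) \<le> exp (y m x)" using yb by (intro texp_le_exp) linarith
    also have "\<dots> \<le> exp ((1 + \<epsilon>) * u\<^sup>2)" using yb by simp
    finally have "Z m x \<le> exp ((1 + \<epsilon>) * u\<^sup>2) / exp (u\<^sup>2 * (1 - \<delta>) / 2)"
      unfolding Z_def using Mlow[OF m] by (intro frac_le) auto
    also have "\<dots> = K" unfolding K_def exp_diff[symmetric] by (simp add: field_simps)
    finally show ?thesis using True by (simp add: Z'_def)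
  next
    case False
    then show ?thesis by (simp add: Z'_def K_def)
  qed
  have iZ': "integrable \<U> (Z' m)" if "m \<in> W" for m
    unfolding Z'_def[abs_def] by (rule integrable_real_mult_indicator[OF I_sets[OF that] Zint[OF that]])
  have iZZ: "integrable \<U> (\<lambda>x. Z' m x * Z' l x)" if "m \<in> W" "l \<in> W" for m l
  proof (rule integrable_bounded_prob[OF prob_space_unit])
    show "(\<lambda>x. Z' m x * Z' l x) \<in> borel_measurable \<U>"
      using iZ'[OF that(1)] iZ'[OF that(2)] by (intro borel_measurable_times borel_measurable_integrable)
    show "norm (Z' m x * Z' l x) \<le> K * K" for x
      using Z'_le_K[OF that(1), of x] Z'_le_K[OF that(2), of x] Z'_le_Z(2)[OF that(1), of x] Z'_le_Z(2)[OF that(2), of x]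
      by (simp add: mult_mono)
  qed
  have diag: "(\<integral>x. Z' m x * Z' m x \<partial>\<U>) \<le> 2 * K" if m: "m \<in> W" for m
  proof -
    have "(\<integral>x. Z' m x * Z' m x \<partial>\<U>) \<le> (\<integral>x. K * Z m x \<partial>\<U>)"
      using Z'_le_K[OF m] Z'_le_Z[OF m]
      by (intro integral_mono iZZ m integrable_mult_right Zint mult_mono) (auto simp: K_def)
    also have "\<dots> = K * (\<integral>x. Z m x \<partial>\<U>)" by (rule integral_mult_right_zero)
    also have "\<dots> \<le> K * 2" using EZ(2)[OF m] E0(2) by (intro mult_left_mono) (auto simp: K_def)
    finally show ?thesis by simp
  qed
  have offdiag: "(\<integral>x. Z' m x * Z' l x \<partial>\<U>) \<le> 1 + E0" if ml: "m \<in> W" "l \<in> W" "m \<noteq> l" for m l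
  proof -
    have iz: "integrable \<U> (\<lambda>x. (texp Q (y m x) * texp Q (y l x)) / (M m * M l))"
      unfolding y_def by (intro integrable_divide int2 ml)
    have "(\<integral>x. Z' m x * Z' l x \<partial>\<U>) \<le> (\<integral>x. (texp Q (y m x) * texp Q (y l x)) / (M m * M l) \<partial>\<U>)"
    proof (intro integral_mono iZZ ml iz)
      fix x
      have "Z' m x * Z' l x \<le> Z m x * Z l x"
        using Z'_le_Z[OF ml(1), of x] Z'_le_Z[OF ml(2), of x] Zpos[OF ml(1), of x] by (intro mult_mono) auto
      then show "Z' m x * Z' l x \<le> (texp Q (y m x) * texp Q (y l x)) / (M m * M l)" by (simp add: Z_def)
    qed
    also have "\<dots> = (\<integral>x. texp Q (y m x) * texp Q (y l x) \<partial>\<U>) / (M m * M l)" by (rule integral_divide_zero)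
    also have "\<dots> \<le> (M m * M l + E0) / (M m * M l)"
    proof (rule divide_right_mono)
      have "(\<integral>x. texp Q (y m x) * texp Q (y l x) \<partial>\<U>)
        \<le> (\<integral>v. exp (\<nu> m * YS (T m) v + \<nu> l * YS (T l) v) \<partial>\<P>) + 6 * exp (- 2 * real Q) * exp (32 * A)"
        unfolding y_def by (intro integral_texp_prod_le T ml Q A)
      also have "(\<integral>v. exp (\<nu> m * YS (T m) v + \<nu> l * YS (T l) v) \<partial>\<P>) = M m * M l"
        unfolding M_def by (intro integral_exp_YS2 T ml)
      finally show "(\<integral>x. texp Q (y m x) * texp Q (y l x) \<partial>\<U>) \<le> M m * M l + E0" using E0(1) by linarith
      show "0 \<le> M m * M l" using M1[OF ml(1)] M1[OF ml(2)] by simp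
    qed
    also have "\<dots> \<le> 1 + E0"
    proof -
      have MM: "1 \<le> M m * M l" using mult_mono[OF M1[OF ml(1)] M1[OF ml(2)]] M1[OF ml(1)] by simp
      then have ne: "M m * M l \<noteq> 0" by linarith
      have "(M m * M l + E0) / (M m * M l) = 1 + E0 / (M m * M l)"
        unfolding add_divide_distrib divide_self[OF ne] ..
      also have "E0 / (M m * M l) \<le> E0 / 1" using MM E0p by (intro divide_left_mono) auto
      finally show ?thesis by simp
    qed
    finally show ?thesis .
  qed
  have iV: "integrable \<U> V" unfolding V_def[abs_def] by (intro Bochner_Integration.integrable_sum iZ')
  have VV: "V x * V x = (\<Sum>m\<in>W. \<Sum>l\<in>W. Z' m x * Z' l x)" for x
    unfolding V_def by (rule sum_product)
  have iVV: "integrable \<U> (\<lambda>x. V x * V x)"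
    unfolding VV by (intro Bochner_Integration.integrable_sum iZZ)
  have EV: "w * (1 - E0 - 6 * D) \<le> (\<integral>x. V x \<partial>\<U>)"
  proof -
    have "w * (1 - E0 - 6 * D) = (\<Sum>m\<in>W. 1 - E0 - 6 * D)" by (simp add: w_def)
    also have "\<dots> \<le> (\<Sum>m\<in>W. \<integral>x. Z' m x \<partial>\<U>)" by (intro sum_mono EZ')
    also have "\<dots> = (\<integral>x. V x \<partial>\<U>)" unfolding V_def by (rule Bochner_Integration.integral_sum[symmetric, OF iZ'])
    finally show ?thesis .
  qed
  have EVV: "(\<integral>x. V x * V x \<partial>\<U>) \<le> w * (2 * K) + w * w * (1 + E0)"
  proof -
    have "(\<integral>x. V x * V x \<partial>\<U>) = (\<Sum>m\<in>W. \<integral>x. (\<Sum>l\<in>W. Z' m x * Z' l x) \<partial>\<U>)"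
      unfolding VV by (intro Bochner_Integration.integral_sum Bochner_Integration.integrable_sum iZZ)
    also have "\<dots> = (\<Sum>m\<in>W. \<Sum>l\<in>W. \<integral>x. Z' m x * Z' l x \<partial>\<U>)"
      by (intro sum.cong refl Bochner_Integration.integral_sum iZZ)
    also have "\<dots> \<le> (\<Sum>m\<in>W. \<Sum>l\<in>W. (if m = l then 2 * K else 0) + (1 + E0))"
    proof (intro sum_mono)
      fix m l assume ml: "m \<in> W" "l \<in> W"
      show "(\<integral>x. Z' m x * Z' l x \<partial>\<U>) \<le> (if m = l then 2 * K else 0) + (1 + E0)"
        using diag[OF ml(1)] offdiag[OF ml] E0p by (cases "m = l") auto
    qed
    also have "\<dots> = (\<Sum>m\<in>W. 2 * K + w * (1 + E0))"
      using W(1) by (intro sum.cong refl) (simp add: sum.distrib w_def)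
    also have "\<dots> = w * (2 * K) + w * w * (1 + E0)" by (simp add: w_def distrib_left)
    finally show ?thesis .
  qed
  \<comment> \<open>Chebyshev's inequality, centred at \<open>w\<close> instead of the exact mean of
    \<open>V\<close>: on the event in question \<open>V\<close> vanishes and \<open>?F\<close>
    equals 1.\<close>
  let ?F = "\<lambda>x. (V x * V x - 2 * w * V x + w * w) / (w * w)"
  have iF: "integrable \<U> ?F"
    by (intro integrable_divide Bochner_Integration.integrable_add Bochner_Integration.integrable_diff iVV
        integrable_mult_right iV U.integrable_const)
  have "measure \<U> {x \<in> space \<U>. \<forall>m\<in>W. \<nu> m * XS (T m) x < (1 - \<epsilon>) * u\<^sup>2} \<le> (\<integral>x. ?F x \<partial>\<U>)"
  proof (rule prob_le_integral[OF prob_space_unit _ iF])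
    have "{x \<in> space \<U>. \<forall>m\<in>W. y m x < (1 - \<epsilon>) * u\<^sup>2} \<in> sets \<U>"
    proof (rule sets.sets_Collect_finite_All[OF _ W(1)])
      show "{x \<in> space \<U>. y m x < (1 - \<epsilon>) * u\<^sup>2} \<in> sets \<U>" if "m \<in> W" for m
        using y_meas[OF that] by measurable
    qed
    then show "Measurable.pred \<U> (\<lambda>x. \<forall>m\<in>W. \<nu> m * XS (T m) x < (1 - \<epsilon>) * u\<^sup>2)"
      unfolding y_def pred_def .
    have sq: "?F x = (V x - w)\<^sup>2 / (w * w)" for x by (simp add: power2_eq_square algebra_simps)
    show "0 \<le> ?F x" for x unfolding sq by simp
    show "1 \<le> ?F x" if "\<forall>m\<in>W. \<nu> m * XS (T m) x < (1 - \<epsilon>) * u\<^sup>2" for x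
    proof -
      have "Z' m x = 0" if "m \<in> W" for m
        using \<open>\<forall>m\<in>W. \<nu> m * XS (T m) x < (1 - \<epsilon>) * u\<^sup>2\<close> that unfolding Z'_def I_def y_def by fastforce
      then have "V x = 0" by (simp add: V_def)
      then show ?thesis using w by simp
    qed
  qed
  also have "\<dots> = ((\<integral>x. V x * V x \<partial>\<U>) - 2 * w * (\<integral>x. V x \<partial>\<U>) + w * w) / (w * w)"
    using iV iVV U.prob_space
    by (simp only: integral_divide_zero Bochner_Integration.integral_add Bochner_Integration.integral_diff
        Bochner_Integration.integrable_diff integrable_mult_right U.integrable_const integral_mult_right_zero)
       simp
  also have "\<dots> \<le> (w * (2 * K) + w * w * (1 + E0) - 2 * w * (w * (1 - E0 - 6 * D)) + w * w) / (w * w)"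
    using EVV EV w by (intro divide_right_mono add_mono diff_mono mult_left_mono) auto
  also have "\<dots> = 2 * K / w + 3 * E0 + 12 * D" using w by (simp add: field_simps)
  finally show ?thesis by (simp add: K_def D_def w_def)
qed

end

text \<open>Takes the place of the second Borel-Cantelli lemma, as different scales are not
  independent: the intersection of all late \<open>N h\<close> is contained in each of them, hence
  has measure 0.\<close>

lemma AE_infinitely_often:
  fixes N :: "nat \<Rightarrow> 'a set"
  assumes M: "prob_space M" and sets: "\<And>h. N h \<in> sets M" and lim: "(\<lambda>h. measure M (N h)) \<longlonglongrightarrow> 0"
  shows "AE x in M. \<exists>\<^sub>F h in sequentially. x \<notin> N h"
proof -
  interpret prob_space M by fact
  have "AE x in M. x \<notin> (\<Inter>h\<in>{k..}. N h)" for k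
  proof (rule AE_not_in)
    have s: "(\<Inter>h\<in>{k..}. N h) \<in> sets M" using sets by (intro sets.countable_INT) auto
    have "measure M (\<Inter>h\<in>{k..}. N h) \<le> 0"
    proof (rule tendsto_lowerbound[OF lim])
      show "eventually (\<lambda>h. measure M (\<Inter>h\<in>{k..}. N h) \<le> measure M (N h)) sequentially"
        using eventually_ge_at_top[of k]
        by eventually_elim (intro finite_measure_mono sets, auto)
    qed simp
    then have "measure M (\<Inter>h\<in>{k..}. N h) = 0" by (simp add: measure_le_0_iff)
    then show "(\<Inter>h\<in>{k..}. N h) \<in> null_sets M" using s by (simp add: null_sets_def emeasure_eq_measure)
  qed
  then have "AE x in M. \<forall>k. x \<notin> (\<Inter>h\<in>{k..}. N h)" by (simp add: AE_all_countable)
  then show ?thesis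
    by (rule AE_mp) (auto intro!: AE_I2 simp: frequently_sequentially)
qed

context permuted_sequence_lil
begin

text \<open>Scale \<open>h\<close> offers \<open>4 * h\<close> disjoint blocks, while the variance
  term of the second moment estimate grows only like a power of \<open>h\<close> with exponent below
  1. All blocks end between the fourth and the eighth power of \<open>B = L ^ h\<close>, so one
  threshold and one approximation serve them all.\<close>

lemma window_event:
  assumes \<tau>2: "\<tau>2 > 0" and L: "L \<ge> 2" and \<epsilon>: "0 < \<epsilon>" "\<epsilon> \<le> 1 / 2"
  defines "T \<equiv> \<lambda>h m. hi (L ^ h) {L ^ m<..L ^ Suc m}"
  defines "v \<equiv> \<lambda>h. (1 - \<epsilon>) * sqrt \<tau>2 * sqrt (2 / (1 + 4 * \<epsilon>) * ln (real h))"
  shows "AE x in \<U>. \<exists>\<^sub>F h in sequentially. \<exists>m\<in>{4 * h..<8 * h}.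
    v h * sqrt (card (T h m)) \<le> G (L ^ h) {L ^ m<..L ^ Suc m} x"
proof -
  define u where "u h = sqrt (2 / (1 + 4 * \<epsilon>) * ln (real h))" for h :: nat
  define \<nu> where "\<nu> h m = u h / (sqrt \<tau>2 * sqrt (card (T h m)))" for h m
  define \<delta> where "\<delta> = \<epsilon>\<^sup>2 / 12"
  define N where "N h = {x \<in> space \<U>. \<forall>m\<in>{4 * h..<8 * h}.
      G (L ^ h) {L ^ m<..L ^ Suc m} x < v h * sqrt (card (T h m))}" for h
  have B1: "1 \<le> L ^ h" for h using L by simp
  have N_sets: "N h \<in> sets \<U>" for h
    unfolding N_def
  proof (intro sets.sets_Collect_finite_All)
    fix m
    show "{x \<in> space \<U>. G (L ^ h) {L ^ m<..L ^ Suc m} x < v h * sqrt (card (T h m))} \<in> sets \<U>"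
      using G_meas[OF B1, of h "{L ^ m<..L ^ Suc m}"] by measurable
  qed simp
  have s\<tau>: "sqrt \<tau>2 > 0" "sqrt \<tau>2 * sqrt \<tau>2 = \<tau>2" using \<tau>2 by auto
  have \<delta>: "\<delta> > 0" "\<delta> \<le> 1" using \<epsilon> power_mono[OF \<epsilon>(2), of 2] by (auto simp: \<delta>_def power2_eq_square)
  \<comment> \<open>\<open>b * (1 / 2 + 2 * \<epsilon>) = 1\<close>, which puts the exponent
    \<open>p\<close> of the variance term below 1, so that \<open>h powr p\<close> loses against the
    number of blocks.\<close>
  define b where "b = 2 / (1 + 4 * \<epsilon>)"
  have b: "b > 0" "b < 2" using \<epsilon> by (auto simp: b_def field_simps)
  have u_b: "u h = sqrt (b * ln (real h))" for h by (simp add: u_def b_def)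
  define a where "a = C / sqrt \<tau>2"
  have a: "a > 0" using C1 s\<tau> by (simp add: a_def)
  define p where "p = b * (1 / 2 + \<epsilon> + \<delta> / 2)"
  have p1: "p < 1"
  proof -
    have "\<delta> / 2 < \<epsilon>"
    proof -
      have "\<epsilon>\<^sup>2 \<le> \<epsilon> * 1" unfolding power2_eq_square using \<epsilon> by (intro mult_left_mono) auto
      then show ?thesis using \<epsilon> by (simp add: \<delta>_def)
    qed
    then have "b * (1 / 2 + \<epsilon> + \<delta> / 2) < b * (1 / 2 + 2 * \<epsilon>)" using b by (intro mult_strict_left_mono) auto
    also have "\<dots> = 1" using \<epsilon> by (simp add: b_def field_simps)
    finally show ?thesis unfolding p_def .
  qed
  define E where "E h = exp (- (ln (real h))\<^sup>2)" for h :: nat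
  have e1: "eventually (\<lambda>h. 2 * (u h * a) / 2 ^ h \<le> 1 / 2) sequentially"
    unfolding u_b using b a by real_asymp
  have e2: "eventually (\<lambda>h. 4 * (u h * a) ^ 3 / 2 ^ h \<le> \<delta> * (u h)\<^sup>2 / 4) sequentially"
    unfolding u_b using b a \<delta> by real_asymp
  \<comment> \<open>Makes the truncation error at most \<open>E h\<close>; the summand 2 pays for
    the factor 6 through \<open>6 \<le> exp 2\<close>.\<close>
  have e3: "eventually (\<lambda>h. 32 * (u h * a)\<^sup>2 + 2 \<le> (ln (real h))\<^sup>2) sequentially"
    unfolding u_b using b a by real_asymp
  have e4: "eventually (\<lambda>h. (1 + \<epsilon>) * \<epsilon> * (u h)\<^sup>2 \<le> (ln (real h))\<^sup>2 / 4) sequentially"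
    unfolding u_b using b \<epsilon>(1) by real_asymp
  have e5: "eventually (\<lambda>h. ln (real h) \<ge> 1) sequentially" by real_asymp
  have e6: "eventually (\<lambda>h. (1 - \<delta> / 2) * \<tau>2 < s2 (L ^ h)) sequentially"
    and e7: "eventually (\<lambda>h. s2 (L ^ h) < (1 + \<delta> / 2) * \<tau>2) sequentially"
  proof -
    have "filterlim (\<lambda>h. L ^ h) at_top sequentially"
    proof (rule filterlim_at_top_mono[OF filterlim_ident])
      show "eventually (\<lambda>h. h \<le> L ^ h) sequentially"
      proof (rule always_eventually, rule allI)
        fix h :: nat
        have "h \<le> 2 ^ h" by (rule less_imp_le[OF less_exp])
        also have "\<dots> \<le> L ^ h" using L by (intro power_mono) auto
        finally show "h \<le> L ^ h" .
      qed
    qed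
    then have lim: "(\<lambda>h. s2 (L ^ h)) \<longlonglongrightarrow> \<tau>2" by (rule filterlim_compose[OF s2_tendsto])
    have "(1 - \<delta> / 2) * \<tau>2 < 1 * \<tau>2" "1 * \<tau>2 < (1 + \<delta> / 2) * \<tau>2"
      using \<tau>2 \<delta> by (intro mult_strict_right_mono, simp, simp)+
    with lim show "eventually (\<lambda>h. (1 - \<delta> / 2) * \<tau>2 < s2 (L ^ h)) sequentially"
      and "eventually (\<lambda>h. s2 (L ^ h) < (1 + \<delta> / 2) * \<tau>2) sequentially"
      by (auto intro: order_tendstoD)
  qed
  have bound: "eventually (\<lambda>h. norm (measure \<U> (N h))
      \<le> 2 * real h powr p / (4 * real h) + 3 * E h + 12 * exp (- (\<epsilon>\<^sup>2 * (u h)\<^sup>2 / 3))) sequentially"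
    using eventually_scale[OF L] e1 e2 e3 e4 e5 e6 e7 eventually_ge_at_top[of 1]
  proof eventually_elim
    case (elim h)
    let ?B = "L ^ h"
    have lnh: "1 \<le> ln (real h)" and h0: "1 \<le> h" using elim by auto
    have u: "u h > 0"
    proof -
      have "0 < b * ln (real h)" using lnh b by (intro mult_pos_pos) linarith+
      then show ?thesis unfolding u_b by (simp only: real_sqrt_gt_0_iff)
    qed
    have sc: "good ?B" "4 * Qh h \<le> ?B" "real (4 * Qh h) \<le> R ?B" "Qh h \<ge> 1" using elim(1) by auto
    have B0: "?B \<ge> i\<^sub>0" using sc(1) by (simp add: good_def)
    let ?P = "{1..L ^ (8 * h)}"
    have P: "finite ?P" "?P \<subseteq> {1..}" by auto
    interpret m: matched "hi ?B ?P" "4 * Qh h" "\<lambda>i x. app ?B (of_int (n i) * x)" "app ?B" C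
      by (rule matched[OF P B1 B0 sc(2,3)])
    have XS: "m.XS (hi ?B P') = G ?B P'" for P'
      by (rule XS_eq_G[OF P B1 B0 sc(3,2)])
    have blk: "finite {L ^ m<..L ^ Suc m}" "{L ^ m<..L ^ Suc m} \<subseteq> {1..}" for m by auto
    \<comment> \<open>A block has at least \<open>L ^ (4 * h)\<close> positions, of which at most
      \<open>L ^ h\<close> are dropped.\<close>
    have card_ge: "2 ^ h \<le> sqrt (card (T h m))" if m: "m \<in> {4 * h..<8 * h}" for m
    proof -
      have "L ^ h * 1 \<le> L ^ h * L ^ (2 * h)" using L by (intro mult_left_mono) auto
      also have "\<dots> = L ^ (3 * h)" by (simp add: power_add[symmetric])
      finally have 1: "L ^ h \<le> L ^ (3 * h)" by simp
      have "L ^ (3 * h) * 2 \<le> L ^ (3 * h) * L ^ h"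
      proof (rule mult_left_mono)
        have "L ^ 1 \<le> L ^ h" using h0 L by (intro power_increasing) auto
        then show "2 \<le> L ^ h" using L by simp
      qed simp
      also have "\<dots> = L ^ (4 * h)" by (simp add: power_add[symmetric])
      also have "\<dots> \<le> L ^ m" using m L by (intro power_increasing) auto
      finally have 2: "2 * L ^ (3 * h) \<le> L ^ m" by simp
      have "2 * L ^ m \<le> L ^ Suc m" using L by simp
      then have "L ^ m \<le> card {L ^ m<..L ^ Suc m}" unfolding card_greaterThanAtMost by linarith
      also have "\<dots> \<le> card (T h m) + L ^ h" unfolding T_def by (rule hi_simps(3)[OF blk])
      finally have 3: "L ^ (3 * h) \<le> card (T h m)" using 1 2 by linarith
      have "(2 ^ h) ^ 2 = (2 :: nat) ^ (2 * h)" by (simp add: power_mult[symmetric] mult.commute)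
      also have "\<dots> \<le> 2 ^ (3 * h)" by (intro power_increasing) auto
      also have "\<dots> \<le> L ^ (3 * h)" using L by (intro power_mono) auto
      finally have "(2 ^ h) ^ 2 \<le> card (T h m)" using 3 by linarith
      then have "real ((2 ^ h) ^ 2) \<le> real (card (T h m))" by (simp only: of_nat_le_iff)
      then show ?thesis by (intro real_le_rsqrt) simp
    qed
    have \<nu>: "\<nu> h m > 0" "\<nu> h m * C \<le> u h * a / 2 ^ h" "(\<nu> h m)\<^sup>2 * card (T h m) = (u h)\<^sup>2 / \<tau>2"
        "card (T h m) * (\<nu> h m * C) ^ 3 \<le> (u h * a) ^ 3 / 2 ^ h"
      if m: "m \<in> {4 * h..<8 * h}" for m
    proof -
      define s where "s = sqrt (card (T h m))"
      have s: "2 ^ h \<le> s" "0 < s" "s * s = card (T h m)"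
        using card_ge[OF m] less_le_trans[OF zero_less_power[of "2 :: real" h] card_ge[OF m]] by (auto simp: s_def)
      have \<nu>s: "\<nu> h m = u h / (sqrt \<tau>2 * s)" by (simp add: \<nu>_def s_def)
      show "\<nu> h m > 0" unfolding \<nu>s using u s s\<tau> by (intro divide_pos_pos mult_pos_pos) auto
      have \<nu>C: "\<nu> h m * C = u h * a / s" by (simp add: \<nu>s a_def)
      show "\<nu> h m * C \<le> u h * a / 2 ^ h" unfolding \<nu>C using u a s
        by (intro divide_left_mono mult_pos_pos mult_nonneg_nonneg) auto
      show "(\<nu> h m)\<^sup>2 * card (T h m) = (u h)\<^sup>2 / \<tau>2"
        unfolding s(3)[symmetric] \<nu>s power_divide power_mult_distrib using s(2) s\<tau>
        by (simp add: power2_eq_square)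
      have "card (T h m) * (\<nu> h m * C) ^ 3 = (s * s) * ((u h * a) ^ 3 / s ^ 3)"
        unfolding \<nu>C s(3) power_divide ..
      also have "\<dots> = (u h * a) ^ 3 / s" using s(2) by (simp add: power3_eq_cube)
      also have "\<dots> \<le> (u h * a) ^ 3 / 2 ^ h" using u a s
        by (intro divide_left_mono mult_pos_pos zero_le_power mult_nonneg_nonneg) auto
      finally show "card (T h m) * (\<nu> h m * C) ^ 3 \<le> (u h * a) ^ 3 / 2 ^ h" .
    qed
    have mgf_up: "m.mgf (\<kappa> * \<nu> h m) ^ card (T h m) \<le> exp (\<kappa>\<^sup>2 * (u h)\<^sup>2 * (1 + \<delta>) / 2)"
      if m: "m \<in> {4 * h..<8 * h}" and \<kappa>: "0 \<le> \<kappa>" "\<kappa> \<le> 2" for m \<kappa>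
    proof -
      have ab: "\<bar>\<kappa> * \<nu> h m\<bar> = \<kappa> * \<nu> h m" using \<kappa> \<nu>(1)[OF m] by simp
      have "\<kappa> * \<nu> h m * C \<le> 2 * (u h * a / 2 ^ h)"
        unfolding mult.assoc using \<kappa> \<nu>(1,2)[OF m] C1 by (intro mult_mono) auto
      also have "\<dots> \<le> 1 / 2" using elim(2) by simp
      finally have w: "\<bar>\<kappa> * \<nu> h m\<bar> * C \<le> 1 / 2" unfolding ab .
      have "m.mgf (\<kappa> * \<nu> h m) ^ card (T h m)
          \<le> exp (card (T h m) * ((\<kappa> * \<nu> h m)\<^sup>2 * s2 ?B / 2 + (\<bar>\<kappa> * \<nu> h m\<bar> * C) ^ 3))"
        by (rule mgf_power_bound[OF m.matched_axioms w order_refl])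
      also have "card (T h m) * ((\<kappa> * \<nu> h m)\<^sup>2 * s2 ?B / 2 + (\<bar>\<kappa> * \<nu> h m\<bar> * C) ^ 3)
          = \<kappa>\<^sup>2 * (((\<nu> h m)\<^sup>2 * card (T h m)) * s2 ?B / 2) + \<kappa>\<^sup>2 * (\<kappa> * (card (T h m) * (\<nu> h m * C) ^ 3))"
        unfolding ab by (simp add: power_mult_distrib power2_eq_square power3_eq_cube algebra_simps)
      also have "\<dots> \<le> \<kappa>\<^sup>2 * ((u h)\<^sup>2 * (1 + \<delta> / 2) / 2) + \<kappa>\<^sup>2 * (2 * ((u h * a) ^ 3 / 2 ^ h))"
      proof (intro add_mono mult_left_mono mult_mono \<nu>(4)[OF m] \<kappa>)
        have "(u h)\<^sup>2 / \<tau>2 * s2 ?B \<le> (u h)\<^sup>2 / \<tau>2 * ((1 + \<delta> / 2) * \<tau>2)"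
          using elim(8) \<tau>2 by (intro mult_left_mono divide_nonneg_pos) auto
        also have "\<dots> = (u h)\<^sup>2 * (1 + \<delta> / 2)" using \<tau>2 by simp
        finally show "(\<nu> h m)\<^sup>2 * card (T h m) * s2 ?B / 2 \<le> (u h)\<^sup>2 * (1 + \<delta> / 2) / 2"
          unfolding \<nu>(3)[OF m] by simp
        show "0 \<le> card (T h m) * (\<nu> h m * C) ^ 3" using \<nu>(1)[OF m] C1
          by (intro mult_nonneg_nonneg zero_le_power) auto
      qed auto
      also have "\<dots> = \<kappa>\<^sup>2 * ((u h)\<^sup>2 * (1 + \<delta> / 2) / 2 + 2 * ((u h * a) ^ 3 / 2 ^ h))" by (simp add: distrib_left)
      also have "\<dots> \<le> \<kappa>\<^sup>2 * ((u h)\<^sup>2 * (1 + \<delta>) / 2)"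
      proof (rule mult_left_mono)
        have "2 * ((u h * a) ^ 3 / 2 ^ h) \<le> \<delta> * (u h)\<^sup>2 / 4"
        proof -
          have "0 \<le> (u h * a) ^ 3 / 2 ^ h" using u a by (intro divide_nonneg_pos zero_le_power) auto
          moreover have "4 * ((u h * a) ^ 3 / 2 ^ h) \<le> \<delta> * (u h)\<^sup>2 / 4" using elim(3) by simp
          ultimately show ?thesis by linarith
        qed
        moreover have "(u h)\<^sup>2 * (1 + \<delta>) / 2 = (u h)\<^sup>2 * (1 + \<delta> / 2) / 2 + \<delta> * (u h)\<^sup>2 / 4" by (simp add: field_simps)
        ultimately show "(u h)\<^sup>2 * (1 + \<delta> / 2) / 2 + 2 * ((u h * a) ^ 3 / 2 ^ h) \<le> (u h)\<^sup>2 * (1 + \<delta>) / 2" by linarith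
      qed simp
      finally show ?thesis by (simp add: mult.assoc)
    qed
    have mgf_low: "exp ((u h)\<^sup>2 * (1 - \<delta>) / 2) \<le> m.mgf (\<nu> h m) ^ card (T h m)"
      if m: "m \<in> {4 * h..<8 * h}" for m
    proof -
      have ab: "\<bar>\<nu> h m\<bar> = \<nu> h m" using \<nu>(1)[OF m] by simp
      have "0 \<le> u h * a / 2 ^ h" using u a by simp
      moreover have "2 * (u h * a) / 2 ^ h = 2 * (u h * a / 2 ^ h)" by simp
      ultimately have w: "\<bar>\<nu> h m\<bar> * C \<le> 1 / 2" using \<nu>(2)[OF m] elim(2) unfolding ab by linarith
      have x: "card (T h m) * ((\<nu> h m)\<^sup>2 * s2 ?B / 2 - 4 * (\<bar>\<nu> h m\<bar> * C) ^ 3)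
          = ((\<nu> h m)\<^sup>2 * card (T h m)) * s2 ?B / 2 - 4 * (card (T h m) * (\<nu> h m * C) ^ 3)"
        unfolding ab by (simp add: algebra_simps)
      have lin: "e \<le> A / 2 - 4 * Y" if "B \<le> A" "B = c" "4 * X \<le> D" "e = c / 2 - D" "Y \<le> X" for A B c D X Y e :: real
        using that by linarith
      have "(u h)\<^sup>2 / \<tau>2 * ((1 - \<delta> / 2) * \<tau>2) \<le> (u h)\<^sup>2 / \<tau>2 * s2 ?B"
        using elim(7) \<tau>2 by (intro mult_left_mono divide_nonneg_pos) auto
      moreover have "(u h)\<^sup>2 / \<tau>2 * ((1 - \<delta> / 2) * \<tau>2) = (u h)\<^sup>2 * (1 - \<delta> / 2)" using \<tau>2 by simp
      moreover have "4 * ((u h * a) ^ 3 / 2 ^ h) \<le> \<delta> * (u h)\<^sup>2 / 4" using elim(3) by simp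
      moreover have "(u h)\<^sup>2 * (1 - \<delta>) / 2 = (u h)\<^sup>2 * (1 - \<delta> / 2) / 2 - \<delta> * (u h)\<^sup>2 / 4" by (simp add: field_simps)
      ultimately have "(u h)\<^sup>2 * (1 - \<delta>) / 2 \<le> card (T h m) * ((\<nu> h m)\<^sup>2 * s2 ?B / 2 - 4 * (\<bar>\<nu> h m\<bar> * C) ^ 3)"
        unfolding x \<nu>(3)[OF m] using \<nu>(4)[OF m] by (rule lin)
      then have "exp ((u h)\<^sup>2 * (1 - \<delta>) / 2) \<le> exp (card (T h m) * ((\<nu> h m)\<^sup>2 * s2 ?B / 2 - 4 * (\<bar>\<nu> h m\<bar> * C) ^ 3))"
        by simp
      also have "\<dots> = exp ((\<nu> h m)\<^sup>2 * s2 ?B / 2 - 4 * (\<bar>\<nu> h m\<bar> * C) ^ 3) ^ card (T h m)"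
        by (rule exp_of_nat_mult)
      also have "\<dots> \<le> m.mgf (\<nu> h m) ^ card (T h m)"
        using m.mgf_bounds(2)[OF w] unfolding s2_def by (intro power_mono) auto
      finally show ?thesis .
    qed
    have "measure \<U> {x \<in> space \<U>. \<forall>m\<in>{4 * h..<8 * h}. \<nu> h m * m.XS (T h m) x < (1 - \<epsilon>) * (u h)\<^sup>2}
      \<le> 2 * exp ((u h)\<^sup>2 * (1 / 2 + \<epsilon> + \<delta> / 2)) / card {4 * h..<8 * h} + 3 * E h + 12 * exp (- (\<epsilon>\<^sup>2 * (u h)\<^sup>2 / 3))"
    proof (rule m.tilted_second_moment[where A = "(u h * a)\<^sup>2" and Q = "Qh h"])
      show "finite {4 * h..<8 * h}" "{4 * h..<8 * h} \<noteq> {}" using h0 by auto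
      show "T h m \<subseteq> hi ?B ?P" if "m \<in> {4 * h..<8 * h}" for m
      proof -
        have "L ^ Suc m \<le> L ^ (8 * h)" using that L by (intro power_increasing) auto
        then show ?thesis unfolding T_def by (intro hi_mono) auto
      qed
      show "T h m \<inter> T h l = {}" if "m \<noteq> l" for m l
      proof -
        have *: "{L ^ i<..L ^ Suc i} \<inter> {L ^ k<..L ^ Suc k} = {}" if "i < k" for i k
        proof -
          have "L ^ Suc i \<le> L ^ k" using that L by (intro power_increasing) auto
          then show ?thesis by auto
        qed
        have "{L ^ m<..L ^ Suc m} \<inter> {L ^ l<..L ^ Suc l} = {}"
          using *[of m l] *[of l m] that by (cases "m < l") (auto simp: Int_commute)
        then show ?thesis unfolding T_def by (intro hi_disjoint) auto
      qed
      show "(\<nu> h m)\<^sup>2 * C\<^sup>2 * card (T h m) \<le> (u h * a)\<^sup>2" if "m \<in> {4 * h..<8 * h}" for m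
      proof -
        have "(\<nu> h m)\<^sup>2 * C\<^sup>2 * card (T h m) = ((\<nu> h m)\<^sup>2 * card (T h m)) * C\<^sup>2" by simp
        also have "\<dots> = (u h * a)\<^sup>2" unfolding \<nu>(3)[OF that] a_def
          using s\<tau> \<tau>2 by (simp add: power_mult_distrib power_divide)
        finally show ?thesis by simp
      qed
      show "6 * exp (- 2 * real (Qh h)) * exp (32 * (u h * a)\<^sup>2) \<le> E h"
      proof -
        have "6 * (exp (- 2 * real (Qh h)) * exp (32 * (u h * a)\<^sup>2)) \<le> exp 2 * exp (- 2 * (ln (real h))\<^sup>2 + ((ln (real h))\<^sup>2 - 2))"
        proof (rule mult_mono)
          have "exp (2 :: real) = exp 1 * exp 1" by (simp add: exp_add[symmetric])
          also have "\<dots> \<ge> (5 / 2) * (5 / 2)" using exp_lower_Taylor_quadratic[of "1 :: real"] by (intro mult_mono) auto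
          finally show "6 \<le> exp (2 :: real)" by simp
          show "exp (- 2 * real (Qh h)) * exp (32 * (u h * a)\<^sup>2) \<le> exp (- 2 * (ln (real h))\<^sup>2 + ((ln (real h))\<^sup>2 - 2))"
            unfolding exp_add[symmetric] using Qh(1)[of h] elim(4) by simp
        qed auto
        also have "\<dots> = E h" unfolding E_def exp_add[symmetric] by simp
        finally show ?thesis by (simp only: mult.assoc)
      qed
      show "E h \<le> 1" by (simp add: E_def)
      show "(1 + \<epsilon>) * \<epsilon> * (u h)\<^sup>2 \<le> real (Qh h) / 4" using elim(5) Qh(1)[of h] by linarith
      show "m.mgf (\<kappa> * \<nu> h m) ^ card (T h m) \<le> exp (\<kappa>\<^sup>2 * (u h)\<^sup>2 * (1 + \<delta>) / 2)"
        if "m \<in> {4 * h..<8 * h}" "0 \<le> \<kappa>" "\<kappa> \<le> 2" for m \<kappa>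
        by (rule mgf_up[OF that])
      show "exp ((u h)\<^sup>2 * (1 - \<delta>) / 2) \<le> m.mgf (\<nu> h m) ^ card (T h m)" if "m \<in> {4 * h..<8 * h}" for m
        by (rule mgf_low[OF that])
      show "\<delta> = \<epsilon>\<^sup>2 / 12" by (rule \<delta>_def)
    qed (use sc \<epsilon> in auto)
    moreover have "N h = {x \<in> space \<U>. \<forall>m\<in>{4 * h..<8 * h}. \<nu> h m * m.XS (T h m) x < (1 - \<epsilon>) * (u h)\<^sup>2}"
    proof -
      have "G ?B {L ^ m<..L ^ Suc m} x < v h * sqrt (card (T h m)) \<longleftrightarrow> \<nu> h m * m.XS (T h m) x < (1 - \<epsilon>) * (u h)\<^sup>2"
        if m: "m \<in> {4 * h..<8 * h}" for m x
      proof -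
        have s: "0 < sqrt (card (T h m))" using less_le_trans[OF zero_less_power[of "2 :: real" h] card_ge[OF m]] by simp
        have "\<nu> h m * (v h * sqrt (card (T h m))) = (1 - \<epsilon>) * (u h)\<^sup>2"
          using s s\<tau>(1) unfolding \<nu>_def v_def u_def[symmetric] by (simp add: power2_eq_square)
        moreover have "m.XS (T h m) x = G ?B {L ^ m<..L ^ Suc m} x" unfolding T_def XS ..
        ultimately show ?thesis using \<nu>(1)[OF m] by (metis mult_less_cancel_left_pos)
      qed
      then show ?thesis unfolding N_def by auto
    qed
    moreover have "exp ((u h)\<^sup>2 * (1 / 2 + \<epsilon> + \<delta> / 2)) = real h powr p"
    proof -
      have "0 \<le> b * ln (real h)" using lnh b by (intro mult_nonneg_nonneg) auto
      then have "(u h)\<^sup>2 = b * ln (real h)" unfolding u_b by simp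
      then show ?thesis using h0 by (simp add: powr_def p_def mult_ac)
    qed
    ultimately show ?case by simp
  qed
  have "(\<lambda>h. measure \<U> (N h)) \<longlonglongrightarrow> 0"
  proof (rule Lim_null_comparison[OF bound])
    have "(\<lambda>h. 2 * real h powr p / (4 * real h)) \<longlonglongrightarrow> 0" using p1 by real_asymp
    moreover have "E \<longlonglongrightarrow> 0" unfolding E_def by real_asymp
    moreover have "(\<lambda>h. exp (- (\<epsilon>\<^sup>2 * (u h)\<^sup>2 / 3))) \<longlonglongrightarrow> 0"
    proof -
      define d where "d = \<epsilon>\<^sup>2 / 3"
      have d: "d > 0" using \<epsilon>(1) by (simp add: d_def)
      have "(\<lambda>h. exp (- (d * (b * ln (real h))))) \<longlonglongrightarrow> 0" using b d by real_asymp
      moreover have "eventually (\<lambda>h. exp (- (d * (b * ln (real h)))) = exp (- (\<epsilon>\<^sup>2 * (u h)\<^sup>2 / 3))) sequentially"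
        using eventually_ge_at_top[of 1]
      proof eventually_elim
        case (elim h)
        then have "0 \<le> b * ln (real h)" using b by (intro mult_nonneg_nonneg) auto
        then have "(u h)\<^sup>2 = b * ln (real h)" unfolding u_b by simp
        then show ?case by (simp add: d_def)
      qed
      ultimately show ?thesis by (rule Lim_transform_eventually)
    qed
    ultimately have "(\<lambda>h. 2 * real h powr p / (4 * real h) + 3 * E h + 12 * exp (- (\<epsilon>\<^sup>2 * (u h)\<^sup>2 / 3))) \<longlonglongrightarrow> 0 + 3 * 0 + 12 * 0"
      by (intro tendsto_add tendsto_mult tendsto_const)
    then show "(\<lambda>h. 2 * real h powr p / (4 * real h) + 3 * E h + 12 * exp (- (\<epsilon>\<^sup>2 * (u h)\<^sup>2 / 3))) \<longlonglongrightarrow> 0" by simp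
  qed
  from AE_infinitely_often[OF prob_space_unit N_sets this]
  show ?thesis
  proof (rule AE_mp, intro AE_I2 impI)
    fix x assume x: "x \<in> space \<U>" and "\<exists>\<^sub>F h in sequentially. x \<notin> N h"
    from this(2) show "\<exists>\<^sub>F h in sequentially. \<exists>m\<in>{4 * h..<8 * h}.
        v h * sqrt (card (T h m)) \<le> G (L ^ h) {L ^ m<..L ^ Suc m} x"
      by (rule frequently_elim1) (use x in \<open>auto simp: N_def not_less\<close>)
  qed
qed

end

section \<open>From the unit interval to the line and from bounds to the limit superior\<close>

lemma trig_poly_minus: "trig_poly D g \<Longrightarrow> trig_poly D (\<lambda>x. - g x)"
proof -
  assume "trig_poly D g"
  then obtain c where c: "\<And>x. complex_of_real (g x) = (\<Sum>j\<in>{- int D..int D}. c j * character j x)"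
    by (auto simp only: trig_poly_def)
  have "complex_of_real (- g x) = (\<Sum>j\<in>{- int D..int D}. - c j * character j x)" for x
    by (simp add: c sum_negf)
  then show "trig_poly D (\<lambda>x. - g x)"
    unfolding trig_poly_def by (intro exI[of _ "\<lambda>j. - c j"] allI)
qed

text \<open>The exceptional set is covered by the integer translates of a null set.\<close>

lemma AE_unit_periodic:
  assumes P: "AE x in \<U>. P x" and per: "\<And>x. P (x + 1) = P x"
  shows "AE x in lebesgue. P x"
proof -
  have "AE x in lebesgue. x \<in> {0..1} \<longrightarrow> P x"
    using P by (subst (asm) AE_restrict_space_iff) auto
  then obtain N where N: "N \<in> null_sets lebesgue" "{x. \<not> (x \<in> {0..1} \<longrightarrow> P x)} \<subseteq> N"
    unfolding eventually_ae_filter by auto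
  have "negligible N" using N(1) by (simp add: negligible_iff_null_sets)
  then have "negligible (\<Union>k::int. (+) (real_of_int k) ` N)"
    by (intro negligible_countable_Union) (auto intro: negligible_translation)
  then have "(\<Union>k::int. (+) (real_of_int k) ` N) \<in> null_sets lebesgue" by (simp add: negligible_iff_null_sets)
  then show ?thesis
  proof (rule AE_I')
    show "{x \<in> space lebesgue. \<not> P x} \<subseteq> (\<Union>k::int. (+) (real_of_int k) ` N)"
    proof safe
      fix x assume x: "\<not> P x"
      have "P (frac x + of_int \<lfloor>x\<rfloor>) = P (frac x)" by (rule periodic_add_int[where h = P, OF per])
      moreover have fx: "frac x + of_int \<lfloor>x\<rfloor> = x" by (simp add: frac_def)
      ultimately have "\<not> P (frac x)" using x by simp
      moreover have "frac x \<in> {0..1}" using frac_lt_1[of x] by (simp add: less_imp_le)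
      ultimately have "frac x \<in> N" using N(2) by blast
      then have "real_of_int \<lfloor>x\<rfloor> + frac x \<in> (+) (real_of_int \<lfloor>x\<rfloor>) ` N" by (rule imageI)
      then show "x \<in> (\<Union>k::int. (+) (real_of_int k) ` N)" using fx by (auto simp: add.commute)
    qed
  qed
qed

text \<open>The tolerances \<open>1 / Suc k\<close> form a sequence, so that statements holding
  almost everywhere for each of them can be combined.\<close>

lemma Limsup_eqI:
  fixes X :: "nat \<Rightarrow> real"
  assumes up: "\<And>k::nat. eventually (\<lambda>N. X N \<le> c + 1 / real (Suc k)) sequentially"
    and low: "\<And>k::nat. \<exists>\<^sub>F N in sequentially. c - 1 / real (Suc k) \<le> X N"
  shows "limsup (\<lambda>N. ereal (X N)) = ereal c"
proof (rule antisym)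
  have ex: "\<exists>k. 1 / real (Suc k) < e" if "e > 0" for e
    using reals_Archimedean[OF that] by (simp add: inverse_eq_divide)
  show "limsup (\<lambda>N. ereal (X N)) \<le> ereal c"
  proof (rule ereal_le_epsilon2)
    fix e :: real assume "e > 0"
    then obtain k where k: "1 / real (Suc k) < e" using ex by blast
    have "limsup (\<lambda>N. ereal (X N)) \<le> ereal (c + 1 / real (Suc k))"
      by (rule Limsup_bounded) (use up[of k] in simp)
    also have "\<dots> \<le> ereal c + ereal e" using k by simp
    finally show "limsup (\<lambda>N. ereal (X N)) \<le> ereal c + ereal e" .
  qed
  show "ereal c \<le> limsup (\<lambda>N. ereal (X N))"
  proof (rule ereal_le_epsilon2)
    fix e :: real assume "e > 0"
    then obtain k where k: "1 / real (Suc k) < e" using ex by blast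
    have "ereal (c - 1 / real (Suc k)) \<le> limsup (\<lambda>N. ereal (X N))"
    proof (rule ccontr)
      assume "\<not> ?thesis"
      then have "eventually (\<lambda>N. ereal (X N) < ereal (c - 1 / real (Suc k))) sequentially"
        by (intro Limsup_lessD) simp
      then have "eventually (\<lambda>N. \<not> (c - 1 / real (Suc k) \<le> X N)) sequentially"
        by (rule eventually_mono) auto
      with low[of k] show False by (simp add: frequently_def)
    qed
    then have "ereal (c - 1 / real (Suc k)) + ereal e \<le> limsup (\<lambda>N. ereal (X N)) + ereal e"
      by (rule add_right_mono)
    moreover have "ereal c \<le> ereal (c - 1 / real (Suc k)) + ereal e" using k by simp
    ultimately show "ereal c \<le> limsup (\<lambda>N. ereal (X N)) + ereal e" by (rule order_trans[rotated])
  qed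
qed

context permuted_sequence_lil
begin

lemma negated: "permuted_sequence_lil n \<sigma> R i\<^sub>0 (\<lambda>x. - f x) C"
proof
  show "\<exists>g. trig_poly D g \<and> (\<forall>x. \<bar>g x\<bar> \<le> C) \<and> (\<integral>x. g x \<partial>\<U>) = 0 \<and> (\<integral>x. \<bar>- f x - g x\<bar> \<partial>\<U>) \<le> C / sqrt (real D)"
    if D: "D \<ge> 1" for D
  proof -
    obtain g where g: "trig_poly D g" "\<And>x. \<bar>g x\<bar> \<le> C" "(\<integral>x. g x \<partial>\<U>) = 0"
        "(\<integral>x. \<bar>f x - g x\<bar> \<partial>\<U>) \<le> C / sqrt D"
      using approx[OF D] by blast
    have "\<bar>- f x - - g x\<bar> = \<bar>f x - g x\<bar>" for x by linarith
    then show ?thesis using g trig_poly_minus[OF g(1)]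
      by (intro exI[of _ "\<lambda>x. - g x"]) auto
  qed
qed (use rf R_mono R_lim n_nonneg \<sigma> f_meas f_per f_mean f_bd C1 R_big in auto)

text \<open>All hypotheses are symmetric in \<open>f\<close> and \<open>- f\<close>. The lower half
  uses this to control the sum preceding a block.\<close>

lemma lil_minus:
  assumes "\<kappa> > sqrt \<tau>2"
  shows "AE x in \<U>. eventually (\<lambda>N. - (\<kappa> * sqrt (2 * real N * ln (ln (real N)))) \<le> S N x) sequentially"
proof -
  interpret neg: permuted_sequence_lil n \<sigma> R i\<^sub>0 "\<lambda>x. - f x" C by (rule negated)
  have "neg.\<tau>2 = \<tau>2" by (simp add: neg.\<tau>2_def \<tau>2_def)
  then have "AE x in \<U>. eventually (\<lambda>N. neg.S N x \<le> \<kappa> * sqrt (2 * real N * ln (ln (real N)))) sequentially"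
    using assms by (intro neg.lil_upper) simp
  moreover have "neg.S N x = - S N x" for N x by (simp add: neg.S_def S_def sum_negf)
  ultimately show ?thesis by (simp add: minus_le_iff)
qed

lemma G_split:
  assumes "a \<le> b"
  shows "G B {1..b} x = G B {1..a} x + G B {a<..b} x"
proof -
  have "{1..b} = {1..a} \<union> {a<..b}" using assms by auto
  then have "(\<Sum>k\<in>{1..b}. if \<sigma> k \<ge> B then app B (of_int (n (\<sigma> k)) * x) else 0)
      = (\<Sum>k\<in>{1..a}. if \<sigma> k \<ge> B then app B (of_int (n (\<sigma> k)) * x) else 0)
      + (\<Sum>k\<in>{a<..b}. if \<sigma> k \<ge> B then app B (of_int (n (\<sigma> k)) * x) else 0)"
    by (simp only: sum.union_disjoint[OF finite_atLeastAtMost finite_greaterThanAtMost] ivl_disj_int)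
  moreover have "{a<..b} \<subseteq> {1..}" by auto
  ultimately show ?thesis by (simp add: G_positions)
qed

text \<open>A large sum over the block ending at \<open>L ^ Suc m\<close> must not be cancelled by
  the sum up to \<open>L ^ m\<close>. The upper half, applied to \<open>- f\<close>, bounds the
  latter from below, and for large \<open>L\<close> this bound is a small fraction of the
  normalisation at \<open>L ^ Suc m\<close>.\<close>

lemma lil_lower:
  assumes \<tau>2: "\<tau>2 > 0" and \<kappa>: "\<kappa> < sqrt \<tau>2"
  shows "AE x in \<U>. \<exists>\<^sub>F N in sequentially. \<kappa> * sqrt (2 * real N * ln (ln (real N))) \<le> S N x"
proof -
  define s where "s = sqrt \<tau>2"
  have s: "s > 0" using \<tau>2 by (simp add: s_def)
  \<comment> \<open>A nonnegative constant, so that enlarging the normalisation to \<open>z\<close>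
    preserves the inequality.\<close>
  define \<kappa>' where "\<kappa>' = max \<kappa> 0"
  have \<kappa>': "\<kappa>' < s" "0 \<le> \<kappa>'" "\<kappa> \<le> \<kappa>'" using \<kappa> s by (auto simp: \<kappa>'_def s_def)
  \<comment> \<open>All losses are expressed by one parameter: \<open>(s + 1) * \<epsilon>\<close>
    for the sum before the block, \<open>\<epsilon>\<close> for the approximation, and under the
    root one factor \<open>1 - \<epsilon>\<close> each for \<open>ln h\<close> against
    \<open>w h\<close> and for the size of the block.\<close>
  have "((\<lambda>\<epsilon>. (1 - \<epsilon>) * s * sqrt ((1 - \<epsilon>) * (1 - \<epsilon>) / (1 + 4 * \<epsilon>)) - (s + 2) * \<epsilon>) \<longlongrightarrow>
      (1 - 0) * s * sqrt ((1 - 0) * (1 - 0) / (1 + 4 * 0)) - (s + 2) * 0) (at_right 0)"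
    by (intro tendsto_intros) auto
  then have "eventually (\<lambda>\<epsilon>. \<kappa>' < (1 - \<epsilon>) * s * sqrt ((1 - \<epsilon>) * (1 - \<epsilon>) / (1 + 4 * \<epsilon>)) - (s + 2) * \<epsilon>) (at_right 0)"
    by (rule order_tendstoD(1)) (use \<kappa>' in simp)
  moreover have "eventually (\<lambda>\<epsilon>::real. 0 < \<epsilon>) (at_right 0)" by (rule eventually_at_right_less)
  moreover have "eventually (\<lambda>\<epsilon>::real. \<epsilon> < 1 / 2) (at_right 0)"
    by (rule eventually_at_rightI[of 0 "1 / 2"]) auto
  ultimately have "eventually (\<lambda>\<epsilon>. 0 < \<epsilon> \<and> \<epsilon> < 1 / 2 \<and>
      \<kappa>' < (1 - \<epsilon>) * s * sqrt ((1 - \<epsilon>) * (1 - \<epsilon>) / (1 + 4 * \<epsilon>)) - (s + 2) * \<epsilon>) (at_right 0)"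
    by eventually_elim simp
  then obtain \<epsilon> where \<epsilon>: "0 < \<epsilon>" "\<epsilon> < 1 / 2"
      and \<kappa>\<epsilon>: "\<kappa>' < (1 - \<epsilon>) * s * sqrt ((1 - \<epsilon>) * (1 - \<epsilon>) / (1 + 4 * \<epsilon>)) - (s + 2) * \<epsilon>"
    using eventually_happens'[OF trivial_limit_at_right_real] by blast
  \<comment> \<open>Ensures \<open>2 / L \<le> \<epsilon>\<close>, so that the positions before the
    block and the dropped ones together make up at most the fraction \<open>\<epsilon>\<close> of
    \<open>L ^ Suc m\<close>, and \<open>1 / sqrt L \<le> \<epsilon>\<close>, which compares the
    normalisations at \<open>L ^ m\<close> and \<open>L ^ Suc m\<close>.\<close>
  define L where "L = nat \<lceil>1 / \<epsilon>\<^sup>2\<rceil> + nat \<lceil>2 / \<epsilon>\<rceil> + 2"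
  have L2: "L \<ge> 2" by (simp add: L_def)
  have L\<epsilon>: "2 / \<epsilon> \<le> real L" "1 / \<epsilon>\<^sup>2 \<le> real L" unfolding L_def using real_nat_ceiling_ge[of "1 / \<epsilon>\<^sup>2"] real_nat_ceiling_ge[of "2 / \<epsilon>"] by linarith+
  have La: "2 / L \<le> \<epsilon>" using L\<epsilon>(1) \<epsilon>(1) L2 by (simp add: field_simps)
  have Lb: "1 / sqrt L \<le> \<epsilon>"
  proof -
    have "1 / \<epsilon> \<le> sqrt L" using L\<epsilon>(2) by (intro real_le_rsqrt) (simp add: power_divide)
    then show ?thesis using \<epsilon>(1) L2 by (simp add: field_simps)
  qed
  have lnL: "ln (real L) > 0" using L2 by simp
  have hL: "h \<le> L ^ h" for h
  proof -
    have "h \<le> 2 ^ h" by (rule less_imp_le[OF less_exp])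
    also have "\<dots> \<le> L ^ h" using L2 by (intro power_mono) auto
    finally show "h \<le> L ^ h" .
  qed
  \<comment> \<open>Bounds the iterated logarithm on the whole window, which ends at
    \<open>L ^ (8 * h)\<close>, and exceeds \<open>ln h\<close> only by a constant.\<close>
  define w where "w h = ln (8 * real h * ln (real L))" for h :: nat
  have e1: "eventually (\<lambda>h. (1 - \<epsilon>) * w h \<le> ln (real h)) sequentially"
    unfolding w_def using lnL \<epsilon>(1) by real_asymp
  have e2: "eventually (\<lambda>h. 1 \<le> w h) sequentially" unfolding w_def using lnL by real_asymp
  have e3: "eventually (\<lambda>h. 2 * (C * real L ^ h + 1) \<le> \<epsilon> * (real L ^ h)\<^sup>2) sequentially"
  proof -
    have "eventually (\<lambda>h. 2 * C + 2 \<le> \<epsilon> * real h) sequentially" using \<epsilon>(1) by real_asymp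
    then show ?thesis
    proof eventually_elim
      case (elim h)
      have "1 \<le> real L ^ h" using L2 by (intro one_le_power) simp
      then have "2 * (C * real L ^ h + 1) \<le> (2 * C + 2) * real L ^ h" by (simp add: algebra_simps)
      also have "\<dots> \<le> (\<epsilon> * real L ^ h) * real L ^ h"
      proof (rule mult_right_mono)
        have "\<epsilon> * real h \<le> \<epsilon> * real L ^ h" using \<epsilon>(1) of_nat_mono[OF hL[of h], where 'a = real]
          by (intro mult_left_mono) auto
        then show "2 * C + 2 \<le> \<epsilon> * real L ^ h" using elim by linarith
      qed simp
      finally show ?case by (simp add: power2_eq_square mult.assoc)
    qed
  qed
  have e4: "eventually (\<lambda>h. 1 \<le> 4 * real h * ln (real L)) sequentially" using lnL by real_asymp
  obtain h1 where h1: "\<And>h. h \<ge> h1 \<Longrightarrow> (1 - \<epsilon>) * w h \<le> ln (real h) \<and> 1 \<le> w h \<and>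
      2 * (C * real L ^ h + 1) \<le> \<epsilon> * (real L ^ h)\<^sup>2 \<and> 1 \<le> 4 * real h * ln (real L)"
    using eventually_conj[OF e1 eventually_conj[OF e2 eventually_conj[OF e3 e4]]]
    unfolding eventually_sequentially by blast
  have win: "AE x in \<U>. \<exists>\<^sub>F h in sequentially. \<exists>m\<in>{4 * h..<8 * h}.
      (1 - \<epsilon>) * sqrt \<tau>2 * sqrt (2 / (1 + 4 * \<epsilon>) * ln (real h)) * sqrt (card (hi (L ^ h) {L ^ m<..L ^ Suc m}))
      \<le> G (L ^ h) {L ^ m<..L ^ Suc m} x"
    by (rule window_event[OF \<tau>2 L2 \<epsilon>(1)]) (use \<epsilon> in simp)
  have neg: "AE x in \<U>. eventually (\<lambda>N. - ((s + 1) * sqrt (2 * real N * ln (ln (real N)))) \<le> S N x) sequentially"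
    by (rule lil_minus) (simp add: s_def)
  have key: "\<kappa> * sqrt (2 * real N * ln (ln (real N))) \<le> S N x"
    if h: "h \<ge> h1" "h \<ge> 1" and m: "4 * h \<le> m" "m < 8 * h" and N: "N = L ^ Suc m"
      and ev: "(1 - \<epsilon>) * sqrt \<tau>2 * sqrt (2 / (1 + 4 * \<epsilon>) * ln (real h)) * sqrt (card (hi (L ^ h) {L ^ m<..L ^ Suc m}))
        \<le> G (L ^ h) {L ^ m<..L ^ Suc m} x"
      and SG: "\<And>N. N \<le> (L ^ h) ^ 16 \<Longrightarrow> \<bar>S N x - G (L ^ h) {1..N} x\<bar> \<le> C * (L ^ h) + 1"
      and low: "- ((s + 1) * sqrt (2 * real (L ^ m) * ln (ln (real (L ^ m))))) \<le> S (L ^ m) x" for h m N x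
  proof -
    define z where "z = sqrt (2 * real N * w h)"
    have w1: "1 \<le> w h" "(1 - \<epsilon>) * w h \<le> ln (real h)" using h1[OF h(1)] by auto
    have NL: "real N = real L * real L ^ m" "real N > 0" using N L2 by auto
    have z0: "z \<ge> 0" using w1 by (simp add: z_def)
    have lnk: "ln (ln (real (L ^ k))) \<le> w h" if k: "4 * h \<le> k" "k \<le> 8 * h" for k
    proof -
      have "ln (real (L ^ k)) = real k * ln (real L)" using L2 by (simp add: ln_realpow)
      moreover have "real k * ln (real L) \<le> 8 * real h * ln (real L)" using k lnL by (intro mult_right_mono) auto
      moreover have "0 < real k * ln (real L)" using k h lnL by (intro mult_pos_pos) auto
      ultimately show ?thesis unfolding w_def by (simp only:) (rule ln_mono, auto)
    qed
    have t0: "\<kappa> * sqrt (2 * real N * ln (ln (real N))) \<le> \<kappa>' * z"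
    proof -
      have "ln (real N) = real (Suc m) * ln (real L)" unfolding N of_nat_power by (rule ln_realpow)
      moreover have "4 * real h * ln (real L) \<le> real (Suc m) * ln (real L)" using m lnL by (intro mult_right_mono) auto
      ultimately have "1 \<le> ln (real N)" using h1[OF h(1)] by linarith
      then have "0 \<le> ln (ln (real N))" by (rule ln_ge_zero)
      then have "\<kappa> * sqrt (2 * real N * ln (ln (real N))) \<le> \<kappa>' * sqrt (2 * real N * ln (ln (real N)))"
        using \<kappa>'(3) by (intro mult_right_mono) auto
      also have "\<dots> \<le> \<kappa>' * z" unfolding z_def N using lnk[of "Suc m"] m \<kappa>'(2)
        by (intro mult_left_mono real_sqrt_le_mono) auto
      finally show ?thesis .
    qed
    have t1: "(s + 1) * sqrt (2 * real (L ^ m) * ln (ln (real (L ^ m)))) \<le> (s + 1) * \<epsilon> * z"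
    proof -
      have "sqrt (2 * real (L ^ m) * ln (ln (real (L ^ m)))) \<le> sqrt (2 * real (L ^ m) * w h)"
        using lnk[of m] m by (intro real_sqrt_le_mono mult_left_mono) auto
      also have "\<dots> = z * (1 / sqrt L)"
        unfolding z_def NL(1) using L2 by (simp add: real_sqrt_mult)
      also have "\<dots> \<le> z * \<epsilon>" using Lb z0 by (intro mult_left_mono)
      finally have "(s + 1) * sqrt (2 * real (L ^ m) * ln (ln (real (L ^ m)))) \<le> (s + 1) * (z * \<epsilon>)"
        using s by (intro mult_left_mono) auto
      then show ?thesis by (simp only: mult_ac)
    qed
    have t2: "2 * (C * real L ^ h + 1) \<le> \<epsilon> * z"
    proof -
      have "(real L ^ h)\<^sup>2 \<le> z"
        unfolding z_def
      proof (rule real_le_rsqrt)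
        have "((real L ^ h)\<^sup>2)\<^sup>2 = real L ^ (4 * h)" by (simp add: power_mult[symmetric] mult.commute)
        also have "\<dots> \<le> real L ^ Suc m" using m L2 by (intro power_increasing) auto
        also have "\<dots> = real N * 1" by (simp add: N)
        also have "\<dots> \<le> real N * (2 * w h)" using w1 by (intro mult_left_mono) auto
        finally show "((real L ^ h)\<^sup>2)\<^sup>2 \<le> 2 * real N * w h" by (simp add: mult_ac)
      qed
      then have "\<epsilon> * (real L ^ h)\<^sup>2 \<le> \<epsilon> * z" using \<epsilon>(1) by (intro mult_left_mono) auto
      then show ?thesis using h1[OF h(1)] by linarith
    qed
    define c where "c = card (hi (L ^ h) {L ^ m<..L ^ Suc m})"
    have c: "(1 - \<epsilon>) * real N \<le> real c"
    proof -
      have "card {L ^ m<..L ^ Suc m} \<le> c + L ^ h"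
        unfolding c_def by (rule hi_simps(3)) auto
      moreover have "L ^ h \<le> L ^ m" using m L2 by (intro power_increasing) auto
      ultimately have "L ^ Suc m \<le> c + 2 * L ^ m" by simp
      then have "real N \<le> real (c + 2 * L ^ m)" unfolding N by (simp only: of_nat_le_iff)
      moreover have "2 * real L ^ m \<le> \<epsilon> * real N"
      proof -
        have "2 * real L ^ m = (2 / L) * real N" unfolding NL using L2 by simp
        also have "\<dots> \<le> \<epsilon> * real N" using La by (intro mult_right_mono) auto
        finally show ?thesis .
      qed
      ultimately show ?thesis by (simp add: left_diff_distrib)
    qed
    have t3: "(1 - \<epsilon>) * s * sqrt ((1 - \<epsilon>) * (1 - \<epsilon>) / (1 + 4 * \<epsilon>)) * z
        \<le> (1 - \<epsilon>) * sqrt \<tau>2 * sqrt (2 / (1 + 4 * \<epsilon>) * ln (real h)) * sqrt c"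
    proof -
      have "((1 - \<epsilon>) * (1 - \<epsilon>) / (1 + 4 * \<epsilon>)) * (2 * real N * w h) = 2 / (1 + 4 * \<epsilon>) * (((1 - \<epsilon>) * w h) * ((1 - \<epsilon>) * real N))"
        by simp
      also have "\<dots> \<le> 2 / (1 + 4 * \<epsilon>) * (ln (real h) * real c)"
      proof (intro mult_left_mono mult_mono w1(2) c)
        show "0 \<le> (1 - \<epsilon>) * real N" using \<epsilon> by (intro mult_nonneg_nonneg) auto
        show "0 \<le> ln (real h)" using h by simp
        show "0 \<le> 2 / (1 + 4 * \<epsilon>)" using \<epsilon> by simp
      qed
      finally have "sqrt ((1 - \<epsilon>) * (1 - \<epsilon>) / (1 + 4 * \<epsilon>)) * z \<le> sqrt (2 / (1 + 4 * \<epsilon>) * ln (real h)) * sqrt c"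
        unfolding z_def real_sqrt_mult[symmetric] mult.assoc[symmetric] by (rule real_sqrt_le_mono)
      then have "(1 - \<epsilon>) * s * (sqrt ((1 - \<epsilon>) * (1 - \<epsilon>) / (1 + 4 * \<epsilon>)) * z)
          \<le> (1 - \<epsilon>) * s * (sqrt (2 / (1 + 4 * \<epsilon>) * ln (real h)) * sqrt c)"
        using \<epsilon> s by (intro mult_left_mono) auto
      then show ?thesis unfolding s_def by (simp only: mult.assoc)
    qed
    have pw: "L ^ k \<le> (L ^ h) ^ 16" if "k \<le> 8 * h" for k
      unfolding power_mult[symmetric] using that L2 by (intro power_increasing) auto
    have g: "G (L ^ h) {1..N} x = G (L ^ h) {1..L ^ m} x + G (L ^ h) {L ^ m<..L ^ Suc m} x"
      unfolding N by (rule G_split) (use L2 in \<open>auto intro: power_increasing\<close>)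
    have sg: "\<bar>S N x - G (L ^ h) {1..N} x\<bar> \<le> C * real L ^ h + 1"
        "\<bar>S (L ^ m) x - G (L ^ h) {1..L ^ m} x\<bar> \<le> C * real L ^ h + 1"
      using SG[of N] SG[of "L ^ m"] pw[of m] pw[of "Suc m"] m unfolding N by auto
    have "\<kappa>' * z \<le> ((1 - \<epsilon>) * s * sqrt ((1 - \<epsilon>) * (1 - \<epsilon>) / (1 + 4 * \<epsilon>)) - (s + 2) * \<epsilon>) * z"
      using \<kappa>\<epsilon> z0 by (intro mult_right_mono) auto
    also have "\<dots> = (1 - \<epsilon>) * s * sqrt ((1 - \<epsilon>) * (1 - \<epsilon>) / (1 + 4 * \<epsilon>)) * z - (s + 1) * \<epsilon> * z - \<epsilon> * z"
      by (simp add: algebra_simps)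
    finally have fin: "\<kappa>' * z \<le> (1 - \<epsilon>) * s * sqrt ((1 - \<epsilon>) * (1 - \<epsilon>) / (1 + 4 * \<epsilon>)) * z - (s + 1) * \<epsilon> * z - \<epsilon> * z" .
    have lin: "T \<le> SN" if "y \<le> A - B - E" "T \<le> y" "X \<le> B" "2 * K \<le> E" "A \<le> Q" "Q \<le> g2" "\<bar>SN - GN\<bar> \<le> K"
        "\<bar>Sm - Gm\<bar> \<le> K" "GN = Gm + g2" "- X \<le> Sm" for T SN y A B E X K Q g2 GN Sm Gm :: real
      using that by linarith
    show ?thesis by (rule lin[OF fin t0 t1 t2 t3 ev[folded c_def] sg g low])
  qed
  show ?thesis
    using win neg AE_S_G
  proof eventually_elim
    case (elim x)
    obtain N1 where N1: "\<And>N. N \<ge> N1 \<Longrightarrow> - ((s + 1) * sqrt (2 * real N * ln (ln (real N)))) \<le> S N x"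
      using elim(2) unfolding eventually_sequentially by blast
    obtain B1 where B1: "\<And>B N. B \<ge> B1 \<Longrightarrow> N \<le> B ^ 16 \<Longrightarrow> \<bar>S N x - G B {1..N} x\<bar> \<le> C * B + 1"
      using elim(3) unfolding eventually_sequentially by blast
    show ?case
      unfolding frequently_sequentially
    proof
      fix N0 :: nat
      obtain h where h: "h \<ge> N0 + N1 + B1 + h1 + 1"
          and "\<exists>m\<in>{4 * h..<8 * h}. (1 - \<epsilon>) * sqrt \<tau>2 * sqrt (2 / (1 + 4 * \<epsilon>) * ln (real h)) * sqrt (card (hi (L ^ h) {L ^ m<..L ^ Suc m}))
            \<le> G (L ^ h) {L ^ m<..L ^ Suc m} x"
        using elim(1) unfolding frequently_sequentially by blast
      then obtain m where m: "4 * h \<le> m" "m < 8 * h"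
          and ev: "(1 - \<epsilon>) * sqrt \<tau>2 * sqrt (2 / (1 + 4 * \<epsilon>) * ln (real h)) * sqrt (card (hi (L ^ h) {L ^ m<..L ^ Suc m}))
            \<le> G (L ^ h) {L ^ m<..L ^ Suc m} x" by auto
      have "N0 \<le> L ^ Suc m" "N1 \<le> L ^ m" "B1 \<le> L ^ h"
        using hL[of "Suc m"] hL[of m] hL[of h] h m by linarith+
      moreover have "\<kappa> * sqrt (2 * real (L ^ Suc m) * ln (ln (real (L ^ Suc m)))) \<le> S (L ^ Suc m) x"
      proof (rule key[OF _ _ m refl ev])
        show "h \<ge> h1" "h \<ge> 1" using h by auto
        show "\<bar>S N x - G (L ^ h) {1..N} x\<bar> \<le> C * (L ^ h) + 1" if "N \<le> (L ^ h) ^ 16" for N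
          by (rule B1) fact+
        show "- ((s + 1) * sqrt (2 * real (L ^ m) * ln (ln (real (L ^ m))))) \<le> S (L ^ m) x"
          by (rule N1) fact
      qed
      ultimately show "\<exists>N\<ge>N0. \<kappa> * sqrt (2 * real N * ln (ln (real N))) \<le> S N x" by blast
    qed
  qed
qed

theorem lil:
  "AE x in lebesgue. limsup (\<lambda>N. ereal (S N x / sqrt (2 * real N * ln (ln (real N))))) = ereal (sqrt \<tau>2)"
proof (rule AE_unit_periodic)
  show "(limsup (\<lambda>N. ereal (S N (x + 1) / sqrt (2 * real N * ln (ln (real N))))) = ereal (sqrt \<tau>2))
      = (limsup (\<lambda>N. ereal (S N x / sqrt (2 * real N * ln (ln (real N))))) = ereal (sqrt \<tau>2))" for x
  proof -
    have "f (of_int k * (x + 1)) = f (of_int k * x)" for k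
      using periodic_add_int[of f "of_int k * x" k, OF f_per] by (simp add: distrib_left)
    then show ?thesis by (simp add: S_def)
  qed
  define \<phi> where "\<phi> N = sqrt (2 * real N * ln (ln (real N)))" for N :: nat
  have \<phi>: "eventually (\<lambda>N. \<phi> N > 0) sequentially"
    unfolding \<phi>_def by real_asymp
  have "AE x in \<U>. \<forall>k::nat. eventually (\<lambda>N. S N x \<le> (sqrt \<tau>2 + 1 / real (Suc k)) * \<phi> N) sequentially"
    unfolding AE_all_countable \<phi>_def by (intro allI lil_upper) simp
  moreover have "AE x in \<U>. \<forall>k::nat. \<exists>\<^sub>F N in sequentially. (sqrt \<tau>2 - 1 / real (Suc k)) * \<phi> N \<le> S N x"
    unfolding AE_all_countable
  proof
    fix k :: nat
    have "\<tau>2 \<ge> 0" unfolding \<tau>2_def by (intro Bochner_Integration.integral_nonneg) auto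
    then consider "\<tau>2 > 0" | "\<tau>2 = 0" by linarith
    then show "AE x in \<U>. \<exists>\<^sub>F N in sequentially. (sqrt \<tau>2 - 1 / real (Suc k)) * \<phi> N \<le> S N x"
    proof cases
      case 1
      then show ?thesis unfolding \<phi>_def by (rule lil_lower) simp
    next
      \<comment> \<open>For vanishing variance the lower bound is the upper half for
        \<open>- f\<close>, with the constant \<open>1 / Suc k\<close>.\<close>
      case 2
      have "AE x in \<U>. eventually (\<lambda>N. - (1 / real (Suc k) * \<phi> N) \<le> S N x) sequentially"
        unfolding \<phi>_def by (rule lil_minus) (simp add: 2)
      then show ?thesis
      proof eventually_elim
        case (elim x)
        from eventually_frequently[OF trivial_limit_sequentially elim] show ?case by (simp add: 2)
      qed
    qed
  qed
  ultimately have "AE x in \<U>. limsup (\<lambda>N. ereal (S N x / \<phi> N)) = ereal (sqrt \<tau>2)"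
  proof eventually_elim
    case (elim x)
    show ?case
    proof (rule Limsup_eqI)
      fix k :: nat
      show "eventually (\<lambda>N. S N x / \<phi> N \<le> sqrt \<tau>2 + 1 / real (Suc k)) sequentially"
        using elim(1)[rule_format, of k] \<phi>
      proof eventually_elim
        case (elim N)
        then show ?case using pos_divide_le_eq by blast
      qed
      have "\<exists>\<^sub>F N in sequentially. (sqrt \<tau>2 - 1 / real (Suc k)) * \<phi> N \<le> S N x \<and> \<phi> N > 0"
        using elim(2)[rule_format, of k] \<phi> by (rule frequently_eventually_frequently)
      then show "\<exists>\<^sub>F N in sequentially. sqrt \<tau>2 - 1 / real (Suc k) \<le> S N x / \<phi> N"
        by (rule frequently_elim1) (use pos_le_divide_eq in blast)
    qed
  qed
  then show "AE x in \<U>. limsup (\<lambda>N. ereal (S N x / sqrt (2 * real N * ln (ln (real N))))) = ereal (sqrt \<tau>2)"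
    unfolding \<phi>_def .
qed

end

section \<open>Application to the random sequence\<close>

lemma permuted_sequenceI:
  fixes \<omega> :: "nat \<Rightarrow> real" and f :: "real \<Rightarrow> real"
  assumes omega_mono: "mono_on {1..} \<omega>"
    and omega_lim: "filterlim \<omega> at_top sequentially"
    and f_meas: "f \<in> borel_measurable lebesgue"
    and f_periodic: "\<And>x. f (x + 1) = f x"
    and f_mean: "(\<integral>x. f x \<partial>lebesgue_on {0..1}) = 0"
    and f_var: "total_variation f 0 1 < \<infinity>"
  obtains C where "\<And>n \<sigma> i\<^sub>0. relation_free n (\<lambda>i. \<omega> i / 136) 65 i\<^sub>0 \<Longrightarrow> (\<And>k. k \<ge> 1 \<Longrightarrow> n k \<ge> 0) \<Longrightarrow>
    bij_betw \<sigma> {1..} {1..} \<Longrightarrow> permuted_sequence n \<sigma> (\<lambda>i. \<omega> i / 136) i\<^sub>0 f C"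
proof -
  obtain V where V: "V \<ge> 0" "\<And>m t. strict_mono_on {..m} t \<Longrightarrow> t 0 = 0 \<Longrightarrow> t m = 1 \<Longrightarrow>
      (\<Sum>i<m. \<bar>f (t (Suc i)) - f (t i)\<bar>) \<le> V"
    using total_variation_bound[OF f_var] by blast
  define K where "K = \<bar>f 0\<bar> + V"
  have K: "\<bar>f x\<bar> \<le> K" for x unfolding K_def by (rule bounded_variation_bounded[where f = f, OF V(2) V(1) f_periodic])
  \<comment> \<open>Large enough for the bound \<open>2 * K\<close> of the approximants, the
    constant \<open>4 * V\<close> of the rate, and \<open>C \<ge> 1\<close>. It is chosen before the
    sequence and the permutation.\<close>
  define C where "C = 1 + 2 * K + 4 * V"
  have K0: "K \<ge> 0" using V(1) by (simp add: K_def)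
  show ?thesis
  proof (rule that)
    fix n :: "nat \<Rightarrow> int" and \<sigma> :: "nat \<Rightarrow> nat" and i\<^sub>0 :: nat
    assume n: "relation_free n (\<lambda>i. \<omega> i / 136) 65 i\<^sub>0" "\<And>k. k \<ge> 1 \<Longrightarrow> n k \<ge> 0" "bij_betw \<sigma> {1..} {1..}"
    show "permuted_sequence n \<sigma> (\<lambda>i. \<omega> i / 136) i\<^sub>0 f C"
    proof
      show "\<omega> i / 136 \<le> \<omega> j / 136" if "1 \<le> i" "i \<le> j" for i j
        using monotone_onD[OF omega_mono, of i j] that by simp
      show "filterlim (\<lambda>i. \<omega> i / 136) at_top sequentially"
        using filterlim_at_top_mult_tendsto_pos[OF tendsto_const[of "1 / 136"] _ omega_lim] by simp
      show "\<bar>f x\<bar> \<le> C" for x using K[of x] K0 V(1) unfolding C_def by linarith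
      show "C \<ge> 1" using K0 V(1) by (simp add: C_def)
      show "\<exists>g. trig_poly D g \<and> (\<forall>x. \<bar>g x\<bar> \<le> C) \<and> (\<integral>x. g x \<partial>\<U>) = 0 \<and> (\<integral>x. \<bar>f x - g x\<bar> \<partial>\<U>) \<le> C / sqrt (real D)"
        if D: "D \<ge> 1" for D
      proof -
        obtain g where g: "trig_poly D g" "\<And>x. \<bar>g x\<bar> \<le> 2 * K" "(\<integral>x. g x \<partial>\<U>) = 0"
            "(\<integral>x. \<bar>f x - g x\<bar> \<partial>\<U>) \<le> 4 * V / sqrt D"
          using fejer_approximation[where f = f, OF f_meas f_periodic f_mean V(2) V(1) K D] by blast
        have "4 * V / sqrt D \<le> C / sqrt D" using K0 by (intro divide_right_mono) (auto simp: C_def)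
        then have "(\<integral>x. \<bar>f x - g x\<bar> \<partial>\<U>) \<le> C / sqrt D" using g(4) by linarith
        moreover have "\<bar>g x\<bar> \<le> C" for x using g(2)[of x] V(1) unfolding C_def by linarith
        ultimately show ?thesis using g by blast
      qed
    qed (use n f_meas f_periodic f_mean in auto)
  qed
qed

theorem theorem3:
  fixes \<omega> :: "nat \<Rightarrow> real" and a :: real and f :: "real \<Rightarrow> real"
  assumes omega_mono: "mono_on {1..} \<omega>"
    and omega_pos: "\<And>k. k \<ge> 1 \<Longrightarrow> \<omega> k > 0"
    and omega_lim: "filterlim \<omega> at_top sequentially"
    and a_pos: "a > 0"
    and a_large: "\<And>k. k \<ge> 1 \<Longrightarrow> block_ints \<omega> a k \<noteq> {}"
    and f_meas: "f \<in> borel_measurable lebesgue"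
    and f_periodic: "\<And>x. f (x + 1) = f x"
    and f_mean: "(\<integral>x. f x \<partial>lebesgue_on {0..1}) = 0"
    and f_var: "total_variation f 0 1 < \<infinity>"
  shows "(AE n in mu_omega \<omega> a. \<forall>\<sigma> :: nat \<Rightarrow> nat. bij_betw \<sigma> {1..} {1..} \<longrightarrow>
            weak_conv_m
              (\<lambda>N. distr (lebesgue_on {0..1}) borel
                 (\<lambda>x. real N powr (- 1 / 2) * (\<Sum>k=1..N. f (real_of_int (n (\<sigma> k)) * x))))
              (centered_normal (L2_norm01 f)))
       \<and> ((\<exists>\<alpha>>0. \<exists>k0. \<forall>k\<ge>k0. \<omega> k \<ge> ln (real k) powr \<alpha>) \<longrightarrow>
          (AE n in mu_omega \<omega> a. \<forall>\<sigma> :: nat \<Rightarrow> nat. bij_betw \<sigma> {1..} {1..} \<longrightarrow>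
            (AE x in lebesgue.
              limsup (\<lambda>N. ereal ((\<Sum>k=1..N. f (real_of_int (n (\<sigma> k)) * x))
                                  / sqrt (2 * real N * ln (ln (real N)))))
              = ereal (L2_norm01 f))))"
proof -
  obtain C where ps: "\<And>n \<sigma> i\<^sub>0. relation_free n (\<lambda>i. \<omega> i / 136) 65 i\<^sub>0 \<Longrightarrow> (\<And>k. k \<ge> 1 \<Longrightarrow> n k \<ge> 0) \<Longrightarrow>
      bij_betw \<sigma> {1..} {1..} \<Longrightarrow> permuted_sequence n \<sigma> (\<lambda>i. \<omega> i / 136) i\<^sub>0 f C"
    using permuted_sequenceI[OF omega_mono omega_lim f_meas f_periodic f_mean f_var] by blast
  \<comment> \<open>The permutation does not occur in this event, so one exceptional null set of
    sequences serves all permutations.\<close>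
  have AE: "AE n in mu_omega \<omega> a. (\<exists>i\<^sub>0. relation_free n (\<lambda>i. \<omega> i / 136) 65 i\<^sub>0) \<and> (\<forall>k\<ge>1. n k \<ge> 0)"
    by (rule AE_relation_free[OF omega_mono _ omega_lim a_pos]) (fact omega_pos a_large)+
  show ?thesis
  proof (intro conjI impI)
    show "AE n in mu_omega \<omega> a. \<forall>\<sigma> :: nat \<Rightarrow> nat. bij_betw \<sigma> {1..} {1..} \<longrightarrow>
            weak_conv_m
              (\<lambda>N. distr (lebesgue_on {0..1}) borel
                 (\<lambda>x. real N powr (- 1 / 2) * (\<Sum>k=1..N. f (real_of_int (n (\<sigma> k)) * x))))
              (centered_normal (L2_norm01 f))"
      using AE
    proof (eventually_elim, intro allI impI)
      fix n and \<sigma> :: "nat \<Rightarrow> nat"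
      assume n: "(\<exists>i\<^sub>0. relation_free n (\<lambda>i. \<omega> i / 136) 65 i\<^sub>0) \<and> (\<forall>k\<ge>1. n k \<ge> 0)" and \<sigma>: "bij_betw \<sigma> {1..} {1..}"
      then obtain i\<^sub>0 where "relation_free n (\<lambda>i. \<omega> i / 136) 65 i\<^sub>0" by blast
      with n \<sigma> interpret permuted_sequence n \<sigma> "\<lambda>i. \<omega> i / 136" i\<^sub>0 f C by (intro ps) auto
      show "weak_conv_m
              (\<lambda>N. distr (lebesgue_on {0..1}) borel
                 (\<lambda>x. real N powr (- 1 / 2) * (\<Sum>k=1..N. f (real_of_int (n (\<sigma> k)) * x))))
              (centered_normal (L2_norm01 f))"
        using clt unfolding S_def \<tau>2_def L2_norm01_def .
    qed
  next
    assume "\<exists>\<alpha>>0. \<exists>k0. \<forall>k\<ge>k0. \<omega> k \<ge> ln (real k) powr \<alpha>"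
    then obtain \<alpha> k0 where \<alpha>: "\<alpha> > 0" "\<And>k. k \<ge> k0 \<Longrightarrow> \<omega> k \<ge> ln (real k) powr \<alpha>" by blast
    \<comment> \<open>Every positive power of \<open>ln B\<close> outgrows all powers of its
      logarithm; this is where the growth condition with arbitrary \<open>\<alpha> > 0\<close> is
      used.\<close>
    have "eventually (\<lambda>B. ln (ln (real B)) ^ 3 \<le> ln (real B) powr \<alpha> / 136) sequentially"
      using \<alpha>(1) by real_asymp
    then have big: "eventually (\<lambda>B. ln (ln (real B)) ^ 3 \<le> \<omega> B / 136) sequentially"
      using eventually_ge_at_top[of k0]
    proof eventually_elim
      case (elim B)
      then show ?case using \<alpha>(2)[of B] by linarith
    qed
    show "AE n in mu_omega \<omega> a. \<forall>\<sigma> :: nat \<Rightarrow> nat. bij_betw \<sigma> {1..} {1..} \<longrightarrow>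
            (AE x in lebesgue.
              limsup (\<lambda>N. ereal ((\<Sum>k=1..N. f (real_of_int (n (\<sigma> k)) * x))
                                  / sqrt (2 * real N * ln (ln (real N)))))
              = ereal (L2_norm01 f))"
      using AE
    proof (eventually_elim, intro allI impI)
      fix n and \<sigma> :: "nat \<Rightarrow> nat"
      assume n: "(\<exists>i\<^sub>0. relation_free n (\<lambda>i. \<omega> i / 136) 65 i\<^sub>0) \<and> (\<forall>k\<ge>1. n k \<ge> 0)" and \<sigma>: "bij_betw \<sigma> {1..} {1..}"
      then obtain i\<^sub>0 where "relation_free n (\<lambda>i. \<omega> i / 136) 65 i\<^sub>0" by blast
      with n \<sigma> have "permuted_sequence n \<sigma> (\<lambda>i. \<omega> i / 136) i\<^sub>0 f C" by (intro ps) auto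
      then interpret permuted_sequence_lil n \<sigma> "\<lambda>i. \<omega> i / 136" i\<^sub>0 f C
        by (rule permuted_sequence_lil.intro) (rule permuted_sequence_lil_axioms.intro[OF big])
      show "AE x in lebesgue.
              limsup (\<lambda>N. ereal ((\<Sum>k=1..N. f (real_of_int (n (\<sigma> k)) * x))
                                  / sqrt (2 * real N * ln (ln (real N)))))
              = ereal (L2_norm01 f)"
        using lil unfolding S_def \<tau>2_def L2_norm01_def .
    qed
  qed
qed

end
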